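(* Let $k$ be a field, let $B=kQ/I$ be a bound quiver algebra, let $F$ be a set of new arrows with no relative cycles, and let $B_F=kQ_F/\langle I\rangle_{kQ_F}$. Let $\Delta=\dim_k HH^1(B_F)-\dim_k HH^1(B)$. Then $$\Delta=\dim_k ZB_F-\dim_k ZB+\sum_{(a,\omega)\in F/\!/W_*}\dim_k\omega+\sum_{\gamma\in R_*}\dim_k\gamma\,\Bigl(\dim_k\mathrm{Ext}^1_B(I_{s(\gamma)},P_{t(\gamma)})-\dim_k\mathrm{Hom}_B(I_{s(\gamma)},P_{t(\gamma)})\Bigr).$$
   Context: A quiver $Q$ has a finite set of vertices $Q_0$, a finite set of arrows $Q_1$, and source and target maps $s,t:Q_1\to Q_0$. A path of length $n>0$ is a sequence of arrows $(a_n,\dots,a_1)$ with $s(a_{i+1})=t(a_i)$; its source is $s(a_1)$ and its target is $t(a_n)$; vertices are the paths of length $0$. $Q_n$ is the set of paths of length $n$. In the path algebra $kQ$ the product $\beta\alpha$ of two paths is their concatenation if $t(\alpha)=s(\beta)$, and $0$ otherwise; vertices are orthogonal idempotents. A bound quiver algebra is $B=kQ/I$ with $I$ a two-sided ideal which is admissible, i.e. $\langle Q_n\rangle\subset I\subset\langle Q_2\rangle$ for some $n\ge 2$. A set of new arrows is a finite set $F$ with two maps $s,t:F\to Q_0$. The quiver $Q_F$ has vertices $Q_0$ and arrows $Q_1\sqcup F$, with the evident source and target maps; $\langle I\rangle_{kQ_F}$ is the two-sided ideal of $kQ_F$ generated by $I$. A relative path of length $n>0$ is a sequence $\gamma=(a_n,\dots,a_1)$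 of elements of $F$ such that $s(a_{i+1})\,B\,t(a_i)\neq 0$ for $i=1,\dots,n-1$; put $s(\gamma)=s(a_1)$, $t(\gamma)=t(a_n)$, and $\dim_k\gamma=\prod_{i=1}^{n-1}\dim_k s(a_{i+1})Bt(a_i)$ (equal to $1$ if $n=1$). $R_*$ is the set of all relative paths of length $n>0$. A relative cycle is a relative path $\gamma$ with $s(\gamma)\,B\,t(\gamma)\neq 0$. An extended relative path of length $n>0$ is a triple $\omega=(y,\gamma,x)$ with $x,y\in Q_0$ and $\gamma$ a relative path of length $n$ such that $yBt(\gamma)\neq0$ and $s(\gamma)Bx\neq 0$; put $t(\omega)=y$, $s(\omega)=x$ and $\dim_k\omega=(\dim_k yBt(\gamma))(\dim_k\gamma)(\dim_k s(\gamma)Bx)$. An extended relative path of length $0$ is a pair $\omega=(y,x)$ of vertices with $yBx\ne0$; put $t(\omega)=y$, $s(\omega)=x$, $\dim_k\omega=\dim_k yBx$. $W_*$ is the set of all extended relative paths of length $n\ge0$, and $F/\!/W_*$ is the set of pairs $(a,\omega)\in F\times W_*$ with $s(a)=s(\omega)$ and $t(a)=t(\omega)$. $HH^1(A)=H^1(A,A)$ is the first Hochschild cohomology, $ZA$ is the center of $A$. For $x\in Q_0$, $P_x=Bx$ and $I_x=\mathrm{Hom}_k(xB,k)$ are respectively the projective cover and the injective envelope of the simple left $B$-module at $x$. *)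

theory Defs
  imports
    "HOL-Algebra.QuotRing"
    "Jordan_Normal_Form.Missing_VectorSpace"
    "Graph_Theory.Arc_Walk"
begin

text \<open>
  A quiver is a finite multi-digraph (\<^locale>\<open>fin_digraph\<close>): \<^const>\<open>tail\<close> is the source map and
  \<^const>\<open>head\<close> the target map. A \<open>k\<close>-vector space, a \<open>k\<close>-algebra and a left module over an algebra
  are all records of type \<^typ>\<open>('s, 'b) module\<close>, where \<^typ>\<open>'s\<close> is the type of the scalars
  (elements of the field, resp. of the algebra). The fields \<^const>\<open>mult\<close> and \<^const>\<open>one\<close> are
  only meaningful when the record is an algebra.
\<close>

text \<open>For an ideal \<open>W\<close> of an algebra \<open>V\<close> this is the quotient algebra; for a subspace \<open>W\<close> of a
  vector space \<open>V\<close> it is the quotient space (the multiplication is then meaningless).\<close>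

definition quot_module :: "('s, 'b, 'z) module_scheme \<Rightarrow> 'b set \<Rightarrow> ('s, 'b set) module" where
  "quot_module V W = ring.extend (V Quot W)
     (module.fields (\<lambda>c X. \<Union>x\<in>X. W +>\<^bsub>V\<^esub> (c \<odot>\<^bsub>V\<^esub> x)))"

definition regular_module :: "('b, 'z) ring_scheme \<Rightarrow> ('b, 'b) module" where
  "regular_module R = ring.extend (ring.truncate R) (module.fields (mult R))"

definition pointwise :: "'x set \<Rightarrow> ('s, 'b, 'z) module_scheme \<Rightarrow> ('s, 'x \<Rightarrow> 'b) module" where
  "pointwise X V = \<lparr>carrier = X \<rightarrow>\<^sub>E carrier V,
     mult = (\<lambda>f g. \<lambda>x\<in>X. f x \<otimes>\<^bsub>V\<^esub> g x),
     one = (\<lambda>x\<in>X. \<one>\<^bsub>V\<^esub>),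
     zero = (\<lambda>x\<in>X. \<zero>\<^bsub>V\<^esub>),
     add = (\<lambda>f g. \<lambda>x\<in>X. f x \<oplus>\<^bsub>V\<^esub> g x),
     smult = (\<lambda>c f. \<lambda>x\<in>X. c \<odot>\<^bsub>V\<^esub> f x)\<rparr>"

text \<open>Functions are made \<^const>\<open>undefined\<close> off their domain, so that equal maps are equal terms.\<close>

definition homs :: "('s, 'r) ring_scheme \<Rightarrow> ('s, 'm, 'z1) module_scheme
    \<Rightarrow> ('s, 'n, 'z2) module_scheme \<Rightarrow> ('m \<Rightarrow> 'n) set" where
  "homs R M N = LinearCombinations.module_hom R M N \<inter> extensional (carrier M)"

text \<open>The Hochschild complex \<open>A \<rightarrow> Hom\<^sub>k(A, A) \<rightarrow> Hom\<^sub>k(A \<otimes> A, A)\<close>; 2-cochains are written as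
  functions of two arguments.\<close>

definition hoch_d0 :: "('k, 'b, 'z) module_scheme \<Rightarrow> 'b \<Rightarrow> 'b \<Rightarrow> 'b" where
  "hoch_d0 A x = (\<lambda>a\<in>carrier A. (a \<otimes>\<^bsub>A\<^esub> x) \<ominus>\<^bsub>A\<^esub> (x \<otimes>\<^bsub>A\<^esub> a))"

definition hoch_d1 :: "('k, 'b, 'z) module_scheme \<Rightarrow> ('b \<Rightarrow> 'b) \<Rightarrow> 'b \<Rightarrow> 'b \<Rightarrow> 'b" where
  "hoch_d1 A f a b =
     ((a \<otimes>\<^bsub>A\<^esub> f b) \<ominus>\<^bsub>A\<^esub> f (a \<otimes>\<^bsub>A\<^esub> b)) \<oplus>\<^bsub>A\<^esub> (f a \<otimes>\<^bsub>A\<^esub> b)"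

definition HH1 :: "('k, 'r) ring_scheme \<Rightarrow> ('k, 'b, 'z) module_scheme
    \<Rightarrow> ('k, ('b \<Rightarrow> 'b) set) module" where
  "HH1 K A = quot_module
     ((pointwise (carrier A) A)
        \<lparr>carrier := {f \<in> homs K A A. \<forall>a\<in>carrier A. \<forall>b\<in>carrier A. hoch_d1 A f a b = \<zero>\<^bsub>A\<^esub>}\<rparr>)
     (hoch_d0 A ` carrier A)"

definition center :: "('k, 'b, 'z) module_scheme \<Rightarrow> ('k, 'b, 'z) module_scheme" where
  "center A = A\<lparr>carrier := {z \<in> carrier A. \<forall>a\<in>carrier A. z \<otimes>\<^bsub>A\<^esub> a = a \<otimes>\<^bsub>A\<^esub> z}\<rparr>"

text \<open>A left \<open>A\<close>-module is a \<open>k\<close>-vector space through \<open>c \<cdot> m = (c \<cdot> 1\<^sub>A) m\<close>.\<close>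

definition underlying_space :: "('k, 'b, 'z1) module_scheme \<Rightarrow> ('b, 'm, 'z2) module_scheme
    \<Rightarrow> ('k, 'm) module" where
  "underlying_space A M = ring.extend (ring.truncate M)
     (module.fields (\<lambda>c m. (c \<odot>\<^bsub>A\<^esub> \<one>\<^bsub>A\<^esub>) \<odot>\<^bsub>M\<^esub> m))"

definition Hom_space :: "('k, 'b, 'z) module_scheme \<Rightarrow> ('b, 'm, 'z1) module_scheme
    \<Rightarrow> ('b, 'n, 'z2) module_scheme \<Rightarrow> ('k, 'm \<Rightarrow> 'n) module" where
  "Hom_space A M N =
     (pointwise (carrier M) (underlying_space A N))\<lparr>carrier := homs A M N\<rparr>"

definition free_module :: "('b, 'z) ring_scheme \<Rightarrow> 'x set \<Rightarrow> ('b, 'x \<Rightarrow> 'b) module" where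
  "free_module R X = (pointwise X (regular_module R))
     \<lparr>carrier := {f \<in> X \<rightarrow>\<^sub>E carrier R. finite {x \<in> X. f x \<noteq> \<zero>\<^bsub>R\<^esub>}}\<rparr>"

text \<open>The canonical map from the free module on the underlying set of \<open>M\<close> onto \<open>M\<close>, and its kernel.\<close>

definition free_cover :: "('b, 'r) ring_scheme \<Rightarrow> ('b, 'm, 'z) module_scheme \<Rightarrow> ('m \<Rightarrow> 'b) \<Rightarrow> 'm" where
  "free_cover R M f = (\<Oplus>\<^bsub>M\<^esub>m\<in>{m \<in> carrier M. f m \<noteq> \<zero>\<^bsub>R\<^esub>}. f m \<odot>\<^bsub>M\<^esub> m)"

definition syzygy :: "('b, 'r) ring_scheme \<Rightarrow> ('b, 'm, 'z) module_scheme \<Rightarrow> ('b, 'm \<Rightarrow> 'b) module" where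
  "syzygy R M = (free_module R (carrier M))
     \<lparr>carrier := {f \<in> carrier (free_module R (carrier M)). free_cover R M f = \<zero>\<^bsub>M\<^esub>}\<rparr>"

text \<open>
  \<open>Ext\<^sup>1\<^sub>A(M, N)\<close> is the first cohomology of \<open>Hom\<^sub>A(P, N)\<close> for the canonical free resolution
  \<open>\<dots> \<rightarrow> P\<^sub>2 \<rightarrow> P\<^sub>1 \<rightarrow> P\<^sub>0 \<rightarrow> M \<rightarrow> 0\<close>: \<open>P\<^sub>0\<close> is free on the set \<open>M\<close>, \<open>P\<^sub>1\<close> is free on the set
  \<open>ker (P\<^sub>0 \<rightarrow> M)\<close>, and \<open>P\<^sub>2\<close> is free on the set \<open>ker (P\<^sub>1 \<rightarrow> P\<^sub>0)\<close>.
\<close>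

definition Ext1 :: "('k, 'b, 'z) module_scheme \<Rightarrow> ('b, 'm, 'z1) module_scheme
    \<Rightarrow> ('b, 'n, 'z2) module_scheme \<Rightarrow> ('k, ((('m \<Rightarrow> 'b) \<Rightarrow> 'b) \<Rightarrow> 'n) set) module" where
  "Ext1 A M N =
    (let P0 = free_module A (carrier M);
         P1 = free_module A (carrier (syzygy A M));
         P2 = free_module A (carrier (syzygy A (syzygy A M)));
         d1 = free_cover A (syzygy A M);
         d2 = free_cover A (syzygy A (syzygy A M))
     in quot_module
          ((Hom_space A P1 N)
             \<lparr>carrier := {\<phi> \<in> homs A P1 N. \<forall>p\<in>carrier P2. \<phi> (d2 p) = \<zero>\<^bsub>N\<^esub>}\<rparr>)
          ((\<lambda>\<psi>. \<lambda>p\<in>carrier P1. \<psi> (d1 p)) ` homs A P0 N))"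

text \<open>
  The path \<open>(a\<^sub>n, \<dots>, a\<^sub>1)\<close> from \<open>x\<close> to \<open>y\<close> is the triple \<open>(x, [a\<^sub>1, \<dots>, a\<^sub>n], y)\<close>: lists are in order
  of traversal, hence the reverse of the usual notation. The vertex \<open>x\<close> is \<open>(x, [], x)\<close>.
\<close>

type_synonym ('v, 'a) qpath = "'v \<times> 'a list \<times> 'v"

definition qpaths :: "('v, 'a) pre_digraph \<Rightarrow> ('v, 'a) qpath set" where
  "qpaths Q = {(x, p, y). pre_digraph.awalk Q x p y}"

definition qpaths_len :: "('v, 'a) pre_digraph \<Rightarrow> nat \<Rightarrow> ('v, 'a) qpath set" where
  "qpaths_len Q n = {(x, p, y) \<in> qpaths Q. length p = n}"

text \<open>The pairs \<open>(\<beta>, \<alpha>)\<close> of paths with \<open>t(\<alpha>) = s(\<beta>)\<close> and concatenation \<open>\<beta>\<alpha> = \<rho>\<close>.\<close>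

definition factorizations :: "('v, 'a) pre_digraph \<Rightarrow> ('v, 'a) qpath
    \<Rightarrow> (('v, 'a) qpath \<times> ('v, 'a) qpath) set" where
  "factorizations Q \<rho> = {((z, q, y), (x, p, z')) | x p z z' q y.
     (z, q, y) \<in> qpaths Q \<and> (x, p, z') \<in> qpaths Q \<and> z' = z \<and> \<rho> = (x, p @ q, y)}"

definition path_algebra :: "('k, 'r) ring_scheme \<Rightarrow> ('v, 'a) pre_digraph
    \<Rightarrow> ('k, ('v, 'a) qpath \<Rightarrow> 'k) module" where
  "path_algebra K Q = \<lparr>
     carrier = {f. range f \<subseteq> carrier K \<and> finite {\<rho>. f \<rho> \<noteq> \<zero>\<^bsub>K\<^esub>} \<and> {\<rho>. f \<rho> \<noteq> \<zero>\<^bsub>K\<^esub>} \<subseteq> qpaths Q},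
     mult = (\<lambda>f g \<rho>. \<Oplus>\<^bsub>K\<^esub>\<pi>\<in>factorizations Q \<rho>. f (fst \<pi>) \<otimes>\<^bsub>K\<^esub> g (snd \<pi>)),
     one = (\<lambda>\<rho>. if \<rho> \<in> qpaths_len Q 0 then \<one>\<^bsub>K\<^esub> else \<zero>\<^bsub>K\<^esub>),
     zero = (\<lambda>\<rho>. \<zero>\<^bsub>K\<^esub>),
     add = (\<lambda>f g \<rho>. f \<rho> \<oplus>\<^bsub>K\<^esub> g \<rho>),
     smult = (\<lambda>c f \<rho>. c \<otimes>\<^bsub>K\<^esub> f \<rho>)\<rparr>"

definition path_elt :: "('k, 'r) ring_scheme \<Rightarrow> ('v, 'a) qpath \<Rightarrow> ('v, 'a) qpath \<Rightarrow> 'k" where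
  "path_elt K \<rho> = (\<lambda>\<sigma>. if \<sigma> = \<rho> then \<one>\<^bsub>K\<^esub> else \<zero>\<^bsub>K\<^esub>)"

definition path_ideal :: "('k, 'r) ring_scheme \<Rightarrow> ('v, 'a) pre_digraph \<Rightarrow> nat
    \<Rightarrow> (('v, 'a) qpath \<Rightarrow> 'k) set" where
  "path_ideal K Q n = genideal (path_algebra K Q) (path_elt K ` qpaths_len Q n)"

definition admissible :: "('k, 'r) ring_scheme \<Rightarrow> ('v, 'a) pre_digraph
    \<Rightarrow> (('v, 'a) qpath \<Rightarrow> 'k) set \<Rightarrow> bool" where
  "admissible K Q I \<longleftrightarrow> ideal I (path_algebra K Q) \<and>
     (\<exists>n\<ge>2. path_ideal K Q n \<subseteq> I \<and> I \<subseteq> path_ideal K Q 2)"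

definition quiver_algebra :: "('k, 'r) ring_scheme \<Rightarrow> ('v, 'a) pre_digraph
    \<Rightarrow> (('v, 'a) qpath \<Rightarrow> 'k) set \<Rightarrow> ('k, (('v, 'a) qpath \<Rightarrow> 'k) set) module" where
  "quiver_algebra K Q I = quot_module (path_algebra K Q) I"

definition idem :: "('k, 'r) ring_scheme \<Rightarrow> ('v, 'a) pre_digraph
    \<Rightarrow> (('v, 'a) qpath \<Rightarrow> 'k) set \<Rightarrow> 'v \<Rightarrow> (('v, 'a) qpath \<Rightarrow> 'k) set" where
  "idem K Q I x = I +>\<^bsub>path_algebra K Q\<^esub> path_elt K (x, [], x)"

definition add_arrows :: "('v, 'a) pre_digraph \<Rightarrow> 'f set \<Rightarrow> ('f \<Rightarrow> 'v) \<Rightarrow> ('f \<Rightarrow> 'v)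
    \<Rightarrow> ('v, 'a + 'f) pre_digraph" where
  "add_arrows Q F s t = \<lparr>verts = verts Q, arcs = arcs Q <+> F,
     tail = case_sum (tail Q) s, head = case_sum (head Q) t\<rparr>"

text \<open>The inclusion of \<open>kQ\<close> in \<open>kQ\<^sub>F\<close>, extending by zero on the paths that use a new arrow.\<close>

definition path_incl :: "('k, 'r) ring_scheme \<Rightarrow> (('v, 'a) qpath \<Rightarrow> 'k)
    \<Rightarrow> ('v, 'a + 'f) qpath \<Rightarrow> 'k" where
  "path_incl K f = (\<lambda>(x, p, y). if \<forall>a\<in>set p. isl a then f (x, map projl p, y) else \<zero>\<^bsub>K\<^esub>)"

definition extended_algebra :: "('k, 'r) ring_scheme \<Rightarrow> ('v, 'a) pre_digraph
    \<Rightarrow> (('v, 'a) qpath \<Rightarrow> 'k) set \<Rightarrow> 'f set \<Rightarrow> ('f \<Rightarrow> 'v) \<Rightarrow> ('f \<Rightarrow> 'v)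
    \<Rightarrow> ('k, (('v, 'a + 'f) qpath \<Rightarrow> 'k) set) module" where
  "extended_algebra K Q I F s t = quiver_algebra K (add_arrows Q F s t)
     (genideal (path_algebra K (add_arrows Q F s t)) (path_incl K ` I))"

text \<open>In what follows \<open>e x\<close> is the image in \<open>B\<close> of the vertex \<open>x\<close>; \<open>corner B e y x\<close> is \<open>yBx\<close>.\<close>

definition corner :: "('k, 'b, 'z) module_scheme \<Rightarrow> ('v \<Rightarrow> 'b) \<Rightarrow> 'v \<Rightarrow> 'v
    \<Rightarrow> ('k, 'b, 'z) module_scheme" where
  "corner B e y x = B\<lparr>carrier := {e y \<otimes>\<^bsub>B\<^esub> b \<otimes>\<^bsub>B\<^esub> e x | b. b \<in> carrier B}\<rparr>"

definition corner_nz :: "('k, 'b, 'z) module_scheme \<Rightarrow> ('v \<Rightarrow> 'b) \<Rightarrow> 'v \<Rightarrow> 'v \<Rightarrow> bool" where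
  "corner_nz B e y x \<longleftrightarrow> carrier (corner B e y x) \<noteq> {\<zero>\<^bsub>B\<^esub>}"

definition corner_dim :: "('k, 'r) ring_scheme \<Rightarrow> ('k, 'b, 'z) module_scheme \<Rightarrow> ('v \<Rightarrow> 'b)
    \<Rightarrow> 'v \<Rightarrow> 'v \<Rightarrow> nat" where
  "corner_dim K B e y x = vectorspace.dim K (corner B e y x)"

definition right_ideal_space :: "('k, 'b, 'z) module_scheme \<Rightarrow> ('v \<Rightarrow> 'b) \<Rightarrow> 'v
    \<Rightarrow> ('k, 'b, 'z) module_scheme" where
  "right_ideal_space B e x = B\<lparr>carrier := {e x \<otimes>\<^bsub>B\<^esub> b | b. b \<in> carrier B}\<rparr>"

definition proj_module :: "('k, 'b, 'z) module_scheme \<Rightarrow> ('v \<Rightarrow> 'b) \<Rightarrow> 'v \<Rightarrow> ('b, 'b) module" where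
  "proj_module B e x = (regular_module B)\<lparr>carrier := {b \<otimes>\<^bsub>B\<^esub> e x | b. b \<in> carrier B}\<rparr>"

text \<open>\<open>Hom\<^sub>k(xB, k)\<close> is a left module because \<open>xB\<close> is a right module: \<open>(b \<phi>)(c) = \<phi>(c b)\<close>.\<close>

definition inj_module :: "('k, 'r) ring_scheme \<Rightarrow> ('k, 'b, 'z) module_scheme \<Rightarrow> ('v \<Rightarrow> 'b) \<Rightarrow> 'v
    \<Rightarrow> ('b, 'b \<Rightarrow> 'k) module" where
  "inj_module K B e x =
     (let xB = right_ideal_space B e x;
          V = pointwise (carrier xB) (regular_module K)
      in ring.extend ((ring.truncate V)\<lparr>carrier := homs K xB (regular_module K)\<rparr>)
           (module.fields (\<lambda>b \<phi>. \<lambda>c\<in>carrier xB. \<phi> (c \<otimes>\<^bsub>B\<^esub> b))))"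

text \<open>As for paths, the relative path \<open>(a\<^sub>n, \<dots>, a\<^sub>1)\<close> is the list \<open>[a\<^sub>1, \<dots>, a\<^sub>n]\<close>.\<close>

definition rel_source :: "('f \<Rightarrow> 'v) \<Rightarrow> 'f list \<Rightarrow> 'v" where
  "rel_source s \<gamma> = s (hd \<gamma>)"

definition rel_target :: "('f \<Rightarrow> 'v) \<Rightarrow> 'f list \<Rightarrow> 'v" where
  "rel_target t \<gamma> = t (last \<gamma>)"

definition rel_paths :: "('k, 'b, 'z) module_scheme \<Rightarrow> ('v \<Rightarrow> 'b) \<Rightarrow> 'f set \<Rightarrow> ('f \<Rightarrow> 'v) \<Rightarrow> ('f \<Rightarrow> 'v)
    \<Rightarrow> 'f list set" where
  "rel_paths B e F s t = {\<gamma>. \<gamma> \<noteq> [] \<and> set \<gamma> \<subseteq> F \<and>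
     (\<forall>i. Suc i < length \<gamma> \<longrightarrow> corner_nz B e (s (\<gamma> ! Suc i)) (t (\<gamma> ! i)))}"

definition rel_dim :: "('k, 'r) ring_scheme \<Rightarrow> ('k, 'b, 'z) module_scheme \<Rightarrow> ('v \<Rightarrow> 'b)
    \<Rightarrow> ('f \<Rightarrow> 'v) \<Rightarrow> ('f \<Rightarrow> 'v) \<Rightarrow> 'f list \<Rightarrow> nat" where
  "rel_dim K B e s t \<gamma> =
     (\<Prod>i<length \<gamma> - 1. corner_dim K B e (s (\<gamma> ! Suc i)) (t (\<gamma> ! i)))"

definition rel_cycles :: "('k, 'b, 'z) module_scheme \<Rightarrow> ('v \<Rightarrow> 'b) \<Rightarrow> 'f set \<Rightarrow> ('f \<Rightarrow> 'v) \<Rightarrow> ('f \<Rightarrow> 'v)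
    \<Rightarrow> 'f list set" where
  "rel_cycles B e F s t =
     {\<gamma> \<in> rel_paths B e F s t. corner_nz B e (rel_source s \<gamma>) (rel_target t \<gamma>)}"

text \<open>The extended relative path \<open>(y, \<gamma>, x)\<close>; the pair \<open>(y, x)\<close> of length 0 is \<open>(y, [], x)\<close>.\<close>

definition ext_rel_paths :: "'v set \<Rightarrow> ('k, 'b, 'z) module_scheme \<Rightarrow> ('v \<Rightarrow> 'b) \<Rightarrow> 'f set
    \<Rightarrow> ('f \<Rightarrow> 'v) \<Rightarrow> ('f \<Rightarrow> 'v) \<Rightarrow> ('v \<times> 'f list \<times> 'v) set" where
  "ext_rel_paths Q0 B e F s t =
     {(y, [], x) | y x. y \<in> Q0 \<and> x \<in> Q0 \<and> corner_nz B e y x} \<union>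
     {(y, \<gamma>, x) | y \<gamma> x. y \<in> Q0 \<and> x \<in> Q0 \<and> \<gamma> \<in> rel_paths B e F s t \<and>
        corner_nz B e y (rel_target t \<gamma>) \<and> corner_nz B e (rel_source s \<gamma>) x}"

definition ext_rel_dim :: "('k, 'r) ring_scheme \<Rightarrow> ('k, 'b, 'z) module_scheme \<Rightarrow> ('v \<Rightarrow> 'b)
    \<Rightarrow> ('f \<Rightarrow> 'v) \<Rightarrow> ('f \<Rightarrow> 'v) \<Rightarrow> 'v \<times> 'f list \<times> 'v \<Rightarrow> nat" where
  "ext_rel_dim K B e s t = (\<lambda>(y, \<gamma>, x).
     if \<gamma> = [] then corner_dim K B e y x
     else corner_dim K B e y (rel_target t \<gamma>) * rel_dim K B e s t \<gamma> *
       corner_dim K B e (rel_source s \<gamma>) x)"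

definition parallel_pairs :: "'v set \<Rightarrow> ('k, 'b, 'z) module_scheme \<Rightarrow> ('v \<Rightarrow> 'b) \<Rightarrow> 'f set
    \<Rightarrow> ('f \<Rightarrow> 'v) \<Rightarrow> ('f \<Rightarrow> 'v) \<Rightarrow> ('f \<times> 'v \<times> 'f list \<times> 'v) set" where
  "parallel_pairs Q0 B e F s t =
     {(a, y, \<gamma>, x). a \<in> F \<and> (y, \<gamma>, x) \<in> ext_rel_paths Q0 B e F s t \<and> s a = x \<and> t a = y}"

end

theory Submission
  imports Defs
begin

text \<open>
  Write \<open>A\<close> for the extended algebra, and for a finite-dimensional \<open>B\<close>-bimodule \<open>X\<close> let the excess of
  \<open>X\<close> be \<open>\<chi>\<^sub>B(X) = dim Der(B, X) - dim X\<close>. Every term of the formula is an excess or a dimension: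

  \<^item> The map that sends an element of \<open>X\<close> to its inner derivation has the invariants of \<open>X\<close> as kernel. For
    \<open>X = A\<close> this gives \<open>dim HH\<^sup>1(A) = \<chi>\<^sub>A(A) + dim ZA\<close> (\<open>dim_HH1\<close>). For \<open>X = Hom\<^sub>k(M, N)\<close> the invariants
    are \<open>Hom\<^sub>B(M, N)\<close>, and derivations modulo inner ones are extensions of \<open>M\<close> by \<open>N\<close>, so
    \<open>dim Ext\<^sup>1\<^sub>B(M, N) - dim Hom\<^sub>B(M, N) = \<chi>\<^sub>B(Hom\<^sub>k(M, N))\<close> (\<open>dim_Ext1_minus_dim_Hom\<close>).
  \<^item> Homomorphisms out of \<open>A\<close> are homomorphisms out of \<open>B\<close> together with a free choice of the images of
    the new arrows in the right corners (\<open>extended_algebra_universal\<close>). A derivation is a homomorphism to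
    a trivial extension, hence \<open>dim Der(A, A) = dim Der(B, A) + \<Sum> dim t(a) A s(a)\<close>, the sum being over
    the new arrows \<open>a\<close> (\<open>dim_derivations\<close>).
  \<^item> Again by the universal property there are a projection \<open>\<pi>\<close> of \<open>A\<close> onto \<open>B\<close> that kills the new
    arrows and, for each new arrow \<open>a\<close>, a Fox derivative \<open>\<theta>\<^sub>a\<close>: the derivation on \<open>A\<close> that vanishes on
    \<open>B\<close> and on the other new arrows, with \<open>u a v \<mapsto> u \<otimes> v\<close> for \<open>v\<close> in \<open>B\<close>. Its values are in
    \<open>A t(a) \<otimes> s(a) B = Hom\<^sub>k(I\<^sub>s\<^sub>(\<^sub>a\<^sub>), A t(a))\<close>, on which \<open>A\<close> acts from the right through \<open>\<pi>\<close>. Since every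
    element of \<open>A\<close> is a sum of an element of \<open>B\<close> and of products \<open>u a v\<close>, it is determined by its
    components under \<open>\<pi>\<close> and the \<open>\<theta>\<^sub>a\<close>, which can be prescribed freely. These maps are \<open>B\<close>-bimodule maps, so
    \<open>\<chi>\<^sub>B(A) = \<chi>\<^sub>B(B) + \<Sum> \<chi>\<^sub>B(Hom\<^sub>k(I\<^sub>s\<^sub>(\<^sub>a\<^sub>), A t(a)))\<close> (\<open>excess_XA\<close>).
  \<^item> The same components of \<open>A x\<close>, in a basis of \<open>s(a) B x\<close>, split the left \<open>B\<close>-module \<open>A x\<close> into \<open>B x\<close>
    and \<open>dim s(a) B x\<close> copies of \<open>A t(a)\<close> for every \<open>a\<close>. For \<open>x = t(c)\<close> this is a recursion for \<open>A t(c)\<close>,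
    well-founded because there are no relative cycles. It shows that \<open>A\<close> is finite-dimensional, and its
    solution is a sum over relative paths (\<open>sum_rel_paths_from\<close>): it expresses the dimension of
    \<open>y A x\<close> (\<open>corner_dim_A\<close>) and the excess of \<open>Hom\<^sub>k(I\<^sub>s\<^sub>(\<^sub>a\<^sub>), A t(a))\<close> (\<open>excess_fox\<close>) in terms of \<open>B\<close>.

  Subtracting \<open>dim HH\<^sup>1(B) = \<chi>\<^sub>B(B) + dim ZB\<close> gives the formula; the dimension of \<open>A\<close> cancels.

  A decomposition of a vector space is given by a jointly bijective family of linear maps to spaces of possibly
  different types, with finite-dimensionality as a conclusion (\<open>dim_jointly_bijective\<close>): the dimension of a space
  is meaningful only if it is finite, and for \<open>A\<close> this is a consequence of the decomposition.
\<close>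

text \<open>\<open>module_hom\<close> denotes homomorphisms between records. A structure with a short name is written as an ordinary subscript.\<close>

hide_const (open) Modules.module_hom

syntax "_index" :: "logic => index"  ("\<^sub>_" [1000] 1000)

abbreviation (input) "kdim == vectorspace.dim"
abbreviation (input) "kfin_dim == vectorspace.fin_dim"
abbreviation (input) "space_of == underlying_space"

section \<open>Dimension counts\<close>

lemmas module_hom_def' = LinearCombinations.module_hom_def

lemma regular_module_simps [simp]:
 "carrier (regular_module R) = carrier R" "add (regular_module R) = add R"
 "zero (regular_module R) = zero R" "mult (regular_module R) = mult R" "one (regular_module R) = one R"
 "smult (regular_module R) = mult R"
 by (auto simp: regular_module_def ring.defs module.defs)

lemma regular_module_derived [simp]:
 "finsum (regular_module R) f Y = finsum R f Y"
 "x \<ominus>\<^bsub>regular_module R\<^esub> y = x \<ominus>\<^sub>R y"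
 by (simp_all add: finsum_def finprod_def a_minus_def a_inv_def m_inv_def)

lemma (in abelian_group) minus_eq_zero_iff:
 assumes "a \<in> carrier G" "b \<in> carrier G"
 shows "a \<ominus> b = \<zero> \<longleftrightarrow> a = b"
proof
 assume "a \<ominus> b = \<zero>"
 moreover have "(a \<ominus> b) \<oplus> b = a" using assms by (simp add: minus_eq a_assoc l_neg)
 ultimately show "a = b" using assms by simp
qed (use assms in \<open>simp add: minus_eq r_neg\<close>)

lemma module_homI:
 assumes "\<And>x. x \<in> carrier V ==> f x \<in> carrier W"
  and "\<And>x y. x \<in> carrier V ==> y \<in> carrier V ==> f (x \<oplus>\<^sub>V y) = f x \<oplus>\<^sub>W f y"
  and "\<And>c x. c \<in> carrier K ==> x \<in> carrier V ==> f (c \<odot>\<^sub>V x) = c \<odot>\<^sub>W f x"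
 shows "f \<in> module_hom K V W"
 using assms by (auto simp: module_hom_def')

lemma module_homD:
 assumes "f \<in> module_hom K V W"
 shows "x \<in> carrier V ==> f x \<in> carrier W"
  and "x \<in> carrier V ==> y \<in> carrier V ==> f (x \<oplus>\<^sub>V y) = f x \<oplus>\<^sub>W f y"
  and "c \<in> carrier K ==> x \<in> carrier V ==> f (c \<odot>\<^sub>V x) = c \<odot>\<^sub>W f x"
 using assms by (auto simp: module_hom_def')

lemma module_hom_comp:
 assumes "f \<in> module_hom K V U" "g \<in> module_hom K U W"
 shows "(\<lambda>v. g (f v)) \<in> module_hom K V W"
 using assms by (auto simp: module_hom_def' Pi_iff)

lemma linear_mapI:
 assumes "vectorspace K V" "vectorspace K W" "f \<in> module_hom K V W"
 shows "linear_map K V W f"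
proof -
 interpret V: vectorspace K V by fact
 interpret W: vectorspace K W by fact
 show ?thesis by unfold_locales (use assms in auto)
qed

lemma linear_zero:
 assumes "vectorspace K V" "vectorspace K W" "f \<in> module_hom K V W"
 shows "f \<zero>\<^sub>V = \<zero>\<^sub>W"
proof -
 interpret linear_map K V W f using linear_mapI[OF assms] .
 show ?thesis by simp
qed

lemma linear_minus:
 assumes "vectorspace K V" "vectorspace K W" "f \<in> module_hom K V W" "x \<in> carrier V" "y \<in> carrier V"
 shows "f (x \<ominus>\<^sub>V y) = f x \<ominus>\<^sub>W f y"
proof -
 interpret linear_map K V W f using linear_mapI[OF assms(1-3)] .
 show ?thesis using assms by simp
qed

lemma linear_finsum:
 assumes "vectorspace K V" "vectorspace K W" "f \<in> module_hom K V W" "finite Y" "g \<in> Y \<rightarrow> carrier V"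
 shows "f (\<Oplus>\<^sub>V y\<in>Y. g y) = (\<Oplus>\<^sub>W y\<in>Y. f (g y))"
proof -
 interpret linear_map K V W f using linear_mapI[OF assms(1-3)] .
 show ?thesis using assms(4,5)
 proof (induction Y rule: finite_induct)
  case (insert x Y)
  then have "f (g u) \<in> carrier W" if "u \<in> insert x Y" for u using that by auto
  then show ?case using insert by (simp add: Pi_def)
 qed simp
qed

lemma vectorspace_regular_module:
 assumes "field K"
 shows "vectorspace K (regular_module K)"
proof -
 interpret K: field K by fact
 have neg: "\<exists>w\<in>carrier K. v \<oplus>\<^sub>K w = \<zero>\<^sub>K" if "v \<in> carrier K" for v
  using K.r_neg[OF that] K.a_inv_closed[OF that] by blast
 show ?thesis
  by (rule vs_criteria)
    (use neg in \<open>auto simp: K.a_ac K.m_assoc K.l_distr K.r_distr K.field_axioms\<close>)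
qed

text \<open>Coordinates without a basis: bijectivity of the coordinate map already gives the dual family, which is a basis.\<close>

lemma dim_eq_card_coordinates:
 assumes "vectorspace K V" "finite X"
  and lin: "\<And>x. x \<in> X ==> c x \<in> module_hom K V (regular_module K)"
  and ex: "\<And>g. g \<in> X \<rightarrow> carrier K ==> \<exists>v\<in>carrier V. \<forall>x\<in>X. c x v = g x"
  and inj: "\<And>v. v \<in> carrier V ==> \<forall>x\<in>X. c x v = \<zero>\<^sub>K ==> v = \<zero>\<^sub>V"
 shows "kfin_dim K V" "kdim K V = card X"
proof -
 interpret V: vectorspace K V by fact
 have "\<exists>v\<in>carrier V. \<forall>y\<in>X. c y v = (if x = y then \<one>\<^sub>K else \<zero>\<^sub>K)" for x
  by (rule ex) auto
 then obtain b where b: "\<And>x. b x \<in> carrier V"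
  "\<And>x y. y \<in> X ==> c y (b x) = (if x = y then \<one>\<^sub>K else \<zero>\<^sub>K)"
  by metis
 have one0: "\<one>\<^sub>K \<noteq> \<zero>\<^sub>K" by simp
 have injb: "inj_on b X"
  using b(2) one0 by (intro inj_onI) metis
 have reg: "vectorspace K (regular_module K)" by (rule vectorspace_regular_module) unfold_locales
 have cl: "c y (\<Oplus>\<^sub>V x\<in>Y. f x) = (\<Oplus>\<^sub>K x\<in>Y. c y (f x))"
  if "y \<in> X" "finite Y" "f \<in> Y \<rightarrow> carrier V" for y f and Y :: "'z set"
  using linear_finsum[OF assms(1) reg lin[OF that(1)] that(2,3)] by simp
 have lc: "v = (\<Oplus>\<^sub>V x\<in>X. c x v \<odot>\<^sub>V b x)" if v: "v \<in> carrier V" for v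
 proof -
  let ?w = "\<Oplus>\<^sub>V x\<in>X. c x v \<odot>\<^sub>V b x"
  have cv: "c x v \<in> carrier K" if "x \<in> X" for x
   using that module_homD(1)[OF lin[OF that] v] by simp
  have tV: "(\<lambda>x. c x v \<odot>\<^sub>V b x) \<in> X \<rightarrow> carrier V" using cv b by auto
  have w: "?w \<in> carrier V" using tV by simp
  have "c y (v \<ominus>\<^sub>V ?w) = \<zero>\<^sub>K" if y: "y \<in> X" for y
  proof -
   have "c y ?w = (\<Oplus>\<^sub>K x\<in>X. c y (c x v \<odot>\<^sub>V b x))" using cl[OF y \<open>finite X\<close> tV] .
   also have "\<dots> = (\<Oplus>\<^sub>K x\<in>X. if y = x then c x v else \<zero>\<^sub>K)"
    using module_homD(3)[OF lin[OF y]] cv b y by (intro V.R.finsum_cong') auto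
   also have "\<dots> = c y v" using y \<open>finite X\<close> cv V.R.finsum_singleton[of y X "\<lambda>x. c x v"] by auto
   finally have e: "c y ?w = c y v" .
   show ?thesis using linear_minus[OF assms(1) reg lin[OF y] v w] e cv[OF y]
    by (simp add: V.R.minus_eq V.R.r_neg)
  qed
  then have "v \<ominus>\<^sub>V ?w = \<zero>\<^sub>V" using inj v w by simp
  then show ?thesis using v w using V.M.minus_eq_zero_iff by blast
 qed
 let ?B = "b ` X"
 have fin: "finite ?B" "?B \<subseteq> carrier V" using \<open>finite X\<close> b by auto
 have re: "V.lincomb a ?B = (\<Oplus>\<^sub>V x\<in>X. a (b x) \<odot>\<^sub>V b x)" if "a \<in> ?B \<rightarrow> carrier K" for a
  unfolding V.lincomb_def using injb that b by (subst V.M.finsum_reindex) (auto simp: Pi_def)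
 have "V.span ?B = carrier V"
 proof
  show "V.span ?B \<subseteq> carrier V" using V.span_is_subset2[OF fin(2)] .
  show "carrier V \<subseteq> V.span ?B"
  proof
   fix v assume v: "v \<in> carrier V"
   let ?a = "\<lambda>u. c (the_inv_into X b u) v"
   have a: "?a \<in> ?B \<rightarrow> carrier K"
    using module_homD(1)[OF lin v] by (auto simp: the_inv_into_f_f[OF injb])
   have "V.lincomb ?a ?B = (\<Oplus>\<^sub>V x\<in>X. c x v \<odot>\<^sub>V b x)"
    unfolding re[OF a] using module_homD(1)[OF lin v] b
    by (intro V.M.finsum_cong') (auto simp: the_inv_into_f_f[OF injb] Pi_def)
   then have "v = V.lincomb ?a ?B" using lc[OF v] by simp
   then show "v \<in> V.span ?B" unfolding V.finite_span[OF fin] using a by blast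
  qed
 qed
 moreover have "V.lin_indpt ?B"
 proof (rule V.finite_lin_indpt2[OF fin])
  fix a assume a: "a \<in> ?B \<rightarrow> carrier K" and z: "V.lincomb a ?B = \<zero>\<^sub>V"
  show "\<forall>v\<in>?B. a v = \<zero>\<^sub>K"
  proof
   fix v assume "v \<in> ?B"
   then obtain y where y: "y \<in> X" "v = b y" by auto
   have aK: "a (b x) \<in> carrier K" if "x \<in> X" for x using a that by auto
   have tV: "(\<lambda>x. a (b x) \<odot>\<^sub>V b x) \<in> X \<rightarrow> carrier V" using aK b by auto
   have "c y \<zero>\<^sub>V = (\<Oplus>\<^sub>K x\<in>X. c y (a (b x) \<odot>\<^sub>V b x))"
    using cl[OF y(1) \<open>finite X\<close> tV] z re[OF a] by simp
   also have "\<dots> = (\<Oplus>\<^sub>K x\<in>X. if y = x then a (b x) else \<zero>\<^sub>K)"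
    using module_homD(3)[OF lin[OF y(1)]] aK b y(1) by (intro V.R.finsum_cong') auto
   also have "\<dots> = a (b y)" using y \<open>finite X\<close> a V.R.finsum_singleton[of y X "\<lambda>x. a (b x)"] by auto
   finally show "a v = \<zero>\<^sub>K" using y cl[OF y(1), of "{}" "\<lambda>_. \<zero>\<^sub>V"] by simp
  qed
 qed
 ultimately have bas: "V.basis ?B" using fin unfolding V.basis_def by auto
 show "V.fin_dim" unfolding V.fin_dim_def using fin \<open>V.span ?B = carrier V\<close> by blast
 show "V.dim = card X" using V.dim_basis[OF fin(1) bas] card_image[OF injb] by simp
qed

lemma coordinates_exist:
 assumes "vectorspace K V" "kfin_dim K V"
 obtains X c where "finite X" "X \<subseteq> carrier V" "card X = kdim K V"
  "\<And>x. x \<in> X ==> c x \<in> module_hom K V (regular_module K)"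
  "\<And>x y. x \<in> X ==> y \<in> X ==> c x y = (if x = y then \<one>\<^sub>K else \<zero>\<^sub>K)"
  "\<And>v. v \<in> carrier V ==> v = (\<Oplus>\<^sub>V x\<in>X. c x v \<odot>\<^sub>V x)"
proof -
 interpret V: vectorspace K V by fact
 obtain X where X: "finite X" "V.basis X" using V.finite_basis_exists[OF assms(2)] by auto
 have XV: "X \<subseteq> carrier V" using X unfolding V.basis_def by auto
 have u: "\<exists>!a. a \<in> X \<rightarrow>\<^sub>E carrier K \<and> V.lincomb a X = v" if "v \<in> carrier V" for v
  using V.basis_criterion[OF X(1) XV] X(2) that by blast
 define a where "a v = (THE a. a \<in> X \<rightarrow>\<^sub>E carrier K \<and> V.lincomb a X = v)" for v
 have a: "a v \<in> X \<rightarrow>\<^sub>E carrier K" "V.lincomb (a v) X = v" if "v \<in> carrier V" for v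
  using theI'[OF u[OF that]] unfolding a_def by auto
 have aK: "a v x \<in> carrier K" if "v \<in> carrier V" "x \<in> X" for v x
  using a(1)[OF that(1)] that(2) by auto
 have eqI: "a v x = g x" if "v \<in> carrier V" "x \<in> X" "g \<in> X \<rightarrow> carrier K" "V.lincomb g X = v" for v x g
 proof -
  have "V.lincomb (restrict g X) X = v"
   using V.lincomb_cong[of X X "restrict g X" g] that XV by auto
  moreover have "restrict g X \<in> X \<rightarrow>\<^sub>E carrier K" using that(3) by auto
  ultimately have "a v = restrict g X" using u[OF that(1)] a[OF that(1)] by blast
  then show ?thesis using that by simp
 qed
 have lin: "(\<lambda>v. a v x) \<in> module_hom K V (regular_module K)" if x: "x \<in> X" for x
 proof (rule module_homI)
  show "a v x \<in> carrier (regular_module K)" if "v \<in> carrier V" for v using aK[OF that x] by simp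
  show "a (v \<oplus>\<^sub>V w) x = a v x \<oplus>\<^bsub>regular_module K\<^esub> a w x" if vw: "v \<in> carrier V" "w \<in> carrier V" for v w
   unfolding regular_module_simps
   by (rule eqI[of _ _ "\<lambda>x. a v x \<oplus>\<^sub>K a w x"])
     (use vw x aK a V.lincomb_sum[OF X(1) XV, of "a v" "a w"] in auto)
  show "a (k \<odot>\<^sub>V v) x = k \<odot>\<^bsub>regular_module K\<^esub> a v x" if kv: "k \<in> carrier K" "v \<in> carrier V" for k v
   unfolding regular_module_simps
   by (rule eqI[of _ _ "\<lambda>x. k \<otimes>\<^sub>K a v x"])
     (use kv x aK a V.lincomb_smult[OF XV, of "a v" k] in auto)
 qed
 have delta: "a y x = (if x = y then \<one>\<^sub>K else \<zero>\<^sub>K)" if "x \<in> X" "y \<in> X" for x y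
 proof (rule eqI[of _ _ "\<lambda>x. if x = y then \<one>\<^sub>K else \<zero>\<^sub>K"])
  have "(\<Oplus>\<^sub>V x\<in>X. (if x = y then \<one>\<^sub>K else \<zero>\<^sub>K) \<odot>\<^sub>V x) = (\<Oplus>\<^sub>V x\<in>X. if y = x then x else \<zero>\<^sub>V)"
   using XV by (intro V.M.finsum_cong') auto
  also have "\<dots> = y" using XV that X(1) V.M.finsum_singleton[of y X "\<lambda>x. x"] by auto
  finally show "V.lincomb (\<lambda>x. if x = y then \<one>\<^sub>K else \<zero>\<^sub>K) X = y" by (simp add: V.lincomb_def)
 qed (use that XV in auto)
 show thesis
  by (rule that[of X "\<lambda>x v. a v x"])
    (use X XV V.dim_basis[OF X] lin delta a in \<open>auto simp: V.lincomb_def\<close>)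
qed

lemma rank_nullity:
 assumes "vectorspace K V" "vectorspace K W" "f \<in> module_hom K V W"
  and "kfin_dim K V" "f ` carrier V = carrier W"
  and "N = {v \<in> carrier V. f v = \<zero>\<^sub>W}"
 shows "kfin_dim K W"
  "kdim K V = kdim K W + kdim K (V\<lparr>carrier := N\<rparr>)"
proof -
 interpret linear_map K V W f using linear_mapI[OF assms(1-3)] .
 show "kfin_dim K W" using rank_nullity_main(2)[OF assms(4,5)] .
 have "imT = carrier W" using surj_imp_imT_carrier[OF assms(5)] .
 moreover have "kerT = N" using assms(6) unfolding ker_def by auto
 moreover have "W.vs (carrier W) = W" by simp
 ultimately show "kdim K V = kdim K W + kdim K (V\<lparr>carrier := N\<rparr>)"
  using rank_nullity_main(1)[OF assms(4)] by simp
qed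

lemma vectorspace_subsetI:
 assumes "vectorspace K V" "N \<subseteq> carrier V" "\<zero>\<^sub>V \<in> N"
  and "\<And>x y. x \<in> N ==> y \<in> N ==> x \<oplus>\<^sub>V y \<in> N"
  and "\<And>c x. c \<in> carrier K ==> x \<in> N ==> c \<odot>\<^sub>V x \<in> N"
 shows "VectorSpace.subspace K N V" "vectorspace K (V\<lparr>carrier := N\<rparr>)"
proof -
 interpret V: vectorspace K V by fact
 show s: "VectorSpace.subspace K N V"
  using assms by (auto simp: VectorSpace.subspace_def submodule_def V.module_axioms)
 show "vectorspace K (V\<lparr>carrier := N\<rparr>)" using V.subspace_is_vs[OF s] .
qed

lemma fin_dim_subspace:
 assumes "vectorspace K V" "kfin_dim K V" "VectorSpace.subspace K N V"
 shows "kfin_dim K (V\<lparr>carrier := N\<rparr>)"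
proof -
 interpret V: vectorspace K V by fact
 interpret N: vectorspace K "V\<lparr>carrier := N\<rparr>" using V.subspace_is_vs[OF assms(3)] .
 have sm: "LinearCombinations.submodule K N V" using assms(3) by simp
 have NV: "N \<subseteq> carrier V" using sm by (simp add: submodule_def)
 have ind: "N.lin_dep S = V.lin_dep S" if "S \<subseteq> N" for S
  using V.span_li_not_depend(2)[OF that sm] .
 have "\<exists>A. finite A \<and> maximal A (\<lambda>S. S \<subseteq> N \<and> N.lin_indpt S)"
 proof (rule maximal_exists[where N = "V.dim" and B = "{}"])
  show "finite A \<and> card A \<le> V.dim" if "A \<subseteq> N \<and> N.lin_indpt A" for A
   using V.li_le_dim[OF assms(2), of A] that ind[of A] NV by blast
 qed (simp add: N.lin_dep_def)
 then obtain A where "finite A" "maximal A (\<lambda>S. S \<subseteq> N \<and> N.lin_indpt S)" by blast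
 then show ?thesis using N.max_li_is_basis[of A] unfolding N.fin_dim_def N.basis_def by auto
qed

lemma dual_basis_exists:
 fixes U :: "('a, 'u, 'z) module_scheme"
 assumes U: "vectorspace K U" "kfin_dim K U"
 shows "\<exists>(X :: 'u set) c. finite X \<and> card X = kdim K U \<and>
   (\<forall>x\<in>X. c x \<in> module_hom K U (regular_module K)) \<and>
   (\<forall>g\<in>X \<rightarrow> carrier K. \<exists>u\<in>carrier U. \<forall>x\<in>X. c x u = g x) \<and>
   (\<forall>v\<in>carrier U. (\<forall>x\<in>X. c x v = \<zero>\<^sub>K) \<longrightarrow> v = \<zero>\<^sub>U)"
proof -
 interpret U: vectorspace K U by fact
 obtain X c where X: "finite X" "X \<subseteq> carrier U" "card X = kdim K U"
  "\<And>x. x \<in> X ==> c x \<in> module_hom K U (regular_module K)"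
  "\<And>x y. x \<in> X ==> y \<in> X ==> c x y = (if x = y then \<one>\<^sub>K else \<zero>\<^sub>K)"
  "\<And>v. v \<in> carrier U ==> v = (\<Oplus>\<^sub>U x\<in>X. c x v \<odot>\<^sub>U x)"
  using coordinates_exist[OF U] by blast
 have ex: "\<exists>u\<in>carrier U. \<forall>x\<in>X. c x u = g x" if g: "g \<in> X \<rightarrow> carrier K" for g
 proof (intro bexI ballI)
  have gU: "(\<lambda>x. g x \<odot>\<^sub>U x) \<in> X \<rightarrow> carrier U" using g X(2) by auto
  then show "(\<Oplus>\<^sub>U x\<in>X. g x \<odot>\<^sub>U x) \<in> carrier U" by simp
  fix y assume y: "y \<in> X"
  have gK: "g x \<in> carrier K" if "x \<in> X" for x using g that by auto
  have "c y (\<Oplus>\<^sub>U x\<in>X. g x \<odot>\<^sub>U x) = (\<Oplus>\<^sub>K x\<in>X. c y (g x \<odot>\<^sub>U x))"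
   using linear_finsum[OF U(1) vectorspace_regular_module X(4)[OF y] X(1) gU] U.field_axioms by simp
  also have "\<dots> = (\<Oplus>\<^sub>K x\<in>X. if y = x then g x else \<zero>\<^sub>K)"
   using module_homD(3)[OF X(4)[OF y]] X(2,5) gK y by (intro U.R.finsum_cong') (auto simp: subset_iff)
  also have "\<dots> = g y" using y X(1) g U.R.finsum_singleton[of y X g] by auto
  finally show "c y (\<Oplus>\<^sub>U x\<in>X. g x \<odot>\<^sub>U x) = g y" .
 qed
 have inj: "v = \<zero>\<^sub>U" if v: "v \<in> carrier U" "\<forall>x\<in>X. c x v = \<zero>\<^sub>K" for v
 proof -
  have "v = (\<Oplus>\<^sub>U x\<in>X. c x v \<odot>\<^sub>U x)" using X(6) v(1) .
  also have "\<dots> = (\<Oplus>\<^sub>U x\<in>X. \<zero>\<^sub>U)"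
   using v(2) X(2) by (intro U.M.finsum_cong') auto
  finally show ?thesis by simp
 qed
 show ?thesis
  by (intro exI[of _ X] exI[of _ c] conjI ballI impI) (assumption | rule X(1) X(3) X(4) ex inj)+
qed

text \<open>The coordinates of all the target spaces together are coordinates on \<open>V\<close>. One target \<open>W0\<close> is singled out
 because its elements may have a different type from those of the spaces \<open>W i\<close>.\<close>

lemma dim_jointly_bijective:
 fixes W0 :: "('k, 'u, 'z) module_scheme" and W :: "'i => ('k, 'w, 'y) module_scheme"
 assumes V: "vectorspace K V" and W0: "vectorspace K W0" "kfin_dim K W0"
  and J: "finite J" and W: "\<And>i. i \<in> J ==> vectorspace K (W i)" "\<And>i. i \<in> J ==> kfin_dim K (W i)"
  and T0: "T0 \<in> module_hom K V W0" and T: "\<And>i. i \<in> J ==> T i \<in> module_hom K V (W i)"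
  and ex: "\<And>w0 w. w0 \<in> carrier W0 ==> (\<And>i. i \<in> J ==> w i \<in> carrier (W i)) ==>
    \<exists>v\<in>carrier V. T0 v = w0 \<and> (\<forall>i\<in>J. T i v = w i)"
  and inj: "\<And>v. v \<in> carrier V ==> T0 v = \<zero>\<^sub>W0 ==> (\<And>i. i \<in> J ==> T i v = \<zero>\<^bsub>W i\<^esub>) ==> v = \<zero>\<^sub>V"
 shows "kfin_dim K V"
  and "kdim K V = kdim K W0 + (\<Sum>i\<in>J. kdim K (W i))"
proof -
 interpret V: vectorspace K V by fact
 obtain X0 :: "'u set" and c0 where 0: "finite X0" "card X0 = kdim K W0"
   "\<forall>x\<in>X0. c0 x \<in> module_hom K W0 (regular_module K)"
   "\<forall>g\<in>X0 \<rightarrow> carrier K. \<exists>u\<in>carrier W0. \<forall>x\<in>X0. c0 x u = g x"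
   "\<forall>v\<in>carrier W0. (\<forall>x\<in>X0. c0 x v = \<zero>\<^sub>K) \<longrightarrow> v = \<zero>\<^sub>W0"
  using dual_basis_exists[OF W0] by (elim exE conjE) (rule that, assumption+)
 have "\<forall>i\<in>J. \<exists>(X :: 'w set) c. finite X \<and> card X = kdim K (W i) \<and>
   (\<forall>x\<in>X. c x \<in> module_hom K (W i) (regular_module K)) \<and>
   (\<forall>g\<in>X \<rightarrow> carrier K. \<exists>u\<in>carrier (W i). \<forall>x\<in>X. c x u = g x) \<and>
   (\<forall>v\<in>carrier (W i). (\<forall>x\<in>X. c x v = \<zero>\<^sub>K) \<longrightarrow> v = \<zero>\<^bsub>W i\<^esub>)"
  by (intro ballI dual_basis_exists W)
 then obtain X :: "'i => 'w set" and c where X: "\<forall>i\<in>J. finite (X i) \<and> card (X i) = kdim K (W i) \<and>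
   (\<forall>x\<in>X i. c i x \<in> module_hom K (W i) (regular_module K)) \<and>
   (\<forall>g\<in>X i \<rightarrow> carrier K. \<exists>u\<in>carrier (W i). \<forall>x\<in>X i. c i x u = g x) \<and>
   (\<forall>v\<in>carrier (W i). (\<forall>x\<in>X i. c i x v = \<zero>\<^sub>K) \<longrightarrow> v = \<zero>\<^bsub>W i\<^esub>)"
  unfolding bchoice_iff by (elim exE) (rule that, assumption)
 define Y where "Y = X0 <+> Sigma J X"
 define d where "d = case_sum (\<lambda>x v. c0 x (T0 v)) (\<lambda>(i, x) v. c i x (T i v))"
 have inY: "x \<in> X0 ==> Inl x \<in> Y" "i \<in> J ==> z \<in> X i ==> Inr (i, z) \<in> Y" for x i z
  unfolding Y_def by blast+
 have finY: "finite Y" unfolding Y_def using 0 X J by auto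
 have lin: "d y \<in> module_hom K V (regular_module K)" if y: "y \<in> Y" for y
 proof -
  consider x where "x \<in> X0" "y = Inl x" | i x where "i \<in> J" "x \<in> X i" "y = Inr (i, x)"
   using y unfolding Y_def by blast
  then show ?thesis
  proof cases
   case 1
   have "c0 x \<in> module_hom K W0 (regular_module K)" using 0(3) 1(1) by blast
   from module_hom_comp[OF T0 this] show ?thesis unfolding 1 d_def by simp
  next
   case 2
   have "c i x \<in> module_hom K (W i) (regular_module K)" using X 2(1,2) by blast
   from module_hom_comp[OF T[OF 2(1)] this] show ?thesis unfolding 2 d_def by simp
  qed
 qed
 have ex': "\<exists>v\<in>carrier V. \<forall>y\<in>Y. d y v = g y" if g: "g \<in> Y \<rightarrow> carrier K" for g
 proof -
  obtain w0 where w0: "w0 \<in> carrier W0" "\<forall>x\<in>X0. c0 x w0 = g (Inl x)"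
   using bspec[OF 0(4), of "\<lambda>x. g (Inl x)"] g unfolding Y_def by auto
  have "\<forall>i\<in>J. \<exists>w\<in>carrier (W i). \<forall>x\<in>X i. c i x w = g (Inr (i, x))"
  proof
   fix i assume i: "i \<in> J"
   have "\<forall>g\<in>X i \<rightarrow> carrier K. \<exists>u\<in>carrier (W i). \<forall>x\<in>X i. c i x u = g x" using X i by blast
   moreover have "(\<lambda>x. g (Inr (i, x))) \<in> X i \<rightarrow> carrier K" using g i by (auto simp: Y_def)
   ultimately show "\<exists>w\<in>carrier (W i). \<forall>x\<in>X i. c i x w = g (Inr (i, x))" by auto
  qed
  then obtain w where w: "\<forall>i\<in>J. w i \<in> carrier (W i) \<and> (\<forall>x\<in>X i. c i x (w i) = g (Inr (i, x)))"
   by metis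
  obtain v where v: "v \<in> carrier V" "T0 v = w0" "\<forall>i\<in>J. T i v = w i"
   using ex[OF w0(1), of w] w by auto
  show ?thesis using v w0 w by (intro bexI[of _ v]) (auto simp: Y_def d_def)
 qed
 have inj': "v = \<zero>\<^sub>V" if v: "v \<in> carrier V" "\<forall>y\<in>Y. d y v = \<zero>\<^sub>K" for v
 proof (rule inj[OF v(1)])
  have "c0 x (T0 v) = \<zero>\<^sub>K" if "x \<in> X0" for x
   using bspec[OF v(2) inY(1)[OF that]] by (simp add: d_def)
  then show "T0 v = \<zero>\<^sub>W0" using 0(5) module_homD(1)[OF T0 v(1)] by blast
  fix i assume i: "i \<in> J"
  have "c i x (T i v) = \<zero>\<^sub>K" if "x \<in> X i" for x
   using bspec[OF v(2) inY(2)[OF i that]] by (simp add: d_def)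
  then show "T i v = \<zero>\<^bsub>W i\<^esub>"
   using X i module_homD(1)[OF T[OF i] v(1)] by blast
 qed
 note res = dim_eq_card_coordinates[OF V finY lin ex' inj']
 show "kfin_dim K V" by (rule res(1)) assumption+
 have "kdim K V = card Y" by (rule res(2)) assumption+
 also have "\<dots> = card X0 + (\<Sum>i\<in>J. card (X i))"
  using 0 X J unfolding Y_def by (simp add: card_Plus card_SigmaI)
 finally show "kdim K V = kdim K W0 + (\<Sum>i\<in>J. kdim K (W i))"
  using 0 X by simp
qed

lemma fin_dim_zero_space:
 assumes "vectorspace K V"
 shows "vectorspace K (V\<lparr>carrier := {\<zero>\<^sub>V}\<rparr>)" "kfin_dim K (V\<lparr>carrier := {\<zero>\<^sub>V}\<rparr>)"
  "kdim K (V\<lparr>carrier := {\<zero>\<^sub>V}\<rparr>) = 0"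
proof -
 interpret V: vectorspace K V by fact
 show vs: "vectorspace K (V\<lparr>carrier := {\<zero>\<^sub>V}\<rparr>)"
  by (rule vectorspace_subsetI[OF assms]) auto
 note r = dim_eq_card_coordinates[OF vs, of "{}" "\<lambda>_. undefined"]
 show "kfin_dim K (V\<lparr>carrier := {\<zero>\<^sub>V}\<rparr>)" by (rule r(1)) auto
 have "kdim K (V\<lparr>carrier := {\<zero>\<^sub>V}\<rparr>) = card ({} :: 'b set)" by (rule r(2)) auto
 then show "kdim K (V\<lparr>carrier := {\<zero>\<^sub>V}\<rparr>) = 0" by simp
qed

text \<open>The case in which the extra target of the preceding count is the zero space.\<close>

lemma dim_jointly_bijective_family:
 fixes W :: "'i => ('k, 'w, 'y) module_scheme"
 assumes V: "vectorspace K V"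
  and J: "finite J" and W: "\<And>i. i \<in> J ==> vectorspace K (W i)" "\<And>i. i \<in> J ==> kfin_dim K (W i)"
  and T: "\<And>i. i \<in> J ==> T i \<in> module_hom K V (W i)"
  and ex: "\<And>w. (\<And>i. i \<in> J ==> w i \<in> carrier (W i)) ==> \<exists>v\<in>carrier V. \<forall>i\<in>J. T i v = w i"
  and inj: "\<And>v. v \<in> carrier V ==> (\<And>i. i \<in> J ==> T i v = \<zero>\<^bsub>W i\<^esub>) ==> v = \<zero>\<^sub>V"
 shows "kfin_dim K V"
  and "kdim K V = (\<Sum>i\<in>J. kdim K (W i))"
proof -
 interpret V: vectorspace K V by fact
 let ?Z = "V\<lparr>carrier := {\<zero>\<^sub>V}\<rparr>"
 note z = fin_dim_zero_space[OF V]
 have T0: "(\<lambda>_. \<zero>\<^sub>V) \<in> module_hom K V ?Z" by (rule module_homI) auto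
 note r = dim_jointly_bijective[OF V z(1,2) J W T0 T, of "\<lambda>i. i"]
 have ex': "\<exists>v\<in>carrier V. \<zero>\<^sub>V = w0 \<and> (\<forall>i\<in>J. T i v = w i)"
  if "w0 \<in> carrier ?Z" "\<And>i. i \<in> J ==> w i \<in> carrier (W i)" for w0 w
  using ex[OF that(2)] that(1) by auto
 have inj': "v = \<zero>\<^sub>V" if "v \<in> carrier V" "\<And>i. i \<in> J ==> T i v = \<zero>\<^bsub>W i\<^esub>" for v
  using inj[OF that] .
 show "kfin_dim K V"
  by (rule dim_jointly_bijective(1)[OF V z(1,2) J W T0 T ex']) (use inj' in auto)
 have "kdim K V = kdim K ?Z + (\<Sum>i\<in>J. kdim K (W i))"
  by (rule dim_jointly_bijective(2)[OF V z(1,2) J W T0 T ex']) (use inj' in auto)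
 then show "kdim K V = (\<Sum>i\<in>J. kdim K (W i))" using z(3) by simp
qed

lemma dim_eq_by_iso:
 assumes V: "vectorspace K V" and W: "vectorspace K W" "kfin_dim K W"
  and T: "T \<in> module_hom K V W" and surj: "\<And>w. w \<in> carrier W ==> \<exists>v\<in>carrier V. T v = w"
  and inj: "\<And>v. v \<in> carrier V ==> T v = \<zero>\<^sub>W ==> v = \<zero>\<^sub>V"
 shows "kfin_dim K V" "kdim K V = kdim K W"
proof -
 note r = dim_jointly_bijective_family[OF V, of "{()}" "\<lambda>_. W" "\<lambda>_. T"]
 show "kfin_dim K V" by (rule r(1)) (use W T inj surj in auto)
 have "kdim K V = (\<Sum>i\<in>{()}. kdim K W)" by (rule r(2)) (use W T inj surj in auto)
 then show "kdim K V = kdim K W" by simp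
qed

section \<open>Spaces of functions and quotient spaces\<close>

lemma pointwise_simps [simp]:
 "carrier (pointwise X V) = X \<rightarrow>\<^sub>E carrier V"
 "zero (pointwise X V) = (\<lambda>x\<in>X. \<zero>\<^sub>V)"
 "add (pointwise X V) = (\<lambda>f g. \<lambda>x\<in>X. f x \<oplus>\<^sub>V g x)"
 "smult (pointwise X V) = (\<lambda>c f. \<lambda>x\<in>X. c \<odot>\<^sub>V f x)"
 by (simp_all add: pointwise_def)

lemma vectorspace_pointwise:
 assumes "vectorspace K V"
 shows "vectorspace K (pointwise X V)"
proof -
 interpret V: vectorspace K V by fact
 have mem: "f x \<in> carrier V" if "f \<in> X \<rightarrow>\<^sub>E carrier V" "x \<in> X" for f x using that by auto
 have ext: "(\<lambda>x\<in>X. g x) = f" if "f \<in> X \<rightarrow>\<^sub>E carrier V" "\<And>x. x \<in> X ==> g x = f x" for f g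
  using that by (auto simp: fun_eq_iff PiE_def extensional_def)
 show ?thesis
 proof (rule vs_criteria)
  show "field K" by unfold_locales
  show "\<forall>v\<in>carrier (pointwise X V). \<exists>neg_v\<in>carrier (pointwise X V). v \<oplus>\<^bsub>pointwise X V\<^esub> neg_v = \<zero>\<^bsub>pointwise X V\<^esub>"
  proof
   fix v assume v: "v \<in> carrier (pointwise X V)"
   then have "(\<lambda>x\<in>X. \<ominus>\<^sub>V v x) \<in> carrier (pointwise X V)" by (auto dest: mem)
   moreover have "v \<oplus>\<^bsub>pointwise X V\<^esub> (\<lambda>x\<in>X. \<ominus>\<^sub>V v x) = \<zero>\<^bsub>pointwise X V\<^esub>"
    using v by (auto intro!: restrict_ext simp: V.M.r_neg mem)
   ultimately show "\<exists>neg_v\<in>carrier (pointwise X V). v \<oplus>\<^bsub>pointwise X V\<^esub> neg_v = \<zero>\<^bsub>pointwise X V\<^esub>" by blast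
  qed
  show "\<forall>v\<in>carrier (pointwise X V). v \<oplus>\<^bsub>pointwise X V\<^esub> \<zero>\<^bsub>pointwise X V\<^esub> = v"
   by (auto intro!: ext simp: mem)
  show "\<forall>v\<in>carrier (pointwise X V). \<one>\<^sub>K \<odot>\<^bsub>pointwise X V\<^esub> v = v"
   by (auto intro!: ext simp: mem)
 qed (auto intro!: restrict_ext simp: mem V.M.a_ac V.smult_l_distr V.smult_r_distr V.smult_assoc1)
qed

lemma homsD:
 assumes "f \<in> homs K V W"
 shows "x \<in> carrier V ==> f x \<in> carrier W"
  and "x \<in> carrier V ==> y \<in> carrier V ==> f (x \<oplus>\<^sub>V y) = f x \<oplus>\<^sub>W f y"
  and "c \<in> carrier K ==> x \<in> carrier V ==> f (c \<odot>\<^sub>V x) = c \<odot>\<^sub>W f x"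
  and "f \<in> module_hom K V W" and "f \<in> extensional (carrier V)" and "f \<in> carrier V \<rightarrow>\<^sub>E carrier W"
 using assms module_homD[of f K V W] by (auto simp: homs_def PiE_def)

lemma homsI:
 assumes "\<And>x. x \<in> carrier V ==> f x \<in> carrier W"
  and "\<And>x y. x \<in> carrier V ==> y \<in> carrier V ==> f (x \<oplus>\<^sub>V y) = f x \<oplus>\<^sub>W f y"
  and "\<And>c x. c \<in> carrier K ==> x \<in> carrier V ==> f (c \<odot>\<^sub>V x) = c \<odot>\<^sub>W f x"
  and "f \<in> extensional (carrier V)"
 shows "f \<in> homs K V W"
 unfolding homs_def using assms by (auto intro: module_homI)

lemma homs_restrictI:
 assumes "f \<in> module_hom K V W"
  and "\<And>x y. x \<in> carrier V ==> y \<in> carrier V ==> x \<oplus>\<^sub>V y \<in> carrier V"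
  and "\<And>c x. c \<in> carrier K ==> x \<in> carrier V ==> c \<odot>\<^sub>V x \<in> carrier V"
 shows "(\<lambda>x\<in>carrier V. f x) \<in> homs K V W"
 by (rule homsI) (use assms module_homD[OF assms(1)] in auto)

lemma extensional_eqI:
 assumes "f \<in> extensional X" "g \<in> extensional X" "\<And>x. x \<in> X ==> f x = g x"
 shows "f = g"
 using assms by (rule extensionalityI)

lemma subspace_homs:
 assumes V: "vectorspace K V" and W: "vectorspace K W"
 shows "VectorSpace.subspace K (homs K V W) (pointwise (carrier V) W)"
  "vectorspace K ((pointwise (carrier V) W)\<lparr>carrier := homs K V W\<rparr>)"
proof -
 interpret V: vectorspace K V by fact
 interpret W: vectorspace K W by fact
 note r = vectorspace_subsetI[OF vectorspace_pointwise[OF W], of "homs K V W" "carrier V"]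
 have sub: "homs K V W \<subseteq> carrier (pointwise (carrier V) W)" by (auto dest: homsD(6))
 have z: "\<zero>\<^bsub>pointwise (carrier V) W\<^esub> \<in> homs K V W" by (rule homsI) auto
 have a: "f \<oplus>\<^bsub>pointwise (carrier V) W\<^esub> g \<in> homs K V W" if "f \<in> homs K V W" "g \<in> homs K V W" for f g
  using homsD(1-3)[OF that(1)] homsD(1-3)[OF that(2)]
  by (intro homsI) (auto simp: W.M.a_ac W.smult_r_distr)
 have s: "c \<odot>\<^bsub>pointwise (carrier V) W\<^esub> f \<in> homs K V W" if "c \<in> carrier K" "f \<in> homs K V W" for c f
  using homsD(1-3)[OF that(2)] that(1)
  by (intro homsI) (auto simp: W.smult_r_distr W.smult_assoc1[symmetric] V.R.m_comm)
 show "VectorSpace.subspace K (homs K V W) (pointwise (carrier V) W)" by (rule r(1)[OF sub z a s])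
 show "vectorspace K ((pointwise (carrier V) W)\<lparr>carrier := homs K V W\<rparr>)" by (rule r(2)[OF sub z a s])
qed

text \<open>A linear map is determined by the values on a basis, and these can be prescribed.\<close>

lemma fin_dim_homs:
 assumes V: "vectorspace K V" "kfin_dim K V" and W: "vectorspace K W" "kfin_dim K W"
 shows "kfin_dim K ((pointwise (carrier V) W)\<lparr>carrier := homs K V W\<rparr>)"
proof -
 interpret V: vectorspace K V by fact
 interpret W: vectorspace K W by fact
 obtain X c where X: "finite X" "X \<subseteq> carrier V" "card X = kdim K V"
  and c: "\<And>x. x \<in> X ==> c x \<in> module_hom K V (regular_module K)"
  and cd: "\<And>x y. x \<in> X ==> y \<in> X ==> c x y = (if x = y then \<one>\<^sub>K else \<zero>\<^sub>K)"
  and cv: "\<And>v. v \<in> carrier V ==> v = (\<Oplus>\<^sub>V x\<in>X. c x v \<odot>\<^sub>V x)"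
  using coordinates_exist[OF V] by blast
 let ?H = "(pointwise (carrier V) W)\<lparr>carrier := homs K V W\<rparr>"
 have XV: "x \<in> carrier V" if "x \<in> X" for x using X that by auto
 have cK: "c x v \<in> carrier K" if "x \<in> X" "v \<in> carrier V" for x v
  using module_homD(1)[OF c[OF that(1)] that(2)] by simp
 note cl = module_homD(2,3)[OF c]
 show ?thesis
 proof (rule dim_jointly_bijective_family(1)[OF subspace_homs(2)[OF V(1) W(1)] X(1),
    where W = "\<lambda>_. W" and T = "\<lambda>x f. f x"])
  show "(\<lambda>f. f x) \<in> module_hom K ?H W" if "x \<in> X" for x
   using XV[OF that] by (intro module_homI) (auto dest: homsD(1))
  show "\<exists>v\<in>carrier ?H. \<forall>x\<in>X. v x = w x" if w: "\<And>x. x \<in> X ==> w x \<in> carrier W" for w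
  proof (intro bexI[of _ "\<lambda>v\<in>carrier V. \<Oplus>\<^sub>W x\<in>X. c x v \<odot>\<^sub>W w x"] ballI)
   have fW: "(\<lambda>x. c x v \<odot>\<^sub>W w x) \<in> X \<rightarrow> carrier W" if "v \<in> carrier V" for v using cK w that by auto
   have "(\<lambda>v. \<Oplus>\<^sub>W x\<in>X. c x v \<odot>\<^sub>W w x) \<in> module_hom K V W"
   proof (rule module_homI)
    show "(\<Oplus>\<^sub>W x\<in>X. c x v \<odot>\<^sub>W w x) \<in> carrier W" if "v \<in> carrier V" for v using fW[OF that] by simp
    show "(\<Oplus>\<^sub>W x\<in>X. c x (u \<oplus>\<^sub>V v) \<odot>\<^sub>W w x) = (\<Oplus>\<^sub>W x\<in>X. c x u \<odot>\<^sub>W w x) \<oplus>\<^sub>W (\<Oplus>\<^sub>W x\<in>X. c x v \<odot>\<^sub>W w x)"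
     if "u \<in> carrier V" "v \<in> carrier V" for u v
    proof -
     have "(\<Oplus>\<^sub>W x\<in>X. c x (u \<oplus>\<^sub>V v) \<odot>\<^sub>W w x) = (\<Oplus>\<^sub>W x\<in>X. c x u \<odot>\<^sub>W w x \<oplus>\<^sub>W c x v \<odot>\<^sub>W w x)"
      using cl that cK w by (intro W.M.finsum_cong') (auto simp: W.smult_l_distr)
     then show ?thesis using W.M.finsum_addf[OF fW[OF that(1)] fW[OF that(2)]] by simp
    qed
    show "(\<Oplus>\<^sub>W x\<in>X. c x (k \<odot>\<^sub>V v) \<odot>\<^sub>W w x) = k \<odot>\<^sub>W (\<Oplus>\<^sub>W x\<in>X. c x v \<odot>\<^sub>W w x)"
     if "k \<in> carrier K" "v \<in> carrier V" for k v
    proof -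
     have "(\<Oplus>\<^sub>W x\<in>X. c x (k \<odot>\<^sub>V v) \<odot>\<^sub>W w x) = (\<Oplus>\<^sub>W x\<in>X. k \<odot>\<^sub>W (c x v \<odot>\<^sub>W w x))"
      using cl that cK w by (intro W.M.finsum_cong') (auto simp: W.smult_assoc1)
     then show ?thesis using W.finsum_smult_ldistr[OF X(1) that(1) fW[OF that(2)]] by simp
    qed
   qed
   then show "(\<lambda>v\<in>carrier V. \<Oplus>\<^sub>W x\<in>X. c x v \<odot>\<^sub>W w x) \<in> carrier ?H"
    by (auto intro!: homs_restrictI)
   fix y assume y: "y \<in> X"
   have "(\<Oplus>\<^sub>W x\<in>X. c x y \<odot>\<^sub>W w x) = (\<Oplus>\<^sub>W x\<in>X. if y = x then w x else \<zero>\<^sub>W)"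
    using cd y w by (intro W.M.finsum_cong') auto
   also have "\<dots> = w y" using W.M.finsum_singleton[OF y X(1), of w] w by auto
   finally show "(\<lambda>v\<in>carrier V. \<Oplus>\<^sub>W x\<in>X. c x v \<odot>\<^sub>W w x) y = w y" using XV[OF y] by simp
  qed
  show "f = \<zero>\<^bsub>?H\<^esub>" if f: "f \<in> carrier ?H" "\<And>x. x \<in> X ==> f x = \<zero>\<^sub>W" for f
  proof (rule extensional_eqI)
   have h: "f \<in> homs K V W" using f by simp
   show "f \<in> extensional (carrier V)" using homsD(5)[OF h] .
   fix v assume v: "v \<in> carrier V"
   have fV: "(\<lambda>x. c x v \<odot>\<^sub>V x) \<in> X \<rightarrow> carrier V" using cK XV v by auto
   have "f v = f (\<Oplus>\<^sub>V x\<in>X. c x v \<odot>\<^sub>V x)" using cv[OF v] by simp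
   also have "\<dots> = (\<Oplus>\<^sub>W x\<in>X. f (c x v \<odot>\<^sub>V x))"
    using linear_finsum[OF V(1) W(1) homsD(4)[OF h] X(1) fV] .
   also have "\<dots> = (\<Oplus>\<^sub>W x\<in>X. \<zero>\<^sub>W)"
    using homsD(3)[OF h] cK XV v f(2) by (intro W.M.finsum_cong') auto
   finally show "f v = \<zero>\<^bsub>?H\<^esub> v" using v by simp
  qed simp
 qed (use W in auto)
qed

lemma quot_module_simps:
 "carrier (quot_module V W) = a_rcosets\<^bsub>V\<^esub> W"
 "add (quot_module V W) = set_add V"
 "zero (quot_module V W) = W"
 "mult (quot_module V W) = rcoset_mult V W"
 "one (quot_module V W) = W +>\<^sub>V \<one>\<^sub>V"
 "smult (quot_module V W) = (\<lambda>c X. \<Union>x\<in>X. W +>\<^sub>V (c \<odot>\<^sub>V x))"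
 by (auto simp: quot_module_def FactRing_def ring.defs module.defs)

text \<open>All that is used about quotient spaces: elements are cosets, and the operations are those of representatives.\<close>

lemma quot_module_coset:
 assumes V: "vectorspace K V" and W: "VectorSpace.subspace K W V"
 shows "carrier (quot_module V W) = (\<lambda>v. W +>\<^sub>V v) ` carrier V"
  and "\<And>u v. u \<in> carrier V ==> v \<in> carrier V ==> (W +>\<^sub>V u) \<oplus>\<^bsub>quot_module V W\<^esub> (W +>\<^sub>V v) = W +>\<^sub>V (u \<oplus>\<^sub>V v)"
  and "\<And>c v. c \<in> carrier K ==> v \<in> carrier V ==> c \<odot>\<^bsub>quot_module V W\<^esub> (W +>\<^sub>V v) = W +>\<^sub>V (c \<odot>\<^sub>V v)"
  and "\<zero>\<^bsub>quot_module V W\<^esub> = W +>\<^sub>V \<zero>\<^sub>V"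
  and "\<And>u v. u \<in> carrier V ==> v \<in> carrier V ==> W +>\<^sub>V u = W +>\<^sub>V v \<longleftrightarrow> u \<ominus>\<^sub>V v \<in> W"
  and "\<And>v. v \<in> carrier V ==> v \<in> W +>\<^sub>V v"
  and "\<And>u v. v \<in> carrier V ==> u \<in> W +>\<^sub>V v ==> u \<in> carrier V \<and> W +>\<^sub>V u = W +>\<^sub>V v"
proof -
 interpret V: vectorspace K V by fact
 have sm: "LinearCombinations.submodule K W V" using W by simp
 have sub: "W \<subseteq> carrier V" and z: "\<zero>\<^sub>V \<in> W" and add: "\<And>x y. x \<in> W ==> y \<in> W ==> x \<oplus>\<^sub>V y \<in> W"
  and sc: "\<And>c x. c \<in> carrier K ==> x \<in> W ==> c \<odot>\<^sub>V x \<in> W"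
  using sm unfolding LinearCombinations.submodule_def by auto
 have neg: "\<ominus>\<^sub>V x \<in> W" if "x \<in> W" for x
 proof -
  have "(\<ominus>\<^sub>K \<one>\<^sub>K) \<odot>\<^sub>V x \<in> W" using sc[of "\<ominus>\<^sub>K \<one>\<^sub>K" x] that by simp
  then show ?thesis using V.smult_l_minus[of "\<one>\<^sub>K" x] that sub by (auto simp: subset_iff)
 qed
 have as: "additive_subgroup W V"
  by (intro additive_subgroup.intro subgroup.intro) (use sub z add neg in \<open>auto simp: a_inv_def[symmetric]\<close>)
 have ag: "abelian_group V" by unfold_locales
 interpret W: abelian_subgroup W V by (rule abelian_subgroupI3[OF as ag])
 show c: "carrier (quot_module V W) = (\<lambda>v. W +>\<^sub>V v) ` carrier V"
  unfolding quot_module_simps A_RCOSETS_def' by auto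
 show "(W +>\<^sub>V u) \<oplus>\<^bsub>quot_module V W\<^esub> (W +>\<^sub>V v) = W +>\<^sub>V (u \<oplus>\<^sub>V v)"
  if "u \<in> carrier V" "v \<in> carrier V" for u v
  using W.a_rcos_sum[OF that] by (simp add: quot_module_simps)
 show "\<zero>\<^bsub>quot_module V W\<^esub> = W +>\<^sub>V \<zero>\<^sub>V" using sub by (simp add: quot_module_simps V.M.a_coset_add_zero)
 show eq: "W +>\<^sub>V u = W +>\<^sub>V v \<longleftrightarrow> u \<ominus>\<^sub>V v \<in> W" if "u \<in> carrier V" "v \<in> carrier V" for u v
 proof
  assume "W +>\<^sub>V u = W +>\<^sub>V v"
  then have "u \<in> W +>\<^sub>V v" using W.a_rcos_self[OF that(1)] by simp
  then obtain w where w: "w \<in> W" "u = w \<oplus>\<^sub>V v" unfolding a_r_coset_def' by auto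
  then have "u \<ominus>\<^sub>V v = w" using that sub by (auto simp: V.M.minus_eq V.M.a_assoc V.M.r_neg subset_iff)
  then show "u \<ominus>\<^sub>V v \<in> W" using w by simp
 next
  assume a: "u \<ominus>\<^sub>V v \<in> W"
  have "u = (u \<ominus>\<^sub>V v) \<oplus>\<^sub>V v" using that by (simp add: V.M.minus_eq V.M.a_assoc V.M.l_neg)
  then have "u \<in> W +>\<^sub>V v" using a unfolding a_r_coset_def' by auto
  then show "W +>\<^sub>V u = W +>\<^sub>V v" using W.a_repr_independence'[of u v] that by auto
 qed
 show self: "v \<in> W +>\<^sub>V v" if "v \<in> carrier V" for v using W.a_rcos_self[OF that] .
 show mem: "u \<in> carrier V \<and> W +>\<^sub>V u = W +>\<^sub>V v" if vu: "v \<in> carrier V" "u \<in> W +>\<^sub>V v" for u v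
 proof
  obtain w where w: "w \<in> W" "u = w \<oplus>\<^sub>V v" using vu(2) unfolding a_r_coset_def' by blast
  then show u: "u \<in> carrier V" using sub vu by auto
  show "W +>\<^sub>V u = W +>\<^sub>V v" using W.a_repr_independence'[of u v] vu by auto
 qed
 show "c \<odot>\<^bsub>quot_module V W\<^esub> (W +>\<^sub>V v) = W +>\<^sub>V (c \<odot>\<^sub>V v)" if cv: "c \<in> carrier K" "v \<in> carrier V" for c v
 proof -
  have "W +>\<^sub>V (c \<odot>\<^sub>V u) = W +>\<^sub>V (c \<odot>\<^sub>V v)" if "u \<in> W +>\<^sub>V v" for u
  proof -
   have u: "u \<in> carrier V" "u \<ominus>\<^sub>V v \<in> W" using mem[OF cv(2) that] eq cv(2) by auto
   have "c \<odot>\<^sub>V u \<ominus>\<^sub>V c \<odot>\<^sub>V v = c \<odot>\<^sub>V (u \<ominus>\<^sub>V v)"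
    using cv u by (simp add: V.M.minus_eq V.smult_r_distr V.smult_r_minus)
   then show ?thesis using sc[OF cv(1) u(2)] eq[of "c \<odot>\<^sub>V u" "c \<odot>\<^sub>V v"] cv u by simp
  qed
  then show ?thesis using self[OF cv(2)] unfolding quot_module_simps by blast
 qed
qed

lemma quot_module_vectorspace:
 assumes V: "vectorspace K V" and W: "VectorSpace.subspace K W V"
 shows "vectorspace K (quot_module V W)"
  and "(\<lambda>v. W +>\<^sub>V v) \<in> module_hom K V (quot_module V W)"
  and "\<And>v. v \<in> carrier V ==> W +>\<^sub>V v = \<zero>\<^bsub>quot_module V W\<^esub> \<longleftrightarrow> v \<in> W"
proof -
 interpret V: vectorspace K V by fact
 note q = quot_module_coset[OF V W]
 show "vectorspace K (quot_module V W)"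
 proof (rule vs_criteria)
  show "field K" by unfold_locales
  show "\<forall>v\<in>carrier (quot_module V W). \<exists>w\<in>carrier (quot_module V W). v \<oplus>\<^bsub>quot_module V W\<^esub> w = \<zero>\<^bsub>quot_module V W\<^esub>"
  proof
   fix X assume "X \<in> carrier (quot_module V W)"
   then obtain v where v: "v \<in> carrier V" "X = W +>\<^sub>V v" using q(1) by auto
   then show "\<exists>w\<in>carrier (quot_module V W). X \<oplus>\<^bsub>quot_module V W\<^esub> w = \<zero>\<^bsub>quot_module V W\<^esub>"
    by (intro bexI[of _ "W +>\<^sub>V (\<ominus>\<^sub>V v)"]) (auto simp: q(1) q(2) q(4) V.M.r_neg)
  qed
 qed (auto simp: q(1) q(2) q(3) q(4) V.M.a_ac V.smult_l_distr V.smult_r_distr V.smult_assoc1)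
 show "(\<lambda>v. W +>\<^sub>V v) \<in> module_hom K V (quot_module V W)"
  by (rule module_homI) (use q(1) in \<open>auto simp: q(2) q(3)\<close>)
 have z: "\<ominus>\<^sub>V \<zero>\<^sub>V = \<zero>\<^sub>V" by (rule V.M.minus_equality) auto
 show "W +>\<^sub>V v = \<zero>\<^bsub>quot_module V W\<^esub> \<longleftrightarrow> v \<in> W" if "v \<in> carrier V" for v
  using that q(5)[OF that, of "\<zero>\<^sub>V"] unfolding q(4) by (simp add: V.M.minus_eq z)
qed

text \<open>Rank and nullity of the canonical projection.\<close>

lemma dim_quot_module:
 assumes V: "vectorspace K V" "kfin_dim K V" and W: "VectorSpace.subspace K W V"
 shows "kfin_dim K (quot_module V W)"
  "kdim K V = kdim K (quot_module V W) + kdim K (V\<lparr>carrier := W\<rparr>)"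
proof -
 note q = quot_module_vectorspace[OF V(1) W] and c = quot_module_coset[OF V(1) W]
 have sub: "W \<subseteq> carrier V" using W unfolding VectorSpace.subspace_def LinearCombinations.submodule_def by auto
 have k: "W = {v \<in> carrier V. W +>\<^sub>V v = \<zero>\<^bsub>quot_module V W\<^esub>}" using q(3) sub by auto
 show "kfin_dim K (quot_module V W)"
  by (rule rank_nullity(1)[OF V(1) q(1,2) V(2) c(1)[symmetric] k])
 show "kdim K V = kdim K (quot_module V W) + kdim K (V\<lparr>carrier := W\<rparr>)"
  by (rule rank_nullity(2)[OF V(1) q(1,2) V(2) c(1)[symmetric] k])
qed

section \<open>Algebras, modules and bimodules\<close>

definition k_algebra :: "('k, 'r) ring_scheme => ('k, 'a, 'z) module_scheme => bool" where
 "k_algebra K A \<longleftrightarrow> vectorspace K A \<and> ring A \<and>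
   (\<forall>c\<in>carrier K. \<forall>a\<in>carrier A. \<forall>b\<in>carrier A.
    (c \<odot>\<^sub>A a) \<otimes>\<^sub>A b = c \<odot>\<^sub>A (a \<otimes>\<^sub>A b) \<and> a \<otimes>\<^sub>A (c \<odot>\<^sub>A b) = c \<odot>\<^sub>A (a \<otimes>\<^sub>A b))"

lemma k_algebraD:
 assumes "k_algebra K A"
 shows "vectorspace K A" "ring A"
  and "\<And>c a b. c \<in> carrier K ==> a \<in> carrier A ==> b \<in> carrier A ==> (c \<odot>\<^sub>A a) \<otimes>\<^sub>A b = c \<odot>\<^sub>A (a \<otimes>\<^sub>A b)"
  and "\<And>c a b. c \<in> carrier K ==> a \<in> carrier A ==> b \<in> carrier A ==> a \<otimes>\<^sub>A (c \<odot>\<^sub>A b) = c \<odot>\<^sub>A (a \<otimes>\<^sub>A b)"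
 using assms unfolding k_algebra_def by auto

lemma k_algebraI:
 assumes V: "vectorspace K A"
  and "\<one>\<^sub>A \<in> carrier A"
  and "\<And>a b. a \<in> carrier A ==> b \<in> carrier A ==> a \<otimes>\<^sub>A b \<in> carrier A"
  and "\<And>a b c. a \<in> carrier A ==> b \<in> carrier A ==> c \<in> carrier A ==> a \<otimes>\<^sub>A b \<otimes>\<^sub>A c = a \<otimes>\<^sub>A (b \<otimes>\<^sub>A c)"
  and "\<And>a. a \<in> carrier A ==> \<one>\<^sub>A \<otimes>\<^sub>A a = a"
  and "\<And>a. a \<in> carrier A ==> a \<otimes>\<^sub>A \<one>\<^sub>A = a"
  and "\<And>a b c. a \<in> carrier A ==> b \<in> carrier A ==> c \<in> carrier A ==> (a \<oplus>\<^sub>A b) \<otimes>\<^sub>A c = a \<otimes>\<^sub>A c \<oplus>\<^sub>A b \<otimes>\<^sub>A c"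
  and "\<And>a b c. a \<in> carrier A ==> b \<in> carrier A ==> c \<in> carrier A ==> c \<otimes>\<^sub>A (a \<oplus>\<^sub>A b) = c \<otimes>\<^sub>A a \<oplus>\<^sub>A c \<otimes>\<^sub>A b"
  and "\<And>c a b. c \<in> carrier K ==> a \<in> carrier A ==> b \<in> carrier A ==> (c \<odot>\<^sub>A a) \<otimes>\<^sub>A b = c \<odot>\<^sub>A (a \<otimes>\<^sub>A b)"
  and "\<And>c a b. c \<in> carrier K ==> a \<in> carrier A ==> b \<in> carrier A ==> a \<otimes>\<^sub>A (c \<odot>\<^sub>A b) = c \<odot>\<^sub>A (a \<otimes>\<^sub>A b)"
 shows "k_algebra K A"
proof -
 interpret V: vectorspace K A by fact
 have "ring A" by (intro ringI monoidI) (use assms V.M.abelian_group_axioms in auto)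
 then show ?thesis unfolding k_algebra_def using assms by auto
qed

definition algebra_homs :: "('k, 'r) ring_scheme => ('k, 'a, 'z) module_scheme => ('k, 'b, 'y) module_scheme => ('a => 'b) set" where
 "algebra_homs K A B = {f \<in> module_hom K A B. f \<one>\<^sub>A = \<one>\<^sub>B \<and>
   (\<forall>a\<in>carrier A. \<forall>b\<in>carrier A. f (a \<otimes>\<^sub>A b) = f a \<otimes>\<^sub>B f b)}"

lemma algebra_homsD:
 assumes "f \<in> algebra_homs K A B"
 shows "f \<in> module_hom K A B" "f \<one>\<^sub>A = \<one>\<^sub>B"
  and "a \<in> carrier A ==> f a \<in> carrier B"
  and "a \<in> carrier A ==> b \<in> carrier A ==> f (a \<oplus>\<^sub>A b) = f a \<oplus>\<^sub>B f b"
  and "c \<in> carrier K ==> a \<in> carrier A ==> f (c \<odot>\<^sub>A a) = c \<odot>\<^sub>B f a"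
  and "a \<in> carrier A ==> b \<in> carrier A ==> f (a \<otimes>\<^sub>A b) = f a \<otimes>\<^sub>B f b"
 using assms module_homD[of f K A B] by (auto simp: algebra_homs_def)

locale left_module =
 fixes R :: "('r, 'z) ring_scheme" and M :: "('r, 'm, 'y) module_scheme"
 assumes R: "ring R" and M: "abelian_group M"
  and smult_closed: "\<And>a x. a \<in> carrier R ==> x \<in> carrier M ==> a \<odot>\<^sub>M x \<in> carrier M"
  and smult_l_distr: "\<And>a b x. a \<in> carrier R ==> b \<in> carrier R ==> x \<in> carrier M ==>
     (a \<oplus>\<^sub>R b) \<odot>\<^sub>M x = a \<odot>\<^sub>M x \<oplus>\<^sub>M b \<odot>\<^sub>M x"
  and smult_r_distr: "\<And>a x y. a \<in> carrier R ==> x \<in> carrier M ==> y \<in> carrier M ==>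
     a \<odot>\<^sub>M (x \<oplus>\<^sub>M y) = a \<odot>\<^sub>M x \<oplus>\<^sub>M a \<odot>\<^sub>M y"
  and smult_assoc: "\<And>a b x. a \<in> carrier R ==> b \<in> carrier R ==> x \<in> carrier M ==>
     (a \<otimes>\<^sub>R b) \<odot>\<^sub>M x = a \<odot>\<^sub>M (b \<odot>\<^sub>M x)"
  and smult_one: "\<And>x. x \<in> carrier M ==> \<one>\<^sub>R \<odot>\<^sub>M x = x"
begin

lemma smult_zero:
 "a \<in> carrier R ==> a \<odot>\<^sub>M \<zero>\<^sub>M = \<zero>\<^sub>M"
 "x \<in> carrier M ==> \<zero>\<^sub>R \<odot>\<^sub>M x = \<zero>\<^sub>M"
proof -
 interpret R: ring R by (rule R)
 interpret M: abelian_group M by (rule M)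
 show "a \<odot>\<^sub>M \<zero>\<^sub>M = \<zero>\<^sub>M" if "a \<in> carrier R"
  using smult_r_distr[OF that, of "\<zero>\<^sub>M" "\<zero>\<^sub>M"] smult_closed[OF that, of "\<zero>\<^sub>M"] by simp
 show "\<zero>\<^sub>R \<odot>\<^sub>M x = \<zero>\<^sub>M" if "x \<in> carrier M"
  using smult_l_distr[OF _ _ that, of "\<zero>\<^sub>R" "\<zero>\<^sub>R"] smult_closed[OF _ that, of "\<zero>\<^sub>R"] by simp
qed

lemma smult_minus:
 assumes "a \<in> carrier R" "x \<in> carrier M" "y \<in> carrier M"
 shows "a \<odot>\<^sub>M (x \<ominus>\<^sub>M y) = a \<odot>\<^sub>M x \<ominus>\<^sub>M a \<odot>\<^sub>M y"
proof -
 interpret M: abelian_group M by (rule M)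
 have "(x \<ominus>\<^sub>M y) \<oplus>\<^sub>M y = x" using assms by (simp add: M.minus_eq M.a_assoc M.l_neg)
 then have "a \<odot>\<^sub>M (x \<ominus>\<^sub>M y) \<oplus>\<^sub>M a \<odot>\<^sub>M y = a \<odot>\<^sub>M x"
  using smult_r_distr[OF assms(1), of "x \<ominus>\<^sub>M y" y] assms by simp
 then show ?thesis using assms smult_closed
  by (metis M.a_assoc M.a_inv_closed M.minus_closed M.minus_eq M.r_neg M.r_zero)
qed

end

lemma underlying_space_simps [simp]:
 "carrier (space_of A M) = carrier M"
 "add (space_of A M) = add M"
 "zero (space_of A M) = zero M"
 "smult (space_of A M) = (\<lambda>c m. (c \<odot>\<^sub>A \<one>\<^sub>A) \<odot>\<^sub>M m)"
 by (simp_all add: underlying_space_def ring.defs module.defs)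

lemma vectorspace_underlying_space:
 assumes A: "k_algebra K A" and M: "left_module A M"
 shows "vectorspace K (space_of A M)"
proof -
 interpret M: left_module A M by fact
 interpret Mg: abelian_group M by (rule M.M)
 interpret A: ring A by (rule M.R)
 interpret V: vectorspace K A using k_algebraD(1)[OF A] .
 have neg: "\<exists>y\<in>carrier M. x \<oplus>\<^sub>M y = \<zero>\<^sub>M" if "x \<in> carrier M" for x
  using Mg.r_neg[OF that] Mg.a_inv_closed[OF that] by blast
 have as: "((a \<otimes>\<^sub>K b) \<odot>\<^sub>A \<one>\<^sub>A) = (a \<odot>\<^sub>A \<one>\<^sub>A) \<otimes>\<^sub>A (b \<odot>\<^sub>A \<one>\<^sub>A)"
  if "a \<in> carrier K" "b \<in> carrier K" for a b
  using that k_algebraD(3)[OF A, of a "\<one>\<^sub>A" "b \<odot>\<^sub>A \<one>\<^sub>A"] by (simp add: V.smult_assoc1)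
 show ?thesis
  by (rule vs_criteria)
    (use neg V.field_axioms in \<open>auto simp: Mg.a_ac M.smult_closed M.smult_r_distr M.smult_one as V.smult_l_distr
     M.smult_l_distr M.smult_assoc\<close>)
qed

lemma dim_cong:
 assumes "vectorspace K V" "vectorspace K W" "kfin_dim K W" "carrier V = carrier W"
  and "\<And>x y. x \<in> carrier V ==> y \<in> carrier V ==> x \<oplus>\<^sub>V y = x \<oplus>\<^sub>W y"
  and "\<And>c x. c \<in> carrier K ==> x \<in> carrier V ==> c \<odot>\<^sub>V x = c \<odot>\<^sub>W x"
 shows "kfin_dim K V" "kdim K V = kdim K W"
proof -
 have h: "(\<lambda>x. x) \<in> module_hom K V W" by (rule module_homI) (use assms in auto)
 have z: "\<zero>\<^sub>V = \<zero>\<^sub>W" using linear_zero[OF assms(1,2) h] .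
 note r = dim_eq_by_iso[OF assms(1-3) h]
 show "kfin_dim K V" by (rule r(1)) (use assms(4) z in auto)
 show "kdim K V = kdim K W" by (rule r(2)) (use assms(4) z in auto)
qed

text \<open>The algebra acts by two functions, so that restriction of scalars changes only these functions.\<close>

record ('k, 'x, 'b) bimodule = "('k, 'x) module" +
 lact :: "'b => 'x => 'x"
 ract :: "'b => 'x => 'x"

definition with_actions :: "('k, 'x, 'z) module_scheme => ('b => 'x => 'x) => ('b => 'x => 'x) => ('k, 'x, 'b) bimodule" where
 "with_actions V l r = module.extend (module.truncate V) (bimodule.fields l r)"

lemma with_actions_simps [simp]:
 "carrier (with_actions V l r) = carrier V" "add (with_actions V l r) = add V"
 "zero (with_actions V l r) = zero V" "smult (with_actions V l r) = smult V"
 "mult (with_actions V l r) = mult V" "one (with_actions V l r) = one V"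
 "lact (with_actions V l r) = l" "ract (with_actions V l r) = r"
 "x \<ominus>\<^bsub>with_actions V l r\<^esub> y = x \<ominus>\<^sub>V y"
 by (simp_all add: with_actions_def module.defs bimodule.defs a_minus_def a_inv_def m_inv_def)

lemma vectorspace_cong:
 assumes "vectorspace K V" "carrier W = carrier V" "zero W = zero V" "add W = add V" "smult W = smult V"
 shows "vectorspace K W"
proof -
 interpret V: vectorspace K V by fact
 have neg: "\<exists>y\<in>carrier V. x \<oplus>\<^sub>V y = \<zero>\<^sub>V" if "x \<in> carrier V" for x
  using V.M.r_neg[OF that] V.M.a_inv_closed[OF that] by blast
 show ?thesis
  by (rule vs_criteria)
    (use neg V.field_axioms in \<open>auto simp: assms V.M.a_ac V.smult_l_distr V.smult_r_distr V.smult_assoc1\<close>)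
qed

locale bimodule =
 fixes K :: "('k, 'r) ring_scheme" and B :: "('k, 'b, 'z) module_scheme" and X :: "('k, 'x, 'b) bimodule"
 assumes alg: "k_algebra K B" and vs: "vectorspace K X"
  and lact_closed: "\<And>b x. b \<in> carrier B ==> x \<in> carrier X ==> lact X b x \<in> carrier X"
  and ract_closed: "\<And>b x. b \<in> carrier B ==> x \<in> carrier X ==> ract X b x \<in> carrier X"
  and lact_add: "\<And>b x y. b \<in> carrier B ==> x \<in> carrier X ==> y \<in> carrier X ==>
     lact X b (x \<oplus>\<^sub>X y) = lact X b x \<oplus>\<^sub>X lact X b y"
  and ract_add: "\<And>b x y. b \<in> carrier B ==> x \<in> carrier X ==> y \<in> carrier X ==>
     ract X b (x \<oplus>\<^sub>X y) = ract X b x \<oplus>\<^sub>X ract X b y"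
  and lact_add_left: "\<And>b c x. b \<in> carrier B ==> c \<in> carrier B ==> x \<in> carrier X ==>
     lact X (b \<oplus>\<^sub>B c) x = lact X b x \<oplus>\<^sub>X lact X c x"
  and ract_add_left: "\<And>b c x. b \<in> carrier B ==> c \<in> carrier B ==> x \<in> carrier X ==>
     ract X (b \<oplus>\<^sub>B c) x = ract X b x \<oplus>\<^sub>X ract X c x"
  and lact_smult: "\<And>k b x. k \<in> carrier K ==> b \<in> carrier B ==> x \<in> carrier X ==>
     lact X b (k \<odot>\<^sub>X x) = k \<odot>\<^sub>X lact X b x"
  and ract_smult: "\<And>k b x. k \<in> carrier K ==> b \<in> carrier B ==> x \<in> carrier X ==>
     ract X b (k \<odot>\<^sub>X x) = k \<odot>\<^sub>X ract X b x"
  and lact_smult_left: "\<And>k b x. k \<in> carrier K ==> b \<in> carrier B ==> x \<in> carrier X ==>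
     lact X (k \<odot>\<^sub>B b) x = k \<odot>\<^sub>X lact X b x"
  and ract_smult_left: "\<And>k b x. k \<in> carrier K ==> b \<in> carrier B ==> x \<in> carrier X ==>
     ract X (k \<odot>\<^sub>B b) x = k \<odot>\<^sub>X ract X b x"
  and lact_mult: "\<And>b c x. b \<in> carrier B ==> c \<in> carrier B ==> x \<in> carrier X ==>
     lact X (b \<otimes>\<^sub>B c) x = lact X b (lact X c x)"
  and ract_mult: "\<And>b c x. b \<in> carrier B ==> c \<in> carrier B ==> x \<in> carrier X ==>
     ract X (b \<otimes>\<^sub>B c) x = ract X c (ract X b x)"
  and lact_one: "\<And>x. x \<in> carrier X ==> lact X \<one>\<^sub>B x = x"
  and ract_one: "\<And>x. x \<in> carrier X ==> ract X \<one>\<^sub>B x = x"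
  and lact_ract: "\<And>b c x. b \<in> carrier B ==> c \<in> carrier B ==> x \<in> carrier X ==>
     lact X b (ract X c x) = ract X c (lact X b x)"
begin

lemma lact_module_hom: "b \<in> carrier B ==> lact X b \<in> module_hom K X X"
 by (rule module_homI) (auto simp: lact_closed lact_add lact_smult)

lemma ract_module_hom: "b \<in> carrier B ==> ract X b \<in> module_hom K X X"
 by (rule module_homI) (auto simp: ract_closed ract_add ract_smult)

lemmas act_minus = linear_minus[OF vs vs lact_module_hom] linear_minus[OF vs vs ract_module_hom]
lemmas act_zero = linear_zero[OF vs vs lact_module_hom] linear_zero[OF vs vs ract_module_hom]

end

definition restrict_scalars :: "('c => 'b) => ('k, 'x, 'b) bimodule => ('k, 'x, 'c) bimodule" where
 "restrict_scalars f X = with_actions X (\<lambda>c. lact X (f c)) (\<lambda>c. ract X (f c))"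

lemma bimodule_restrict_scalars:
 assumes "bimodule K B X" "k_algebra K C" "f \<in> algebra_homs K C B"
 shows "bimodule K C (restrict_scalars f X)"
proof -
 interpret X: bimodule K B X by fact
 note f = algebra_homsD[OF assms(3)]
 have "vectorspace K (restrict_scalars f X)"
  by (rule vectorspace_cong[OF X.vs]) (auto simp: restrict_scalars_def)
 then show ?thesis
  by (intro bimodule.intro)
    (auto simp: assms(2) f restrict_scalars_def X.lact_closed X.ract_closed X.lact_add X.ract_add X.lact_add_left
     X.ract_add_left X.lact_smult X.ract_smult X.lact_smult_left X.ract_smult_left X.lact_mult X.ract_mult
     X.lact_one X.ract_one X.lact_ract)
qed

definition regular_bimodule :: "('k, 'b, 'z) module_scheme => ('k, 'b, 'b) bimodule" where
 "regular_bimodule A = with_actions A (\<lambda>a x. a \<otimes>\<^sub>A x) (\<lambda>a x. x \<otimes>\<^sub>A a)"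

lemma bimodule_regular:
 assumes "k_algebra K A"
 shows "bimodule K A (regular_bimodule A)"
proof -
 interpret V: vectorspace K A using k_algebraD(1)[OF assms] .
 interpret A: ring A using k_algebraD(2)[OF assms] .
 have "vectorspace K (regular_bimodule A)"
  by (rule vectorspace_cong[OF k_algebraD(1)[OF assms]]) (auto simp: regular_bimodule_def)
 then show ?thesis
  by (intro bimodule.intro)
    (auto simp: assms regular_bimodule_def A.l_distr A.r_distr A.m_assoc k_algebraD(3,4)[OF assms])
qed

definition hom_bimodule :: "('k, 'r) ring_scheme => ('k, 'b, 'z) module_scheme => ('b, 'm, 'y) module_scheme =>
  ('b, 'n, 'x) module_scheme => ('k, 'm => 'n, 'b) bimodule" where
 "hom_bimodule K B M N = with_actions
   ((pointwise (carrier M) (space_of B N))\<lparr>carrier := homs K (space_of B M) (space_of B N)\<rparr>)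
   (\<lambda>b h. \<lambda>m\<in>carrier M. b \<odot>\<^sub>N h m) (\<lambda>b h. \<lambda>m\<in>carrier M. h (b \<odot>\<^sub>M m))"

lemma hom_bimodule_simps:
 "carrier (hom_bimodule K B M N) = homs K (space_of B M) (space_of B N)"
 "zero (hom_bimodule K B M N) = (\<lambda>m\<in>carrier M. \<zero>\<^sub>N)"
 "add (hom_bimodule K B M N) = (\<lambda>f g. \<lambda>m\<in>carrier M. f m \<oplus>\<^sub>N g m)"
 "smult (hom_bimodule K B M N) = (\<lambda>c f. \<lambda>m\<in>carrier M. (c \<odot>\<^sub>B \<one>\<^sub>B) \<odot>\<^sub>N f m)"
 "lact (hom_bimodule K B M N) = (\<lambda>b h. \<lambda>m\<in>carrier M. b \<odot>\<^sub>N h m)"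
 "ract (hom_bimodule K B M N) = (\<lambda>b h. \<lambda>m\<in>carrier M. h (b \<odot>\<^sub>M m))"
 by (simp_all add: hom_bimodule_def)

lemma bimodule_hom_bimodule:
 assumes B: "k_algebra K B" and M: "left_module B M" and N: "left_module B N"
 shows "bimodule K B (hom_bimodule K B M N)"
proof -
 interpret M: left_module B M by fact
 interpret N: left_module B N by fact
 interpret Mg: abelian_group M by (rule M.M)
 interpret Ng: abelian_group N by (rule N.M)
 interpret V: vectorspace K B using k_algebraD(1)[OF B] .
 interpret B: ring B using k_algebraD(2)[OF B] .
 note uM = vectorspace_underlying_space[OF B M] and uN = vectorspace_underlying_space[OF B N]
 have vs: "vectorspace K (hom_bimodule K B M N)"
  by (rule vectorspace_cong[OF subspace_homs(2)[OF uM uN]]) (auto simp: hom_bimodule_def)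
 have central: "(k \<odot>\<^sub>B \<one>\<^sub>B) \<otimes>\<^sub>B b = b \<otimes>\<^sub>B (k \<odot>\<^sub>B \<one>\<^sub>B)" "k \<odot>\<^sub>B b = (k \<odot>\<^sub>B \<one>\<^sub>B) \<otimes>\<^sub>B b"
  if "k \<in> carrier K" "b \<in> carrier B" for k b
  using k_algebraD(3,4)[OF B] that by auto
 have cM: "b \<odot>\<^sub>M ((k \<odot>\<^sub>B \<one>\<^sub>B) \<odot>\<^sub>M m) = (k \<odot>\<^sub>B \<one>\<^sub>B) \<odot>\<^sub>M (b \<odot>\<^sub>M m)"
  if "k \<in> carrier K" "b \<in> carrier B" "m \<in> carrier M" for k b m
  using central(1)[OF that(1,2)] that M.smult_assoc[symmetric] by simp
 have cN: "b \<odot>\<^sub>N ((k \<odot>\<^sub>B \<one>\<^sub>B) \<odot>\<^sub>N m) = (k \<odot>\<^sub>B \<one>\<^sub>B) \<odot>\<^sub>N (b \<odot>\<^sub>N m)"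
  if "k \<in> carrier K" "b \<in> carrier B" "m \<in> carrier N" for k b m
  using central(1)[OF that(1,2)] that N.smult_assoc[symmetric] by simp
 have h2: "f (m \<oplus>\<^sub>M m') = f m \<oplus>\<^sub>N f m'"
  if "f \<in> homs K (space_of B M) (space_of B N)" "m \<in> carrier M" "m' \<in> carrier M" for f m m'
  using homsD(2)[OF that(1)] that by auto
 have h3: "f ((k \<odot>\<^sub>B \<one>\<^sub>B) \<odot>\<^sub>M m) = (k \<odot>\<^sub>B \<one>\<^sub>B) \<odot>\<^sub>N f m"
  if "f \<in> homs K (space_of B M) (space_of B N)" "m \<in> carrier M" "k \<in> carrier K" for f m k
  using homsD(3)[OF that(1)] that by auto
 have h1: "f m \<in> carrier N"
  if "f \<in> homs K (space_of B M) (space_of B N)" "m \<in> carrier M" for f m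
  using homsD(1)[OF that(1)] that by auto
 have ext: "f = (\<lambda>m\<in>carrier M. g m)" if "f \<in> homs K (space_of B M) (space_of B N)"
  "\<And>m. m \<in> carrier M ==> f m = g m" for f g
  using homsD(5)[OF that(1)] that(2) by (auto simp: extensional_def fun_eq_iff)
 have kb: "k \<odot>\<^sub>B \<one>\<^sub>B \<in> carrier B" if "k \<in> carrier K" for k using that by simp
 let ?X = "hom_bimodule K B M N"
 have cl: "h \<in> homs K (space_of B M) (space_of B N) ==> h \<in> carrier ?X" for h by (simp add: hom_bimodule_simps)
 have lc: "lact ?X b h \<in> carrier ?X" if b: "b \<in> carrier B" and f: "h \<in> carrier ?X" for b h
  using b f unfolding hom_bimodule_simps
  by (intro homsI) (auto simp: h3 h2 h1 N.smult_closed N.smult_r_distr M.smult_closed cN kb)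
 have rc: "ract ?X b h \<in> carrier ?X" if b: "b \<in> carrier B" and f: "h \<in> carrier ?X" for b h
  using b f unfolding hom_bimodule_simps
  by (intro homsI) (auto simp: h3 h2 h1 M.smult_closed M.smult_r_distr cM kb)
 show ?thesis
 proof (rule bimodule.intro[OF B vs lc rc])
  fix b h h' assume b: "b \<in> carrier B" and f: "h \<in> carrier ?X" "h' \<in> carrier ?X"
  show "lact ?X b (h \<oplus>\<^bsub>?X\<^esub> h') = lact ?X b h \<oplus>\<^bsub>?X\<^esub> lact ?X b h'"
   using b f h1 N.smult_r_distr unfolding hom_bimodule_simps by (intro restrict_ext) simp
  show "ract ?X b (h \<oplus>\<^bsub>?X\<^esub> h') = ract ?X b h \<oplus>\<^bsub>?X\<^esub> ract ?X b h'"
   using b M.smult_closed unfolding hom_bimodule_simps by (intro restrict_ext) simp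
 next
  fix b c h assume b: "b \<in> carrier B" "c \<in> carrier B" and f: "h \<in> carrier ?X"
  have f': "h \<in> homs K (space_of B M) (space_of B N)" using f by (simp add: hom_bimodule_simps)
  show "lact ?X (b \<oplus>\<^sub>B c) h = lact ?X b h \<oplus>\<^bsub>?X\<^esub> lact ?X c h"
   using b h1[OF f'] N.smult_l_distr unfolding hom_bimodule_simps by (intro restrict_ext) simp
  show "ract ?X (b \<oplus>\<^sub>B c) h = ract ?X b h \<oplus>\<^bsub>?X\<^esub> ract ?X c h"
   using b h2[OF f'] M.smult_closed M.smult_l_distr unfolding hom_bimodule_simps by (intro restrict_ext) simp
  show "lact ?X (b \<otimes>\<^sub>B c) h = lact ?X b (lact ?X c h)"
   using b h1[OF f'] N.smult_assoc unfolding hom_bimodule_simps by (intro restrict_ext) simp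
  show "ract ?X (b \<otimes>\<^sub>B c) h = ract ?X c (ract ?X b h)"
   using b M.smult_assoc M.smult_closed unfolding hom_bimodule_simps by (intro restrict_ext) simp
  show "lact ?X b (ract ?X c h) = ract ?X c (lact ?X b h)"
   using b M.smult_closed unfolding hom_bimodule_simps by (intro restrict_ext) simp
 next
  fix k b h assume k: "k \<in> carrier K" "b \<in> carrier B" and f: "h \<in> carrier ?X"
  have f': "h \<in> homs K (space_of B M) (space_of B N)" using f by (simp add: hom_bimodule_simps)
  have kbm: "(k \<odot>\<^sub>B b) \<odot>\<^sub>M m = (k \<odot>\<^sub>B \<one>\<^sub>B) \<odot>\<^sub>M (b \<odot>\<^sub>M m)" if "m \<in> carrier M" for m
   using M.smult_assoc[OF kb[OF k(1)] k(2) that] central(2)[OF k] by simp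
  have kbn: "(k \<odot>\<^sub>B b) \<odot>\<^sub>N m = (k \<odot>\<^sub>B \<one>\<^sub>B) \<odot>\<^sub>N (b \<odot>\<^sub>N m)" if "m \<in> carrier N" for m
   using N.smult_assoc[OF kb[OF k(1)] k(2) that] central(2)[OF k] by simp
  show "lact ?X b (k \<odot>\<^bsub>?X\<^esub> h) = k \<odot>\<^bsub>?X\<^esub> lact ?X b h"
   using k h1[OF f'] cN unfolding hom_bimodule_simps by (intro restrict_ext) simp
  show "ract ?X b (k \<odot>\<^bsub>?X\<^esub> h) = k \<odot>\<^bsub>?X\<^esub> ract ?X b h"
   using k M.smult_closed unfolding hom_bimodule_simps by (intro restrict_ext) simp
  show "lact ?X (k \<odot>\<^sub>B b) h = k \<odot>\<^bsub>?X\<^esub> lact ?X b h"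
   using k h1[OF f'] kbn unfolding hom_bimodule_simps by (intro restrict_ext) simp
  show "ract ?X (k \<odot>\<^sub>B b) h = k \<odot>\<^bsub>?X\<^esub> ract ?X b h"
   using k h3[OF f'] M.smult_closed kbm unfolding hom_bimodule_simps by (intro restrict_ext) simp
 next
  fix h assume "h \<in> carrier ?X"
  then have f': "h \<in> homs K (space_of B M) (space_of B N)" by (simp add: hom_bimodule_simps)
  show "lact ?X \<one>\<^sub>B h = h" "ract ?X \<one>\<^sub>B h = h"
   unfolding hom_bimodule_simps by (rule ext[OF f', symmetric]; simp add: M.smult_one N.smult_one h1[OF f'])+
 qed
qed

section \<open>Derivations\<close>

definition derivations :: "('k, 'r) ring_scheme => ('k, 'b, 'z) module_scheme => ('k, 'x, 'b) bimodule => ('b => 'x) set" where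
 "derivations K B X = {D \<in> homs K B X. \<forall>a\<in>carrier B. \<forall>b\<in>carrier B.
   D (a \<otimes>\<^sub>B b) = lact X a (D b) \<oplus>\<^sub>X ract X b (D a)}"

definition der_space :: "('k, 'r) ring_scheme => ('k, 'b, 'z) module_scheme => ('k, 'x, 'b) bimodule => ('k, 'b => 'x) module" where
 "der_space K B X = (pointwise (carrier B) X)\<lparr>carrier := derivations K B X\<rparr>"

definition derivation_excess :: "('k, 'r) ring_scheme => ('k, 'b, 'z) module_scheme => ('k, 'x, 'b) bimodule => int" where
 "derivation_excess K B X = int (kdim K (der_space K B X)) - int (kdim K X)"

lemma der_space_simps [simp]:
 "carrier (der_space K B X) = derivations K B X"
 "zero (der_space K B X) = (\<lambda>b\<in>carrier B. \<zero>\<^sub>X)"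
 "add (der_space K B X) = (\<lambda>f g. \<lambda>b\<in>carrier B. f b \<oplus>\<^sub>X g b)"
 "smult (der_space K B X) = (\<lambda>c f. \<lambda>b\<in>carrier B. c \<odot>\<^sub>X f b)"
 by (simp_all add: der_space_def)

lemma derivationsD:
 assumes "D \<in> derivations K B X"
 shows "D \<in> homs K B X" "b \<in> carrier B ==> D b \<in> carrier X"
  and "a \<in> carrier B ==> b \<in> carrier B ==> D (a \<oplus>\<^sub>B b) = D a \<oplus>\<^sub>X D b"
  and "c \<in> carrier K ==> b \<in> carrier B ==> D (c \<odot>\<^sub>B b) = c \<odot>\<^sub>X D b"
  and "D \<in> module_hom K B X" and "D \<in> extensional (carrier B)"
  and "a \<in> carrier B ==> b \<in> carrier B ==> D (a \<otimes>\<^sub>B b) = lact X a (D b) \<oplus>\<^sub>X ract X b (D a)"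
 using assms homsD[of D K B X] by (auto simp: derivations_def)

context bimodule
begin

lemma subspace_derivations:
 "VectorSpace.subspace K (derivations K B X) ((pointwise (carrier B) X)\<lparr>carrier := homs K B X\<rparr>)"
 "vectorspace K (der_space K B X)"
proof -
 interpret B: ring B using k_algebraD(2)[OF alg] .
 interpret X: vectorspace K X by (rule vs)
 note hs = subspace_homs[OF k_algebraD(1)[OF alg] vs]
 interpret H: vectorspace K "(pointwise (carrier B) X)\<lparr>carrier := homs K B X\<rparr>" by (rule hs(2))
 let ?H = "(pointwise (carrier B) X)\<lparr>carrier := homs K B X\<rparr>"
 have closed: "f \<oplus>\<^bsub>?H\<^esub> g \<in> homs K B X" if "f \<in> homs K B X" "g \<in> homs K B X" for f g
  using H.M.add.m_closed[of f g] that by simp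
 have closed': "c \<odot>\<^bsub>?H\<^esub> f \<in> homs K B X" if "c \<in> carrier K" "f \<in> homs K B X" for f c
  using H.smult_closed[of c f] that by simp
 note r = vectorspace_subsetI[OF hs(2), of "derivations K B X"]
 have sub: "derivations K B X \<subseteq> carrier ?H" by (auto simp: derivations_def)
 have z: "\<zero>\<^bsub>?H\<^esub> \<in> derivations K B X"
  using H.M.zero_closed by (auto simp: derivations_def act_zero)
 have a: "f \<oplus>\<^bsub>?H\<^esub> g \<in> derivations K B X" if "f \<in> derivations K B X" "g \<in> derivations K B X" for f g
 proof -
  have "f \<oplus>\<^bsub>?H\<^esub> g \<in> homs K B X" using closed that by (auto simp: derivations_def)
  then show ?thesis
   using derivationsD(2,7)[OF that(1)] derivationsD(2,7)[OF that(2)]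
   by (auto simp: derivations_def lact_add ract_add lact_closed ract_closed X.M.a_ac)
 qed
 have s: "c \<odot>\<^bsub>?H\<^esub> f \<in> derivations K B X" if "c \<in> carrier K" "f \<in> derivations K B X" for c f
 proof -
  have "c \<odot>\<^bsub>?H\<^esub> f \<in> homs K B X" using closed' that by (auto simp: derivations_def)
  then show ?thesis
   using derivationsD(2,7)[OF that(2)] that(1)
   by (auto simp: derivations_def lact_smult ract_smult lact_closed ract_closed X.smult_r_distr)
 qed
 show "VectorSpace.subspace K (derivations K B X) ?H" by (rule r(1)[OF sub z a s])
 show "vectorspace K (der_space K B X)" using r(2)[OF sub z a s] by (simp add: der_space_def)
qed

lemma fin_dim_der_space:
 assumes "kfin_dim K B" "kfin_dim K X"
 shows "kfin_dim K (der_space K B X)"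
 using fin_dim_subspace[OF subspace_homs(2)[OF k_algebraD(1)[OF alg] vs]
   fin_dim_homs[OF k_algebraD(1)[OF alg] assms(1) vs assms(2)] subspace_derivations(1)]
 by (simp add: der_space_def)

lemma derivation_one:
 assumes "D \<in> derivations K B X"
 shows "D \<one>\<^sub>B = \<zero>\<^sub>X"
proof -
 interpret B: ring B using k_algebraD(2)[OF alg] .
 interpret X: vectorspace K X by (rule vs)
 have "D (\<one>\<^sub>B \<otimes>\<^sub>B \<one>\<^sub>B) = D \<one>\<^sub>B \<oplus>\<^sub>X D \<one>\<^sub>B"
  using derivationsD(7)[OF assms, of "\<one>\<^sub>B" "\<one>\<^sub>B"] derivationsD(2)[OF assms, of "\<one>\<^sub>B"]
  by (simp add: lact_one ract_one)
 then show ?thesis using derivationsD(2)[OF assms, of "\<one>\<^sub>B"] by simp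
qed

definition inner :: "'x => 'b => 'x" where
 "inner x = (\<lambda>b\<in>carrier B. lact X b x \<ominus>\<^sub>X ract X b x)"

definition invariants :: "'x set" where
 "invariants = {x \<in> carrier X. \<forall>b\<in>carrier B. lact X b x = ract X b x}"

lemma minus_add:
 assumes "a \<in> carrier X" "b \<in> carrier X" "c \<in> carrier X" "d \<in> carrier X"
 shows "(a \<oplus>\<^sub>X b) \<ominus>\<^sub>X (c \<oplus>\<^sub>X d) = (a \<ominus>\<^sub>X c) \<oplus>\<^sub>X (b \<ominus>\<^sub>X d)"
proof -
 interpret X: vectorspace K X by (rule vs)
 show ?thesis using assms by (simp add: X.M.minus_eq X.M.minus_add X.M.a_ac)
qed

lemma smult_minus:
 assumes "k \<in> carrier K" "a \<in> carrier X" "b \<in> carrier X"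
 shows "k \<odot>\<^sub>X (a \<ominus>\<^sub>X b) = k \<odot>\<^sub>X a \<ominus>\<^sub>X k \<odot>\<^sub>X b"
proof -
 interpret X: vectorspace K X by (rule vs)
 show ?thesis using assms by (simp add: X.M.minus_eq X.smult_r_distr X.smult_r_minus)
qed

lemma inner_derivation:
 assumes "x \<in> carrier X"
 shows "inner x \<in> derivations K B X"
proof -
 interpret B: ring B using k_algebraD(2)[OF alg] .
 interpret X: vectorspace K X by (rule vs)
 interpret BV: vectorspace K B using k_algebraD(1)[OF alg] .
 have "inner x \<in> homs K B X"
  by (rule homsI)
    (use assms in \<open>auto simp: inner_def lact_closed ract_closed lact_add_left ract_add_left
     lact_smult_left ract_smult_left minus_add smult_minus\<close>)
 moreover have "inner x (a \<otimes>\<^sub>B b) = lact X a (inner x b) \<oplus>\<^sub>X ract X b (inner x a)"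
  if "a \<in> carrier B" "b \<in> carrier B" for a b
 proof -
  let ?u = "lact X a (lact X b x)" and ?v = "lact X a (ract X b x)" and ?w = "ract X b (ract X a x)"
  have m: "?u \<in> carrier X" "?v \<in> carrier X" "?w \<in> carrier X" using that assms by (auto simp: lact_closed ract_closed)
  have "?u \<ominus>\<^sub>X ?w = (?u \<ominus>\<^sub>X ?v) \<oplus>\<^sub>X (?v \<ominus>\<^sub>X ?w)"
   using m by (simp add: X.M.minus_eq X.M.a_assoc X.M.r_neg1 X.M.r_neg2)
  then show ?thesis using that assms
   by (simp add: inner_def lact_mult ract_mult act_minus lact_closed ract_closed lact_ract)
 qed
 ultimately show ?thesis by (auto simp: derivations_def)
qed

lemma inner_linear: "inner \<in> module_hom K X (der_space K B X)"
proof -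
 interpret X: vectorspace K X by (rule vs)
 show ?thesis
 proof (rule module_homI)
  show "inner x \<in> carrier (der_space K B X)" if "x \<in> carrier X" for x using inner_derivation[OF that] by simp
 qed (auto simp: inner_def lact_add ract_add lact_smult ract_smult minus_add smult_minus
     lact_closed ract_closed intro!: restrict_ext)
qed

text \<open>Rank and nullity of the map that sends an element to its inner derivation.\<close>

lemma inner_image:
 "VectorSpace.subspace K (inner ` carrier X) (der_space K B X)"
 "kfin_dim K X ==>
   kdim K X = kdim K ((der_space K B X)\<lparr>carrier := inner ` carrier X\<rparr>) +
    kdim K (X\<lparr>carrier := invariants\<rparr>)"
 "vectorspace K (X\<lparr>carrier := invariants\<rparr>)"
 "kfin_dim K X ==> kfin_dim K (X\<lparr>carrier := invariants\<rparr>)"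
proof -
 interpret X: vectorspace K X by (rule vs)
 interpret L: linear_map K X "der_space K B X" inner
  by (rule linear_mapI[OF vs subspace_derivations(2) inner_linear])
 have im: "L.imT = inner ` carrier X" by (simp add: L.im_def)
 have ker: "L.kerT = invariants"
 proof -
  have "inner x = \<zero>\<^bsub>der_space K B X\<^esub> \<longleftrightarrow> (\<forall>b\<in>carrier B. lact X b x = ract X b x)" if x: "x \<in> carrier X" for x
  proof -
   have "inner x = \<zero>\<^bsub>der_space K B X\<^esub> \<longleftrightarrow> (\<forall>b\<in>carrier B. lact X b x \<ominus>\<^sub>X ract X b x = \<zero>\<^sub>X)"
    unfolding inner_def der_space_simps by (auto simp: fun_eq_iff restrict_def)
   then show ?thesis using X.M.minus_eq_zero_iff x lact_closed ract_closed by simp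
  qed
  then show ?thesis unfolding L.ker_def invariants_def by auto
 qed
 show "VectorSpace.subspace K (inner ` carrier X) (der_space K B X)" using L.imT_is_subspace im by simp
 have k: "VectorSpace.subspace K invariants X" using L.kerT_is_subspace ker by simp
 show "vectorspace K (X\<lparr>carrier := invariants\<rparr>)" using X.subspace_is_vs[OF k] .
 show "kfin_dim K (X\<lparr>carrier := invariants\<rparr>)" if "kfin_dim K X"
  using fin_dim_subspace[OF vs that k] .
 show "kdim K X = kdim K ((der_space K B X)\<lparr>carrier := inner ` carrier X\<rparr>) +
    kdim K (X\<lparr>carrier := invariants\<rparr>)" if "kfin_dim K X"
  using L.rank_nullity_main(1)[OF that] im ker by simp
qed

end

definition bimodule_homs :: "('k, 'r) ring_scheme => ('k, 'b, 'z) module_scheme => ('k, 'x, 'b) bimodule =>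
  ('k, 'y, 'b) bimodule => ('x => 'y) set" where
 "bimodule_homs K B X Y = {T \<in> module_hom K X Y. \<forall>b\<in>carrier B. \<forall>x\<in>carrier X.
   T (lact X b x) = lact Y b (T x) \<and> T (ract X b x) = ract Y b (T x)}"

lemma bimodule_homsD:
 assumes "T \<in> bimodule_homs K B X Y"
 shows "T \<in> module_hom K X Y"
  and "x \<in> carrier X ==> T x \<in> carrier Y"
  and "x \<in> carrier X ==> y \<in> carrier X ==> T (x \<oplus>\<^sub>X y) = T x \<oplus>\<^sub>Y T y"
  and "c \<in> carrier K ==> x \<in> carrier X ==> T (c \<odot>\<^sub>X x) = c \<odot>\<^sub>Y T x"
  and "b \<in> carrier B ==> x \<in> carrier X ==> T (lact X b x) = lact Y b (T x)"
  and "b \<in> carrier B ==> x \<in> carrier X ==> T (ract X b x) = ract Y b (T x)"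
 using assms module_homD[of T K X Y] by (auto simp: bimodule_homs_def)

lemma derivation_comp:
 assumes X: "bimodule K B X" and Y: "bimodule K B Y" and T: "T \<in> bimodule_homs K B X Y"
 shows "D \<in> derivations K B X ==> (\<lambda>b\<in>carrier B. T (D b)) \<in> derivations K B Y"
  and "(\<lambda>D. \<lambda>b\<in>carrier B. T (D b)) \<in> module_hom K (der_space K B X) (der_space K B Y)"
proof -
 interpret X: bimodule K B X by fact
 interpret Y: bimodule K B Y by fact
 interpret B: ring B using k_algebraD(2)[OF X.alg] .
 interpret BV: vectorspace K B using k_algebraD(1)[OF X.alg] .
 note t = bimodule_homsD[OF T]
 show d: "(\<lambda>b\<in>carrier B. T (D b)) \<in> derivations K B Y" if D: "D \<in> derivations K B X" for D
 proof -
  note d = derivationsD[OF D]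
  have "(\<lambda>b\<in>carrier B. T (D b)) \<in> homs K B Y"
   by (rule homsI) (auto simp: d(2,3,4) t(2,3,4))
  then show ?thesis
   by (auto simp: derivations_def d(2,7) t(2,3,5,6) X.lact_closed X.ract_closed)
 qed
 show "(\<lambda>D. \<lambda>b\<in>carrier B. T (D b)) \<in> module_hom K (der_space K B X) (der_space K B Y)"
 proof (rule module_homI)
  show "(\<lambda>b\<in>carrier B. T (D b)) \<in> carrier (der_space K B Y)" if "D \<in> carrier (der_space K B X)" for D
   using d that by simp
 qed (auto simp: derivationsD(2) t(3,4) intro!: restrict_ext)
qed

text \<open>Composition with the maps \<open>T i\<close> decomposes a derivation into derivations to the targets, and this
 correspondence is again jointly bijective. So dimensions of bimodules and of spaces of derivations are both additive.\<close>

lemma derivation_excess_additive: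
 fixes W :: "'i => ('k, 'w, 'b) bimodule"
 assumes B: "k_algebra K B" "kfin_dim K B"
  and X: "bimodule K B X" and W0: "bimodule K B W0" "kfin_dim K W0"
  and J: "finite J" and W: "\<And>i. i \<in> J ==> bimodule K B (W i)" "\<And>i. i \<in> J ==> kfin_dim K (W i)"
  and T0: "T0 \<in> bimodule_homs K B X W0" and T: "\<And>i. i \<in> J ==> T i \<in> bimodule_homs K B X (W i)"
  and ex: "\<And>w0 w. w0 \<in> carrier W0 ==> (\<And>i. i \<in> J ==> w i \<in> carrier (W i)) ==>
    \<exists>v\<in>carrier X. T0 v = w0 \<and> (\<forall>i\<in>J. T i v = w i)"
  and inj: "\<And>v. v \<in> carrier X ==> T0 v = \<zero>\<^sub>W0 ==> (\<And>i. i \<in> J ==> T i v = \<zero>\<^bsub>W i\<^esub>) ==> v = \<zero>\<^sub>X"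
 shows "kfin_dim K X"
  and "derivation_excess K B X = derivation_excess K B W0 + (\<Sum>i\<in>J. derivation_excess K B (W i))"
proof -
 interpret X: bimodule K B X by fact
 interpret W0: bimodule K B W0 by fact
 interpret XV: vectorspace K X by (rule X.vs)
 interpret B: ring B using k_algebraD(2)[OF X.alg] .
 interpret BV: vectorspace K B using k_algebraD(1)[OF X.alg] .
 have Wvs: "vectorspace K (W i)" if "i \<in> J" for i using bimodule.vs[OF W(1)[OF that]] .
 note t0 = bimodule_homsD[OF T0] and t = bimodule_homsD[OF T]
 note r = dim_jointly_bijective[OF X.vs W0.vs W0(2) J Wvs W(2) t0(1) t(1) ex inj]
 show fdX: "kfin_dim K X" by (rule r(1))
 have dX: "kdim K X = kdim K W0 + (\<Sum>i\<in>J. kdim K (W i))" by (rule r(2))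
 have uniq: "u = v" if uv: "u \<in> carrier X" "v \<in> carrier X" "T0 u = T0 v" "\<And>i. i \<in> J ==> T i u = T i v" for u v
 proof -
  interpret W0V: vectorspace K W0 by (rule W0.vs)
  have "u \<ominus>\<^sub>X v = \<zero>\<^sub>X"
  proof (rule inj)
   show "T0 (u \<ominus>\<^sub>X v) = \<zero>\<^sub>W0"
    using linear_minus[OF X.vs W0.vs t0(1) uv(1,2)] uv t0(2) W0V.M.minus_eq_zero_iff by simp
   fix i assume i: "i \<in> J"
   interpret Wi: vectorspace K "W i" by (rule Wvs[OF i])
   show "T i (u \<ominus>\<^sub>X v) = \<zero>\<^bsub>W i\<^esub>"
    using linear_minus[OF X.vs Wvs[OF i] t(1)[OF i] uv(1,2)] uv(1,2) uv(4)[OF i] t(2)[OF i] Wi.M.minus_eq_zero_iff by simp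
  qed (use uv in simp)
  then show ?thesis using XV.M.minus_eq_zero_iff uv by blast
 qed
 have dD: "kdim K (der_space K B X) = kdim K (der_space K B W0) +
   (\<Sum>i\<in>J. kdim K (der_space K B (W i)))"
 proof (rule dim_jointly_bijective(2)[OF X.subspace_derivations(2) W0.subspace_derivations(2) _ J])
  show "kfin_dim K (der_space K B W0)" using W0.fin_dim_der_space[OF B(2) W0(2)] .
  show "vectorspace K (der_space K B (W i))" if "i \<in> J" for i
   using bimodule.subspace_derivations(2)[OF W(1)[OF that]] .
  show "kfin_dim K (der_space K B (W i))" if "i \<in> J" for i
   using bimodule.fin_dim_der_space[OF W(1)[OF that] B(2) W(2)[OF that]] .
  show "(\<lambda>D. \<lambda>b\<in>carrier B. T0 (D b)) \<in> module_hom K (der_space K B X) (der_space K B W0)"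
   by (rule derivation_comp(2)[OF X W0(1) T0])
  show "(\<lambda>D. \<lambda>b\<in>carrier B. T i (D b)) \<in> module_hom K (der_space K B X) (der_space K B (W i))" if "i \<in> J" for i
   by (rule derivation_comp(2)[OF X W(1)[OF that] T[OF that]])
  show "D = \<zero>\<^bsub>der_space K B X\<^esub>"
   if D: "D \<in> carrier (der_space K B X)" "(\<lambda>b\<in>carrier B. T0 (D b)) = \<zero>\<^bsub>der_space K B W0\<^esub>"
    "\<And>i. i \<in> J ==> (\<lambda>b\<in>carrier B. T i (D b)) = \<zero>\<^bsub>der_space K B (W i)\<^esub>" for D
  proof (rule extensional_eqI)
   have D': "D \<in> derivations K B X" using D by simp
   show "D \<in> extensional (carrier B)" using derivationsD(6)[OF D'] .
   fix b assume b: "b \<in> carrier B"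
   have "T0 (D b) = \<zero>\<^sub>W0" using fun_cong[OF D(2), of b] b by simp
   moreover have "T i (D b) = \<zero>\<^bsub>W i\<^esub>" if "i \<in> J" for i using fun_cong[OF D(3)[OF that], of b] b by simp
   ultimately show "D b = \<zero>\<^bsub>der_space K B X\<^esub> b" using inj[OF derivationsD(2)[OF D' b]] b by simp
  qed simp
  show "\<exists>D\<in>carrier (der_space K B X). (\<lambda>b\<in>carrier B. T0 (D b)) = D0 \<and> (\<forall>i\<in>J. (\<lambda>b\<in>carrier B. T i (D b)) = E i)"
   if D0: "D0 \<in> carrier (der_space K B W0)" and E: "\<And>i. i \<in> J ==> E i \<in> carrier (der_space K B (W i))" for D0 E
  proof -
   have D0': "D0 \<in> derivations K B W0" and E': "\<And>i. i \<in> J ==> E i \<in> derivations K B (W i)" using D0 E by auto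
   note d0 = derivationsD[OF D0'] and e = derivationsD[OF E']
   have "\<exists>v. v \<in> carrier X \<and> T0 v = D0 b \<and> (\<forall>i\<in>J. T i v = E i b)" if "b \<in> carrier B" for b
    using ex[of "D0 b" "\<lambda>i. E i b"] d0(2)[OF that] e(2)[OF _ that] by blast
   then obtain D where D: "\<And>b. b \<in> carrier B ==> D b \<in> carrier X" "\<And>b. b \<in> carrier B ==> T0 (D b) = D0 b"
    "\<And>b i. b \<in> carrier B ==> i \<in> J ==> T i (D b) = E i b" by metis
   have "(\<lambda>b\<in>carrier B. D b) \<in> homs K B X"
   proof (rule homsI)
    show "(\<lambda>b\<in>carrier B. D b) (x \<oplus>\<^sub>B y) = (\<lambda>b\<in>carrier B. D b) x \<oplus>\<^sub>X (\<lambda>b\<in>carrier B. D b) y"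
     if xy: "x \<in> carrier B" "y \<in> carrier B" for x y
    proof -
     have "D (x \<oplus>\<^sub>B y) = D x \<oplus>\<^sub>X D y"
      by (rule uniq) (use xy in \<open>auto simp: D t0(3) t(3) d0(3) e(3)\<close>)
     then show ?thesis using xy by simp
    qed
    show "(\<lambda>b\<in>carrier B. D b) (c \<odot>\<^sub>B x) = c \<odot>\<^sub>X (\<lambda>b\<in>carrier B. D b) x"
     if cx: "c \<in> carrier K" "x \<in> carrier B" for c x
    proof -
     have "D (c \<odot>\<^sub>B x) = c \<odot>\<^sub>X D x"
      by (rule uniq) (use cx in \<open>auto simp: D t0(4) t(4) d0(4) e(4)\<close>)
     then show ?thesis using cx by simp
    qed
   qed (auto simp: D)
   moreover have "D (x \<otimes>\<^sub>B y) = lact X x (D y) \<oplus>\<^sub>X ract X y (D x)" if xy: "x \<in> carrier B" "y \<in> carrier B" for x y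
    by (rule uniq) (use xy in \<open>auto simp: D t0(3,5,6) t(3,5,6) d0(7) e(7) X.lact_closed X.ract_closed\<close>)
   ultimately have "(\<lambda>b\<in>carrier B. D b) \<in> derivations K B X" by (auto simp: derivations_def)
   moreover have "(\<lambda>b\<in>carrier B. T0 ((\<lambda>b\<in>carrier B. D b) b)) = D0"
    by (rule extensional_eqI[OF _ d0(6)]) (auto simp: D)
   moreover have "(\<lambda>b\<in>carrier B. T i ((\<lambda>b\<in>carrier B. D b) b)) = E i" if "i \<in> J" for i
    by (rule extensional_eqI[OF _ e(6)[OF that]]) (use that in \<open>auto simp: D\<close>)
   ultimately show ?thesis by (intro bexI[of _ "\<lambda>b\<in>carrier B. D b"]) auto
  qed
 qed
 show "derivation_excess K B X = derivation_excess K B W0 + (\<Sum>i\<in>J. derivation_excess K B (W i))"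
  unfolding derivation_excess_def dD dX by (simp add: sum_subtractf)
qed

text \<open>Inner derivations of the regular bimodule are the image of the first Hochschild differential, and its invariants are the center.\<close>

lemma dim_HH1:
 assumes A: "k_algebra K A" "kfin_dim K A"
 shows "int (kdim K (HH1 K A)) =
  derivation_excess K A (regular_bimodule A) + int (kdim K (center A))"
proof -
 let ?X = "regular_bimodule A"
 interpret X: bimodule K A ?X by (rule bimodule_regular[OF A(1)])
 interpret V: vectorspace K A using k_algebraD(1)[OF A(1)] .
 interpret A: ring A using k_algebraD(2)[OF A(1)] .
 have s: "carrier ?X = carrier A" "add ?X = add A" "zero ?X = zero A" "smult ?X = smult A"
   "lact ?X = (\<lambda>a x. a \<otimes>\<^sub>A x)" "ract ?X = (\<lambda>a x. x \<otimes>\<^sub>A a)" "mult ?X = mult A" "one ?X = one A"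
  by (simp_all add: regular_bimodule_def)
 have fdX: "kfin_dim K ?X" "kdim K ?X = kdim K A"
  using dim_cong[OF X.vs k_algebraD(1)[OF A(1)] A(2)] by (simp_all add: s)
 have pw: "pointwise (carrier A) ?X = pointwise (carrier A) A" by (simp add: pointwise_def s)
 have hm: "homs K A ?X = homs K A A" by (simp add: homs_def module_hom_def' s)
 have coc: "hoch_d1 A f a b = \<zero>\<^sub>A \<longleftrightarrow> f (a \<otimes>\<^sub>A b) = a \<otimes>\<^sub>A f b \<oplus>\<^sub>A f a \<otimes>\<^sub>A b"
  if f: "f \<in> homs K A A" and ab: "a \<in> carrier A" "b \<in> carrier A" for f a b
 proof -
  have m: "f a \<in> carrier A" "f b \<in> carrier A" "f (a \<otimes>\<^sub>A b) \<in> carrier A" using homsD(1)[OF f] ab by auto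
  have "hoch_d1 A f a b = (a \<otimes>\<^sub>A f b \<oplus>\<^sub>A f a \<otimes>\<^sub>A b) \<ominus>\<^sub>A f (a \<otimes>\<^sub>A b)"
   unfolding hoch_d1_def using m ab by (simp add: a_minus_def V.M.a_ac)
  then show ?thesis using V.M.minus_eq_zero_iff[of "a \<otimes>\<^sub>A f b \<oplus>\<^sub>A f a \<otimes>\<^sub>A b" "f (a \<otimes>\<^sub>A b)"] m ab by auto
 qed
 have der: "{f \<in> homs K A A. \<forall>a\<in>carrier A. \<forall>b\<in>carrier A. hoch_d1 A f a b = \<zero>\<^sub>A} = derivations K A ?X"
  unfolding derivations_def hm using coc by (auto simp: s)
 have inn: "hoch_d0 A ` carrier A = X.inner ` carrier ?X"
  unfolding hoch_d0_def X.inner_def by (simp add: s regular_bimodule_def image_def cong: restrict_cong)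
 have hh: "HH1 K A = quot_module (der_space K A ?X) (X.inner ` carrier ?X)"
  unfolding HH1_def der inn der_space_def pw ..
 have d1: "kdim K (der_space K A ?X) = kdim K (HH1 K A) +
   kdim K ((der_space K A ?X)\<lparr>carrier := X.inner ` carrier ?X\<rparr>)"
  unfolding hh by (rule dim_quot_module(2)[OF X.subspace_derivations(2) X.fin_dim_der_space[OF A(2) fdX(1)] X.inner_image(1)])
 have inv: "X.invariants = carrier (center A)"
  unfolding X.invariants_def center_def by (auto simp: s)
 have cvs: "vectorspace K (center A)"
  by (rule vectorspace_cong[OF X.inner_image(3)]) (auto simp: inv center_def s)
 have "kdim K (center A) = kdim K (?X\<lparr>carrier := X.invariants\<rparr>)"
  by (rule dim_cong(2)[OF cvs X.inner_image(3) X.inner_image(4)[OF fdX(1)]]) (auto simp: inv center_def s)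
 then show ?thesis using X.inner_image(2)[OF fdX(1)] d1 fdX(2) unfolding derivation_excess_def by simp
qed

section \<open>Free modules and first extension groups\<close>

lemma free_module_simps:
 "carrier (free_module R X) = {f \<in> X \<rightarrow>\<^sub>E carrier R. finite {x \<in> X. f x \<noteq> \<zero>\<^sub>R}}"
 "zero (free_module R X) = (\<lambda>x\<in>X. \<zero>\<^sub>R)"
 "add (free_module R X) = (\<lambda>f g. \<lambda>x\<in>X. f x \<oplus>\<^sub>R g x)"
 "smult (free_module R X) = (\<lambda>b f. \<lambda>x\<in>X. b \<otimes>\<^sub>R f x)"
 by (simp_all add: free_module_def)

lemma free_moduleI:
 assumes "\<And>x. x \<in> X ==> E x \<in> carrier R" "finite {x \<in> X. E x \<noteq> \<zero>\<^sub>R}"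
 shows "(\<lambda>x\<in>X. E x) \<in> carrier (free_module R X)"
proof -
 have "{x \<in> X. (\<lambda>x\<in>X. E x) x \<noteq> \<zero>\<^sub>R} = {x \<in> X. E x \<noteq> \<zero>\<^sub>R}" by auto
 then show ?thesis using assms by (simp add: free_module_simps)
qed

lemma left_module_free_module:
 assumes "ring R"
 shows "left_module R (free_module R X)"
proof -
 interpret R: ring R by fact
 have ext: "(\<lambda>x\<in>X. g x) = f" if "f \<in> X \<rightarrow>\<^sub>E carrier R" "\<And>x. x \<in> X ==> g x = f x" for f g
  using that by (auto simp: fun_eq_iff PiE_def extensional_def)
 have mem: "f x \<in> carrier R" if "f \<in> X \<rightarrow>\<^sub>E carrier R" "x \<in> X" for f x using that by auto
 have cl: "(\<lambda>x\<in>X. f x \<oplus>\<^sub>R g x) \<in> carrier (free_module R X)"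
  if "f \<in> carrier (free_module R X)" "g \<in> carrier (free_module R X)" for f g
 proof -
  have "{x \<in> X. f x \<oplus>\<^sub>R g x \<noteq> \<zero>\<^sub>R} \<subseteq> {x \<in> X. f x \<noteq> \<zero>\<^sub>R} \<union> {x \<in> X. g x \<noteq> \<zero>\<^sub>R}" by auto
  then have "finite {x \<in> X. f x \<oplus>\<^sub>R g x \<noteq> \<zero>\<^sub>R}"
   by (rule finite_subset) (use that in \<open>simp add: free_module_simps\<close>)
  then show ?thesis using that by (intro free_moduleI) (auto simp: free_module_simps mem)
 qed
 have scl: "(\<lambda>x\<in>X. b \<otimes>\<^sub>R f x) \<in> carrier (free_module R X)"
  if "f \<in> carrier (free_module R X)" "b \<in> carrier R" for f b
 proof -
  have "{x \<in> X. b \<otimes>\<^sub>R f x \<noteq> \<zero>\<^sub>R} \<subseteq> {x \<in> X. f x \<noteq> \<zero>\<^sub>R}" using that by auto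
  then have "finite {x \<in> X. b \<otimes>\<^sub>R f x \<noteq> \<zero>\<^sub>R}"
   by (rule finite_subset) (use that in \<open>simp add: free_module_simps\<close>)
  then show ?thesis using that by (intro free_moduleI) (auto simp: free_module_simps mem)
 qed
 have neg: "(\<lambda>x\<in>X. \<ominus>\<^sub>R f x) \<in> carrier (free_module R X)" if "f \<in> carrier (free_module R X)" for f
 proof -
  have "{x \<in> X. \<ominus>\<^sub>R f x \<noteq> \<zero>\<^sub>R} \<subseteq> {x \<in> X. f x \<noteq> \<zero>\<^sub>R}" using that by auto
  then have "finite {x \<in> X. \<ominus>\<^sub>R f x \<noteq> \<zero>\<^sub>R}"
   by (rule finite_subset) (use that in \<open>simp add: free_module_simps\<close>)
  then show ?thesis using that by (intro free_moduleI) (auto simp: free_module_simps mem)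
 qed
 have mem': "f x \<in> carrier R" if "f \<in> carrier (free_module R X)" "x \<in> X" for f x
  using that by (auto simp: free_module_simps)
 have ext': "(\<lambda>x\<in>X. g x) = f" if "f \<in> carrier (free_module R X)" "\<And>x. x \<in> X ==> g x = f x" for f g
  using that ext by (auto simp: free_module_simps)
 have ag: "abelian_group (free_module R X)"
 proof (rule abelian_groupI)
  show "\<exists>g\<in>carrier (free_module R X). g \<oplus>\<^bsub>free_module R X\<^esub> f = \<zero>\<^bsub>free_module R X\<^esub>"
   if "f \<in> carrier (free_module R X)" for f
   using neg[OF that] mem'[OF that]
   by (intro bexI[of _ "\<lambda>x\<in>X. \<ominus>\<^sub>R f x"]) (auto simp: free_module_simps(2,3) R.l_neg intro!: restrict_ext)
  show "\<zero>\<^bsub>free_module R X\<^esub> \<oplus>\<^bsub>free_module R X\<^esub> f = f" if "f \<in> carrier (free_module R X)" for f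
   using that mem'[OF that] unfolding free_module_simps(2,3) by (intro ext') auto
 qed (use cl mem' in \<open>auto simp: free_module_simps(2,3) R.a_ac intro!: restrict_ext\<close>, auto simp: free_module_simps)
 show ?thesis
 proof (intro left_module.intro)
  show "\<one>\<^sub>R \<odot>\<^bsub>free_module R X\<^esub> f = f" if "f \<in> carrier (free_module R X)" for f
   using that mem'[OF that] unfolding free_module_simps(4) by (intro ext') auto
 qed (use assms ag scl mem' in \<open>auto simp: free_module_simps(2,3,4) R.l_distr R.r_distr R.m_assoc intro!: restrict_ext\<close>)
qed

definition single :: "('b, 'r) ring_scheme => 'x set => 'x => 'b => 'x => 'b" where
 "single R X x b = (\<lambda>y\<in>X. if y = x then b else \<zero>\<^sub>R)"

definition supp_sum :: "('b, 'r) ring_scheme => 'x set => ('n, 'z) ring_scheme => ('x => 'b => 'n) => ('x => 'b) => 'n" where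
 "supp_sum R X N h f = (\<Oplus>\<^sub>N x\<in>{x \<in> X. f x \<noteq> \<zero>\<^sub>R}. h x (f x))"

lemma single_closed: "ring R ==> x \<in> X ==> b \<in> carrier R ==> single R X x b \<in> carrier (free_module R X)"
proof -
 assume a: "ring R" "x \<in> X" "b \<in> carrier R"
 interpret R: ring R by fact
 have "{y \<in> X. single R X x b y \<noteq> \<zero>\<^sub>R} \<subseteq> {x}" by (auto simp: single_def)
 then have "finite {y \<in> X. single R X x b y \<noteq> \<zero>\<^sub>R}" using finite_subset by blast
 then show ?thesis using a by (auto simp: free_module_simps single_def)
qed

lemma free_module_induct [consumes 2, case_names zero add single]:
 assumes "ring R" and f: "f \<in> carrier (free_module R X)"
  and "P \<zero>\<^bsub>free_module R X\<^esub>"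
  and "\<And>f g. f \<in> carrier (free_module R X) ==> g \<in> carrier (free_module R X) ==> P f ==> P g ==> P (f \<oplus>\<^bsub>free_module R X\<^esub> g)"
  and "\<And>x b. x \<in> X ==> b \<in> carrier R ==> P (single R X x b)"
 shows "P f"
 using f
proof (induction "card {x \<in> X. f x \<noteq> \<zero>\<^sub>R}" arbitrary: f)
 case 0
 then have fin: "finite {x \<in> X. f x \<noteq> \<zero>\<^sub>R}" by (simp add: free_module_simps)
 then have "f x = \<zero>\<^sub>R" if "x \<in> X" for x using 0(1) that by auto
 then have "f = \<zero>\<^bsub>free_module R X\<^esub>" using 0(2)
  by (auto simp: free_module_simps fun_eq_iff PiE_def extensional_def)
 then show ?case using assms(3) by simp
next
 case (Suc n)
 interpret R: ring R by fact
 have fin: "finite {x \<in> X. f x \<noteq> \<zero>\<^sub>R}" using Suc by (simp add: free_module_simps)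
 obtain x where x: "x \<in> X" "f x \<noteq> \<zero>\<^sub>R" using Suc(2) by (metis (mono_tags, lifting) card.empty empty_Collect_eq nat.distinct(1))
 define g where "g = (\<lambda>y\<in>X. if y = x then \<zero>\<^sub>R else f y)"
 have sup: "{y \<in> X. g y \<noteq> \<zero>\<^sub>R} = {y \<in> X. f y \<noteq> \<zero>\<^sub>R} - {x}" by (auto simp: g_def)
 have g: "g \<in> carrier (free_module R X)" using Suc(3) fin sup by (auto simp: free_module_simps g_def)
 have "card {y \<in> X. g y \<noteq> \<zero>\<^sub>R} = n" unfolding sup using Suc(2) x fin by (subst card_Diff_singleton) auto
 then have "P g" using Suc(1)[of g] g by simp
 have fx: "f x \<in> carrier R" using Suc(3) x by (auto simp: free_module_simps)
 have "f = single R X x (f x) \<oplus>\<^bsub>free_module R X\<^esub> g"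
  using Suc(3) x by (auto simp: free_module_simps g_def single_def fun_eq_iff PiE_def extensional_def Pi_def)
 then show ?case using assms(4)[OF single_closed[OF assms(1) x(1) fx] g assms(5)[OF x(1) fx] \<open>P g\<close>] by simp
qed

text \<open>The additive extension to the free module of a family of additive maps on the coefficients. It is used for
 homomorphisms, for derivations and for linear maps on path algebras.\<close>

lemma supp_sum_additive:
 assumes "ring R" "abelian_group N"
  and h: "\<And>x b. x \<in> X ==> b \<in> carrier R ==> h x b \<in> carrier N"
  and add: "\<And>x b c. x \<in> X ==> b \<in> carrier R ==> c \<in> carrier R ==> h x (b \<oplus>\<^sub>R c) = h x b \<oplus>\<^sub>N h x c"
 shows "f \<in> carrier (free_module R X) ==> supp_sum R X N h f \<in> carrier N"
  and "f \<in> carrier (free_module R X) ==> g \<in> carrier (free_module R X) ==>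
     supp_sum R X N h (f \<oplus>\<^bsub>free_module R X\<^esub> g) = supp_sum R X N h f \<oplus>\<^sub>N supp_sum R X N h g"
  and "x \<in> X ==> b \<in> carrier R ==> supp_sum R X N h (single R X x b) = h x b"
  and "supp_sum R X N h \<zero>\<^bsub>free_module R X\<^esub> = \<zero>\<^sub>N"
  and "f \<in> carrier (free_module R X) ==> finite S ==> S \<subseteq> X ==> {x \<in> X. f x \<noteq> \<zero>\<^sub>R} \<subseteq> S ==>
     supp_sum R X N h f = (\<Oplus>\<^sub>N x\<in>S. h x (f x))"
proof -
 interpret R: ring R by fact
 interpret N: abelian_group N by fact
 have h0: "h x \<zero>\<^sub>R = \<zero>\<^sub>N" if "x \<in> X" for x using add[OF that, of "\<zero>\<^sub>R" "\<zero>\<^sub>R"] h[OF that, of "\<zero>\<^sub>R"] by simp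
 have mem: "f x \<in> carrier R" if "f \<in> carrier (free_module R X)" "x \<in> X" for f x
  using that by (auto simp: free_module_simps)
 show sup: "supp_sum R X N h f = (\<Oplus>\<^sub>N x\<in>S. h x (f x))"
  if f: "f \<in> carrier (free_module R X)" and S: "finite S" "S \<subseteq> X" "{x \<in> X. f x \<noteq> \<zero>\<^sub>R} \<subseteq> S" for f S
  unfolding supp_sum_def
  by (rule N.add.finprod_mono_neutral_cong_left) (use f S h0 h mem in \<open>auto simp: Pi_def subset_iff\<close>)
 show "supp_sum R X N h f \<in> carrier N" if "f \<in> carrier (free_module R X)" for f
  unfolding supp_sum_def using mem[OF that] h by (intro N.finsum_closed) auto
 show "supp_sum R X N h (f \<oplus>\<^bsub>free_module R X\<^esub> g) = supp_sum R X N h f \<oplus>\<^sub>N supp_sum R X N h g"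
  if f: "f \<in> carrier (free_module R X)" and g: "g \<in> carrier (free_module R X)" for f g
 proof -
  interpret P: left_module R "free_module R X" by (rule left_module_free_module[OF assms(1)])
  interpret P: abelian_group "free_module R X" by (rule P.M)
  let ?S = "{x \<in> X. f x \<noteq> \<zero>\<^sub>R} \<union> {x \<in> X. g x \<noteq> \<zero>\<^sub>R}"
  have S: "finite ?S" "?S \<subseteq> X" using f g by (auto simp: free_module_simps)
  have "supp_sum R X N h (f \<oplus>\<^bsub>free_module R X\<^esub> g) = (\<Oplus>\<^sub>N x\<in>?S. h x ((f \<oplus>\<^bsub>free_module R X\<^esub> g) x))"
   by (rule sup[OF P.a_closed[OF f g] S]) (auto simp: free_module_simps)
  also have "\<dots> = (\<Oplus>\<^sub>N x\<in>?S. h x (f x) \<oplus>\<^sub>N h x (g x))"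
   using mem[OF f] mem[OF g] h add by (intro N.finsum_cong') (auto simp: free_module_simps)
  also have "\<dots> = (\<Oplus>\<^sub>N x\<in>?S. h x (f x)) \<oplus>\<^sub>N (\<Oplus>\<^sub>N x\<in>?S. h x (g x))"
   using mem[OF f] mem[OF g] h by (intro N.finsum_addf) auto
  finally show ?thesis using sup[OF f S] sup[OF g S] by simp
 qed
 show "supp_sum R X N h (single R X x b) = h x b" if "x \<in> X" "b \<in> carrier R"
 proof -
  have "supp_sum R X N h (single R X x b) = (\<Oplus>\<^sub>N y\<in>{x}. h y (single R X x b y))"
   by (rule sup[OF single_closed[OF assms(1) that]]) (use that in \<open>auto simp: single_def\<close>)
  then show ?thesis using that h by (simp add: single_def)
 qed
 have e: "{x \<in> X. \<zero>\<^bsub>free_module R X\<^esub> x \<noteq> \<zero>\<^sub>R} = {}" by (auto simp: free_module_simps)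
 show "supp_sum R X N h \<zero>\<^bsub>free_module R X\<^esub> = \<zero>\<^sub>N" unfolding supp_sum_def e by (rule N.finsum_empty)
qed

lemma left_module_subset:
 assumes "left_module R M" "H \<subseteq> carrier M" "\<zero>\<^sub>M \<in> H"
  and add: "\<And>x y. x \<in> H ==> y \<in> H ==> x \<oplus>\<^sub>M y \<in> H"
  and smult: "\<And>a x. a \<in> carrier R ==> x \<in> H ==> a \<odot>\<^sub>M x \<in> H"
 shows "left_module R (M\<lparr>carrier := H\<rparr>)"
proof -
 interpret M: left_module R M by fact
 interpret R: ring R by (rule M.R)
 interpret Mg: abelian_group M by (rule M.M)
 have mem: "x \<in> carrier M" if "x \<in> H" for x using assms(2) that by auto
 have ag: "abelian_group (M\<lparr>carrier := H\<rparr>)"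
 proof (rule abelian_groupI)
  fix x assume x: "x \<in> carrier (M\<lparr>carrier := H\<rparr>)"
  then have xM: "x \<in> H" "x \<in> carrier M" using mem by auto
  have "(\<ominus>\<^sub>R \<one>\<^sub>R) \<odot>\<^sub>M x \<oplus>\<^sub>M \<one>\<^sub>R \<odot>\<^sub>M x = \<zero>\<^sub>M"
   using M.smult_l_distr[of "\<ominus>\<^sub>R \<one>\<^sub>R" "\<one>\<^sub>R" x] xM M.smult_zero(2)[of x] by (simp add: R.l_neg)
  then show "\<exists>y\<in>carrier (M\<lparr>carrier := H\<rparr>). y \<oplus>\<^bsub>M\<lparr>carrier := H\<rparr>\<^esub> x = \<zero>\<^bsub>M\<lparr>carrier := H\<rparr>\<^esub>"
   using smult[of "\<ominus>\<^sub>R \<one>\<^sub>R" x] xM M.smult_one by auto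
 qed (use assms mem in \<open>auto simp: Mg.a_ac\<close>)
 show ?thesis
  by (intro left_module.intro)
    (use ag M.R smult mem in \<open>auto simp: M.smult_l_distr M.smult_r_distr M.smult_assoc M.smult_one\<close>)
qed

lemma single_smult:
 assumes "ring R" "b \<in> carrier R"
 shows "b \<odot>\<^bsub>free_module R X\<^esub> single R X x c = single R X x (b \<otimes>\<^sub>R c)"
proof -
 interpret R: ring R by fact
 show ?thesis using assms(2) by (auto simp: free_module_simps single_def fun_eq_iff)
qed

lemma free_lift_exists:
 assumes N: "left_module R N" and u: "\<And>x. x \<in> X ==> u x \<in> carrier N"
 obtains \<psi> where "\<psi> \<in> module_hom R (free_module R X) N"
  "\<And>x b. x \<in> X ==> b \<in> carrier R ==> \<psi> (single R X x b) = b \<odot>\<^sub>N u x"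
  "\<psi> = supp_sum R X N (\<lambda>x b. b \<odot>\<^sub>N u x)"
proof -
 interpret N: left_module R N by fact
 interpret R: ring R by (rule N.R)
 interpret Ng: abelian_group N by (rule N.M)
 interpret P: left_module R "free_module R X" by (rule left_module_free_module[OF N.R])
 let ?\<psi> = "supp_sum R X N (\<lambda>x b. b \<odot>\<^sub>N u x)"
 note s = supp_sum_additive[OF N.R N.M, of X "\<lambda>x b. b \<odot>\<^sub>N u x", OF N.smult_closed[OF _ u] N.smult_l_distr[OF _ _ u]]
 have single: "?\<psi> (single R X x b) = b \<odot>\<^sub>N u x" if "x \<in> X" "b \<in> carrier R" for x b
  by (rule s(3)) (use that in auto)
 have "?\<psi> \<in> module_hom R (free_module R X) N"
 proof (rule module_homI)
  show "?\<psi> f \<in> carrier N" if "f \<in> carrier (free_module R X)" for f by (rule s(1)) (use that in auto)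
  show ad: "?\<psi> (f \<oplus>\<^bsub>free_module R X\<^esub> g) = ?\<psi> f \<oplus>\<^sub>N ?\<psi> g"
   if "f \<in> carrier (free_module R X)" "g \<in> carrier (free_module R X)" for f g by (rule s(2)) (use that in auto)
  have z: "?\<psi> \<zero>\<^bsub>free_module R X\<^esub> = \<zero>\<^sub>N" by (rule s(4)) auto
  show "?\<psi> (b \<odot>\<^bsub>free_module R X\<^esub> f) = b \<odot>\<^sub>N ?\<psi> f" if b: "b \<in> carrier R" and f: "f \<in> carrier (free_module R X)" for b f
   using N.R f
  proof (induction rule: free_module_induct)
   case zero
   then show ?case using b by (simp add: z P.smult_zero N.smult_zero)
  next
   case (add f g)
   then show ?case using b ad[of f g] ad[of "b \<odot>\<^bsub>free_module R X\<^esub> f" "b \<odot>\<^bsub>free_module R X\<^esub> g"] s(1)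
    by (simp add: P.smult_r_distr N.smult_r_distr P.smult_closed N.smult_closed u)
  next
   case (single x c)
   then show ?case using b by (simp add: single_smult[OF N.R] \<open>\<And>x b. x \<in> X ==> b \<in> carrier R ==> ?\<psi> (single R X x b) = b \<odot>\<^sub>N u x\<close> N.smult_assoc u)
  qed
 qed
 then show thesis using that single by blast
qed

lemma free_cover_hom:
 assumes M: "left_module R M"
 shows "free_cover R M \<in> module_hom R (free_module R (carrier M)) M"
  and "m \<in> carrier M ==> b \<in> carrier R ==> free_cover R M (single R (carrier M) m b) = b \<odot>\<^sub>M m"
  and "free_cover R M = supp_sum R (carrier M) M (\<lambda>m b. b \<odot>\<^sub>M m)"
proof -
 show eq: "free_cover R M = supp_sum R (carrier M) M (\<lambda>m b. b \<odot>\<^sub>M m)"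
  by (simp add: free_cover_def supp_sum_def fun_eq_iff)
 obtain \<psi> where p: "\<psi> \<in> module_hom R (free_module R (carrier M)) M"
  "\<And>x b. x \<in> carrier M ==> b \<in> carrier R ==> \<psi> (single R (carrier M) x b) = b \<odot>\<^sub>M x"
  "\<psi> = supp_sum R (carrier M) M (\<lambda>x b. b \<odot>\<^sub>M x)"
  using free_lift_exists[OF M, of "carrier M" "\<lambda>x. x"] by blast
 show "free_cover R M \<in> module_hom R (free_module R (carrier M)) M" using p(1) unfolding eq p(3) .
 show "m \<in> carrier M ==> b \<in> carrier R ==> free_cover R M (single R (carrier M) m b) = b \<odot>\<^sub>M m"
  using p(2) unfolding eq p(3) .
qed

lemma syzygy_simps:
 "carrier (syzygy R M) = {f \<in> carrier (free_module R (carrier M)). free_cover R M f = \<zero>\<^sub>M}"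
 "zero (syzygy R M) = zero (free_module R (carrier M))"
 "add (syzygy R M) = add (free_module R (carrier M))"
 "smult (syzygy R M) = smult (free_module R (carrier M))"
 by (simp_all add: syzygy_def)

lemma module_hom_zero:
 assumes M: "left_module R M" and N: "left_module R N" and f: "f \<in> module_hom R M N"
 shows "f \<zero>\<^sub>M = \<zero>\<^sub>N"
proof -
 interpret M: left_module R M by fact
 interpret N: left_module R N by fact
 interpret Mg: abelian_group M by (rule M.M)
 interpret Ng: abelian_group N by (rule N.M)
 show ?thesis using module_homD(2)[OF f, of "\<zero>\<^sub>M" "\<zero>\<^sub>M"] module_homD(1)[OF f, of "\<zero>\<^sub>M"] by simp
qed

lemma left_module_syzygy:
 assumes M: "left_module R M"
 shows "left_module R (syzygy R M)"
proof -
 interpret M: left_module R M by fact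
 interpret Mg: abelian_group M by (rule M.M)
 interpret P: left_module R "free_module R (carrier M)" by (rule left_module_free_module[OF M.R])
 interpret Pg: abelian_group "free_module R (carrier M)" by (rule P.M)
 note h = module_homD[OF free_cover_hom(1)[OF M]]
 note z = module_hom_zero[OF P.left_module_axioms M free_cover_hom(1)[OF M]]
 show ?thesis unfolding syzygy_def
  by (rule left_module_subset[OF P.left_module_axioms]) (auto simp: h z P.smult_closed M.smult_zero)
qed

lemma subspace_module_homs:
 assumes B: "k_algebra K B" and P: "left_module B P" and N: "left_module B N"
 shows "VectorSpace.subspace K (homs B P N) (pointwise (carrier P) (space_of B N))"
  "vectorspace K ((pointwise (carrier P) (space_of B N))\<lparr>carrier := homs B P N\<rparr>)"
proof -
 interpret P: left_module B P by fact
 interpret N: left_module B N by fact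
 interpret Pg: abelian_group P by (rule P.M)
 interpret Ng: abelian_group N by (rule N.M)
 interpret V: vectorspace K B using k_algebraD(1)[OF B] .
 interpret B: ring B by (rule N.R)
 let ?H = "pointwise (carrier P) (space_of B N)"
 note uN = vectorspace_underlying_space[OF B N]
 note r = vectorspace_subsetI[OF vectorspace_pointwise[OF uN], of "homs B P N" "carrier P"]
 have sub: "homs B P N \<subseteq> carrier ?H" using homsD(6) by fastforce
 have z: "\<zero>\<^bsub>?H\<^esub> \<in> homs B P N" by (rule homsI) (auto simp: N.smult_zero P.smult_closed)
 have a: "f \<oplus>\<^bsub>?H\<^esub> g \<in> homs B P N" if "f \<in> homs B P N" "g \<in> homs B P N" for f g
  using homsD(1-3)[OF that(1)] homsD(1-3)[OF that(2)]
  by (intro homsI) (auto simp: Ng.a_ac N.smult_r_distr P.smult_closed)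
 have s: "c \<odot>\<^bsub>?H\<^esub> f \<in> homs B P N" if "c \<in> carrier K" "f \<in> homs B P N" for c f
 proof -
  have c: "c \<odot>\<^sub>B \<one>\<^sub>B \<in> carrier B" using that by simp
  have "(c \<odot>\<^sub>B \<one>\<^sub>B) \<odot>\<^sub>N (b \<odot>\<^sub>N n) = b \<odot>\<^sub>N ((c \<odot>\<^sub>B \<one>\<^sub>B) \<odot>\<^sub>N n)" if "b \<in> carrier B" "n \<in> carrier N" for b n
   using that c \<open>c \<in> carrier K\<close> k_algebraD(3,4)[OF B, of c] by (simp add: N.smult_assoc[symmetric])
  then show ?thesis
   using homsD(1-3)[OF that(2)] c
   by (intro homsI) (auto simp: N.smult_r_distr P.smult_closed N.smult_closed)
 qed
 show "VectorSpace.subspace K (homs B P N) ?H" by (rule r(1)[OF sub z a s])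
 show "vectorspace K (?H\<lparr>carrier := homs B P N\<rparr>)" by (rule r(2)[OF sub z a s])
qed

locale two_modules =
 fixes K :: "('k, 'r) ring_scheme" and B :: "('k, 'b, 'z) module_scheme" (structure)
  and M :: "('b, 'm, 'y) module_scheme" and N :: "('b, 'n, 'x) module_scheme"
 assumes B: "k_algebra K B" and fdB: "kfin_dim K B"
  and M: "left_module B M" and N: "left_module B N"
  and fdM: "kfin_dim K (space_of B M)"
  and fdN: "kfin_dim K (space_of B N)"
begin

abbreviation "X \<equiv> hom_bimodule K B M N"
abbreviation "P0 \<equiv> free_module B (carrier M)"
abbreviation "\<Omega>1 \<equiv> syzygy B M"
abbreviation "P1 \<equiv> free_module B (carrier \<Omega>1)"
abbreviation "\<Omega>2 \<equiv> syzygy B \<Omega>1"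
abbreviation "P2 \<equiv> free_module B (carrier \<Omega>2)"
abbreviation "d1 \<equiv> free_cover B \<Omega>1"
abbreviation "d2 \<equiv> free_cover B \<Omega>2"
abbreviation "cocycles \<equiv> {\<phi> \<in> homs B P1 N. \<forall>p\<in>carrier P2. \<phi> (d2 p) = \<zero>\<^sub>N}"
abbreviation "cocycle_space \<equiv> (pointwise (carrier P1) (space_of B N))\<lparr>carrier := cocycles\<rparr>"
abbreviation "coboundaries \<equiv> (\<lambda>\<psi>. \<lambda>p\<in>carrier P1. \<psi> (d1 p)) ` homs B P0 N"

sublocale M: left_module B M by (rule M)
sublocale N: left_module B N by (rule N)
sublocale B: ring B by (rule M.R)
sublocale Mg: abelian_group M by (rule M.M)
sublocale Ng: abelian_group N by (rule N.M)
sublocale P0: left_module B P0 by (rule left_module_free_module[OF M.R])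
sublocale P0g: abelian_group P0 by (rule P0.M)
sublocale P1: left_module B P1 by (rule left_module_free_module[OF M.R])
sublocale P1g: abelian_group P1 by (rule P1.M)
sublocale O1: left_module B \<Omega>1 by (rule left_module_syzygy[OF M])
sublocale O2: left_module B \<Omega>2 by (rule left_module_syzygy[OF O1.left_module_axioms])
sublocale BV: vectorspace K B using k_algebraD(1)[OF B] .
sublocale X: bimodule K B X by (rule bimodule_hom_bimodule[OF B M N])

lemmas cover = module_homD[OF free_cover_hom(1)[OF M]]
lemmas cover_single = free_cover_hom(2)[OF M]
lemmas cover_zero = module_hom_zero[OF P0.left_module_axioms M free_cover_hom(1)[OF M]]
lemmas d1 = module_homD[OF free_cover_hom(1)[OF O1.left_module_axioms]]
lemmas d1_single = free_cover_hom(2)[OF O1.left_module_axioms]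
lemmas d2 = module_homD[OF free_cover_hom(1)[OF O2.left_module_axioms]]
lemmas d2_single = free_cover_hom(2)[OF O2.left_module_axioms]

lemma O1_mem: "\<omega> \<in> carrier \<Omega>1 \<longleftrightarrow> \<omega> \<in> carrier P0 \<and> free_cover B M \<omega> = \<zero>\<^sub>M"
 by (auto simp: syzygy_simps)

lemma O2_mem: "p \<in> carrier \<Omega>2 \<longleftrightarrow> p \<in> carrier P1 \<and> d1 p = \<zero>\<^sub>P0"
 by (auto simp: syzygy_simps)

lemma kB: "c \<in> carrier K ==> c \<odot> \<one> \<in> carrier B" by simp

lemma central: "c \<in> carrier K ==> b \<in> carrier B ==> (c \<odot> \<one>) \<otimes> b = b \<otimes> (c \<odot> \<one>)"
 "c \<in> carrier K ==> b \<in> carrier B ==> c \<odot> b = (c \<odot> \<one>) \<otimes> b"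
 using k_algebraD(3,4)[OF B] by auto

lemma single0: "m \<in> carrier M ==> b \<in> carrier B ==> single B (carrier M) m b \<in> carrier P0"
 by (rule single_closed[OF M.R])

lemma d1_surj: "\<omega> \<in> carrier \<Omega>1 ==> single B (carrier \<Omega>1) \<omega> \<one> \<in> carrier P1 \<and> d1 (single B (carrier \<Omega>1) \<omega> \<one>) = \<omega>"
 using single_closed[OF M.R, of \<omega> "carrier \<Omega>1" "\<one>"] d1_single[of \<omega> "\<one>"] O1.smult_one by simp

lemma Ext1_eq: "Ext1 B M N = quot_module cocycle_space coboundaries"
 by (simp add: Ext1_def Let_def Hom_space_def)

text \<open>The restriction of this map to the first syzygy is \<open>B\<close>-linear: the failure of a derivation to be linear is measured by the
 free cover, which is 0 there.\<close>

definition lift_der :: "('b => 'm => 'n) => ('m => 'b) => 'n" where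
 "lift_der D = supp_sum B (carrier M) N (\<lambda>m b. D b m)"

lemma der_facts:
 assumes D: "D \<in> derivations K B X"
 shows "b \<in> carrier B ==> m \<in> carrier M ==> D b m \<in> carrier N"
  and "b \<in> carrier B ==> m \<in> carrier M ==> m' \<in> carrier M ==> D b (m \<oplus>\<^sub>M m') = D b m \<oplus>\<^sub>N D b m'"
  and "a \<in> carrier B ==> b \<in> carrier B ==> m \<in> carrier M ==> D (a \<oplus> b) m = D a m \<oplus>\<^sub>N D b m"
  and "a \<in> carrier B ==> b \<in> carrier B ==> m \<in> carrier M ==> D (a \<otimes> b) m = a \<odot>\<^sub>N D b m \<oplus>\<^sub>N D a (b \<odot>\<^sub>M m)"
  and "c \<in> carrier K ==> b \<in> carrier B ==> m \<in> carrier M ==> D (c \<odot> b) m = (c \<odot> \<one>) \<odot>\<^sub>N D b m"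
  and "m \<in> carrier M ==> D \<one> m = \<zero>\<^sub>N"
  and "b \<in> carrier B ==> D b \<zero>\<^sub>M = \<zero>\<^sub>N"
proof -
 note d = derivationsD[OF D]
 have h: "D b \<in> homs K (space_of B M) (space_of B N)" if "b \<in> carrier B" for b
  using d(2)[OF that] by (simp add: hom_bimodule_simps)
 show c: "b \<in> carrier B ==> m \<in> carrier M ==> D b m \<in> carrier N" for b m
  using homsD(1)[OF h] by simp
 show a: "b \<in> carrier B ==> m \<in> carrier M ==> m' \<in> carrier M ==> D b (m \<oplus>\<^sub>M m') = D b m \<oplus>\<^sub>N D b m'" for b m m'
  using homsD(2)[OF h] by simp
 show "a \<in> carrier B ==> b \<in> carrier B ==> m \<in> carrier M ==> D (a \<oplus> b) m = D a m \<oplus>\<^sub>N D b m"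
  using d(3)[of a b] by (simp add: hom_bimodule_simps)
 show "a \<in> carrier B ==> b \<in> carrier B ==> m \<in> carrier M ==> D (a \<otimes> b) m = a \<odot>\<^sub>N D b m \<oplus>\<^sub>N D a (b \<odot>\<^sub>M m)"
  using d(7)[of a b] by (simp add: hom_bimodule_simps)
 show "c \<in> carrier K ==> b \<in> carrier B ==> m \<in> carrier M ==> D (c \<odot> b) m = (c \<odot> \<one>) \<odot>\<^sub>N D b m"
  using d(4)[of c b] by (simp add: hom_bimodule_simps)
 show "m \<in> carrier M ==> D \<one> m = \<zero>\<^sub>N"
  using X.derivation_one[OF D] by (simp add: hom_bimodule_simps)
 show "b \<in> carrier B ==> D b \<zero>\<^sub>M = \<zero>\<^sub>N"
  using a[of b "\<zero>\<^sub>M" "\<zero>\<^sub>M"] c[of b "\<zero>\<^sub>M"] by simp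
qed

lemma lift_der_facts:
 assumes D: "D \<in> derivations K B X"
 shows "f \<in> carrier P0 ==> lift_der D f \<in> carrier N"
  and "f \<in> carrier P0 ==> g \<in> carrier P0 ==> lift_der D (f \<oplus>\<^sub>P0 g) = lift_der D f \<oplus>\<^sub>N lift_der D g"
  and "m \<in> carrier M ==> b \<in> carrier B ==> lift_der D (single B (carrier M) m b) = D b m"
  and "lift_der D \<zero>\<^sub>P0 = \<zero>\<^sub>N"
  and "f \<in> carrier P0 ==> b \<in> carrier B ==> lift_der D (b \<odot>\<^sub>P0 f) = b \<odot>\<^sub>N lift_der D f \<oplus>\<^sub>N D b (free_cover B M f)"
proof -
 note df = der_facts[OF D]
 note s = supp_sum_additive[OF M.R N.M, of "carrier M" "\<lambda>m b. D b m", OF df(1) df(3), folded lift_der_def]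
 show c: "lift_der D f \<in> carrier N" if "f \<in> carrier P0" for f by (rule s(1)) (use that in auto)
 show a: "lift_der D (f \<oplus>\<^sub>P0 g) = lift_der D f \<oplus>\<^sub>N lift_der D g" if "f \<in> carrier P0" "g \<in> carrier P0" for f g
  by (rule s(2)) (use that in auto)
 show si: "lift_der D (single B (carrier M) m b) = D b m" if "m \<in> carrier M" "b \<in> carrier B" for m b
  by (rule s(3)) (use that in auto)
 show z: "lift_der D \<zero>\<^sub>P0 = \<zero>\<^sub>N" by (rule s(4)) auto
 show "lift_der D (b \<odot>\<^sub>P0 f) = b \<odot>\<^sub>N lift_der D f \<oplus>\<^sub>N D b (free_cover B M f)" if f: "f \<in> carrier P0" and b: "b \<in> carrier B" for f b
  using M.R f
 proof (induction rule: free_module_induct)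
  case zero
  then show ?case using b by (simp add: z P0.smult_zero N.smult_zero cover_zero df(7))
 next
  case (add f g)
  then show ?case using b
   by (simp add: P0.smult_r_distr P0.smult_closed N.smult_r_distr a c cover df(1,2) N.smult_closed Ng.a_ac)
 next
  case (single m c)
  then show ?case using b by (simp add: single_smult[OF M.R] si df(4) cover_single)
 qed
qed

text \<open>The cocycle, up to sign, of the extension of \<open>M\<close> by \<open>N\<close> in which \<open>b\<close> sends \<open>(n, m)\<close> to \<open>(b n + D(b) m, b m)\<close>.\<close>

definition ext_class :: "('b => 'm => 'n) => (('m => 'b) => 'b) => 'n" where
 "ext_class D = (\<lambda>p\<in>carrier P1. lift_der D (d1 p))"

lemma ext_class_cocycle:
 assumes D: "D \<in> derivations K B X"
 shows "ext_class D \<in> cocycles"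
proof -
 note l = lift_der_facts[OF D]
 have in0: "d1 p \<in> carrier P0" "free_cover B M (d1 p) = \<zero>\<^sub>M" if "p \<in> carrier P1" for p
  using d1(1)[OF that] O1_mem by auto
 have add: "d1 (p \<oplus>\<^sub>P1 q) = d1 p \<oplus>\<^sub>P0 d1 q" if "p \<in> carrier P1" "q \<in> carrier P1" for p q
  using d1(2)[OF that] by (simp add: syzygy_simps(3))
 have sm: "d1 (b \<odot>\<^sub>P1 p) = b \<odot>\<^sub>P0 d1 p" if "p \<in> carrier P1" "b \<in> carrier B" for p b
  using d1(3)[OF that(2,1)] by (simp add: syzygy_simps(4))
 have "ext_class D \<in> homs B P1 N"
  by (rule homsI) (auto simp: ext_class_def in0 add sm l P1.smult_closed der_facts(7)[OF D] N.smult_closed)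
 moreover have "ext_class D (d2 p) = \<zero>\<^sub>N" if "p \<in> carrier P2" for p
  using d2(1)[OF that] O2_mem by (simp add: ext_class_def l)
 ultimately show ?thesis by auto
qed

lemma vectorspace_cocycles:
 "VectorSpace.subspace K cocycles (pointwise (carrier P1) (space_of B N))" "vectorspace K cocycle_space"
proof -
 note sp = subspace_module_homs[OF B P1.left_module_axioms N]
 interpret H: vectorspace K "(pointwise (carrier P1) (space_of B N))\<lparr>carrier := homs B P1 N\<rparr>" by (rule sp(2))
 let ?H = "pointwise (carrier P1) (space_of B N)"
 note uN = vectorspace_underlying_space[OF B N]
 note r = vectorspace_subsetI[OF vectorspace_pointwise[OF uN], of cocycles "carrier P1"]
 have d2': "d2 p \<in> carrier P1" if "p \<in> carrier P2" for p using d2(1)[OF that] O2_mem by auto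
 have sub: "cocycles \<subseteq> carrier ?H" using homsD(6) by fastforce
 have z: "\<zero>\<^bsub>?H\<^esub> \<in> cocycles" using H.M.zero_closed d2' by simp
 have a: "f \<oplus>\<^bsub>?H\<^esub> g \<in> cocycles" if "f \<in> cocycles" "g \<in> cocycles" for f g
  using H.M.add.m_closed[of f g] that d2' by simp
 have s: "c \<odot>\<^bsub>?H\<^esub> f \<in> cocycles" if "c \<in> carrier K" "f \<in> cocycles" for c f
  using H.smult_closed[of c f] that d2' by (simp add: N.smult_zero)
 show "VectorSpace.subspace K cocycles ?H" by (rule r(1)[OF sub z a s])
 show "vectorspace K cocycle_space" by (rule r(2)[OF sub z a s])
qed

lemma subspace_coboundaries: "VectorSpace.subspace K coboundaries cocycle_space"
proof -
 note sp = subspace_module_homs[OF B P0.left_module_axioms N]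
 interpret H: vectorspace K "(pointwise (carrier P0) (space_of B N))\<lparr>carrier := homs B P0 N\<rparr>" by (rule sp(2))
 have in0: "d1 p \<in> carrier P0" if "p \<in> carrier P1" for p
  using d1(1)[OF that] O1_mem by auto
 have add: "d1 (p \<oplus>\<^sub>P1 q) = d1 p \<oplus>\<^sub>P0 d1 q" if "p \<in> carrier P1" "q \<in> carrier P1" for p q
  using d1(2)[OF that] by (simp add: syzygy_simps(3))
 have sm: "d1 (b \<odot>\<^sub>P1 p) = b \<odot>\<^sub>P0 d1 p" if "p \<in> carrier P1" "b \<in> carrier B" for p b
  using d1(3)[OF that(2,1)] by (simp add: syzygy_simps(4))
 have hz: "\<psi> \<zero>\<^sub>P0 = \<zero>\<^sub>N" if "\<psi> \<in> homs B P0 N" for \<psi>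
  using module_hom_zero[OF P0.left_module_axioms N homsD(4)[OF that]] .
 let ?r = "\<lambda>\<psi>. \<lambda>p\<in>carrier P1. \<psi> (d1 p)"
 have mem: "?r \<psi> \<in> cocycles" if h: "\<psi> \<in> homs B P0 N" for \<psi>
 proof -
  have "?r \<psi> \<in> homs B P1 N"
   by (rule homsI) (use homsD(1-3)[OF h] in \<open>auto simp: in0 add sm P1.smult_closed\<close>)
  moreover have "?r \<psi> (d2 p) = \<zero>\<^sub>N" if "p \<in> carrier P2" for p
   using d2(1)[OF that] O2_mem hz[OF h] by simp
  ultimately show ?thesis by auto
 qed
 show ?thesis
 proof (rule vectorspace_subsetI(1)[OF vectorspace_cocycles(2)])
  show "coboundaries \<subseteq> carrier cocycle_space" using mem by auto
  have "\<zero>\<^bsub>cocycle_space\<^esub> = ?r (\<lambda>f\<in>carrier P0. \<zero>\<^sub>N)" using in0 by (auto intro!: restrict_ext)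
  moreover have "(\<lambda>f\<in>carrier P0. \<zero>\<^sub>N) \<in> homs B P0 N" using H.M.zero_closed by simp
  ultimately show "\<zero>\<^bsub>cocycle_space\<^esub> \<in> coboundaries" by blast
  show "x \<oplus>\<^bsub>cocycle_space\<^esub> y \<in> coboundaries" if xy: "x \<in> coboundaries" "y \<in> coboundaries" for x y
  proof -
   obtain f g where fg: "f \<in> homs B P0 N" "g \<in> homs B P0 N" "x = ?r f" "y = ?r g" using xy by auto
   have "x \<oplus>\<^bsub>cocycle_space\<^esub> y = ?r (\<lambda>u\<in>carrier P0. f u \<oplus>\<^sub>N g u)" using in0 fg by (auto intro!: restrict_ext)
   moreover have "(\<lambda>u\<in>carrier P0. f u \<oplus>\<^sub>N g u) \<in> homs B P0 N" using H.M.add.m_closed[of f g] fg by simp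
   ultimately show ?thesis by blast
  qed
  show "c \<odot>\<^bsub>cocycle_space\<^esub> x \<in> coboundaries" if c: "c \<in> carrier K" and x: "x \<in> coboundaries" for c x
  proof -
   obtain f where f: "f \<in> homs B P0 N" "x = ?r f" using x by auto
   have "c \<odot>\<^bsub>cocycle_space\<^esub> x = ?r (\<lambda>u\<in>carrier P0. (c \<odot> \<one>) \<odot>\<^sub>N f u)" using in0 f by (auto intro!: restrict_ext)
   moreover have "(\<lambda>u\<in>carrier P0. (c \<odot> \<one>) \<odot>\<^sub>N f u) \<in> homs B P0 N" using H.smult_closed[of c f] f c by simp
   ultimately show ?thesis by blast
  qed
 qed
qed

end

lemma (in abelian_group) add_minus_cancel_left:
 assumes "a \<in> carrier G" "c \<in> carrier G"
 shows "(a \<oplus> c) \<ominus> a = c"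
proof -
 have "(a \<oplus> c) \<ominus> a = (c \<oplus> a) \<oplus> \<ominus> a" using assms by (simp add: minus_eq a_comm)
 also have "\<dots> = c" using assms by (simp add: a_assoc r_neg)
 finally show ?thesis .
qed

context two_modules
begin

lemma ext_class_linear: "ext_class \<in> module_hom K (der_space K B X) cocycle_space"
proof (rule module_homI)
 have in0: "d1 p \<in> carrier P0" if "p \<in> carrier P1" for p using d1(1)[OF that] O1_mem by auto
 show "ext_class D \<in> carrier cocycle_space" if "D \<in> carrier (der_space K B X)" for D
  using ext_class_cocycle[of D] that by simp
 have add: "lift_der (\<lambda>b\<in>carrier B. D b \<oplus>\<^sub>X E b) f = lift_der D f \<oplus>\<^sub>N lift_der E f"
  if D: "D \<in> derivations K B X" and E: "E \<in> derivations K B X" and f: "f \<in> carrier P0" for D E f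
 proof -
  interpret V: vectorspace K "der_space K B X" by (rule X.subspace_derivations(2))
  define S where "S = (\<lambda>b\<in>carrier B. D b \<oplus>\<^sub>X E b)"
  have S: "S \<in> derivations K B X"
   using V.M.add.m_closed[of D E] D E by (simp add: S_def)
  have Se: "S b = D b \<oplus>\<^sub>X E b" if "b \<in> carrier B" for b using that by (simp add: S_def)
  note lD = lift_der_facts[OF D] and lE = lift_der_facts[OF E] and lS = lift_der_facts[OF S]
  show ?thesis unfolding S_def[symmetric] using M.R f
  proof (induction rule: free_module_induct)
   case zero then show ?case by (simp add: lD(4) lE(4) lS(4))
  next
   case (add f g) then show ?case by (simp add: lD(1,2) lE(1,2) lS(2) Ng.a_ac)
  next
   case (single m b) then show ?case by (simp add: lD(3) lE(3) lS(3) Se hom_bimodule_simps)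
  qed
 qed
 show "ext_class (D \<oplus>\<^bsub>der_space K B X\<^esub> E) = ext_class D \<oplus>\<^bsub>cocycle_space\<^esub> ext_class E"
  if "D \<in> carrier (der_space K B X)" "E \<in> carrier (der_space K B X)" for D E
  using that in0 by (auto simp: ext_class_def add intro!: restrict_ext)
 have sm: "lift_der (\<lambda>b\<in>carrier B. c \<odot>\<^sub>X D b) f = (c \<odot> \<one>) \<odot>\<^sub>N lift_der D f"
  if D: "D \<in> derivations K B X" and c: "c \<in> carrier K" and f: "f \<in> carrier P0" for D c f
 proof -
  interpret V: vectorspace K "der_space K B X" by (rule X.subspace_derivations(2))
  define S where "S = (\<lambda>b\<in>carrier B. c \<odot>\<^sub>X D b)"
  have S: "S \<in> derivations K B X"
   using V.smult_closed[of c D] D c by (simp add: S_def)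
  have Se: "S b = c \<odot>\<^sub>X D b" if "b \<in> carrier B" for b using that by (simp add: S_def)
  note lD = lift_der_facts[OF D] and lS = lift_der_facts[OF S]
  show ?thesis unfolding S_def[symmetric] using M.R f
  proof (induction rule: free_module_induct)
   case zero then show ?case using c by (simp add: lD(4) lS(4) N.smult_zero)
  next
   case (add f g) then show ?case using c by (simp add: lD(1,2) lS(2) N.smult_r_distr)
  next
   case (single m b) then show ?case by (simp add: lD(3) lS(3) Se hom_bimodule_simps)
  qed
 qed
 show "ext_class (c \<odot>\<^bsub>der_space K B X\<^esub> D) = c \<odot>\<^bsub>cocycle_space\<^esub> ext_class D"
  if "c \<in> carrier K" "D \<in> carrier (der_space K B X)" for c D
  using that in0 by (auto simp: ext_class_def sm intro!: restrict_ext)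
qed

lemma X_mem: "u \<in> carrier X \<longleftrightarrow> u \<in> homs K (space_of B M) (space_of B N)"
 by (simp add: hom_bimodule_simps)

lemma inner_eval:
 assumes u: "u \<in> carrier X" and b: "b \<in> carrier B" and m: "m \<in> carrier M"
 shows "X.inner u b m \<oplus>\<^sub>N u (b \<odot>\<^sub>M m) = b \<odot>\<^sub>N u m"
proof -
 interpret XV: vectorspace K X by (rule X.vs)
 have "X.inner u b \<oplus>\<^sub>X ract X b u = lact X b u"
  using X.lact_closed[OF b u] X.ract_closed[OF b u] b
  by (simp add: X.inner_def XV.M.minus_eq XV.M.a_assoc XV.M.l_neg)
 from fun_cong[OF this, of m] show ?thesis using m by (simp add: hom_bimodule_simps)
qed

text \<open>Both directions are explicit: if the class of \<open>D\<close> is the coboundary of \<open>\<psi>\<close>, then the additive extension of \<open>D\<close> and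
 \<open>\<psi>\<close> agree on the first syzygy, so their difference descends to a linear map \<open>M \<rightarrow> N\<close> whose inner derivation is \<open>D\<close> up to sign.\<close>

lemma ext_class_coboundary_iff:
 assumes D: "D \<in> derivations K B X"
 shows "ext_class D \<in> coboundaries \<longleftrightarrow> D \<in> X.inner ` carrier X"
proof
 note l = lift_der_facts[OF D] and df = der_facts[OF D]
 have in0: "d1 p \<in> carrier P0" "free_cover B M (d1 p) = \<zero>\<^sub>M" if "p \<in> carrier P1" for p
  using d1(1)[OF that] O1_mem by auto
 {
  assume "D \<in> X.inner ` carrier X"
  then obtain u where u: "u \<in> carrier X" "D = X.inner u" by auto
  have uh: "u \<in> homs K (space_of B M) (space_of B N)" using u X_mem by simp
  have um: "u m \<in> carrier N" if "m \<in> carrier M" for m using homsD(1)[OF uh] that by simp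
  have ua: "u (m \<oplus>\<^sub>M m') = u m \<oplus>\<^sub>N u m'" if "m \<in> carrier M" "m' \<in> carrier M" for m m' using homsD(2)[OF uh] that by simp
  have u0: "u \<zero>\<^sub>M = \<zero>\<^sub>N" using ua[of "\<zero>\<^sub>M" "\<zero>\<^sub>M"] um[of "\<zero>\<^sub>M"] by simp
  obtain \<psi> where \<psi>: "\<psi> \<in> module_hom B P0 N"
   "\<And>x b. x \<in> carrier M ==> b \<in> carrier B ==> \<psi> (single B (carrier M) x b) = b \<odot>\<^sub>N u x"
   using free_lift_exists[OF N, of "carrier M" u] um by blast
  note p = module_homD[OF \<psi>(1)]
  have eq: "lift_der D f \<oplus>\<^sub>N u (free_cover B M f) = \<psi> f" if "f \<in> carrier P0" for f
   using M.R that
  proof (induction rule: free_module_induct)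
   case zero then show ?case using module_hom_zero[OF P0.left_module_axioms N \<psi>(1)] by (simp add: l cover_zero u0)
  next
   case (add f g)
   have "lift_der D (f \<oplus>\<^sub>P0 g) \<oplus>\<^sub>N u (free_cover B M (f \<oplus>\<^sub>P0 g)) =
     (lift_der D f \<oplus>\<^sub>N u (free_cover B M f)) \<oplus>\<^sub>N (lift_der D g \<oplus>\<^sub>N u (free_cover B M g))"
    using add(1,2) by (simp add: l cover ua um Ng.a_ac)
   then show ?case using add p(2)[OF add(1,2)] by simp
  next
   case (single m b) then show ?case using inner_eval[OF u(1)] by (simp add: l cover_single \<psi>(2) u(2)[symmetric])
  qed
  have "lift_der D (d1 q) = \<psi> (d1 q)" if "q \<in> carrier P1" for q
   using eq[OF in0(1)[OF that]] in0[OF that] l(1) by (simp add: u0)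
  then have "ext_class D = (\<lambda>q\<in>carrier P1. (\<lambda>f\<in>carrier P0. \<psi> f) (d1 q))"
   unfolding ext_class_def using in0 by (auto intro!: restrict_ext)
  moreover have "(\<lambda>f\<in>carrier P0. \<psi> f) \<in> homs B P0 N" by (rule homs_restrictI[OF \<psi>(1)]) (auto simp: P0.smult_closed)
  ultimately show "ext_class D \<in> coboundaries" by blast
 next
  assume "ext_class D \<in> coboundaries"
  then obtain \<psi> where \<psi>: "\<psi> \<in> homs B P0 N" "ext_class D = (\<lambda>p\<in>carrier P1. \<psi> (d1 p))" by auto
  note p = homsD[OF \<psi>(1)]
  have eqO: "lift_der D \<omega> = \<psi> \<omega>" if "\<omega> \<in> carrier \<Omega>1" for \<omega>
   using fun_cong[OF \<psi>(2), of "single B (carrier \<Omega>1) \<omega> \<one>"] d1_surj[OF that] by (simp add: ext_class_def)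
  have diff: "lift_der D f \<oplus>\<^sub>N \<psi> g = lift_der D g \<oplus>\<^sub>N \<psi> f"
   if fg: "f \<in> carrier P0" "g \<in> carrier P0" "free_cover B M f = free_cover B M g" for f g
  proof -
   define w where "w = f \<ominus>\<^sub>P0 g"
   have w: "w \<in> carrier P0" "f = w \<oplus>\<^sub>P0 g" unfolding w_def using fg by (auto simp: P0g.minus_eq P0g.a_assoc P0g.l_neg)
   have "free_cover B M w \<oplus>\<^sub>M free_cover B M g = free_cover B M g" using cover(2)[OF w(1) fg(2)] w(2) fg(3) by simp
   then have "free_cover B M w = \<zero>\<^sub>M" using cover(1)[OF w(1)] cover(1)[OF fg(2)] by simp
   then have "lift_der D w = \<psi> w" using eqO O1_mem w(1) by blast
   then show ?thesis using l(1,2) p(1,2) w fg(2) by (simp add: Ng.a_ac)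
  qed
  define u where "u = (\<lambda>m\<in>carrier M. \<psi> (single B (carrier M) m \<one>))"
  have um: "u m \<in> carrier N" if "m \<in> carrier M" for m unfolding u_def using that p(1) single0 by simp
  have \<psi>s: "\<psi> (single B (carrier M) m b) = b \<odot>\<^sub>N u m" if "m \<in> carrier M" "b \<in> carrier B" for m b
   using p(3)[OF that(2) single0[OF that(1) B.one_closed]] single_smult[OF M.R that(2), of "carrier M" m "\<one>"] that
   by (simp add: u_def)
  have key: "D b m \<oplus>\<^sub>N u (b \<odot>\<^sub>M m) = b \<odot>\<^sub>N u m" if bm: "b \<in> carrier B" "m \<in> carrier M" for b m
  proof -
   have "lift_der D (single B (carrier M) m b) \<oplus>\<^sub>N \<psi> (single B (carrier M) (b \<odot>\<^sub>M m) \<one>) =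
    lift_der D (single B (carrier M) (b \<odot>\<^sub>M m) \<one>) \<oplus>\<^sub>N \<psi> (single B (carrier M) m b)"
    by (rule diff) (use bm in \<open>auto simp: single0 cover_single M.smult_closed M.smult_one\<close>)
   then show ?thesis using bm by (simp add: l(3) \<psi>s M.smult_closed N.smult_one um df(6) N.smult_closed)
  qed
  have "u \<in> homs K (space_of B M) (space_of B N)"
  proof (rule homsI)
   show "u x \<in> carrier (space_of B N)" if "x \<in> carrier (space_of B M)" for x using um that by simp
   show "u (m \<oplus>\<^bsub>space_of B M\<^esub> m') = u m \<oplus>\<^bsub>space_of B N\<^esub> u m'"
    if "m \<in> carrier (space_of B M)" "m' \<in> carrier (space_of B M)" for m m'
   proof -
    have mm: "m \<in> carrier M" "m' \<in> carrier M" using that by auto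
    let ?e = "\<lambda>m. single B (carrier M) m \<one>"
    have "lift_der D (?e (m \<oplus>\<^sub>M m')) \<oplus>\<^sub>N \<psi> (?e m \<oplus>\<^sub>P0 ?e m') = lift_der D (?e m \<oplus>\<^sub>P0 ?e m') \<oplus>\<^sub>N \<psi> (?e (m \<oplus>\<^sub>M m'))"
     by (rule diff) (use mm in \<open>auto simp: single0 cover cover_single M.smult_one\<close>)
    then show ?thesis using mm by (simp add: l(2,3) single0 df(6) p(2) \<psi>s N.smult_one um)
   qed
   show "u (c \<odot>\<^bsub>space_of B M\<^esub> m) = c \<odot>\<^bsub>space_of B N\<^esub> u m"
    if "c \<in> carrier K" "m \<in> carrier (space_of B M)" for c m
   proof -
    have cm: "c \<odot> \<one> \<in> carrier B" "m \<in> carrier M" using that by auto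
    have "D (c \<odot> \<one>) m = \<zero>\<^sub>N" using df(5)[OF that(1) B.one_closed cm(2)] df(6)[OF cm(2)] N.smult_zero(1)[OF cm(1)] by simp
    then show ?thesis using key[OF cm] um cm by (simp add: M.smult_closed)
   qed
  qed (simp add: u_def)
  then have u: "u \<in> carrier X" using X_mem by simp
  interpret XV: vectorspace K X by (rule X.vs)
  have "D b = X.inner u b" if b: "b \<in> carrier B" for b
  proof -
   have Db: "D b \<in> carrier X" using derivationsD(2)[OF D b] .
   have "D b \<oplus>\<^sub>X ract X b u = lact X b u"
    using key[OF b] by (auto simp: hom_bimodule_simps intro!: restrict_ext)
   then have "D b = lact X b u \<ominus>\<^sub>X ract X b u"
    using Db X.ract_closed[OF b u] by (metis XV.M.minus_eq XV.M.a_assoc XV.M.r_neg XV.M.r_zero XV.M.a_inv_closed)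
   then show ?thesis using b by (simp add: X.inner_def)
  qed
  then have "D = X.inner u"
   by (intro extensional_eqI[OF derivationsD(6)[OF D]]) (auto simp: X.inner_def)
  then show "D \<in> X.inner ` carrier X" using u by blast
 }
qed

text \<open>Lift a basis of \<open>M\<close> over \<open>k\<close>; the section is not linear over \<open>B\<close> in general.\<close>

lemma linear_section:
 obtains \<sigma> where "\<And>m. m \<in> carrier M ==> \<sigma> m \<in> carrier P0" "\<And>m. m \<in> carrier M ==> free_cover B M (\<sigma> m) = m"
  "\<And>m m'. m \<in> carrier M ==> m' \<in> carrier M ==> \<sigma> (m \<oplus>\<^sub>M m') = \<sigma> m \<oplus>\<^sub>P0 \<sigma> m'"
  "\<And>c m. c \<in> carrier K ==> m \<in> carrier M ==> \<sigma> ((c \<odot> \<one>) \<odot>\<^sub>M m) = (c \<odot> \<one>) \<odot>\<^sub>P0 \<sigma> m"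
proof -
 note uM = vectorspace_underlying_space[OF B M]
 interpret UM: vectorspace K "space_of B M" by (rule uM)
 obtain Y c where Y: "finite Y" "Y \<subseteq> carrier (space_of B M)"
  and c: "\<And>x. x \<in> Y ==> c x \<in> module_hom K (space_of B M) (regular_module K)"
  and cv: "\<And>v. v \<in> carrier (space_of B M) ==>
    v = (\<Oplus>\<^bsub>space_of B M\<^esub>x\<in>Y. c x v \<odot>\<^bsub>space_of B M\<^esub> x)"
  by (rule coordinates_exist[OF uM fdM], rule that, assumption+)
 have YM: "Y \<subseteq> carrier M" using Y by simp
 have cl: "c x m \<in> carrier K" "c x (m \<oplus>\<^sub>M m') = c x m \<oplus>\<^sub>K c x m'"
  "k \<in> carrier K ==> c x ((k \<odot> \<one>) \<odot>\<^sub>M m) = k \<otimes>\<^sub>K c x m"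
  if "x \<in> Y" "m \<in> carrier M" "m' \<in> carrier M" for x m m' k
  using module_homD(1)[OF c[OF that(1)], of m] module_homD(2)[OF c[OF that(1)], of m m'] module_homD(3)[OF c[OF that(1)], of k m] that by simp_all
 have cl1: "c x m \<in> carrier K" if "x \<in> Y" "m \<in> carrier M" for x m using cl(1)[OF that that(2)] .
 have cl3: "k \<in> carrier K ==> c x ((k \<odot> \<one>) \<odot>\<^sub>M m) = k \<otimes>\<^sub>K c x m"
  if "x \<in> Y" "m \<in> carrier M" for x m k using cl(3)[OF that that(2)] .
 define \<sigma> where "\<sigma> m = (\<lambda>y\<in>carrier M. if y \<in> Y then c y m \<odot> \<one> else \<zero>)" for m
 have s: "{x \<in> carrier M. \<sigma> m x \<noteq> \<zero>} \<subseteq> Y" for m by (auto simp: \<sigma>_def)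
 have P: "\<sigma> m \<in> carrier P0" if "m \<in> carrier M" for m
  unfolding \<sigma>_def
 proof (rule free_moduleI)
  show "finite {x \<in> carrier M. (if x \<in> Y then c x m \<odot> \<one> else \<zero>) \<noteq> \<zero>}"
   by (rule finite_subset[OF _ Y(1)]) auto
 qed (use cl1 that in auto)
 have fs: "finsum (space_of B M) f Y = finsum M f Y" for f
  by (simp add: finsum_def finprod_def)
 have "free_cover B M (\<sigma> m) = m" if m: "m \<in> carrier M" for m
 proof -
  have "free_cover B M (\<sigma> m) = (\<Oplus>\<^sub>M x\<in>Y. \<sigma> m x \<odot>\<^sub>M x)"
   unfolding free_cover_hom(3)[OF M]
   by (rule supp_sum_additive(5)[OF M.R M.M _ _ P[OF m] Y(1) YM s]) (auto simp: M.smult_closed M.smult_l_distr)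
  also have "\<dots> = (\<Oplus>\<^sub>M x\<in>Y. (c x m \<odot> \<one>) \<odot>\<^sub>M x)"
   using YM cl1 m by (intro Mg.finsum_cong') (auto simp: \<sigma>_def M.smult_closed subset_iff)
  also have "\<dots> = m" using cv[of m] m by (simp add: fs)
  finally show ?thesis .
 qed
 moreover have "\<sigma> (m \<oplus>\<^sub>M m') = \<sigma> m \<oplus>\<^sub>P0 \<sigma> m'" if "m \<in> carrier M" "m' \<in> carrier M" for m m'
  using that cl1 cl(2) by (auto simp: \<sigma>_def free_module_simps fun_eq_iff BV.smult_l_distr)
 moreover have "\<sigma> ((k \<odot> \<one>) \<odot>\<^sub>M m) = (k \<odot> \<one>) \<odot>\<^sub>P0 \<sigma> m" if "k \<in> carrier K" "m \<in> carrier M" for k m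
  using that cl1 cl3 k_algebraD(3)[OF B] by (auto simp: \<sigma>_def free_module_simps fun_eq_iff BV.smult_assoc1)
 ultimately show thesis using that[of \<sigma>] P by blast
qed

text \<open>A linear section \<open>\<sigma>\<close> of the free cover of \<open>M\<close> gives elements \<open>\<sigma>(b m) - b \<sigma>(m)\<close> of the first syzygy. The
 cocycle is a homomorphism on this syzygy, because it vanishes on the relations, and its values on these elements
 are, up to sign, those of the derivation.\<close>

lemma ext_class_surjective:
 assumes \<phi>: "\<phi> \<in> cocycles"
 shows "\<exists>D\<in>derivations K B X. \<exists>c\<in>coboundaries. \<phi> = (\<lambda>p\<in>carrier P1. ext_class D p \<oplus>\<^sub>N c p)"
proof -
 have h: "\<phi> \<in> homs B P1 N" and van: "\<And>p. p \<in> carrier P2 ==> \<phi> (d2 p) = \<zero>\<^sub>N" using \<phi> by auto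
 note hp = homsD[OF h]
 have in0: "d1 p \<in> carrier P0" "free_cover B M (d1 p) = \<zero>\<^sub>M" if "p \<in> carrier P1" for p
  using d1(1)[OF that] O1_mem by auto
 have eqP1: "\<phi> p = \<phi> q" if pq: "p \<in> carrier P1" "q \<in> carrier P1" "d1 p = d1 q" for p q
 proof -
  define w where "w = p \<ominus>\<^sub>P1 q"
  have w: "w \<in> carrier P1" "p = w \<oplus>\<^sub>P1 q" unfolding w_def using pq by (auto simp: P1g.minus_eq P1g.a_assoc P1g.l_neg)
  have "d1 w \<oplus>\<^sub>P0 d1 q = d1 q" using d1(2)[OF w(1) pq(2)] w(2) pq(3) by (simp add: syzygy_simps(3))
  then have "d1 w = \<zero>\<^sub>P0" using in0(1)[OF w(1)] in0(1)[OF pq(2)] by simp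
  then have w2: "w \<in> carrier \<Omega>2" using O2_mem w(1) by blast
  have "single B (carrier \<Omega>2) w \<one> \<in> carrier P2" using single_closed[OF M.R w2 B.one_closed] .
  from van[OF this] have "\<phi> w = \<zero>\<^sub>N" using d2_single[OF w2 B.one_closed] O2.smult_one[OF w2] by simp
  then show ?thesis using hp(2)[OF w(1) pq(2)] w(2) hp(1)[OF pq(2)] by simp
 qed
 define \<theta> where "\<theta> \<omega> = \<phi> (single B (carrier \<Omega>1) \<omega> \<one>)" for \<omega>
 have \<theta>d: "\<theta> (d1 p) = \<phi> p" if p: "p \<in> carrier P1" for p
  unfolding \<theta>_def using d1_surj[OF d1(1)[OF p]] by (intro eqP1) (auto simp: p)
 have \<theta>c: "\<theta> \<omega> \<in> carrier N" if "\<omega> \<in> carrier \<Omega>1" for \<omega>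
  unfolding \<theta>_def using d1_surj[OF that] hp(1) by simp
 have \<theta>a: "\<theta> (v \<oplus>\<^sub>P0 w) = \<theta> v \<oplus>\<^sub>N \<theta> w" if vw: "v \<in> carrier \<Omega>1" "w \<in> carrier \<Omega>1" for v w
 proof -
  let ?e = "\<lambda>\<omega>. single B (carrier \<Omega>1) \<omega> \<one>"
  have "d1 (?e v \<oplus>\<^sub>P1 ?e w) = v \<oplus>\<^sub>P0 w" using d1(2)[of "?e v" "?e w"] d1_surj vw by (simp add: syzygy_simps(3))
  then have "\<theta> (v \<oplus>\<^sub>P0 w) = \<phi> (?e v \<oplus>\<^sub>P1 ?e w)" using \<theta>d[of "?e v \<oplus>\<^sub>P1 ?e w"] d1_surj vw by simp
  also have "\<dots> = \<theta> v \<oplus>\<^sub>N \<theta> w" unfolding \<theta>_def using hp(2) d1_surj vw by simp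
  finally show ?thesis .
 qed
 have \<theta>s: "\<theta> (b \<odot>\<^sub>P0 w) = b \<odot>\<^sub>N \<theta> w" if bw: "b \<in> carrier B" "w \<in> carrier \<Omega>1" for b w
 proof -
  let ?e = "single B (carrier \<Omega>1) w \<one>"
  have e: "?e \<in> carrier P1" "d1 ?e = w" using d1_surj bw by auto
  have "d1 (b \<odot>\<^sub>P1 ?e) = b \<odot>\<^sub>P0 w" using d1(3)[OF bw(1) e(1)] e(2) by (simp add: syzygy_simps(4))
  then have "\<theta> (b \<odot>\<^sub>P0 w) = \<phi> (b \<odot>\<^sub>P1 ?e)" using \<theta>d[OF P1.smult_closed[OF bw(1) e(1)]] by simp
  also have "\<dots> = b \<odot>\<^sub>N \<theta> w" unfolding \<theta>_def using hp(3) e bw by simp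
  finally show ?thesis .
 qed
 obtain \<sigma> where \<sigma>: "\<And>m. m \<in> carrier M ==> \<sigma> m \<in> carrier P0" "\<And>m. m \<in> carrier M ==> free_cover B M (\<sigma> m) = m"
  "\<And>m m'. m \<in> carrier M ==> m' \<in> carrier M ==> \<sigma> (m \<oplus>\<^sub>M m') = \<sigma> m \<oplus>\<^sub>P0 \<sigma> m'"
  "\<And>c m. c \<in> carrier K ==> m \<in> carrier M ==> \<sigma> ((c \<odot> \<one>) \<odot>\<^sub>M m) = (c \<odot> \<one>) \<odot>\<^sub>P0 \<sigma> m"
  using linear_section by blast
 have \<sigma>0: "\<sigma> \<zero>\<^sub>M = \<zero>\<^sub>P0" using \<sigma>(3)[of "\<zero>\<^sub>M" "\<zero>\<^sub>M"] \<sigma>(1)[of "\<zero>\<^sub>M"] by simp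
 have O_minus: "f \<ominus>\<^sub>P0 g \<in> carrier \<Omega>1" if "f \<in> carrier P0" "g \<in> carrier P0" "free_cover B M f = free_cover B M g" for f g
 proof -
  have "(f \<ominus>\<^sub>P0 g) \<oplus>\<^sub>P0 g = f" using that by (simp add: P0g.minus_eq P0g.a_assoc P0g.l_neg)
  then have "free_cover B M (f \<ominus>\<^sub>P0 g) \<oplus>\<^sub>M free_cover B M g = free_cover B M g" using cover(2)[of "f \<ominus>\<^sub>P0 g" g] that by simp
  then show ?thesis using that cover(1) O1_mem by simp
 qed
 \<comment> \<open>\<open>\<delta>\<close> measures the failure of the section to be a homomorphism of modules\<close>
 define \<delta> where "\<delta> b m = b \<odot>\<^sub>P0 \<sigma> m \<ominus>\<^sub>P0 \<sigma> (b \<odot>\<^sub>M m)" for b m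
 have \<delta>: "\<delta> b m \<in> carrier \<Omega>1" if "b \<in> carrier B" "m \<in> carrier M" for b m
  unfolding \<delta>_def by (rule O_minus) (use that in \<open>auto simp: P0.smult_closed \<sigma> M.smult_closed cover\<close>)
 have \<delta>0: "\<delta> b m \<in> carrier P0" if "b \<in> carrier B" "m \<in> carrier M" for b m using \<delta>[OF that] O1_mem by blast
 have pm: "(a \<oplus>\<^sub>P0 b) \<ominus>\<^sub>P0 (c \<oplus>\<^sub>P0 d) = (a \<ominus>\<^sub>P0 c) \<oplus>\<^sub>P0 (b \<ominus>\<^sub>P0 d)"
  if "a \<in> carrier P0" "b \<in> carrier P0" "c \<in> carrier P0" "d \<in> carrier P0" for a b c d
  using that by (simp add: P0g.minus_eq P0g.minus_add P0g.a_ac)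
 define D where "D = (\<lambda>b\<in>carrier B. \<lambda>m\<in>carrier M. \<theta> (\<delta> b m))"
 have Db: "D b \<in> carrier X" if b: "b \<in> carrier B" for b
  unfolding X_mem
 proof (rule homsI)
  show "D b m \<in> carrier (space_of B N)" if "m \<in> carrier (space_of B M)" for m
   using that b \<theta>c \<delta> by (simp add: D_def)
  show "D b (m \<oplus>\<^bsub>space_of B M\<^esub> m') = D b m \<oplus>\<^bsub>space_of B N\<^esub> D b m'"
   if mm: "m \<in> carrier (space_of B M)" "m' \<in> carrier (space_of B M)" for m m'
  proof -
   have "\<delta> b (m \<oplus>\<^sub>M m') = \<delta> b m \<oplus>\<^sub>P0 \<delta> b m'"
    using mm b by (simp add: \<delta>_def \<sigma>(1,3) M.smult_closed M.smult_r_distr P0.smult_r_distr P0.smult_closed pm)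
   then show ?thesis using mm b \<theta>a \<delta> by (simp add: D_def)
  qed
  show "D b (c \<odot>\<^bsub>space_of B M\<^esub> m) = c \<odot>\<^bsub>space_of B N\<^esub> D b m"
   if cm: "c \<in> carrier K" "m \<in> carrier (space_of B M)" for c m
  proof -
   let ?c = "c \<odot> \<one>"
   have m: "m \<in> carrier M" using cm by simp
   have "b \<odot>\<^sub>M (?c \<odot>\<^sub>M m) = ?c \<odot>\<^sub>M (b \<odot>\<^sub>M m)" "b \<odot>\<^sub>P0 (?c \<odot>\<^sub>P0 \<sigma> m) = ?c \<odot>\<^sub>P0 (b \<odot>\<^sub>P0 \<sigma> m)"
    using cm(1) m b central(1)[OF cm(1) b] \<sigma>(1)[OF m] M.smult_assoc[symmetric] P0.smult_assoc[symmetric] by simp_all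
   then have "\<delta> b (?c \<odot>\<^sub>M m) = ?c \<odot>\<^sub>P0 \<delta> b m"
    using cm(1) m b by (simp add: \<delta>_def \<sigma>(1,4) M.smult_closed P0.smult_minus P0.smult_closed)
   then show ?thesis using cm(1) m b \<theta>s[of ?c "\<delta> b m"] \<delta> M.smult_closed by (simp add: D_def)
  qed
 qed (use b in \<open>simp add: D_def\<close>)
 have "D \<in> homs K B X"
 proof (rule homsI)
  show "D b \<in> carrier X" if "b \<in> carrier B" for b using Db[OF that] .
  show "D (a \<oplus> b) = D a \<oplus>\<^sub>X D b" if ab: "a \<in> carrier B" "b \<in> carrier B" for a b
  proof -
   have "\<delta> (a \<oplus> b) m = \<delta> a m \<oplus>\<^sub>P0 \<delta> b m" if "m \<in> carrier M" for m
    using ab that by (simp add: \<delta>_def \<sigma>(1,3) M.smult_closed M.smult_l_distr P0.smult_l_distr P0.smult_closed pm)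
   then show ?thesis using ab \<theta>a \<delta> by (auto simp: D_def hom_bimodule_simps intro!: restrict_ext)
  qed
  show "D (c \<odot> b) = c \<odot>\<^sub>X D b" if cb: "c \<in> carrier K" "b \<in> carrier B" for c b
  proof -
   have "\<delta> (c \<odot> b) m = (c \<odot> \<one>) \<odot>\<^sub>P0 \<delta> b m" if "m \<in> carrier M" for m
    using cb that by (simp add: \<delta>_def central(2)[OF cb] \<sigma>(1,4) M.smult_closed M.smult_assoc P0.smult_assoc P0.smult_closed P0.smult_minus)
   then show ?thesis using cb \<theta>s \<delta> by (auto simp: D_def hom_bimodule_simps intro!: restrict_ext)
  qed
 qed (simp add: D_def)
 moreover have "D (a \<otimes> b) = lact X a (D b) \<oplus>\<^sub>X ract X b (D a)" if ab: "a \<in> carrier B" "b \<in> carrier B" for a b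
 proof -
  have "\<delta> (a \<otimes> b) m = a \<odot>\<^sub>P0 \<delta> b m \<oplus>\<^sub>P0 \<delta> a (b \<odot>\<^sub>M m)" if m: "m \<in> carrier M" for m
  proof -
   let ?u = "a \<odot>\<^sub>P0 (b \<odot>\<^sub>P0 \<sigma> m)" and ?v = "a \<odot>\<^sub>P0 \<sigma> (b \<odot>\<^sub>M m)" and ?w = "\<sigma> (a \<odot>\<^sub>M (b \<odot>\<^sub>M m))"
   have mem: "?u \<in> carrier P0" "?v \<in> carrier P0" "?w \<in> carrier P0" using ab m by (auto simp: P0.smult_closed \<sigma> M.smult_closed)
   have "?u \<ominus>\<^sub>P0 ?w = (?u \<ominus>\<^sub>P0 ?v) \<oplus>\<^sub>P0 (?v \<ominus>\<^sub>P0 ?w)"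
    using mem by (simp add: P0g.minus_eq P0g.a_assoc P0g.r_neg1 P0g.r_neg2)
   then show ?thesis using ab m by (simp add: \<delta>_def P0.smult_assoc M.smult_assoc P0.smult_minus P0.smult_closed \<sigma>(1) M.smult_closed)
  qed
  then show ?thesis using ab \<theta>a \<theta>s \<delta> O1.smult_closed M.smult_closed
   by (auto simp: D_def hom_bimodule_simps syzygy_simps(4)[symmetric] intro!: restrict_ext)
 qed
 ultimately have D: "D \<in> derivations K B X" by (auto simp: derivations_def)
 have De: "D b m = \<theta> (\<delta> b m)" if "b \<in> carrier B" "m \<in> carrier M" for b m using that by (simp add: D_def)
 note l = lift_der_facts[OF D]
 obtain \<tau> where \<tau>: "\<tau> \<in> module_hom B P0 P0"
  "\<And>x b. x \<in> carrier M ==> b \<in> carrier B ==> \<tau> (single B (carrier M) x b) = b \<odot>\<^sub>P0 \<sigma> x"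
  using free_lift_exists[OF P0.left_module_axioms, of "carrier M" \<sigma>] \<sigma>(1) by blast
 note t = module_homD[OF \<tau>(1)] and t0 = module_hom_zero[OF P0.left_module_axioms P0.left_module_axioms \<tau>(1)]
 have cov: "free_cover B M (\<tau> f) = free_cover B M f" if "f \<in> carrier P0" for f
  using M.R that
  by (induction rule: free_module_induct) (auto simp: t t0 cover \<tau>(2) cover_single \<sigma>)
 have tm: "\<tau> f \<ominus>\<^sub>P0 \<sigma> (free_cover B M f) \<in> carrier \<Omega>1" if "f \<in> carrier P0" for f
  by (rule O_minus) (use that in \<open>auto simp: t cover cov \<sigma>\<close>)
 have lift: "lift_der D f = \<theta> (\<tau> f \<ominus>\<^sub>P0 \<sigma> (free_cover B M f))" if "f \<in> carrier P0" for f
  using M.R that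
 proof (induction rule: free_module_induct)
  case zero
  have "\<theta> \<zero>\<^sub>P0 = \<zero>\<^sub>N" using \<theta>a[of "\<zero>\<^sub>P0" "\<zero>\<^sub>P0"] \<theta>c[of "\<zero>\<^sub>P0"] O1_mem cover_zero by simp
  then show ?case by (simp add: l(4) t0 cover_zero \<sigma>0 P0g.minus_eq P0g.r_neg)
 next
  case (add f g)
  have "\<tau> (f \<oplus>\<^sub>P0 g) \<ominus>\<^sub>P0 \<sigma> (free_cover B M (f \<oplus>\<^sub>P0 g)) =
   (\<tau> f \<ominus>\<^sub>P0 \<sigma> (free_cover B M f)) \<oplus>\<^sub>P0 (\<tau> g \<ominus>\<^sub>P0 \<sigma> (free_cover B M g))"
   using add(1,2) by (simp add: t cover \<sigma>(1,3) pm)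
  then show ?case using add by (simp add: l(2) \<theta>a tm)
 next
  case (single m b)
  then show ?case by (simp add: l(3) \<tau>(2) cover_single De \<delta>_def)
 qed
 have dm: "f \<ominus>\<^sub>P0 \<tau> f \<in> carrier \<Omega>1" if "f \<in> carrier P0" for f
  by (rule O_minus) (use that in \<open>auto simp: t cov\<close>)
 define \<psi> where "\<psi> = (\<lambda>f\<in>carrier P0. \<theta> (f \<ominus>\<^sub>P0 \<tau> f))"
 have "\<psi> \<in> homs B P0 N"
 proof (rule homsI)
  show "\<psi> f \<in> carrier N" if "f \<in> carrier P0" for f using that \<theta>c dm by (simp add: \<psi>_def)
  show "\<psi> (f \<oplus>\<^sub>P0 g) = \<psi> f \<oplus>\<^sub>N \<psi> g" if fg: "f \<in> carrier P0" "g \<in> carrier P0" for f g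
  proof -
   have "(f \<oplus>\<^sub>P0 g) \<ominus>\<^sub>P0 \<tau> (f \<oplus>\<^sub>P0 g) = (f \<ominus>\<^sub>P0 \<tau> f) \<oplus>\<^sub>P0 (g \<ominus>\<^sub>P0 \<tau> g)" using fg by (simp add: t pm)
   then show ?thesis using fg \<theta>a dm by (simp add: \<psi>_def)
  qed
  show "\<psi> (b \<odot>\<^sub>P0 f) = b \<odot>\<^sub>N \<psi> f" if bf: "b \<in> carrier B" "f \<in> carrier P0" for b f
  proof -
   have "(b \<odot>\<^sub>P0 f) \<ominus>\<^sub>P0 \<tau> (b \<odot>\<^sub>P0 f) = b \<odot>\<^sub>P0 (f \<ominus>\<^sub>P0 \<tau> f)" using bf by (simp add: t P0.smult_minus)
   then show ?thesis using bf \<theta>s dm by (simp add: \<psi>_def P0.smult_closed)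
  qed
 qed (simp add: \<psi>_def)
 then have cb: "(\<lambda>p\<in>carrier P1. \<psi> (d1 p)) \<in> coboundaries" by blast
 have "\<phi> p = lift_der D (d1 p) \<oplus>\<^sub>N \<psi> (d1 p)" if p: "p \<in> carrier P1" for p
 proof -
  let ?w = "d1 p"
  have w: "?w \<in> carrier P0" "free_cover B M ?w = \<zero>\<^sub>M" using in0 p by auto
  have tw: "\<tau> ?w \<in> carrier \<Omega>1" using tm[OF w(1)] w t(1)[OF w(1)] P0g.minus_equality[of "\<zero>\<^sub>P0" "\<zero>\<^sub>P0"] by (simp add: \<sigma>0 P0g.minus_eq)
  have lw: "lift_der D ?w = \<theta> (\<tau> ?w)" using lift[OF w(1)] w t(1)[OF w(1)] P0g.minus_equality[of "\<zero>\<^sub>P0" "\<zero>\<^sub>P0"] by (simp add: \<sigma>0 P0g.minus_eq)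
  have "\<phi> p = \<theta> ?w" using \<theta>d[OF p] by simp
  also have "?w = \<tau> ?w \<oplus>\<^sub>P0 (?w \<ominus>\<^sub>P0 \<tau> ?w)" using w(1) t(1)[OF w(1)] by (simp add: P0g.minus_eq P0g.a_ac P0g.r_neg1 P0g.r_neg)
  also have "\<theta> \<dots> = \<theta> (\<tau> ?w) \<oplus>\<^sub>N \<theta> (?w \<ominus>\<^sub>P0 \<tau> ?w)" using \<theta>a[OF tw dm[OF w(1)]] .
  finally show ?thesis using lw w(1) by (simp add: \<psi>_def)
 qed
 then have "\<phi> = (\<lambda>p\<in>carrier P1. ext_class D p \<oplus>\<^sub>N (\<lambda>p\<in>carrier P1. \<psi> (d1 p)) p)"
  by (intro extensional_eqI[OF hp(5)]) (auto simp: ext_class_def)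
 then show ?thesis using D cb by blast
qed

text \<open>Derivations map onto the cocycles modulo coboundaries with the inner derivations as kernel, and the
 invariants of \<open>Hom\<^sub>k(M, N)\<close> are the module homomorphisms.\<close>

theorem dim_Ext1_minus_dim_Hom:
 "int (kdim K (Ext1 B M N)) - int (kdim K (Hom_space B M N)) = derivation_excess K B X"
 "kfin_dim K X"
proof -
 note uM = vectorspace_underlying_space[OF B M] and uN = vectorspace_underlying_space[OF B N]
 interpret C: vectorspace K cocycle_space by (rule vectorspace_cocycles(2))
 note q = quot_module_vectorspace[OF vectorspace_cocycles(2) subspace_coboundaries]
  and qc = quot_module_coset[OF vectorspace_cocycles(2) subspace_coboundaries]
 have fdX: "kfin_dim K X"
  by (rule dim_cong(1)[OF X.vs subspace_homs(2)[OF uM uN] fin_dim_homs[OF uM fdM uN fdN]])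
    (simp_all add: hom_bimodule_simps)
 then show "kfin_dim K X" .
 let ?T = "\<lambda>D. coboundaries +>\<^bsub>cocycle_space\<^esub> ext_class D"
 have T: "?T \<in> module_hom K (der_space K B X) (quot_module cocycle_space coboundaries)"
  by (rule module_hom_comp[OF ext_class_linear q(2)])
 have ec: "ext_class D \<in> carrier cocycle_space" if "D \<in> carrier (der_space K B X)" for D
  using ext_class_cocycle[of D] that by simp
 have surj: "?T ` carrier (der_space K B X) = carrier (quot_module cocycle_space coboundaries)"
 proof
  show "?T ` carrier (der_space K B X) \<subseteq> carrier (quot_module cocycle_space coboundaries)"
   using module_homD(1)[OF T] by auto
  show "carrier (quot_module cocycle_space coboundaries) \<subseteq> ?T ` carrier (der_space K B X)"
  proof
   fix Z assume "Z \<in> carrier (quot_module cocycle_space coboundaries)"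
   then obtain \<phi> where \<phi>: "\<phi> \<in> carrier cocycle_space" "Z = coboundaries +>\<^bsub>cocycle_space\<^esub> \<phi>" using qc(1) by auto
   have \<phi>': "\<phi> \<in> cocycles" using \<phi>(1) by simp
   obtain D c where D: "D \<in> derivations K B X" and c: "c \<in> coboundaries"
    and eq: "\<phi> = (\<lambda>p\<in>carrier P1. ext_class D p \<oplus>\<^sub>N c p)"
    using ext_class_surjective[OF \<phi>'] by blast
   have D': "D \<in> carrier (der_space K B X)" using D by simp
   have sub: "coboundaries \<subseteq> carrier cocycle_space"
    using subspace_coboundaries unfolding VectorSpace.subspace_def LinearCombinations.submodule_def by blast
   then have cC: "c \<in> carrier cocycle_space" using c by blast
   have eq': "\<phi> = ext_class D \<oplus>\<^bsub>cocycle_space\<^esub> c" using eq by simp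
   have "\<phi> \<ominus>\<^bsub>cocycle_space\<^esub> ext_class D = c"
    unfolding eq' by (rule C.M.add_minus_cancel_left[OF ec[OF D'] cC])
   then have "coboundaries +>\<^bsub>cocycle_space\<^esub> \<phi> = ?T D" using qc(5)[OF \<phi>(1) ec[OF D']] c by simp
   then show "Z \<in> ?T ` carrier (der_space K B X)" using \<phi>(2) D' by blast
  qed
 qed
 have ker: "X.inner ` carrier X = {D \<in> carrier (der_space K B X). ?T D = \<zero>\<^bsub>quot_module cocycle_space coboundaries\<^esub>}"
  using q(3)[OF ec] ext_class_coboundary_iff X.inner_derivation by auto
 have d1: "kdim K (der_space K B X) = kdim K (Ext1 B M N) +
   kdim K ((der_space K B X)\<lparr>carrier := X.inner ` carrier X\<rparr>)"
  unfolding Ext1_eq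
  by (rule rank_nullity(2)[OF X.subspace_derivations(2) q(1) T X.fin_dim_der_space[OF fdB fdX] surj ker])
 have inv: "X.invariants = homs B M N"
 proof
  show "X.invariants \<subseteq> homs B M N"
  proof
   fix u assume u: "u \<in> X.invariants"
   then have uX: "u \<in> homs K (space_of B M) (space_of B N)" unfolding X.invariants_def X_mem by simp
   have "b \<odot>\<^sub>N u m = u (b \<odot>\<^sub>M m)" if "b \<in> carrier B" "m \<in> carrier M" for b m
   proof -
    have "lact X b u = ract X b u" using u that(1) unfolding X.invariants_def by blast
    from fun_cong[OF this, of m] show ?thesis using that by (simp add: hom_bimodule_simps)
   qed
   then show "u \<in> homs B M N" using homsD(1,2,5)[OF uX] by (intro homsI) simp_all
  qed
  show "homs B M N \<subseteq> X.invariants"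
  proof
   fix u assume u: "u \<in> homs B M N"
   note h = homsD[OF u]
   have "u \<in> carrier X" unfolding X_mem
    by (rule homsI) (simp_all add: h(1,2,5) h(3)[OF kB])
   moreover have "lact X b u = ract X b u" if "b \<in> carrier B" for b
    unfolding hom_bimodule_simps by (rule restrict_ext) (simp add: h(3)[OF that])
   ultimately show "u \<in> X.invariants" unfolding X.invariants_def by blast
  qed
 qed
 have "kdim K (Hom_space B M N) = kdim K (X\<lparr>carrier := X.invariants\<rparr>)"
  by (rule dim_cong(2)[OF _ X.inner_image(3) X.inner_image(4)[OF fdX]])
    (use subspace_module_homs(2)[OF B M N] in \<open>simp_all add: Hom_space_def inv hom_bimodule_simps\<close>)
 then show "int (kdim K (Ext1 B M N)) - int (kdim K (Hom_space B M N)) = derivation_excess K B X"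
  using d1 X.inner_image(2)[OF fdX] unfolding derivation_excess_def by simp
qed

end

section \<open>Sums over relative paths\<close>

lemma rel_paths_Cons:
 "c # \<gamma> \<in> rel_paths B e F s t \<longleftrightarrow>
   c \<in> F \<and> (\<gamma> = [] \<or> \<gamma> \<in> rel_paths B e F s t \<and> corner_nz B e (s (hd \<gamma>)) (t c))"
proof (cases \<gamma>)
 case Nil
 then show ?thesis by (auto simp: rel_paths_def)
next
 case (Cons d \<gamma>')
 have "(\<forall>i. Suc i < length (c # \<gamma>) \<longrightarrow> corner_nz B e (s ((c # \<gamma>) ! Suc i)) (t ((c # \<gamma>) ! i))) \<longleftrightarrow>
  corner_nz B e (s (hd \<gamma>)) (t c) \<and> (\<forall>i. Suc i < length \<gamma> \<longrightarrow> corner_nz B e (s (\<gamma> ! Suc i)) (t (\<gamma> ! i)))"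
  (is "?L \<longleftrightarrow> ?R")
 proof
  assume L: ?L
  have "corner_nz B e (s (hd \<gamma>)) (t c)" using spec[OF L, of 0] Cons by simp
  moreover have "corner_nz B e (s (\<gamma> ! Suc i)) (t (\<gamma> ! i))" if "Suc i < length \<gamma>" for i
   using spec[OF L, of "Suc i"] that by simp
  ultimately show ?R by blast
 next
  assume R: ?R
  show ?L
  proof (intro allI impI)
   fix i assume "Suc i < length (c # \<gamma>)"
   then show "corner_nz B e (s ((c # \<gamma>) ! Suc i)) (t ((c # \<gamma>) ! i))"
    using R Cons by (cases i) auto
  qed
 qed
 then show ?thesis using Cons unfolding rel_paths_def by auto
qed

lemma rel_dim_Cons:
 "rel_dim K B e s t [c] = 1"
 "\<gamma> \<noteq> [] ==> rel_dim K B e s t (c # \<gamma>) = corner_dim K B e (s (hd \<gamma>)) (t c) * rel_dim K B e s t \<gamma>"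
proof -
 show "rel_dim K B e s t [c] = 1" by (simp add: rel_dim_def)
 assume "\<gamma> \<noteq> []"
 then obtain d \<gamma>' where g: "\<gamma> = d # \<gamma>'" by (cases \<gamma>) auto
 show "rel_dim K B e s t (c # \<gamma>) = corner_dim K B e (s (hd \<gamma>)) (t c) * rel_dim K B e s t \<gamma>"
  unfolding rel_dim_def g using prod.lessThan_Suc_shift[of "\<lambda>i. corner_dim K B e (s ((c # d # \<gamma>') ! Suc i)) (t ((c # d # \<gamma>') ! i))" "length \<gamma>'"]
  by simp
qed

context
 fixes B :: "('k, 'b, 'z) module_scheme" and e :: "'v => 'b" and F :: "'f set" and s t :: "'f => 'v"
 assumes finF: "finite F" and no_cycles: "rel_cycles B e F s t = {}"
begin

text \<open>A repeated arrow would close up a relative cycle. So relative paths have bounded length,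
 and recursions along them terminate.\<close>

lemma rel_paths_distinct:
 assumes "\<gamma> \<in> rel_paths B e F s t"
 shows "distinct \<gamma>"
proof (rule ccontr)
 assume "\<not> distinct \<gamma>"
 then obtain i j where ij: "i < j" "j < length \<gamma>" "\<gamma> ! i = \<gamma> ! j"
  unfolding distinct_conv_nth by (metis linorder_neqE_nat)
 define \<delta> where "\<delta> = take (j - i) (drop i \<gamma>)"
 have len: "length \<delta> = j - i" using ij by (simp add: \<delta>_def)
 have nth: "\<delta> ! k = \<gamma> ! (i + k)" if "k < j - i" for k using that ij by (simp add: \<delta>_def)
 have nz: "corner_nz B e (s (\<gamma> ! Suc k)) (t (\<gamma> ! k))" if "Suc k < length \<gamma>" for k
  using assms that by (auto simp: rel_paths_def)
 have ne: "\<delta> \<noteq> []" using len ij by auto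
 have sub: "set \<delta> \<subseteq> F" using assms set_take_subset[of "j - i" "drop i \<gamma>"] set_drop_subset[of i \<gamma>]
  unfolding \<delta>_def rel_paths_def by blast
 have "\<delta> \<in> rel_paths B e F s t"
  unfolding rel_paths_def using ne sub nz nth len ij by auto
 moreover have "hd \<delta> = \<gamma> ! j" using ne nth[of 0] ij by (simp add: hd_conv_nth)
 moreover have "last \<delta> = \<gamma> ! (j - 1)" using ne nth[of "j - i - 1"] ij len by (simp add: last_conv_nth)
 moreover have "corner_nz B e (s (\<gamma> ! j)) (t (\<gamma> ! (j - 1)))" using nz[of "j - 1"] ij by simp
 ultimately have "\<delta> \<in> rel_cycles B e F s t"
  by (simp add: rel_cycles_def rel_source_def rel_target_def)
 then show False using no_cycles by simp
qed

lemma finite_rel_paths: "finite (rel_paths B e F s t)"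
proof (rule finite_subset)
 show "rel_paths B e F s t \<subseteq> {\<gamma>. set \<gamma> \<subseteq> F \<and> length \<gamma> \<le> card F}"
 proof
  fix \<gamma> assume g: "\<gamma> \<in> rel_paths B e F s t"
  have "set \<gamma> \<subseteq> F" using g by (simp add: rel_paths_def)
  moreover have "length \<gamma> = card (set \<gamma>)" using rel_paths_distinct[OF g] by (simp add: distinct_card)
  ultimately show "\<gamma> \<in> {\<gamma>. set \<gamma> \<subseteq> F \<and> length \<gamma> \<le> card F}" using card_mono[OF finF] by auto
 qed
 show "finite {\<gamma>. set \<gamma> \<subseteq> F \<and> length \<gamma> \<le> card F}" using finite_lists_length_le[OF finF] .
qed

text \<open>Relative paths have bounded length, so one can descend along the relation that \<open>a\<close> may follow \<open>c\<close>.\<close>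

lemma rel_path_induct [consumes 1, case_names step]:
 assumes "c \<in> F"
  and step: "\<And>c. c \<in> F ==> (\<And>a. a \<in> F ==> corner_nz B e (s a) (t c) ==> P a) ==> P c"
 shows "P c"
proof -
 define S where "S c = {\<gamma> \<in> rel_paths B e F s t. hd \<gamma> = c}" for c
 define m where "m c = Max (length ` S c)" for c
 have fin: "finite (length ` S c)" for c using finite_rel_paths by (simp add: S_def)
 have dec: "m a < m c" if ac: "a \<in> F" "c \<in> F" "corner_nz B e (s a) (t c)" for a c
 proof -
  have "[a] \<in> S a" using ac by (simp add: S_def rel_paths_Cons)
  then have "m a \<in> length ` S a" unfolding m_def using fin by (intro Max_in) auto
  then obtain \<gamma> where g: "\<gamma> \<in> S a" "length \<gamma> = m a" by auto
  have "c # \<gamma> \<in> S c" using g ac by (auto simp: S_def rel_paths_Cons)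
  then have "length (c # \<gamma>) \<in> length ` S c" by (rule imageI)
  then have "length (c # \<gamma>) \<le> m c" unfolding m_def by (rule Max_ge[OF fin])
  then show ?thesis using g by simp
 qed
 show ?thesis using assms(1)
 proof (induction "m c" arbitrary: c rule: less_induct)
  case less
  then show ?case using step[of c] dec by blast
 qed
qed

text \<open>The solution of the recursion that is satisfied by each invariant of \<open>A t(c)\<close>: unfolding it once prepends the
 arrow \<open>c\<close> to the relative paths that start with \<open>a\<close>.\<close>

lemma sum_rel_paths_from:
 fixes g :: "'f => int" and v :: "'v => int"
 assumes rec: "\<And>c. c \<in> F ==> g c = v (t c) + (\<Sum>a\<in>F. int (corner_dim K B e (s a) (t c)) * g a)"
  and zero: "\<And>x y. \<not> corner_nz B e y x ==> corner_dim K B e y x = 0"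
  and "c \<in> F"
 shows "g c = (\<Sum>\<gamma>\<in>{\<gamma> \<in> rel_paths B e F s t. hd \<gamma> = c}. int (rel_dim K B e s t \<gamma>) * v (rel_target t \<gamma>))"
 using \<open>c \<in> F\<close>
proof (induction rule: rel_path_induct)
 case (step c)
 let ?R = "rel_paths B e F s t"
 let ?w = "\<lambda>\<gamma>. int (rel_dim K B e s t \<gamma>) * v (rel_target t \<gamma>)"
 let ?d = "\<lambda>a. int (corner_dim K B e (s a) (t c))"
 let ?S = "\<lambda>a. {\<gamma> \<in> ?R. hd \<gamma> = a}"
 let ?G = "{a \<in> F. corner_nz B e (s a) (t c)}"
 have split: "?S c = insert [c] ((#) c ` (\<Union>a\<in>?G. ?S a))"
 proof (rule subset_antisym; rule subsetI)
  fix \<gamma> assume "\<gamma> \<in> ?S c"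
  then have g: "\<gamma> \<in> ?R" "hd \<gamma> = c" by auto
  then obtain \<gamma>' where g': "\<gamma> = c # \<gamma>'" by (cases \<gamma>) (auto simp: rel_paths_def)
  show "\<gamma> \<in> insert [c] ((#) c ` (\<Union>a\<in>?G. ?S a))"
  proof (cases "\<gamma>' = []")
   case False
   then have "\<gamma>' \<in> ?R" "corner_nz B e (s (hd \<gamma>')) (t c)" using g g' by (auto simp: rel_paths_Cons)
   moreover have "hd \<gamma>' \<in> F" using False \<open>\<gamma>' \<in> ?R\<close> by (auto simp: rel_paths_def)
   ultimately show ?thesis using g' by blast
  qed (use g' in simp)
 next
  fix \<gamma> assume "\<gamma> \<in> insert [c] ((#) c ` (\<Union>a\<in>?G. ?S a))"
  then show "\<gamma> \<in> ?S c" using step(1) by (auto simp: rel_paths_Cons)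
 qed
 have fin: "finite (\<Union>a\<in>?G. ?S a)" using finF finite_rel_paths by auto
 have "(\<Sum>\<gamma>\<in>?S c. ?w \<gamma>) = ?w [c] + (\<Sum>\<gamma>\<in>(#) c ` (\<Union>a\<in>?G. ?S a). ?w \<gamma>)"
  unfolding split using fin by (subst sum.insert) (auto simp: rel_paths_def)
 also have "(\<Sum>\<gamma>\<in>(#) c ` (\<Union>a\<in>?G. ?S a). ?w \<gamma>) = (\<Sum>\<gamma>\<in>(\<Union>a\<in>?G. ?S a). ?w (c # \<gamma>))"
  by (subst sum.reindex) (auto simp: inj_on_def)
 also have "\<dots> = (\<Sum>a\<in>?G. \<Sum>\<gamma>\<in>?S a. ?w (c # \<gamma>))"
  by (subst sum.UNION_disjoint) (use finF finite_rel_paths in auto)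
 also have "\<dots> = (\<Sum>a\<in>?G. ?d a * g a)"
 proof (rule sum.cong)
  fix a assume a: "a \<in> ?G"
  have "(\<Sum>\<gamma>\<in>?S a. ?w (c # \<gamma>)) = (\<Sum>\<gamma>\<in>?S a. ?d a * ?w \<gamma>)"
  proof (rule sum.cong)
   fix \<gamma> assume g: "\<gamma> \<in> ?S a"
   then have ne: "\<gamma> \<noteq> []" by (auto simp: rel_paths_def)
   then show "?w (c # \<gamma>) = ?d a * ?w \<gamma>" using g by (simp add: rel_dim_Cons(2) rel_target_def)
  qed simp
  then show "(\<Sum>\<gamma>\<in>?S a. ?w (c # \<gamma>)) = ?d a * g a" using step(2)[of a] a by (simp add: sum_distrib_left)
 qed simp
 also have "\<dots> = (\<Sum>a\<in>F. ?d a * g a)"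
  by (rule sum.mono_neutral_left) (use finF zero in auto)
 also have "?w [c] = v (t c)" by (simp add: rel_dim_Cons(1) rel_target_def)
 finally show ?case using rec[OF step(1)] by simp
qed

lemma sum_rel_paths_by_source_arrow:
 fixes w :: "'f list => int"
 shows "(\<Sum>\<gamma>\<in>rel_paths B e F s t. w \<gamma>) = (\<Sum>a\<in>F. \<Sum>\<gamma>\<in>{\<gamma> \<in> rel_paths B e F s t. hd \<gamma> = a}. w \<gamma>)"
proof -
 have hd: "hd \<gamma> \<in> F" if "\<gamma> \<in> rel_paths B e F s t" for \<gamma>
  using that hd_in_set[of \<gamma>] by (auto simp: rel_paths_def)
 have "rel_paths B e F s t = (\<Union>a\<in>F. {\<gamma> \<in> rel_paths B e F s t. hd \<gamma> = a})"
  using hd by blast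
 then have "(\<Sum>\<gamma>\<in>rel_paths B e F s t. w \<gamma>) = (\<Sum>\<gamma>\<in>(\<Union>a\<in>F. {\<gamma> \<in> rel_paths B e F s t. hd \<gamma> = a}). w \<gamma>)" by simp
 also have "\<dots> = (\<Sum>a\<in>F. \<Sum>\<gamma>\<in>{\<gamma> \<in> rel_paths B e F s t. hd \<gamma> = a}. w \<gamma>)"
  by (subst sum.UNION_disjoint) (use finF finite_rel_paths in auto)
 finally show ?thesis .
qed

text \<open>The extended relative paths of length 0 contribute the corners of \<open>B\<close> themselves. The conditions on nonzero corners can be dropped,
 since otherwise the dimension is 0.\<close>

lemma sum_parallel_pairs:
 assumes zero: "\<And>x y. \<not> corner_nz B e y x ==> corner_dim K B e y x = 0"
  and Q0: "s ` F \<subseteq> Q0" "t ` F \<subseteq> Q0"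
 shows "(\<Sum>(a, \<omega>)\<in>parallel_pairs Q0 B e F s t. int (ext_rel_dim K B e s t \<omega>)) =
  (\<Sum>a\<in>F. int (corner_dim K B e (t a) (s a)) +
    (\<Sum>\<gamma>\<in>rel_paths B e F s t. int (corner_dim K B e (t a) (rel_target t \<gamma>)) * int (rel_dim K B e s t \<gamma>) *
     int (corner_dim K B e (rel_source s \<gamma>) (s a))))"
proof -
 let ?R = "rel_paths B e F s t"
 let ?f = "\<lambda>(a, \<omega>). int (ext_rel_dim K B e s t \<omega>)"
 let ?P0 = "(\<lambda>a. (a, t a, [], s a)) ` F" and ?P1 = "(\<lambda>(a, \<gamma>). (a, t a, \<gamma>, s a)) ` (F \<times> ?R)"
 have ne: "[] \<notin> ?R" by (simp add: rel_paths_def)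
 have "(\<Sum>p\<in>parallel_pairs Q0 B e F s t. ?f p) = (\<Sum>p\<in>?P0 \<union> ?P1. ?f p)"
 proof (rule sum.mono_neutral_left)
  show "finite (?P0 \<union> ?P1)" using finF finite_rel_paths by auto
  show "parallel_pairs Q0 B e F s t \<subseteq> ?P0 \<union> ?P1"
   unfolding parallel_pairs_def ext_rel_paths_def by auto
  show "\<forall>p\<in>?P0 \<union> ?P1 - parallel_pairs Q0 B e F s t. ?f p = 0"
  proof
   fix p assume p: "p \<in> ?P0 \<union> ?P1 - parallel_pairs Q0 B e F s t"
   then consider a where "a \<in> F" "p = (a, t a, [], s a)" | a \<gamma> where "a \<in> F" "\<gamma> \<in> ?R" "p = (a, t a, \<gamma>, s a)" by auto
   then show "?f p = 0"
   proof cases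
    case 1
    then have "\<not> corner_nz B e (t a) (s a)" using p Q0 unfolding parallel_pairs_def ext_rel_paths_def by auto
    then show ?thesis using 1 zero by (simp add: ext_rel_dim_def)
   next
    case 2
    then have "\<not> corner_nz B e (t a) (rel_target t \<gamma>) \<or> \<not> corner_nz B e (rel_source s \<gamma>) (s a)"
     using p Q0 unfolding parallel_pairs_def ext_rel_paths_def by auto
    moreover have "\<gamma> \<noteq> []" using 2 ne by auto
    ultimately show ?thesis using 2 zero by (auto simp: ext_rel_dim_def)
   qed
  qed
 qed
 also have "\<dots> = (\<Sum>p\<in>?P0. ?f p) + (\<Sum>p\<in>?P1. ?f p)"
  by (rule sum.union_disjoint) (use finF finite_rel_paths ne in auto)
 also have "(\<Sum>p\<in>?P0. ?f p) = (\<Sum>a\<in>F. int (corner_dim K B e (t a) (s a)))"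
  by (subst sum.reindex) (auto simp: inj_on_def ext_rel_dim_def)
 also have "(\<Sum>p\<in>?P1. ?f p) = (\<Sum>(a, \<gamma>)\<in>F \<times> ?R. ?f (a, t a, \<gamma>, s a))"
  by (subst sum.reindex) (auto simp: inj_on_def intro!: sum.cong)
 also have "\<dots> = (\<Sum>a\<in>F. \<Sum>\<gamma>\<in>?R. ?f (a, t a, \<gamma>, s a))" by (simp add: sum.cartesian_product)
 also have "\<dots> = (\<Sum>a\<in>F. \<Sum>\<gamma>\<in>?R. int (corner_dim K B e (t a) (rel_target t \<gamma>)) * int (rel_dim K B e s t \<gamma>) *
     int (corner_dim K B e (rel_source s \<gamma>) (s a)))"
  using ne by (intro sum.cong refl) (auto simp: ext_rel_dim_def)
 finally show ?thesis by (simp add: sum.distrib)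
qed

end

section \<open>Projective and injective modules\<close>

definition pull_module :: "('c => 'b) => ('b, 'm, 'z) module_scheme => ('c, 'm) module" where
 "pull_module f M = ring.extend (ring.truncate M) (module.fields (\<lambda>c. smult M (f c)))"

lemma pull_module_simps [simp]:
 "carrier (pull_module f M) = carrier M" "add (pull_module f M) = add M"
 "zero (pull_module f M) = zero M" "smult (pull_module f M) = (\<lambda>c. smult M (f c))"
 by (simp_all add: pull_module_def ring.defs module.defs)

lemma abelian_group_cong:
 assumes "abelian_group V" "carrier W = carrier V" "zero W = zero V" "add W = add V"
 shows "abelian_group W"
proof -
 interpret V: abelian_group V by fact
 have neg: "\<exists>y\<in>carrier V. y \<oplus>\<^sub>V x = \<zero>\<^sub>V" if "x \<in> carrier V" for x
  using V.l_neg[OF that] V.a_inv_closed[OF that] by blast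
 show ?thesis by (rule abelian_groupI) (use neg in \<open>auto simp: assms V.a_ac\<close>)
qed

lemma left_module_pull_module:
 assumes M: "left_module B M" and C: "k_algebra K C" and f: "f \<in> algebra_homs K C B"
 shows "left_module C (pull_module f M)"
proof -
 interpret M: left_module B M by fact
 interpret Mg: abelian_group M by (rule M.M)
 note fD = algebra_homsD[OF f]
 have "abelian_group (pull_module f M)" by (rule abelian_group_cong[OF M.M]) simp_all
 then show ?thesis
  by (intro left_module.intro)
    (auto simp: k_algebraD(2)[OF C] fD M.smult_closed M.smult_l_distr M.smult_r_distr M.smult_assoc M.smult_one)
qed

lemma scalar_hom:
 assumes "k_algebra K C" "f \<in> algebra_homs K C B" "c \<in> carrier K"
 shows "f (c \<odot>\<^sub>C \<one>\<^sub>C) = c \<odot>\<^sub>B \<one>\<^sub>B"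
proof -
 interpret C: ring C using k_algebraD(2)[OF assms(1)] .
 show ?thesis using algebra_homsD(2)[OF assms(2)] algebra_homsD(5)[OF assms(2,3) C.one_closed] by simp
qed

lemma homs_pull_module:
 assumes C: "k_algebra K C" and f: "f \<in> algebra_homs K C B" and g: "g \<in> algebra_homs K C A"
 shows "homs K (space_of C (pull_module f M)) (space_of C (pull_module g N)) =
  homs K (space_of B M) (space_of A N)"
 using scalar_hom[OF C f] scalar_hom[OF C g] unfolding homs_def module_hom_def' by auto

lemma left_module_regular:
 assumes "ring R" shows "left_module R (regular_module R)"
proof -
 interpret R: ring R by fact
 have "abelian_group (regular_module R)" by (rule abelian_group_cong[OF R.abelian_group_axioms]) simp_all
 then show ?thesis by (intro left_module.intro) (auto simp: assms R.l_distr R.r_distr R.m_assoc)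
qed

lemma proj_module_simps [simp]:
 "carrier (proj_module B e x) = {b \<otimes>\<^sub>B e x | b. b \<in> carrier B}"
 "add (proj_module B e x) = add B" "zero (proj_module B e x) = zero B" "smult (proj_module B e x) = mult B"
 by (simp_all add: proj_module_def)

lemma left_module_proj_module:
 assumes "ring B" "e x \<in> carrier B"
 shows "left_module B (proj_module B e x)"
proof -
 interpret B: ring B by fact
 have z: "\<zero>\<^sub>B = \<zero>\<^sub>B \<otimes>\<^sub>B e x" using assms(2) by simp
 show ?thesis unfolding proj_module_def
 proof (rule left_module_subset[OF left_module_regular[OF assms(1)]])
  show "\<zero>\<^bsub>regular_module B\<^esub> \<in> {b \<otimes>\<^sub>B e x |b. b \<in> carrier B}" using z by auto
  fix y z assume "y \<in> {b \<otimes>\<^sub>B e x |b. b \<in> carrier B}" "z \<in> {b \<otimes>\<^sub>B e x |b. b \<in> carrier B}"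
  then obtain b c where "b \<in> carrier B" "c \<in> carrier B" "y = b \<otimes>\<^sub>B e x" "z = c \<otimes>\<^sub>B e x" by auto
  then show "y \<oplus>\<^bsub>regular_module B\<^esub> z \<in> {b \<otimes>\<^sub>B e x |b. b \<in> carrier B}"
   using assms(2) B.l_distr[of b c "e x"] by (auto intro!: exI[of _ "b \<oplus>\<^sub>B c"])
 next
  fix a y assume "a \<in> carrier B" "y \<in> {b \<otimes>\<^sub>B e x |b. b \<in> carrier B}"
  then obtain b where "a \<in> carrier B" "b \<in> carrier B" "y = b \<otimes>\<^sub>B e x" by auto
  then show "a \<odot>\<^bsub>regular_module B\<^esub> y \<in> {b \<otimes>\<^sub>B e x |b. b \<in> carrier B}"
   using assms(2) B.m_assoc[of a b "e x"] by (auto intro!: exI[of _ "a \<otimes>\<^sub>B b"])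
 qed (use assms(2) in auto)
qed

lemma image_subspace:
 assumes "vectorspace K V" "T \<in> module_hom K V V"
 shows "VectorSpace.subspace K (T ` carrier V) V" "vectorspace K (V\<lparr>carrier := T ` carrier V\<rparr>)"
proof -
 interpret V: vectorspace K V by fact
 interpret linear_map K V V T by (rule linear_mapI[OF assms(1,1,2)])
 show s: "VectorSpace.subspace K (T ` carrier V) V" using imT_is_subspace by (simp add: im_def)
 show "vectorspace K (V\<lparr>carrier := T ` carrier V\<rparr>)" using V.subspace_is_vs[OF s] .
qed

lemma mult_module_hom:
 assumes B: "k_algebra K B" and "p \<in> carrier B" "f \<in> carrier B"
 shows "(\<lambda>b. p \<otimes>\<^sub>B b \<otimes>\<^sub>B f) \<in> module_hom K B B"
proof -
 interpret B: ring B using k_algebraD(2)[OF B] .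
 interpret V: vectorspace K B using k_algebraD(1)[OF B] .
 show ?thesis by (rule module_homI) (use assms(2,3) in \<open>auto simp: B.l_distr B.r_distr k_algebraD(3,4)[OF B]\<close>)
qed

lemma corner_space:
 assumes B: "k_algebra K B" and "p \<in> carrier B" "f \<in> carrier B"
 defines "C \<equiv> {p \<otimes>\<^sub>B b \<otimes>\<^sub>B f | b. b \<in> carrier B}"
 shows "vectorspace K (B\<lparr>carrier := C\<rparr>)" "C \<subseteq> carrier B"
  "kfin_dim K B ==> kfin_dim K (B\<lparr>carrier := C\<rparr>)"
proof -
 interpret B: ring B using k_algebraD(2)[OF B] .
 have C: "C = (\<lambda>b. p \<otimes>\<^sub>B b \<otimes>\<^sub>B f) ` carrier B" by (auto simp: C_def)
 note i = image_subspace[OF k_algebraD(1)[OF B] mult_module_hom[OF assms(1-3)]]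
 show "vectorspace K (B\<lparr>carrier := C\<rparr>)" using i(2) C by simp
 show "C \<subseteq> carrier B" using assms(2,3) by (auto simp: C_def)
 show "kfin_dim K (B\<lparr>carrier := C\<rparr>)" if "kfin_dim K B"
  using fin_dim_subspace[OF k_algebraD(1)[OF B] that i(1)] C by simp
qed

lemma right_ideal_space:
 assumes B: "k_algebra K B" and "e x \<in> carrier B"
 shows "vectorspace K (right_ideal_space B e x)"
  "right_ideal_space B e x = B\<lparr>carrier := {e x \<otimes>\<^sub>B b \<otimes>\<^sub>B \<one>\<^sub>B | b. b \<in> carrier B}\<rparr>"
  "kfin_dim K B ==> kfin_dim K (right_ideal_space B e x)"
proof -
 interpret B: ring B using k_algebraD(2)[OF B] .
 show eq: "right_ideal_space B e x = B\<lparr>carrier := {e x \<otimes>\<^sub>B b \<otimes>\<^sub>B \<one>\<^sub>B | b. b \<in> carrier B}\<rparr>"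
 proof -
  have "{e x \<otimes>\<^sub>B b | b. b \<in> carrier B} = {e x \<otimes>\<^sub>B b \<otimes>\<^sub>B \<one>\<^sub>B | b. b \<in> carrier B}"
   using assms(2) by (metis (no_types, lifting) B.m_closed B.r_one)
  then show ?thesis by (simp add: right_ideal_space_def)
 qed
 show "vectorspace K (right_ideal_space B e x)" unfolding eq
  by (rule corner_space(1)[OF assms(1,2) B.one_closed])
 show "kfin_dim K B ==> kfin_dim K (right_ideal_space B e x)" unfolding eq
  by (rule corner_space(3)[OF assms(1,2) B.one_closed])
qed

lemma fin_dim_proj_module:
 assumes B: "k_algebra K B" "kfin_dim K B" and "e x \<in> carrier B"
 shows "kfin_dim K (space_of B (proj_module B e x))"
proof -
 interpret B: ring B using k_algebraD(2)[OF B(1)] .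
 note c = corner_space[OF B(1) B.one_closed assms(3)]
 have eq: "{\<one>\<^sub>B \<otimes>\<^sub>B b \<otimes>\<^sub>B e x | b. b \<in> carrier B} = {b \<otimes>\<^sub>B e x | b. b \<in> carrier B}"
  by (metis (no_types, lifting) B.l_one)
 note vs = vectorspace_underlying_space[OF B(1) left_module_proj_module[of B e x, OF B.ring_axioms assms(3)]]
 show ?thesis
  by (rule dim_cong(1)[OF vs c(1) c(3)[OF B(2)]])
    (use assms(3) eq in \<open>auto simp: k_algebraD(3)[OF B(1)]\<close>)
qed

lemma inj_module_simps:
 "carrier (inj_module K B e x) = homs K (right_ideal_space B e x) (regular_module K)"
 "add (inj_module K B e x) = (\<lambda>f g. \<lambda>v\<in>carrier (right_ideal_space B e x). f v \<oplus>\<^sub>K g v)"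
 "zero (inj_module K B e x) = (\<lambda>v\<in>carrier (right_ideal_space B e x). \<zero>\<^sub>K)"
 "smult (inj_module K B e x) = (\<lambda>b f. \<lambda>v\<in>carrier (right_ideal_space B e x). f (v \<otimes>\<^sub>B b))"
 by (simp_all add: inj_module_def Let_def ring.defs module.defs pointwise_def)

lemma right_ideal_simps:
 "carrier (right_ideal_space B e x) = {e x \<otimes>\<^sub>B b | b. b \<in> carrier B}"
 "add (right_ideal_space B e x) = add B" "zero (right_ideal_space B e x) = zero B"
 "smult (right_ideal_space B e x) = smult B"
 by (simp_all add: right_ideal_space_def)

lemma right_ideal_mult:
 assumes "ring B" "e x \<in> carrier B" "v \<in> carrier (right_ideal_space B e x)"
 shows "v \<in> carrier B" "b \<in> carrier B ==> v \<otimes>\<^sub>B b \<in> carrier (right_ideal_space B e x)"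
proof -
 interpret B: ring B by fact
 obtain c where c: "c \<in> carrier B" "v = e x \<otimes>\<^sub>B c" using assms(3) by (auto simp: right_ideal_simps)
 then show "v \<in> carrier B" using assms(2) by simp
 show "v \<otimes>\<^sub>B b \<in> carrier (right_ideal_space B e x)" if "b \<in> carrier B"
  using c that assms(2) by (auto simp: right_ideal_simps B.m_assoc intro!: exI[of _ "c \<otimes>\<^sub>B b"])
qed

lemma inj_module_facts:
 assumes B: "k_algebra K B" and ex: "e x \<in> carrier B"
 shows "left_module B (inj_module K B e x)"
  and "kfin_dim K B ==> kfin_dim K (space_of B (inj_module K B e x))"
  and "k \<in> carrier K ==> \<phi> \<in> carrier (inj_module K B e x) ==>
    k \<odot>\<^bsub>space_of B (inj_module K B e x)\<^esub> \<phi> = (\<lambda>v\<in>carrier (right_ideal_space B e x). k \<otimes>\<^sub>K \<phi> v)"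
proof -
 interpret B: ring B using k_algebraD(2)[OF B] .
 interpret V: vectorspace K B using k_algebraD(1)[OF B] .
 let ?S = "right_ideal_space B e x" and ?I = "inj_module K B e x"
 note S = right_ideal_space[of K B e x, OF B ex]
 interpret S: vectorspace K ?S by (rule S(1))
 note rm = right_ideal_mult[of B e x, OF B.ring_axioms ex]
 have reg: "vectorspace K (regular_module K)" by (rule vectorspace_regular_module) unfold_locales
 have hvs: "vectorspace K ((pointwise (carrier ?S) (regular_module K))\<lparr>carrier := homs K ?S (regular_module K)\<rparr>)"
  by (rule subspace_homs(2)[OF S(1) reg])
 interpret H: vectorspace K "(pointwise (carrier ?S) (regular_module K))\<lparr>carrier := homs K ?S (regular_module K)\<rparr>" by (rule hvs)
 have ag: "abelian_group ?I"
  by (rule abelian_group_cong[OF H.M.abelian_group_axioms]) (simp_all add: inj_module_simps)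
 have h: "f (v \<oplus>\<^sub>B w) = f v \<oplus>\<^sub>K f w" "f v \<in> carrier K" "k \<in> carrier K ==> f (k \<odot>\<^sub>B v) = k \<otimes>\<^sub>K f v"
  if "f \<in> carrier ?I" "v \<in> carrier ?S" "w \<in> carrier ?S" for f v w k
  using homsD(1-3)[of f K ?S "regular_module K"] that by (auto simp: inj_module_simps right_ideal_simps(2,4))
 have h2: "f v \<in> carrier K" "k \<in> carrier K ==> f (k \<odot>\<^sub>B v) = k \<otimes>\<^sub>K f v" if "f \<in> carrier ?I" "v \<in> carrier ?S" for f v k
  using h[OF that that(2)] by auto
 have Sadd: "v \<oplus>\<^sub>B w \<in> carrier ?S" if "v \<in> carrier ?S" "w \<in> carrier ?S" for v w
  using S.M.a_closed[OF that] by (simp add: right_ideal_simps(2))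
 have Ssm: "k \<odot>\<^sub>B v \<in> carrier ?S" if "k \<in> carrier K" "v \<in> carrier ?S" for k v
  using S.smult_closed[OF that] by (simp add: right_ideal_simps(4))
 have sc: "b \<odot>\<^bsub>?I\<^esub> f \<in> carrier ?I" if bf: "b \<in> carrier B" "f \<in> carrier ?I" for b f
 proof -
  have "b \<odot>\<^bsub>?I\<^esub> f \<in> homs K ?S (regular_module K)"
  proof (rule homsI)
   show "(b \<odot>\<^bsub>?I\<^esub> f) v \<in> carrier (regular_module K)" if "v \<in> carrier ?S" for v
    using that bf h2 rm by (simp add: inj_module_simps(4))
   show "(b \<odot>\<^bsub>?I\<^esub> f) (v \<oplus>\<^bsub>?S\<^esub> w) = (b \<odot>\<^bsub>?I\<^esub> f) v \<oplus>\<^bsub>regular_module K\<^esub> (b \<odot>\<^bsub>?I\<^esub> f) w" if "v \<in> carrier ?S" "w \<in> carrier ?S" for v w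
    using that bf h(1)[OF bf(2) rm(2)[OF that(1) bf(1)] rm(2)[OF that(2) bf(1)]] Sadd[OF that] rm(1)
    by (simp add: inj_module_simps(4) right_ideal_simps(2) B.l_distr)
   show "(b \<odot>\<^bsub>?I\<^esub> f) (k \<odot>\<^bsub>?S\<^esub> v) = k \<odot>\<^bsub>regular_module K\<^esub> (b \<odot>\<^bsub>?I\<^esub> f) v" if "k \<in> carrier K" "v \<in> carrier ?S" for k v
    using that bf h2(2)[OF bf(2) rm(2)[OF that(2) bf(1)] that(1)] Ssm[OF that] rm(1)
    by (simp add: inj_module_simps(4) right_ideal_simps(4) k_algebraD(3)[OF B])
   show "b \<odot>\<^bsub>?I\<^esub> f \<in> extensional (carrier ?S)" by (simp add: inj_module_simps(4))
  qed
  then show ?thesis by (simp add: inj_module_simps(1))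
 qed
 have one: "\<one>\<^sub>B \<odot>\<^bsub>?I\<^esub> f = f" if f: "f \<in> carrier ?I" for f
 proof (rule extensional_eqI)
  show "f \<in> extensional (carrier ?S)" using homsD(5)[of f K ?S] f by (simp add: inj_module_simps(1))
 qed (use rm(1) in \<open>auto simp: inj_module_simps(4)\<close>)
 show lm: "left_module B ?I"
 proof (rule left_module.intro[OF B.ring_axioms ag sc _ _ _ one])
  show "(a \<oplus>\<^sub>B b) \<odot>\<^bsub>?I\<^esub> f = a \<odot>\<^bsub>?I\<^esub> f \<oplus>\<^bsub>?I\<^esub> b \<odot>\<^bsub>?I\<^esub> f" if "a \<in> carrier B" "b \<in> carrier B" "f \<in> carrier ?I" for a b f
   unfolding inj_module_simps(2,4)
   by (rule restrict_ext) (use that h(1)[OF that(3)] rm in \<open>simp add: B.r_distr\<close>)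
  show "a \<odot>\<^bsub>?I\<^esub> (f \<oplus>\<^bsub>?I\<^esub> g) = a \<odot>\<^bsub>?I\<^esub> f \<oplus>\<^bsub>?I\<^esub> a \<odot>\<^bsub>?I\<^esub> g" if "a \<in> carrier B" "f \<in> carrier ?I" "g \<in> carrier ?I" for a f g
   unfolding inj_module_simps(2,4)
   by (rule restrict_ext) (use that rm in simp)
  show "(a \<otimes>\<^sub>B b) \<odot>\<^bsub>?I\<^esub> f = a \<odot>\<^bsub>?I\<^esub> (b \<odot>\<^bsub>?I\<^esub> f)" if "a \<in> carrier B" "b \<in> carrier B" "f \<in> carrier ?I" for a b f
   unfolding inj_module_simps(4)
   by (rule restrict_ext) (use that rm in \<open>simp add: B.m_assoc\<close>)
 qed
 show sm: "k \<odot>\<^bsub>space_of B ?I\<^esub> \<phi> = (\<lambda>v\<in>carrier ?S. k \<otimes>\<^sub>K \<phi> v)" if "k \<in> carrier K" "\<phi> \<in> carrier ?I" for k \<phi>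
  unfolding underlying_space_simps inj_module_simps(4)
 proof (rule restrict_ext)
  fix v assume v: "v \<in> carrier ?S"
  have "v \<otimes>\<^sub>B (k \<odot>\<^sub>B \<one>\<^sub>B) = k \<odot>\<^sub>B v" using k_algebraD(4)[OF B that(1) rm(1)[OF v] B.one_closed] rm(1)[OF v] by simp
  then show "\<phi> (v \<otimes>\<^sub>B (k \<odot>\<^sub>B \<one>\<^sub>B)) = k \<otimes>\<^sub>K \<phi> v" using h2(2)[OF that(2) v that(1)] by simp
 qed
 show "kfin_dim K (space_of B ?I)" if fd: "kfin_dim K B"
 proof (rule dim_cong(1)[OF vectorspace_underlying_space[OF B lm] hvs])
  have reg1: "kfin_dim K (regular_module K)"
  proof -
   have fld: "field K" by unfold_locales
   have idm: "(\<lambda>x. x) \<in> module_hom K (regular_module K) (regular_module K)" by (rule module_homI) auto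
   show ?thesis
    by (rule dim_eq_card_coordinates(1)[OF reg, of "{()}" "\<lambda>_ x. x"]) (use idm in auto)
  qed
  show "kfin_dim K ((pointwise (carrier ?S) (regular_module K))\<lparr>carrier := homs K ?S (regular_module K)\<rparr>)"
   by (rule fin_dim_homs[OF S(1) S(3)[OF fd] reg reg1])
  show "k \<odot>\<^bsub>space_of B ?I\<^esub> \<phi> = k \<odot>\<^bsub>(pointwise (carrier ?S) (regular_module K))\<lparr>carrier := homs K ?S (regular_module K)\<rparr>\<^esub> \<phi>"
   if "k \<in> carrier K" "\<phi> \<in> carrier (space_of B ?I)" for k \<phi>
   using sm[of k \<phi>] that by simp
 qed (simp_all add: inj_module_simps)
qed

text \<open>Coordinates on \<open>p B f\<close>, extended to linear forms on \<open>p B\<close> along right multiplication by \<open>f\<close>; they are elements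
 of the injective module, which is the dual of \<open>p B\<close>.\<close>

lemma right_dual_basis:
 assumes B: "k_algebra K B" and fd: "kfin_dim K B" and ex: "e x \<in> carrier B" and f: "f \<in> carrier B" "f \<otimes>\<^sub>B f = f"
 obtains Y \<psi> where "finite Y" "card Y = kdim K (B\<lparr>carrier := {e x \<otimes>\<^sub>B b \<otimes>\<^sub>B f | b. b \<in> carrier B}\<rparr>)"
  "Y \<subseteq> {e x \<otimes>\<^sub>B b \<otimes>\<^sub>B f | b. b \<in> carrier B}"
  "\<And>j. j \<in> Y ==> \<psi> j \<in> carrier (inj_module K B e x)"
  "\<And>i j. i \<in> Y ==> j \<in> Y ==> \<psi> i j = (if i = j then \<one>\<^sub>K else \<zero>\<^sub>K)"
  "\<And>v. v \<in> carrier (right_ideal_space B e x) ==> v \<otimes>\<^sub>B f = (\<Oplus>\<^sub>B j\<in>Y. \<psi> j v \<odot>\<^sub>B j)"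
proof -
 interpret B: ring B using k_algebraD(2)[OF B] .
 interpret V: vectorspace K B using k_algebraD(1)[OF B] .
 let ?C = "{e x \<otimes>\<^sub>B b \<otimes>\<^sub>B f | b. b \<in> carrier B}" and ?S = "right_ideal_space B e x"
 let ?CS = "B\<lparr>carrier := ?C\<rparr>"
 note c = corner_space[OF B ex f(1)]
 interpret C: vectorspace K ?CS by (rule c(1))
 obtain Y \<eta> where Y: "finite Y" "Y \<subseteq> carrier ?CS" "card Y = kdim K ?CS"
  and \<eta>: "\<And>j. j \<in> Y ==> \<eta> j \<in> module_hom K ?CS (regular_module K)"
   "\<And>i j. i \<in> Y ==> j \<in> Y ==> \<eta> i j = (if i = j then \<one>\<^sub>K else \<zero>\<^sub>K)"
   "\<And>v. v \<in> carrier ?CS ==> v = (\<Oplus>\<^bsub>?CS\<^esub>j\<in>Y. \<eta> j v \<odot>\<^bsub>?CS\<^esub> j)"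
  by (rule coordinates_exist[OF c(1) c(3)[OF fd]], rule that, assumption+)
 have memS: "v \<otimes>\<^sub>B f \<in> ?C" "v \<in> carrier B" if "v \<in> carrier ?S" for v
  using that ex f by (auto simp: right_ideal_simps)
 have CinS: "v \<in> carrier ?S" "v \<otimes>\<^sub>B f = v" if v: "v \<in> ?C" for v
 proof -
  obtain b where b: "b \<in> carrier B" "v = e x \<otimes>\<^sub>B b \<otimes>\<^sub>B f" using v by blast
  then have "v = e x \<otimes>\<^sub>B (b \<otimes>\<^sub>B f)" using ex f by (simp add: B.m_assoc)
  then show "v \<in> carrier ?S" using b f by (auto simp: right_ideal_simps)
  show "v \<otimes>\<^sub>B f = v" using b ex f by (simp add: B.m_assoc)
 qed
 define \<psi> where "\<psi> j = (\<lambda>v\<in>carrier ?S. \<eta> j (v \<otimes>\<^sub>B f))" for j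
 show thesis
 proof (rule that[of Y \<psi>])
  show "Y \<subseteq> ?C" using Y(2) by simp
  show "\<psi> j \<in> carrier (inj_module K B e x)" if j: "j \<in> Y" for j
  proof -
   have m: "(\<lambda>v. v \<otimes>\<^sub>B f) \<in> module_hom K ?S ?CS"
    by (rule module_homI) (use memS f k_algebraD(3)[OF B] in \<open>auto simp: right_ideal_simps(2,4) B.l_distr\<close>)
   interpret S: vectorspace K ?S by (rule right_ideal_space(1)[of K B e x, OF B ex])
   show ?thesis unfolding inj_module_simps(1) \<psi>_def
    by (rule homs_restrictI[OF module_hom_comp[OF m \<eta>(1)[OF j]]]) auto
  qed
  show "\<psi> i j = (if i = j then \<one>\<^sub>K else \<zero>\<^sub>K)" if "i \<in> Y" "j \<in> Y" for i j
  proof -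
   have jC: "j \<in> ?C" using that Y(2) by auto
   show ?thesis using \<eta>(2)[OF that] CinS[OF jC] by (simp add: \<psi>_def)
  qed
  show "v \<otimes>\<^sub>B f = (\<Oplus>\<^sub>B j\<in>Y. \<psi> j v \<odot>\<^sub>B j)" if v: "v \<in> carrier ?S" for v
  proof -
   have vC: "v \<otimes>\<^sub>B f \<in> carrier ?CS" using memS[OF v] by simp
   have incl: "(\<lambda>v. v) \<in> module_hom K ?CS B" by (rule module_homI) (use c(2) in auto)
   have \<eta>K: "\<eta> j (v \<otimes>\<^sub>B f) \<in> carrier K" if "j \<in> Y" for j using module_homD(1)[OF \<eta>(1)[OF that] vC] by simp
   have g: "(\<lambda>j. \<eta> j (v \<otimes>\<^sub>B f) \<odot>\<^bsub>?CS\<^esub> j) \<in> Y \<rightarrow> carrier ?CS"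
    using \<eta>K Y(2) C.smult_closed by blast
   have "v \<otimes>\<^sub>B f = (\<Oplus>\<^bsub>?CS\<^esub>j\<in>Y. \<eta> j (v \<otimes>\<^sub>B f) \<odot>\<^bsub>?CS\<^esub> j)" by (rule \<eta>(3)[OF vC])
   also have "\<dots> = (\<Oplus>\<^sub>B j\<in>Y. \<eta> j (v \<otimes>\<^sub>B f) \<odot>\<^bsub>?CS\<^esub> j)"
    using linear_finsum[OF c(1) k_algebraD(1)[OF B] incl Y(1) g] .
   finally show ?thesis using v by (simp add: \<psi>_def)
  qed
 qed (use Y in auto)
qed

lemma hom_bimodule_map:
 assumes B: "k_algebra K B" and M: "left_module B M" and S: "S \<in> module_hom B L N"
 shows "(\<lambda>h. \<lambda>m\<in>carrier M. S (h m)) \<in> bimodule_homs K B (hom_bimodule K B M L) (hom_bimodule K B M N)"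
proof -
 interpret M: left_module B M by fact
 interpret Mg: abelian_group M by (rule M.M)
 interpret B: ring B by (rule M.R)
 interpret BV: vectorspace K B using k_algebraD(1)[OF B] .
 have kB: "k \<odot>\<^sub>B \<one>\<^sub>B \<in> carrier B" if "k \<in> carrier K" for k using that by simp
 note s = module_homD[OF S]
 have hc: "h m \<in> carrier L" if "h \<in> homs K (space_of B M) (space_of B L)" "m \<in> carrier M" for h m
  using homsD(1)[OF that(1)] that(2) by simp
 have lin: "(\<lambda>h. \<lambda>m\<in>carrier M. S (h m)) \<in> module_hom K (hom_bimodule K B M L) (hom_bimodule K B M N)"
 proof (rule module_homI)
  fix h assume "h \<in> carrier (hom_bimodule K B M L)"
  then have h: "h \<in> homs K (space_of B M) (space_of B L)" by (simp add: hom_bimodule_simps)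
  note hD = homsD(1-3)[OF h, simplified]
  show "(\<lambda>m\<in>carrier M. S (h m)) \<in> carrier (hom_bimodule K B M N)"
   unfolding hom_bimodule_simps
   by (rule homsI) (simp_all add: hD s(1,2) s(3)[OF kB] M.smult_closed kB)
 qed (auto simp: hom_bimodule_simps s(2) s(3)[OF kB] hc intro!: restrict_ext)
 show ?thesis unfolding bimodule_homs_def
  using lin by (auto simp: hom_bimodule_simps s(3) hc M.smult_closed intro!: restrict_ext)
qed

text \<open>The functor \<open>Hom\<^sub>k(M, _)\<close> preserves jointly bijective families when \<open>M\<close> is finite-dimensional.\<close>

lemma hom_bimodule_excess_additive:
 fixes W :: "'i => ('b, 'w) module"
 assumes B: "k_algebra K B" "kfin_dim K B"
  and M: "left_module B M" "kfin_dim K (space_of B M)"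
  and L: "left_module B L" and W0: "left_module B W0" "kfin_dim K (space_of B W0)"
  and J: "finite J" and W: "\<And>i. i \<in> J ==> left_module B (W i)" "\<And>i. i \<in> J ==> kfin_dim K (space_of B (W i))"
  and T0: "T0 \<in> module_hom B L W0" and T: "\<And>i. i \<in> J ==> T i \<in> module_hom B L (W i)"
  and ex: "\<And>w0 w. w0 \<in> carrier W0 ==> (\<And>i. i \<in> J ==> w i \<in> carrier (W i)) ==>
    \<exists>v\<in>carrier L. T0 v = w0 \<and> (\<forall>i\<in>J. T i v = w i)"
  and inj: "\<And>v. v \<in> carrier L ==> T0 v = \<zero>\<^sub>W0 ==> (\<And>i. i \<in> J ==> T i v = \<zero>\<^bsub>W i\<^esub>) ==> v = \<zero>\<^sub>L"
 shows "derivation_excess K B (hom_bimodule K B M L) =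
   derivation_excess K B (hom_bimodule K B M W0) + (\<Sum>i\<in>J. derivation_excess K B (hom_bimodule K B M (W i)))"
proof (rule derivation_excess_additive(2)[OF B, where ?T0.0 = "\<lambda>h. \<lambda>m\<in>carrier M. T0 (h m)" and T = "\<lambda>i h. \<lambda>m\<in>carrier M. T i (h m)"])
 interpret M: left_module B M by fact
 interpret L: left_module B L by fact
 interpret Lg: abelian_group L by (rule L.M)
 interpret Mg: abelian_group M by (rule M.M)
 interpret B: ring B by (rule M.R)
 interpret BV: vectorspace K B using k_algebraD(1)[OF B(1)] .
 have kB: "k \<odot>\<^sub>B \<one>\<^sub>B \<in> carrier B" if "k \<in> carrier K" for k using that by simp
 show "bimodule K B (hom_bimodule K B M L)" by (rule bimodule_hom_bimodule[OF B(1) M(1) L])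
 show "bimodule K B (hom_bimodule K B M W0)" by (rule bimodule_hom_bimodule[OF B(1) M(1) W0(1)])
 show "kfin_dim K (hom_bimodule K B M W0)"
  by (rule two_modules.dim_Ext1_minus_dim_Hom(2)[OF two_modules.intro[OF B M(1) W0(1) M(2) W0(2)]])
 show "finite J" by (rule J)
 show "bimodule K B (hom_bimodule K B M (W i))" if "i \<in> J" for i by (rule bimodule_hom_bimodule[OF B(1) M(1) W(1)[OF that]])
 show "kfin_dim K (hom_bimodule K B M (W i))" if "i \<in> J" for i
  by (rule two_modules.dim_Ext1_minus_dim_Hom(2)[OF two_modules.intro[OF B M(1) W(1)[OF that] M(2) W(2)[OF that]]])
 show "(\<lambda>h. \<lambda>m\<in>carrier M. T0 (h m)) \<in> bimodule_homs K B (hom_bimodule K B M L) (hom_bimodule K B M W0)"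
  by (rule hom_bimodule_map[OF B(1) M(1) T0])
 show "(\<lambda>h. \<lambda>m\<in>carrier M. T i (h m)) \<in> bimodule_homs K B (hom_bimodule K B M L) (hom_bimodule K B M (W i))" if "i \<in> J" for i
  by (rule hom_bimodule_map[OF B(1) M(1) T[OF that]])
 have hc: "h m \<in> carrier L" if "h \<in> homs K (space_of B M) (space_of B L)" "m \<in> carrier M" for h m
  using homsD(1)[OF that(1)] that(2) by simp
 show "h = \<zero>\<^bsub>hom_bimodule K B M L\<^esub>" if h: "h \<in> carrier (hom_bimodule K B M L)"
  "(\<lambda>m\<in>carrier M. T0 (h m)) = \<zero>\<^bsub>hom_bimodule K B M W0\<^esub>"
  "\<And>i. i \<in> J ==> (\<lambda>m\<in>carrier M. T i (h m)) = \<zero>\<^bsub>hom_bimodule K B M (W i)\<^esub>" for h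
 proof (rule extensional_eqI)
  have hh: "h \<in> homs K (space_of B M) (space_of B L)" using h(1) by (simp add: hom_bimodule_simps)
  show "h \<in> extensional (carrier M)" using homsD(5)[OF hh] by simp
  show "\<zero>\<^bsub>hom_bimodule K B M L\<^esub> \<in> extensional (carrier M)" by (simp add: hom_bimodule_simps)
  fix m assume m: "m \<in> carrier M"
  have "T0 (h m) = \<zero>\<^sub>W0" using fun_cong[OF h(2), of m] m by (simp add: hom_bimodule_simps)
  moreover have "T i (h m) = \<zero>\<^bsub>W i\<^esub>" if "i \<in> J" for i using fun_cong[OF h(3)[OF that], of m] m by (simp add: hom_bimodule_simps)
  ultimately have "h m = \<zero>\<^sub>L" by (rule inj[OF hc[OF hh m]])
  then show "h m = \<zero>\<^bsub>hom_bimodule K B M L\<^esub> m" using m by (simp add: hom_bimodule_simps)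
 qed
 have cancel: "S w = \<zero>\<^sub>N" if N: "left_module B N" and S: "S \<in> module_hom B L N" and wv: "w \<in> carrier L" "v \<in> carrier L"
   and eq: "S (w \<oplus>\<^sub>L v) = S v" for S w v and N :: "('b, 'w) module"
 proof -
  interpret Ng: abelian_group N by (rule left_module.M[OF N])
  show ?thesis using module_homD(2)[OF S wv] module_homD(1)[OF S wv(1)] module_homD(1)[OF S wv(2)] eq by simp
 qed
 have uniq: "u = v" if uv: "u \<in> carrier L" "v \<in> carrier L" "T0 u = T0 v" "\<And>i. i \<in> J ==> T i u = T i v" for u v
 proof -
  define w where "w = u \<ominus>\<^sub>L v"
  have w: "w \<in> carrier L" "w \<oplus>\<^sub>L v = u" using uv by (auto simp: w_def Lg.minus_eq Lg.a_assoc Lg.l_neg)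
  interpret W0g: abelian_group W0 by (rule left_module.M[OF W0(1)])
  have "T0 w = \<zero>\<^sub>W0"
   using module_homD(2)[OF T0 w(1) uv(2)] module_homD(1)[OF T0 w(1)] module_homD(1)[OF T0 uv(2)] w(2) uv(3) by simp
  moreover have "T i w = \<zero>\<^bsub>W i\<^esub>" if "i \<in> J" for i
   by (rule cancel[OF W(1)[OF that] T[OF that] w(1) uv(2)]) (use w uv(4)[OF that] in simp)
  ultimately have "w = \<zero>\<^sub>L" by (rule inj[OF w(1)])
  then show ?thesis using w uv by simp
 qed
 show "\<exists>h\<in>carrier (hom_bimodule K B M L). (\<lambda>m\<in>carrier M. T0 (h m)) = h0 \<and> (\<forall>i\<in>J. (\<lambda>m\<in>carrier M. T i (h m)) = k i)"
  if "h0 \<in> carrier (hom_bimodule K B M W0)" "\<And>i. i \<in> J ==> k i \<in> carrier (hom_bimodule K B M (W i))" for h0 k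
 proof -
  have h0: "h0 \<in> homs K (space_of B M) (space_of B W0)" using that(1) by (simp add: hom_bimodule_simps)
  have k: "k i \<in> homs K (space_of B M) (space_of B (W i))" if "i \<in> J" for i
   using \<open>\<And>i. i \<in> J ==> k i \<in> carrier (hom_bimodule K B M (W i))\<close>[OF that] by (simp add: hom_bimodule_simps)
  note hD = homsD[OF h0, simplified] and kD = homsD[OF k, simplified]
  have "\<exists>v. v \<in> carrier L \<and> T0 v = h0 m \<and> (\<forall>i\<in>J. T i v = k i m)" if "m \<in> carrier M" for m
   using ex[of "h0 m" "\<lambda>i. k i m"] hD(1)[OF that] kD(1)[OF _ that] by blast
  then obtain h where h: "\<And>m. m \<in> carrier M ==> h m \<in> carrier L" "\<And>m. m \<in> carrier M ==> T0 (h m) = h0 m"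
   "\<And>m i. m \<in> carrier M ==> i \<in> J ==> T i (h m) = k i m" by metis
  note t0 = module_homD[OF T0] and t = module_homD[OF T]
  have "(\<lambda>m\<in>carrier M. h m) \<in> homs K (space_of B M) (space_of B L)"
  proof (rule homsI)
   fix m m' assume "m \<in> carrier (space_of B M)" "m' \<in> carrier (space_of B M)"
   then have m: "m \<in> carrier M" "m' \<in> carrier M" by auto
   have "h (m \<oplus>\<^sub>M m') = h m \<oplus>\<^sub>L h m'"
    by (rule uniq) (use m in \<open>simp_all add: h t0(2) t(2) hD(2) kD(2)\<close>)
   then show "(\<lambda>m\<in>carrier M. h m) (m \<oplus>\<^bsub>space_of B M\<^esub> m') =
    (\<lambda>m\<in>carrier M. h m) m \<oplus>\<^bsub>space_of B L\<^esub> (\<lambda>m\<in>carrier M. h m) m'" using m by simp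
  next
   fix c m assume "c \<in> carrier K" "m \<in> carrier (space_of B M)"
   then have m: "c \<in> carrier K" "m \<in> carrier M" by auto
   have "h ((c \<odot>\<^sub>B \<one>\<^sub>B) \<odot>\<^sub>M m) = (c \<odot>\<^sub>B \<one>\<^sub>B) \<odot>\<^sub>L h m"
    by (rule uniq) (use m in \<open>simp_all add: h t0(3)[OF kB] t(3)[OF _ kB] hD(3) kD(3) M.smult_closed kB L.smult_closed\<close>)
   then show "(\<lambda>m\<in>carrier M. h m) (c \<odot>\<^bsub>space_of B M\<^esub> m) =
    c \<odot>\<^bsub>space_of B L\<^esub> (\<lambda>m\<in>carrier M. h m) m" using m M.smult_closed kB by simp
  qed (use h in auto)
  moreover have "(\<lambda>m\<in>carrier M. T0 ((\<lambda>m\<in>carrier M. h m) m)) = h0"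
   by (rule extensional_eqI[OF _ hD(5)]) (auto simp: h)
  moreover have "(\<lambda>m\<in>carrier M. T i ((\<lambda>m\<in>carrier M. h m) m)) = k i" if "i \<in> J" for i
   by (rule extensional_eqI[OF _ kD(5)[OF that]]) (use that in \<open>auto simp: h\<close>)
  ultimately show ?thesis by (intro bexI[of _ "\<lambda>m\<in>carrier M. h m"]) (auto simp: hom_bimodule_simps)
 qed
qed

section \<open>Adjoining arrows to an algebra\<close>

text \<open>The properties of the extended algebra that enter the computation, apart from its presentation: \<open>A\<close> is generated by \<open>B\<close> and
 by the new arrows \<open>\<alpha> a\<close>, and it has the projection, the Fox derivatives and the extensions of derivations that the universal
 property provides. The right action on the target of \<open>\<theta> a\<close> is through \<open>\<pi>\<close>.\<close>

locale arrow_extension =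
 fixes K :: "('k, 'r) ring_scheme" and B :: "('k, 'b) module" and A :: "('k, 'c) module" (structure)
  and \<iota> :: "'b => 'c" and \<pi> :: "'c => 'b" and V :: "'v set" and e :: "'v => 'b"
  and F :: "'f set" and s t :: "'f => 'v" and \<alpha> :: "'f => 'c"
  and \<theta> :: "'f => 'c => ('b => 'k) => 'c"
 assumes B: "k_algebra K B" and fdB: "kfin_dim K B" and A: "k_algebra K A"
  and \<iota>: "\<iota> \<in> algebra_homs K B A" and \<pi>: "\<pi> \<in> algebra_homs K A B"
  and \<pi>\<iota>: "\<And>b. b \<in> carrier B ==> \<pi> (\<iota> b) = b"
  and e: "\<And>x. x \<in> V ==> e x \<in> carrier B" "\<And>x. x \<in> V ==> e x \<otimes>\<^sub>B e x = e x"
  and F: "finite F" "\<And>a. a \<in> F ==> s a \<in> V" "\<And>a. a \<in> F ==> t a \<in> V"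
  and \<alpha>: "\<And>a. a \<in> F ==> \<alpha> a \<in> carrier A" "\<And>a. a \<in> F ==> \<iota> (e (t a)) \<otimes> \<alpha> a = \<alpha> a"
   "\<And>a. a \<in> F ==> \<alpha> a \<otimes> \<iota> (e (s a)) = \<alpha> a"
  and \<pi>\<alpha>: "\<And>a. a \<in> F ==> \<pi> (\<alpha> a) = \<zero>\<^sub>B"
  and generated: "\<And>S. S \<subseteq> carrier A ==> \<iota> ` carrier B \<subseteq> S ==> \<alpha> ` F \<subseteq> S ==>
    (\<And>x y. x \<in> S ==> y \<in> S ==> x \<oplus> y \<in> S) ==> (\<And>x y. x \<in> S ==> y \<in> S ==> x \<otimes> y \<in> S) ==> carrier A \<subseteq> S"
  and \<theta>: "\<And>a. a \<in> F ==> \<theta> a \<in> derivations K A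
    (hom_bimodule K A (pull_module \<pi> (inj_module K B e (s a))) (proj_module A (\<lambda>x. \<iota> (e x)) (t a)))"
  and \<theta>\<iota>: "\<And>a b \<phi>. a \<in> F ==> b \<in> carrier B ==> \<phi> \<in> carrier (inj_module K B e (s a)) ==> \<theta> a (\<iota> b) \<phi> = \<zero>"
  and \<theta>\<alpha>: "\<And>a c \<phi>. a \<in> F ==> c \<in> F ==> \<phi> \<in> carrier (inj_module K B e (s a)) ==>
    \<theta> a (\<alpha> c) \<phi> = (if c = a then \<phi> (e (s a)) \<odot> \<iota> (e (t a)) else \<zero>)"
  and extend_derivation: "\<And>\<delta> d. \<delta> \<in> derivations K B (restrict_scalars \<iota> (regular_bimodule A)) ==>
    (\<And>a. a \<in> F ==> d a \<in> carrier A \<and> \<iota> (e (t a)) \<otimes> d a \<otimes> \<iota> (e (s a)) = d a) ==>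
    \<exists>D\<in>derivations K A (regular_bimodule A). (\<forall>b\<in>carrier B. D (\<iota> b) = \<delta> b) \<and>
     (\<forall>a\<in>F. \<iota> (e (t a)) \<otimes> D (\<alpha> a) \<otimes> \<iota> (e (s a)) = d a)"
begin

abbreviation "I a \<equiv> inj_module K B e (s a)"
abbreviation "eA \<equiv> \<lambda>x. \<iota> (e x)"
abbreviation "PA x \<equiv> proj_module A eA x"
abbreviation "L x \<equiv> pull_module \<iota> (PA x)"

sublocale A: ring A using k_algebraD(2)[OF A] .
sublocale B: ring B using k_algebraD(2)[OF B] .
sublocale AV: vectorspace K A using k_algebraD(1)[OF A] .
sublocale BV: vectorspace K B using k_algebraD(1)[OF B] .

lemmas i = algebra_homsD[OF \<iota>]
lemmas p = algebra_homsD[OF \<pi>]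

lemma eA: "x \<in> V ==> eA x \<in> carrier A" "x \<in> V ==> eA x \<otimes> eA x = eA x"
 using i(3)[OF e(1)] i(6)[OF e(1) e(1), of x x] e(2)[of x] by auto

lemma PA_mem: "x \<in> V ==> z \<in> carrier (PA x) \<longleftrightarrow> z \<in> carrier A \<and> z \<otimes> eA x = z"
 using eA by (auto simp: A.m_assoc intro!: exI[of _ z])

lemma IB: "a \<in> F ==> left_module B (I a)" "a \<in> F ==> kfin_dim K (space_of B (I a))"
 using inj_module_facts(1)[of K B e "s a", OF B e(1)[OF F(2)]] inj_module_facts(2)[of K B e "s a", OF B e(1)[OF F(2)] fdB] by auto

lemma PAmod: "x \<in> V ==> left_module A (PA x)"
 by (rule left_module_proj_module) (auto simp: A.ring_axioms eA)

lemma Lmod: "x \<in> V ==> left_module B (L x)"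
 by (rule left_module_pull_module[OF PAmod B \<iota>])

lemma PBmod: "x \<in> V ==> left_module B (proj_module B e x)"
 by (rule left_module_proj_module) (auto simp: B.ring_axioms e)

text \<open>Whether a linear map is regarded over \<open>A\<close> or over \<open>B\<close> does not matter: the scalars of \<open>k\<close> act in the same way.\<close>

lemma fox_homs:
 "carrier (hom_bimodule K A (pull_module \<pi> (I a)) (PA (t a))) = homs K (space_of B (I a)) (space_of A (PA (t a)))"
proof -
 have id: "(\<lambda>x. x) \<in> algebra_homs K A A" by (auto simp: algebra_homs_def intro: module_homI)
 have "homs K (space_of A (pull_module \<pi> (I a))) (space_of A (pull_module (\<lambda>x. x) (PA (t a)))) =
  homs K (space_of B (I a)) (space_of A (PA (t a)))" by (rule homs_pull_module[OF A \<pi> id])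
 moreover have "homs K (space_of A (pull_module \<pi> (I a))) (space_of A (pull_module (\<lambda>x. x) (PA (t a)))) =
  homs K (space_of A (pull_module \<pi> (I a))) (space_of A (PA (t a)))"
  unfolding homs_def module_hom_def' by simp
 ultimately show ?thesis by (simp add: hom_bimodule_simps(1))
qed

lemma A_scalar: "c \<in> carrier K ==> z \<in> carrier A ==> (c \<odot> \<one>) \<otimes> z = c \<odot> z"
 using k_algebraD(3)[OF A, of c "\<one>" z] by simp

lemma fox_hom:
 assumes "x \<in> V" "h \<in> homs K (space_of B (I a)) (space_of A (PA x))"
 shows "h \<in> module_hom K (space_of B (I a)) A"
 using homsD(1-3)[OF assms(2)] PA_mem[OF assms(1)] A_scalar by (intro module_homI) auto

context
 fixes a assumes a: "a \<in> F"
begin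

lemmas \<theta>a = derivationsD[OF \<theta>[OF a]]

lemma \<theta>_hom: "z \<in> carrier A ==> \<theta> a z \<in> homs K (space_of B (I a)) (space_of A (PA (t a)))"
 using \<theta>a(2)[of z] fox_homs by simp

lemma \<theta>_PA: "z \<in> carrier A ==> \<phi> \<in> carrier (I a) ==> \<theta> a z \<phi> \<in> carrier (PA (t a))"
 using homsD(1)[OF \<theta>_hom] by simp

lemma \<theta>_closed: "z \<in> carrier A ==> \<phi> \<in> carrier (I a) ==> \<theta> a z \<phi> \<in> carrier A"
 using \<theta>_PA PA_mem[OF F(3)[OF a]] by blast

lemma \<theta>_lin_form: "z \<in> carrier A ==> \<theta> a z \<in> module_hom K (space_of B (I a)) A"
 by (rule fox_hom[OF F(3)[OF a] \<theta>_hom])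

lemma \<theta>_lin: "\<phi> \<in> carrier (I a) ==> (\<lambda>z. \<theta> a z \<phi>) \<in> module_hom K A A"
 using \<theta>a(3,4) A_scalar \<theta>_closed
 by (intro module_homI) (simp_all add: hom_bimodule_simps)

lemma \<theta>_mult: "z \<in> carrier A ==> w \<in> carrier A ==> \<phi> \<in> carrier (I a) ==>
  \<theta> a (z \<otimes> w) \<phi> = z \<otimes> \<theta> a w \<phi> \<oplus> \<theta> a z (\<pi> w \<odot>\<^bsub>I a\<^esub> \<phi>)"
 using \<theta>a(7)[of z w] by (simp add: hom_bimodule_simps)

lemma \<theta>_zero: "z \<in> carrier A ==> \<theta> a z \<zero>\<^bsub>I a\<^esub> = \<zero>"
 using linear_zero[OF vectorspace_underlying_space[OF B IB(1)[OF a]] AV.vectorspace_axioms \<theta>_lin_form] by simp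

lemma I_smult: "b \<in> carrier B ==> \<phi> \<in> carrier (I a) ==> b \<odot>\<^bsub>I a\<^esub> \<phi> \<in> carrier (I a)"
 by (rule left_module.smult_closed[OF IB(1)[OF a]])

lemma es_mem: "e (s a) \<in> carrier (right_ideal_space B e (s a))"
 using e(1)[OF F(2)[OF a]] by (auto simp: right_ideal_simps intro!: exI[of _ "\<one>\<^sub>B"])

lemma I_val: "\<phi> \<in> carrier (I a) ==> v \<in> carrier (right_ideal_space B e (s a)) ==> \<phi> v \<in> carrier K"
 using homsD(1)[of \<phi> K "right_ideal_space B e (s a)" "regular_module K"] by (simp add: inj_module_simps)

text \<open>The Fox derivative along \<open>a\<close> of \<open>u \<cdot> c \<cdot> v\<close> is \<open>u \<otimes> v\<close> if \<open>c = a\<close> and 0 otherwise: the derivative of \<open>u\<close> does not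
 contribute, because the right action is through \<open>\<pi>\<close> and \<open>\<pi>\<close> kills \<open>c\<close>.\<close>

lemma \<theta>_word:
 assumes c: "c \<in> F" and u: "u \<in> carrier A" and v: "v \<in> carrier B" and \<phi>: "\<phi> \<in> carrier (I a)"
 shows "\<theta> a (u \<otimes> \<alpha> c \<otimes> \<iota> v) \<phi> = (if c = a then \<phi> (e (s a) \<otimes>\<^sub>B v) \<odot> (u \<otimes> eA (t a)) else \<zero>)"
proof -
 note ia = i(3)[OF v] and ac = \<alpha>(1)[OF c]
 have v\<phi>: "v \<odot>\<^bsub>I a\<^esub> \<phi> \<in> carrier (I a)" by (rule I_smult[OF v \<phi>])
 have "\<theta> a (u \<otimes> \<alpha> c \<otimes> \<iota> v) \<phi> = \<theta> a (u \<otimes> (\<alpha> c \<otimes> \<iota> v)) \<phi>" using u ac ia by (simp add: A.m_assoc)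
 also have "\<dots> = u \<otimes> \<theta> a (\<alpha> c \<otimes> \<iota> v) \<phi> \<oplus> \<theta> a u (\<pi> (\<alpha> c \<otimes> \<iota> v) \<odot>\<^bsub>I a\<^esub> \<phi>)"
  using u ac ia \<phi> by (simp add: \<theta>_mult)
 also have "\<pi> (\<alpha> c \<otimes> \<iota> v) = \<zero>\<^sub>B" using p(6)[OF ac ia] \<pi>\<alpha>[OF c] \<pi>\<iota>[OF v] v by simp
 also have "\<zero>\<^sub>B \<odot>\<^bsub>I a\<^esub> \<phi> = \<zero>\<^bsub>I a\<^esub>" by (rule left_module.smult_zero(2)[OF IB(1)[OF a] \<phi>])
 also have "\<theta> a u \<zero>\<^bsub>I a\<^esub> = \<zero>" by (rule \<theta>_zero[OF u])
 also have "\<theta> a (\<alpha> c \<otimes> \<iota> v) \<phi> = \<theta> a (\<alpha> c) (v \<odot>\<^bsub>I a\<^esub> \<phi>)"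
  using ac ia \<phi> v v\<phi> by (simp add: \<theta>_mult \<theta>\<iota>[OF a v \<phi>] \<pi>\<iota> \<theta>_closed)
 also have "\<dots> = (if c = a then (v \<odot>\<^bsub>I a\<^esub> \<phi>) (e (s a)) \<odot> eA (t a) else \<zero>)" by (rule \<theta>\<alpha>[OF a c v\<phi>])
 also have "(v \<odot>\<^bsub>I a\<^esub> \<phi>) (e (s a)) = \<phi> (e (s a) \<otimes>\<^sub>B v)" using es_mem by (simp add: inj_module_simps(4))
 finally have "\<theta> a (u \<otimes> \<alpha> c \<otimes> \<iota> v) \<phi> =
   u \<otimes> (if c = a then \<phi> (e (s a) \<otimes>\<^sub>B v) \<odot> eA (t a) else \<zero>) \<oplus> \<zero>" .
 moreover have "\<phi> (e (s a) \<otimes>\<^sub>B v) \<in> carrier K"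
  by (rule I_val[OF \<phi>]) (use v in \<open>auto simp: right_ideal_simps\<close>)
 ultimately show ?thesis using u eA[OF F(3)[OF a]] by (simp add: k_algebraD(4)[OF A])
qed

text \<open>Expansion of a linear map on \<open>I a\<close> along a dual basis; this is the identification of \<open>Hom\<^sub>k(I a, A)\<close> with \<open>A \<otimes> s(a) B\<close>.\<close>

lemma expand_form:
 assumes Y: "finite Y" "\<And>j. j \<in> Y ==> \<psi> j \<in> carrier (I a)" "Y \<subseteq> carrier (right_ideal_space B e (s a))"
  and f: "f \<in> carrier B"
  and vf: "\<And>v. v \<in> carrier (right_ideal_space B e (s a)) ==> v \<otimes>\<^sub>B f = (\<Oplus>\<^sub>B j\<in>Y. \<psi> j v \<odot>\<^sub>B j)"
  and \<phi>: "\<phi> \<in> carrier (I a)" and h: "h \<in> module_hom K (space_of B (I a)) A"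
 shows "h (f \<odot>\<^bsub>I a\<^esub> \<phi>) = (\<Oplus>j\<in>Y. \<phi> j \<odot> h (\<psi> j))"
proof -
 let ?S = "right_ideal_space B e (s a)" and ?U = "space_of B (I a)"
 note uI = vectorspace_underlying_space[OF B IB(1)[OF a]]
 interpret UI: vectorspace K ?U by (rule uI)
 have esB: "e (s a) \<in> carrier B" using e F a by auto
 note sv = right_ideal_space[of K B e "s a", OF B esB]
 interpret S: vectorspace K ?S by (rule sv(1))
 note rm = right_ideal_mult[of B e "s a", OF B.ring_axioms esB]
 have reg: "vectorspace K (regular_module K)" by (rule vectorspace_regular_module) unfold_locales
 have \<phi>j: "\<phi> j \<in> carrier K" if "j \<in> Y" for j using I_val[OF \<phi>] Y(3) that by auto
 have sm: "k \<odot>\<^bsub>?U\<^esub> \<psi>' = (\<lambda>v\<in>carrier ?S. k \<otimes>\<^sub>K \<psi>' v)" if "k \<in> carrier K" "\<psi>' \<in> carrier (I a)" for k \<psi>'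
  by (rule inj_module_facts(3)[of K B e "s a", OF B esB that])
 have tU: "(\<lambda>j. \<phi> j \<odot>\<^bsub>?U\<^esub> \<psi> j) \<in> Y \<rightarrow> carrier ?U"
 proof
  fix j assume "j \<in> Y"
  then show "\<phi> j \<odot>\<^bsub>?U\<^esub> \<psi> j \<in> carrier ?U" using \<phi>j Y(2) by (intro UI.smult_closed) auto
 qed
 have "f \<odot>\<^bsub>I a\<^esub> \<phi> = (\<Oplus>\<^bsub>?U\<^esub>j\<in>Y. \<phi> j \<odot>\<^bsub>?U\<^esub> \<psi> j)"
 proof (rule extensional_eqI)
  show "f \<odot>\<^bsub>I a\<^esub> \<phi> \<in> extensional (carrier ?S)" by (simp add: inj_module_simps(4))
  have "(\<Oplus>\<^bsub>?U\<^esub>j\<in>Y. \<phi> j \<odot>\<^bsub>?U\<^esub> \<psi> j) \<in> carrier ?U" using tU by (rule UI.M.finsum_closed)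
  then show "(\<Oplus>\<^bsub>?U\<^esub>j\<in>Y. \<phi> j \<odot>\<^bsub>?U\<^esub> \<psi> j) \<in> extensional (carrier ?S)"
   using homsD(5)[of _ K ?S "regular_module K"] by (simp add: inj_module_simps(1))
  fix v assume v: "v \<in> carrier ?S"
  have ev: "(\<lambda>\<phi>. \<phi> v) \<in> module_hom K ?U (regular_module K)"
  proof (rule module_homI)
   show "k \<in> carrier K ==> \<psi>' \<in> carrier ?U ==> (k \<odot>\<^bsub>?U\<^esub> \<psi>') v = k \<odot>\<^bsub>regular_module K\<^esub> \<psi>' v" for k \<psi>'
    using sm[of k \<psi>'] v by simp
  qed (use v I_val in \<open>auto simp: inj_module_simps(2)\<close>)
  have \<psi>v: "\<psi> j v \<in> carrier K" if "j \<in> Y" for j using I_val[OF Y(2)[OF that] v] .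
  have "(\<Oplus>\<^bsub>?U\<^esub>j\<in>Y. \<phi> j \<odot>\<^bsub>?U\<^esub> \<psi> j) v = (\<Oplus>\<^sub>K j\<in>Y. (\<phi> j \<odot>\<^bsub>?U\<^esub> \<psi> j) v)"
   using linear_finsum[OF uI reg ev Y(1) tU] by simp
  also have "\<dots> = (\<Oplus>\<^sub>K j\<in>Y. \<psi> j v \<otimes>\<^sub>K \<phi> j)"
   using sm[OF \<phi>j Y(2)] v \<psi>v \<phi>j by (intro AV.R.finsum_cong') (auto simp: AV.R.m_comm)
  also have "\<dots> = \<phi> (\<Oplus>\<^bsub>?S\<^esub>j\<in>Y. \<psi> j v \<odot>\<^bsub>?S\<^esub> j)"
  proof -
   have \<phi>h: "\<phi> \<in> homs K ?S (regular_module K)" using \<phi> by (simp add: inj_module_simps(1))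
   have g: "(\<lambda>j. \<psi> j v \<odot>\<^bsub>?S\<^esub> j) \<in> Y \<rightarrow> carrier ?S" using \<psi>v Y(3) S.smult_closed by blast
   have "\<phi> (\<Oplus>\<^bsub>?S\<^esub>j\<in>Y. \<psi> j v \<odot>\<^bsub>?S\<^esub> j) = (\<Oplus>\<^sub>K j\<in>Y. \<phi> (\<psi> j v \<odot>\<^bsub>?S\<^esub> j))"
    using linear_finsum[OF sv(1) reg homsD(4)[OF \<phi>h] Y(1) g] by simp
   also have "\<dots> = (\<Oplus>\<^sub>K j\<in>Y. \<psi> j v \<otimes>\<^sub>K \<phi> j)"
    using homsD(3)[OF \<phi>h] \<psi>v \<phi>j Y(3) by (intro AV.R.finsum_cong') auto
   finally show ?thesis by simp
  qed
  also have "(\<Oplus>\<^bsub>?S\<^esub>j\<in>Y. \<psi> j v \<odot>\<^bsub>?S\<^esub> j) = v \<otimes>\<^sub>B f"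
  proof -
   have g: "(\<lambda>j. \<psi> j v \<odot>\<^bsub>?S\<^esub> j) \<in> Y \<rightarrow> carrier ?S" using \<psi>v Y(3) S.smult_closed by blast
   have incl: "(\<lambda>v. v) \<in> module_hom K ?S B"
    by (rule module_homI) (use rm(1) in \<open>auto simp: right_ideal_simps(2,4)\<close>)
   have "(\<Oplus>\<^bsub>?S\<^esub>j\<in>Y. \<psi> j v \<odot>\<^bsub>?S\<^esub> j) = (\<Oplus>\<^sub>B j\<in>Y. \<psi> j v \<odot>\<^bsub>?S\<^esub> j)"
    by (rule linear_finsum[OF sv(1) BV.vectorspace_axioms incl Y(1) g])
   then show ?thesis using vf[OF v] by (simp add: right_ideal_simps(4))
  qed
  finally have r: "(\<Oplus>\<^bsub>?U\<^esub>j\<in>Y. \<phi> j \<odot>\<^bsub>?U\<^esub> \<psi> j) v = \<phi> (v \<otimes>\<^sub>B f)" .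
  have l: "(f \<odot>\<^bsub>I a\<^esub> \<phi>) v = \<phi> (v \<otimes>\<^sub>B f)" using v by (simp add: inj_module_simps(4))
  show "(f \<odot>\<^bsub>I a\<^esub> \<phi>) v = (\<Oplus>\<^bsub>?U\<^esub>j\<in>Y. \<phi> j \<odot>\<^bsub>?U\<^esub> \<psi> j) v" by (rule trans[OF l r[symmetric]])
 qed
 then have "h (f \<odot>\<^bsub>I a\<^esub> \<phi>) = (\<Oplus>j\<in>Y. h (\<phi> j \<odot>\<^bsub>?U\<^esub> \<psi> j))"
  using linear_finsum[OF uI AV.vectorspace_axioms h Y(1) tU] by simp
 also have "\<dots> = (\<Oplus>j\<in>Y. \<phi> j \<odot> h (\<psi> j))"
  using module_homD(1,3)[OF h] \<phi>j Y(2) by (intro A.finsum_cong') auto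
 finally show ?thesis .
qed

end

text \<open>Elements \<open>Y\<close> that span \<open>s(a) B\<close>, with coordinate forms \<open>\<psi>\<close> and the resulting expansion of linear maps on the dual \<open>I a\<close>.\<close>

definition dual_basis :: "'f => 'b set => ('b => 'b => 'k) => bool" where
 "dual_basis a Y \<psi> \<longleftrightarrow> finite Y \<and> Y \<subseteq> carrier (right_ideal_space B e (s a)) \<and>
   (\<forall>j\<in>Y. \<psi> j \<in> carrier (I a) \<and> j \<in> carrier B \<and> e (s a) \<otimes>\<^sub>B j = j) \<and>
   (\<forall>h\<in>module_hom K (space_of B (I a)) A. \<forall>\<phi>\<in>carrier (I a). h \<phi> = (\<Oplus>j\<in>Y. \<phi> j \<odot> h (\<psi> j))) \<and>
   (\<forall>v\<in>carrier (right_ideal_space B e (s a)). v = (\<Oplus>\<^sub>B j\<in>Y. \<psi> j v \<odot>\<^sub>B j))"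

lemma dual_basis_family: "\<exists>Y \<psi>. \<forall>a\<in>F. dual_basis a (Y a) (\<psi> a)"
proof -
 have "\<exists>Y \<psi>. dual_basis a Y \<psi>" if a: "a \<in> F" for a
 proof -
 have esB: "e (s a) \<in> carrier B" and V: "s a \<in> V" using e F a by auto
 obtain Y \<psi> where Y: "finite Y" "card Y = kdim K (B\<lparr>carrier := {e (s a) \<otimes>\<^sub>B b \<otimes>\<^sub>B \<one>\<^sub>B | b. b \<in> carrier B}\<rparr>)"
  "Y \<subseteq> {e (s a) \<otimes>\<^sub>B b \<otimes>\<^sub>B \<one>\<^sub>B | b. b \<in> carrier B}"
  "\<And>j. j \<in> Y ==> \<psi> j \<in> carrier (inj_module K B e (s a))"
  "\<And>i j. i \<in> Y ==> j \<in> Y ==> \<psi> i j = (if i = j then \<one>\<^sub>K else \<zero>\<^sub>K)"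
  "\<And>v. v \<in> carrier (right_ideal_space B e (s a)) ==> v \<otimes>\<^sub>B \<one>\<^sub>B = (\<Oplus>\<^sub>B j\<in>Y. \<psi> j v \<odot>\<^sub>B j)"
  by (rule right_dual_basis[of K B e "s a" "\<one>\<^sub>B", OF B fdB esB B.one_closed B.r_one[OF B.one_closed]], rule that, assumption+)
 have YS: "Y \<subseteq> carrier (right_ideal_space B e (s a))"
  using Y(3) right_ideal_space(2)[of K B e "s a", OF B esB] by auto
 have jB: "j \<in> carrier B" "e (s a) \<otimes>\<^sub>B j = j" if "j \<in> Y" for j
  using subsetD[OF Y(3) that] esB e(2)[OF V] by (auto simp: B.m_assoc[symmetric])
 have one: "\<one>\<^sub>B \<odot>\<^bsub>I a\<^esub> \<phi> = \<phi>" if "\<phi> \<in> carrier (I a)" for \<phi>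
  by (rule left_module.smult_one[OF IB(1)[OF a] that])
 have ex: "h \<phi> = (\<Oplus>j\<in>Y. \<phi> j \<odot> h (\<psi> j))"
  if "h \<in> module_hom K (space_of B (I a)) A" "\<phi> \<in> carrier (I a)" for h \<phi>
  using expand_form[OF a Y(1,4) YS B.one_closed Y(6) that(2,1)] one[OF that(2)] by simp
 have dec: "v = (\<Oplus>\<^sub>B j\<in>Y. \<psi> j v \<odot>\<^sub>B j)" if v: "v \<in> carrier (right_ideal_space B e (s a))" for v
  using Y(6)[OF v] B.r_one[OF right_ideal_mult(1)[of B e "s a", OF B.ring_axioms esB v]] by simp
 have "dual_basis a Y \<psi>" unfolding dual_basis_def using Y(1) YS Y(4) jB ex dec by blast
 then show ?thesis by blast
 qed
 then show ?thesis by metis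
qed

text \<open>Every element of \<open>A\<close> is a sum of an element of \<open>B\<close> and of words \<open>u \<cdot> a \<cdot> v\<close> with \<open>v\<close> in \<open>B\<close>,
 because such sums are stable under right multiplication by the generators.\<close>

inductive_set words :: "'c set" where
 base: "b \<in> carrier B ==> \<iota> b \<in> words"
| word: "a \<in> F ==> u \<in> carrier A ==> v \<in> carrier B ==> u \<otimes> \<alpha> a \<otimes> \<iota> v \<in> words"
| add: "x \<in> words ==> y \<in> words ==> x \<oplus> y \<in> words"

lemma words_closed: "z \<in> words ==> z \<in> carrier A"
 by (induction rule: words.induct) (auto simp: i(3) \<alpha>)

lemma words_base_mult: "z \<in> words ==> b \<in> carrier B ==> z \<otimes> \<iota> b \<in> words"
proof (induction rule: words.induct)
 case (base c)
 then show ?case using words.base[of "c \<otimes>\<^sub>B b"] by (simp add: i(6))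
next
 case (word a u v)
 then show ?case using words.word[of a u "v \<otimes>\<^sub>B b"] by (simp add: i(3,6) \<alpha> A.m_assoc)
next
 case (add x y)
 then show ?case using words.add[of "x \<otimes> \<iota> b" "y \<otimes> \<iota> b"] words_closed by (simp add: A.l_distr i(3))
qed

lemma words_eq: "words = carrier A"
proof
 show "words \<subseteq> carrier A" using words_closed by auto
 have am: "z \<otimes> \<alpha> a \<in> words" if "z \<in> carrier A" "a \<in> F" for z a
  using words.word[OF that(2,1) e(1)[OF F(2)[OF that(2)]]] that \<alpha> i(3)[OF e(1)[OF F(2)[OF that(2)]]] by (simp add: A.m_assoc)
 let ?S = "{y \<in> carrier A. \<forall>x\<in>words. x \<otimes> y \<in> words}"
 have "carrier A \<subseteq> ?S"
 proof (rule generated)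
  show "\<iota> ` carrier B \<subseteq> ?S" using words_base_mult i(3) by auto
  show "\<alpha> ` F \<subseteq> ?S" using am words_closed \<alpha> by auto
  show "x \<oplus> y \<in> ?S" if "x \<in> ?S" "y \<in> ?S" for x y
   using that words.add words_closed by (auto simp: A.r_distr)
  show "x \<otimes> y \<in> ?S" if "x \<in> ?S" "y \<in> ?S" for x y
   using that words_closed by (auto simp: A.m_assoc[symmetric])
 qed auto
 moreover have "\<one> \<in> words" using words.base[OF B.one_closed] i(2) by simp
 ultimately show "carrier A \<subseteq> words" using A.l_one by force
qed

text \<open>An element is recovered from its components as \<open>\<pi>(z) + \<Sum> \<theta>\<^sub>a(z)(\<psi>\<^sub>j) a j\<close>, where \<open>j\<close> runs through a spanning set of \<open>s(a) B\<close> with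
 coordinate forms \<open>\<psi>\<^sub>j\<close>. It suffices to check this on the sums in \<open>words\<close>, by the formula for the derivative of \<open>u \<cdot> c \<cdot> v\<close>.\<close>

lemma zero_if_components_zero:
 assumes z: "z \<in> carrier A" and "\<pi> z = \<zero>\<^sub>B"
  and \<theta>0: "\<And>a \<phi>. a \<in> F ==> \<phi> \<in> carrier (I a) ==> \<theta> a z \<phi> = \<zero>"
 shows "z = \<zero>"
proof -
 obtain Y \<psi> where d: "\<forall>a\<in>F. dual_basis a (Y a) (\<psi> a)" using dual_basis_family by blast
 have Y: "finite (Y a)" "Y a \<subseteq> carrier (right_ideal_space B e (s a))"
  "j \<in> Y a ==> \<psi> a j \<in> carrier (I a)" "j \<in> Y a ==> j \<in> carrier B"
  "v \<in> carrier (right_ideal_space B e (s a)) ==> v = (\<Oplus>\<^sub>B j\<in>Y a. \<psi> a j v \<odot>\<^sub>B j)" if "a \<in> F" for a j v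
  using bspec[OF d that] unfolding dual_basis_def by blast+
 let ?S = "\<lambda>a z. \<Oplus>j\<in>Y a. \<theta> a z (\<psi> a j) \<otimes> (\<alpha> a \<otimes> \<iota> j)"
 \<comment> \<open>every element is recovered from its components\<close>
 define E where "E z = \<iota> (\<pi> z) \<oplus> (\<Oplus>a\<in>F. \<Oplus>j\<in>Y a. \<theta> a z (\<psi> a j) \<otimes> (\<alpha> a \<otimes> \<iota> j))" for z
 have tm: "\<theta> a z (\<psi> a j) \<otimes> (\<alpha> a \<otimes> \<iota> j) \<in> carrier A" if "z \<in> carrier A" "a \<in> F" "j \<in> Y a" for a j z
  using that \<theta>_closed[OF that(2) that(1) Y(3)[OF that(2,3)]] \<alpha> i(3) Y(4) by simp
 have inner: "?S a z \<in> carrier A" if "z \<in> carrier A" "a \<in> F" for a z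
  using tm[OF that] by (intro A.finsum_closed) auto
 have "E z = z" if "z \<in> words" for z using that
 proof (induction rule: words.induct)
  case (base b)
  have "?S a (\<iota> b) = \<zero>" if "a \<in> F" for a
  proof -
   have "?S a (\<iota> b) = (\<Oplus>j\<in>Y a. \<zero>)"
    using that base by (intro A.finsum_cong') (auto simp: \<theta>\<iota> Y(3,4) \<alpha> i(3))
   then show ?thesis by simp
  qed
  then have "(\<Oplus>a\<in>F. \<Oplus>j\<in>Y a. \<theta> a (\<iota> b) (\<psi> a j) \<otimes> (\<alpha> a \<otimes> \<iota> j)) = (\<Oplus>a\<in>F. \<zero>)"
   by (intro A.finsum_cong') auto
  then show ?case using base by (simp add: E_def \<pi>\<iota> i(3))
 next
  case (word c u v)
  let ?w = "u \<otimes> \<alpha> c \<otimes> \<iota> v"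
  have w: "?w \<in> carrier A" and uB: "eA (t c) \<in> carrier A" and esB: "e (s c) \<in> carrier B"
   using word \<alpha> i(3) e(1) F by auto
  have esv: "e (s c) \<otimes>\<^sub>B v \<in> carrier (right_ideal_space B e (s c))" using word esB by (auto simp: right_ideal_simps)
  have "\<pi> ?w = \<zero>\<^sub>B" using word \<alpha>(1)[OF word(1)] i(3)[OF word(3)] by (simp add: p(3,6) \<pi>\<alpha> \<pi>\<iota>)
  moreover have "?S a ?w = (if c = a then ?w else \<zero>)" if a: "a \<in> F" for a
  proof (cases "c = a")
   case False
   have "?S a ?w = (\<Oplus>j\<in>Y a. \<zero>)"
    using a word False by (intro A.finsum_cong') (auto simp: \<theta>_word Y(3,4) \<alpha> i(3))
   then show ?thesis using False by simp
  next
   case True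
   let ?q = "e (s c) \<otimes>\<^sub>B v"
   have qj: "\<psi> c j ?q \<in> carrier K" if "j \<in> Y c" for j using I_val[OF word(1) Y(3)[OF word(1) that] esv] .
   have uu: "u \<otimes> eA (t c) \<otimes> \<alpha> c = u \<otimes> \<alpha> c" using word uB \<alpha> by (simp add: A.m_assoc)
   have ua: "u \<otimes> \<alpha> c \<in> carrier A" using word \<alpha> by simp
   have lin: "(\<lambda>b. u \<otimes> \<alpha> c \<otimes> \<iota> b) \<in> module_hom K B A"
    by (rule module_homI) (use ua in \<open>auto simp: i A.r_distr k_algebraD(4)[OF A]\<close>)
   have "?S a ?w = (\<Oplus>j\<in>Y c. u \<otimes> \<alpha> c \<otimes> \<iota> (\<psi> c j ?q \<odot>\<^sub>B j))"
   proof (rule A.finsum_cong')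
    fix j assume "j \<in> Y c"
    then have j: "j \<in> Y c" "j \<in> carrier B" "\<iota> j \<in> carrier A" using Y(4)[OF word(1)] i(3) by auto
    have "\<theta> c ?w (\<psi> c j) \<otimes> (\<alpha> c \<otimes> \<iota> j) = \<psi> c j ?q \<odot> ((u \<otimes> eA (t c)) \<otimes> (\<alpha> c \<otimes> \<iota> j))"
     using word j qj[OF j(1)] uB \<alpha>(1)[OF word(1)] by (simp add: \<theta>_word[OF word(1)] Y(3) k_algebraD(3)[OF A])
    also have "(u \<otimes> eA (t c)) \<otimes> (\<alpha> c \<otimes> \<iota> j) = u \<otimes> \<alpha> c \<otimes> \<iota> j"
     using uu word j uB \<alpha>(1)[OF word(1)] by (simp add: A.m_assoc[symmetric])
    also have "\<psi> c j ?q \<odot> (u \<otimes> \<alpha> c \<otimes> \<iota> j) = u \<otimes> \<alpha> c \<otimes> \<iota> (\<psi> c j ?q \<odot>\<^sub>B j)"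
     using module_homD(3)[OF lin qj[OF j(1)] j(2)] by simp
    finally show "\<theta> a ?w (\<psi> a j) \<otimes> (\<alpha> a \<otimes> \<iota> j) = u \<otimes> \<alpha> c \<otimes> \<iota> (\<psi> c j ?q \<odot>\<^sub>B j)" using True by simp
   qed (use True qj Y(4)[OF word(1)] ua i(3) in auto)
   also have "\<dots> = u \<otimes> \<alpha> c \<otimes> \<iota> (\<Oplus>\<^sub>B j\<in>Y c. \<psi> c j ?q \<odot>\<^sub>B j)"
    using linear_finsum[OF BV.vectorspace_axioms AV.vectorspace_axioms lin Y(1)[OF word(1)], of "\<lambda>j. \<psi> c j ?q \<odot>\<^sub>B j"]
     qj Y(4)[OF word(1)] by auto
   also have "\<dots> = u \<otimes> \<alpha> c \<otimes> \<iota> ?q" using Y(5)[OF word(1) esv] by simp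
   also have "\<dots> = ?w" using word esB \<alpha>(1,3)[OF word(1)] i(3)[OF esB] i(3)[OF word(3)]
    by (metis A.m_assoc i(6) ua)
   finally show ?thesis using True by simp
  qed
  then have "(\<Oplus>a\<in>F. \<Oplus>j\<in>Y a. \<theta> a ?w (\<psi> a j) \<otimes> (\<alpha> a \<otimes> \<iota> j)) = (\<Oplus>a\<in>F. if c = a then ?w else \<zero>)"
   using w by (intro A.finsum_cong') auto
  moreover have "\<dots> = ?w" using A.finsum_singleton[OF word(1) F(1), of "\<lambda>_. ?w"] w by auto
  ultimately show ?case using w i(3)[OF B.zero_closed] linear_zero[OF BV.vectorspace_axioms AV.vectorspace_axioms i(1)] by (simp add: E_def)
 next
  case (add x y)
  have xy: "x \<in> carrier A" "y \<in> carrier A" using add words_closed by auto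
  have "?S a (x \<oplus> y) =
    ?S a x \<oplus> ?S a y"
   if a: "a \<in> F" for a
  proof -
   have "?S a (x \<oplus> y) =
    (\<Oplus>j\<in>Y a. \<theta> a x (\<psi> a j) \<otimes> (\<alpha> a \<otimes> \<iota> j) \<oplus> \<theta> a y (\<psi> a j) \<otimes> (\<alpha> a \<otimes> \<iota> j))"
    using xy a module_homD(2)[OF \<theta>_lin[OF a Y(3)[OF a]], of _ x y] \<theta>_closed[OF a xy(1) Y(3)[OF a]] \<theta>_closed[OF a xy(2) Y(3)[OF a]] \<alpha>(1)[OF a] i(3) Y(4)[OF a]
    by (intro A.finsum_cong') (auto simp: A.l_distr)
   then show ?thesis using tm[OF xy(1) a] tm[OF xy(2) a] by (simp add: A.finsum_addf Pi_def)
  qed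
  then have "(\<Oplus>a\<in>F. \<Oplus>j\<in>Y a. \<theta> a (x \<oplus> y) (\<psi> a j) \<otimes> (\<alpha> a \<otimes> \<iota> j)) =
   (\<Oplus>a\<in>F. ?S a x \<oplus> ?S a y)"
   using inner[OF xy(1)] inner[OF xy(2)] by (intro A.finsum_cong') auto
  also have "\<dots> = (\<Oplus>a\<in>F. \<Oplus>j\<in>Y a. \<theta> a x (\<psi> a j) \<otimes> (\<alpha> a \<otimes> \<iota> j)) \<oplus> (\<Oplus>a\<in>F. \<Oplus>j\<in>Y a. \<theta> a y (\<psi> a j) \<otimes> (\<alpha> a \<otimes> \<iota> j))"
   using inner[OF xy(1)] inner[OF xy(2)] by (intro A.finsum_addf) auto
  finally have "E (x \<oplus> y) = E x \<oplus> E y"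
   unfolding E_def using xy inner[OF xy(1)] inner[OF xy(2)] by (simp add: p(3,4) i(3,4) A.a_ac Pi_def)
  then show ?case using add by simp
 qed
 then have "z = E z" using z words_eq by simp
 also have "E z = \<zero>"
 proof -
  have "(\<Oplus>a\<in>F. \<Oplus>j\<in>Y a. \<theta> a z (\<psi> a j) \<otimes> (\<alpha> a \<otimes> \<iota> j)) = (\<Oplus>a\<in>F. \<zero>)"
  proof (rule A.finsum_cong')
   fix a assume a: "a \<in> F"
   have "?S a z = (\<Oplus>j\<in>Y a. \<zero>)"
    using a \<theta>0[OF a Y(3)[OF a]] \<alpha>(1)[OF a] i(3) Y(4)[OF a] by (intro A.finsum_cong') auto
   then show "?S a z = \<zero>" by simp
  qed auto
  then show ?thesis using assms(2) linear_zero[OF BV.vectorspace_axioms AV.vectorspace_axioms i(1)] by (simp add: E_def)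
 qed
 finally show ?thesis .
qed

end

section \<open>The columns of the extended algebra\<close>

lemma module_hom_underlying:
 assumes B: "k_algebra K B" and f: "f \<in> module_hom B M N"
 shows "f \<in> module_hom K (space_of B M) (space_of B N)"
proof -
 interpret B: ring B using k_algebraD(2)[OF B] .
 interpret V: vectorspace K B using k_algebraD(1)[OF B] .
 show ?thesis by (rule module_homI) (simp_all add: module_homD[OF f])
qed

context arrow_extension
begin

lemma PB_mem: "x \<in> V ==> b \<in> carrier (proj_module B e x) \<longleftrightarrow> b \<in> carrier B \<and> b \<otimes>\<^sub>B e x = b"
 using e by (auto simp: B.m_assoc intro!: exI[of _ b])

text \<open>The sum \<open>b + \<Sum> u\<^sub>a\<^sub>j a j\<close> has the prescribed components.\<close>

lemma word_sum_exists:
 assumes Y: "\<And>a. a \<in> F ==> finite (Y a)" "\<And>a j. a \<in> F ==> j \<in> Y a ==> j \<in> carrier B"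
   "\<And>a j. a \<in> F ==> j \<in> Y a ==> e (s a) \<otimes>\<^sub>B j = j"
  and b: "b \<in> carrier B" and u: "\<And>a j. a \<in> F ==> j \<in> Y a ==> u a j \<in> carrier (PA (t a))"
 shows "\<exists>z\<in>carrier A. \<pi> z = b \<and>
  (\<forall>a\<in>F. \<forall>\<phi>\<in>carrier (I a). \<theta> a z \<phi> = (\<Oplus>j\<in>Y a. \<phi> j \<odot> u a j))"
proof -
 have uA: "u a j \<in> carrier A" "u a j \<otimes> eA (t a) = u a j" if "a \<in> F" "j \<in> Y a" for a j
  using u[OF that] PA_mem[OF F(3)[OF that(1)]] by auto
 let ?w = "\<lambda>a j. u a j \<otimes> \<alpha> a \<otimes> \<iota> j"
 let ?S = "\<lambda>a. \<Oplus>j\<in>Y a. ?w a j"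
 have w: "?w a j \<in> carrier A" if "a \<in> F" "j \<in> Y a" for a j
  using uA[OF that] \<alpha>(1)[OF that(1)] i(3)[OF Y(2)[OF that]] by simp
 have S: "?S a \<in> carrier A" if "a \<in> F" for a using w[OF that] by (intro A.finsum_closed) auto
 define z where "z = \<iota> b \<oplus> (\<Oplus>a\<in>F. ?S a)"
 have SS: "(\<Oplus>a\<in>F. ?S a) \<in> carrier A" using S by (intro A.finsum_closed) auto
 have zA: "z \<in> carrier A" unfolding z_def using SS i(3)[OF b] by simp
 have lin2: "f z = f (\<iota> b) \<oplus>\<^sub>W (\<Oplus>\<^sub>W a\<in>F. \<Oplus>\<^sub>W j\<in>Y a. f (?w a j))"
  if W: "vectorspace K W" and f: "f \<in> module_hom K A W" for f and W :: "('k, 'w, 'ww) module_scheme"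
 proof -
  interpret W: vectorspace K W by (rule W)
  have fw: "f (?w a j) \<in> carrier W" if "a \<in> F" "j \<in> Y a" for a j using module_homD(1)[OF f w[OF that]] .
  have "f z = f (\<iota> b) \<oplus>\<^sub>W f (\<Oplus>a\<in>F. ?S a)" unfolding z_def using module_homD(2)[OF f i(3)[OF b] SS] .
  also have "f (\<Oplus>a\<in>F. ?S a) = (\<Oplus>\<^sub>W a\<in>F. f (?S a))"
   by (rule linear_finsum[OF AV.vectorspace_axioms W f F(1)]) (use S in auto)
  also have "\<dots> = (\<Oplus>\<^sub>W a\<in>F. \<Oplus>\<^sub>W j\<in>Y a. f (?w a j))"
  proof (rule W.M.finsum_cong')
   show "(\<lambda>a. \<Oplus>\<^sub>W j\<in>Y a. f (?w a j)) \<in> F \<rightarrow> carrier W" using fw by (auto intro!: W.M.finsum_closed)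
   show "f (?S a) = (\<Oplus>\<^sub>W j\<in>Y a. f (?w a j))" if "a \<in> F" for a
    by (rule linear_finsum[OF AV.vectorspace_axioms W f Y(1)[OF that]]) (use w[OF that] in auto)
  qed simp
  finally show ?thesis .
 qed
 show ?thesis
 proof (intro bexI[OF _ zA] conjI ballI)
  have "\<pi> (?w a j) = \<zero>\<^sub>B" if "a \<in> F" "j \<in> Y a" for a j
   using that uA[OF that] \<alpha>(1)[OF that(1)] i(3)[OF Y(2)[OF that]] by (simp add: p(3,6) \<pi>\<alpha> \<pi>\<iota> Y(2))
  then have pw: "(\<Oplus>\<^sub>B j\<in>Y a. \<pi> (?w a j)) = \<zero>\<^sub>B" if "a \<in> F" for a
   using that by (subst B.finsum_cong'[of _ "Y a" "\<lambda>_. \<zero>\<^sub>B"]) auto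
  have "\<pi> z = \<pi> (\<iota> b) \<oplus>\<^sub>B (\<Oplus>\<^sub>B a\<in>F. \<Oplus>\<^sub>B j\<in>Y a. \<pi> (?w a j))"
  proof -
   have f: "\<pi> \<in> module_hom K A B" by (rule p(1))
   have fw: "\<pi> (?w a j) \<in> carrier B" if "a \<in> F" "j \<in> Y a" for a j using module_homD(1)[OF f w[OF that]] .
   have "\<pi> z = \<pi> (\<iota> b) \<oplus>\<^sub>B \<pi> (\<Oplus>a\<in>F. ?S a)" unfolding z_def using module_homD(2)[OF f i(3)[OF b] SS] .
   also have "\<pi> (\<Oplus>a\<in>F. ?S a) = (\<Oplus>\<^sub>B a\<in>F. \<pi> (?S a))"
    by (rule linear_finsum[OF AV.vectorspace_axioms BV.vectorspace_axioms f F(1)]) (use S in auto)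
   also have "\<dots> = (\<Oplus>\<^sub>B a\<in>F. \<Oplus>\<^sub>B j\<in>Y a. \<pi> (?w a j))"
   proof (rule B.finsum_cong')
    show "(\<lambda>a. \<Oplus>\<^sub>B j\<in>Y a. \<pi> (?w a j)) \<in> F \<rightarrow> carrier B" using fw by (auto intro!: B.finsum_closed)
    show "\<pi> (?S a) = (\<Oplus>\<^sub>B j\<in>Y a. \<pi> (?w a j))" if "a \<in> F" for a
     by (rule linear_finsum[OF AV.vectorspace_axioms BV.vectorspace_axioms f Y(1)[OF that]]) (use w[OF that] in auto)
   qed simp
   finally show ?thesis .
  qed
  also have "(\<Oplus>\<^sub>B a\<in>F. \<Oplus>\<^sub>B j\<in>Y a. \<pi> (?w a j)) = (\<Oplus>\<^sub>B a\<in>F. \<zero>\<^sub>B)" using pw by (intro B.finsum_cong') auto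
  finally show "\<pi> z = b" using b by (simp add: \<pi>\<iota>)
  fix a \<phi> assume a: "a \<in> F" and \<phi>: "\<phi> \<in> carrier (I a)"
  have f: "(\<lambda>z. \<theta> a z \<phi>) \<in> module_hom K A A" by (rule \<theta>_lin[OF a \<phi>])
  have fw: "\<theta> a (?w c j) \<phi> \<in> carrier A" if "c \<in> F" "j \<in> Y c" for c j using module_homD(1)[OF f w[OF that]] .
  have \<phi>j: "\<phi> j \<in> carrier K" if "j \<in> Y a" for j
  proof (rule I_val[OF a \<phi>])
   have "j = e (s a) \<otimes>\<^sub>B j" using Y(3)[OF a that] by simp
   then show "j \<in> carrier (right_ideal_space B e (s a))" using Y(2)[OF a that] by (auto simp: right_ideal_simps)
  qed
  have "\<theta> a z \<phi> = \<theta> a (\<iota> b) \<phi> \<oplus> \<theta> a (\<Oplus>a\<in>F. ?S a) \<phi>" unfolding z_def using module_homD(2)[OF f i(3)[OF b] SS] .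
  also have "\<theta> a (\<Oplus>a\<in>F. ?S a) \<phi> = (\<Oplus>c\<in>F. \<theta> a (?S c) \<phi>)"
   by (rule linear_finsum[OF AV.vectorspace_axioms AV.vectorspace_axioms f F(1)]) (use S in auto)
  also have "\<dots> = (\<Oplus>c\<in>F. if a = c then (\<Oplus>j\<in>Y a. \<phi> j \<odot> u a j) else \<zero>)"
  proof (rule A.finsum_cong')
   have cl: "(\<Oplus>j\<in>Y a. \<phi> j \<odot> u a j) \<in> carrier A" using \<phi>j uA(1)[OF a] by (intro A.finsum_closed) auto
   then show "(\<lambda>c. if a = c then (\<Oplus>j\<in>Y a. \<phi> j \<odot> u a j) else \<zero>) \<in> F \<rightarrow> carrier A" by auto
   fix c assume c: "c \<in> F"
   have "\<theta> a (?S c) \<phi> = (\<Oplus>j\<in>Y c. \<theta> a (?w c j) \<phi>)"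
    by (rule linear_finsum[OF AV.vectorspace_axioms AV.vectorspace_axioms f Y(1)[OF c]]) (use w[OF c] in auto)
   also have "\<dots> = (\<Oplus>j\<in>Y c. if c = a then \<phi> j \<odot> u c j else \<zero>)"
    using \<phi>j uA[OF c] Y(2,3)[OF c] a c \<phi> by (intro A.finsum_cong') (auto simp: \<theta>_word)
   also have "\<dots> = (if a = c then (\<Oplus>j\<in>Y a. \<phi> j \<odot> u a j) else \<zero>)" by (cases "a = c") auto
   finally show "\<theta> a (?S c) \<phi> = (if a = c then (\<Oplus>j\<in>Y a. \<phi> j \<odot> u a j) else \<zero>)" .
  qed simp
  also have "\<dots> = (\<Oplus>j\<in>Y a. \<phi> j \<odot> u a j)"
  proof -
   have cl: "(\<Oplus>j\<in>Y a. \<phi> j \<odot> u a j) \<in> carrier A" using \<phi>j uA(1)[OF a] by (intro A.finsum_closed) auto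
   show ?thesis using A.finsum_singleton[OF a F(1), of "\<lambda>_. \<Oplus>j\<in>Y a. \<phi> j \<odot> u a j"] cl by auto
  qed
  also have "\<theta> a (\<iota> b) \<phi> = \<zero>" by (rule \<theta>\<iota>[OF a b \<phi>])
  finally show "\<theta> a z \<phi> = (\<Oplus>j\<in>Y a. \<phi> j \<odot> u a j)" using \<phi>j uA(1)[OF a] by (simp add: A.finsum_closed Pi_def)
 qed
qed

text \<open>A basis of \<open>s(a) B x\<close> with dual forms on \<open>s(a) B\<close>, and the expansion of linear maps on the part \<open>x (I a)\<close> of the dual.\<close>

definition column_basis :: "'v => 'f => 'b set => ('b => 'b => 'k) => bool" where
 "column_basis x a Y \<psi> \<longleftrightarrow> finite Y \<and> card Y = corner_dim K B e (s a) x \<and>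
   (\<forall>j\<in>Y. \<psi> j \<in> carrier (I a) \<and> j \<in> carrier B \<and> e (s a) \<otimes>\<^sub>B j = j \<and> j \<otimes>\<^sub>B e x = j) \<and>
   (\<forall>i\<in>Y. \<forall>j\<in>Y. \<psi> i j = (if i = j then \<one>\<^sub>K else \<zero>\<^sub>K)) \<and>
   (\<forall>h\<in>module_hom K (space_of B (I a)) A. \<forall>\<phi>\<in>carrier (I a). h (e x \<odot>\<^bsub>I a\<^esub> \<phi>) = (\<Oplus>j\<in>Y. \<phi> j \<odot> h (\<psi> j)))"

lemma column_basis_family:
 assumes x: "x \<in> V"
 shows "\<exists>Y \<psi>. \<forall>a\<in>F. column_basis x a (Y a) (\<psi> a)"
proof -
 have "\<exists>Y \<psi>. column_basis x a Y \<psi>" if a: "a \<in> F" for a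
 proof -
  have esB: "e (s a) \<in> carrier B" and V: "s a \<in> V" using e F a by auto
  obtain Y \<psi> where Y: "finite Y" "card Y = kdim K (B\<lparr>carrier := {e (s a) \<otimes>\<^sub>B b \<otimes>\<^sub>B e x | b. b \<in> carrier B}\<rparr>)"
   "Y \<subseteq> {e (s a) \<otimes>\<^sub>B b \<otimes>\<^sub>B e x | b. b \<in> carrier B}"
   "\<And>j. j \<in> Y ==> \<psi> j \<in> carrier (inj_module K B e (s a))"
   "\<And>i j. i \<in> Y ==> j \<in> Y ==> \<psi> i j = (if i = j then \<one>\<^sub>K else \<zero>\<^sub>K)"
   "\<And>v. v \<in> carrier (right_ideal_space B e (s a)) ==> v \<otimes>\<^sub>B e x = (\<Oplus>\<^sub>B j\<in>Y. \<psi> j v \<odot>\<^sub>B j)"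
   by (rule right_dual_basis[of K B e "s a" "e x", OF B fdB esB e(1)[OF x] e(2)[OF x]], rule that, assumption+)
  have jB: "j \<in> carrier B" "e (s a) \<otimes>\<^sub>B j = j" "j \<otimes>\<^sub>B e x = j" if j: "j \<in> Y" for j
  proof -
   obtain b where b: "b \<in> carrier B" "j = e (s a) \<otimes>\<^sub>B b \<otimes>\<^sub>B e x" using subsetD[OF Y(3) j] by blast
   show "j \<in> carrier B" using b esB e(1)[OF x] by simp
   show "e (s a) \<otimes>\<^sub>B j = j" using b esB e(1)[OF x] e(2)[OF V] by (simp add: B.m_assoc[symmetric])
   show "j \<otimes>\<^sub>B e x = j" using b esB e(1)[OF x] e(2)[OF x] by (simp add: B.m_assoc)
  qed
  have YS: "Y \<subseteq> carrier (right_ideal_space B e (s a))"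
  proof
   fix j assume j: "j \<in> Y"
   show "j \<in> carrier (right_ideal_space B e (s a))"
    unfolding right_ideal_simps(1) by (rule CollectI, rule exI[of _ j]) (simp add: jB(1,2)[OF j])
  qed
  have ex: "h (e x \<odot>\<^bsub>I a\<^esub> \<phi>) = (\<Oplus>j\<in>Y. \<phi> j \<odot> h (\<psi> j))"
   if "h \<in> module_hom K (space_of B (I a)) A" "\<phi> \<in> carrier (I a)" for h \<phi>
   by (rule expand_form[OF a Y(1,4) YS e(1)[OF x] Y(6) that(2,1)])
  have cd: "card Y = corner_dim K B e (s a) x" using Y(2) by (simp add: corner_dim_def corner_def)
  have "column_basis x a Y \<psi>"
   unfolding column_basis_def using Y(1) cd Y(4,5) jB ex by (intro conjI ballI) auto
  then show ?thesis by blast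
 qed
 then show ?thesis by metis
qed

context
 fixes x Y \<psi> assumes x: "x \<in> V" and cb: "\<forall>a\<in>F. column_basis x a (Y a) (\<psi> a)"
begin

lemma cbD:
 assumes "a \<in> F"
 shows "finite (Y a)" "card (Y a) = corner_dim K B e (s a) x"
  "j \<in> Y a ==> \<psi> a j \<in> carrier (I a)" "j \<in> Y a ==> j \<in> carrier B" "j \<in> Y a ==> e (s a) \<otimes>\<^sub>B j = j" "j \<in> Y a ==> j \<otimes>\<^sub>B e x = j"
  "i \<in> Y a ==> j \<in> Y a ==> \<psi> a i j = (if i = j then \<one>\<^sub>K else \<zero>\<^sub>K)"
  "h \<in> module_hom K (space_of B (I a)) A ==> \<phi> \<in> carrier (I a) ==> h (e x \<odot>\<^bsub>I a\<^esub> \<phi>) = (\<Oplus>j\<in>Y a. \<phi> j \<odot> h (\<psi> a j))"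
 using bspec[OF cb assms] unfolding column_basis_def by blast+

lemma jS: "a \<in> F ==> j \<in> Y a ==> j \<in> carrier (right_ideal_space B e (s a))"
 unfolding right_ideal_simps(1) by (rule CollectI, rule exI[of _ j]) (simp add: cbD(4,5))

text \<open>On \<open>A x\<close> the Fox derivatives only see the part \<open>s(a) B x\<close> of \<open>s(a) B\<close>, because the elements are fixed by right
 multiplication by \<open>x\<close>.\<close>

lemma \<theta>_idem:
 assumes "a \<in> F" "z \<in> carrier A" "\<phi> \<in> carrier (I a)"
 shows "\<theta> a (z \<otimes> eA x) \<phi> = \<theta> a z (e x \<odot>\<^bsub>I a\<^esub> \<phi>)"
 using \<theta>_mult[OF assms(1,2) eA(1)[OF x] assms(3)] \<theta>\<iota>[OF assms(1) e(1)[OF x] assms(3)] \<pi>\<iota>[OF e(1)[OF x]] assms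
  \<theta>_closed[OF assms(1,2) I_smult[OF assms(1) e(1)[OF x] assms(3)]] by simp

lemma column_ex:
 assumes b: "b \<in> carrier (proj_module B e x)" and u: "\<And>a j. a \<in> F ==> j \<in> Y a ==> u a j \<in> carrier (PA (t a))"
 shows "\<exists>z\<in>carrier (PA x). \<pi> z = b \<and> (\<forall>a\<in>F. \<forall>j\<in>Y a. \<theta> a z (\<psi> a j) = u a j)"
proof -
 have bB: "b \<in> carrier B" "b \<otimes>\<^sub>B e x = b" using b PB_mem[OF x] by auto
 have "\<exists>z\<in>carrier A. \<pi> z = b \<and>
  (\<forall>a\<in>F. \<forall>\<phi>\<in>carrier (I a). \<theta> a z \<phi> = (\<Oplus>j\<in>Y a. \<phi> j \<odot> u a j))"
  by (rule word_sum_exists) (simp_all add: cbD(1,4,5) bB(1) u del: proj_module_simps)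
 then obtain z where z: "z \<in> carrier A" "\<pi> z = b"
  "\<And>a \<phi>. a \<in> F ==> \<phi> \<in> carrier (I a) ==> \<theta> a z \<phi> = (\<Oplus>j\<in>Y a. \<phi> j \<odot> u a j)"
  by blast
 have "z \<otimes> eA x \<in> carrier (PA x)" using z(1) by auto
 moreover have "\<pi> (z \<otimes> eA x) = b" using p(6)[OF z(1) eA(1)[OF x]] z(2) \<pi>\<iota>[OF e(1)[OF x]] bB by simp
 moreover have "\<theta> a (z \<otimes> eA x) (\<psi> a k) = u a k" if a: "a \<in> F" and k: "k \<in> Y a" for a k
 proof -
  have \<psi>k: "\<psi> a k \<in> carrier (I a)" by (rule cbD(3)[OF a k])
  have uA: "u a j \<in> carrier A" if "j \<in> Y a" for j using u[OF a that] PA_mem[OF F(3)[OF a]] by blast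
  have "\<theta> a (z \<otimes> eA x) (\<psi> a k) = \<theta> a z (e x \<odot>\<^bsub>I a\<^esub> \<psi> a k)" by (rule \<theta>_idem[OF a z(1) \<psi>k])
  also have "\<dots> = (\<Oplus>j\<in>Y a. (e x \<odot>\<^bsub>I a\<^esub> \<psi> a k) j \<odot> u a j)"
   by (rule z(3)[OF a I_smult[OF a e(1)[OF x] \<psi>k]])
  also have "\<dots> = (\<Oplus>j\<in>Y a. if k = j then u a j else \<zero>)"
  proof (rule A.finsum_cong')
   fix j assume j: "j \<in> Y a"
   have "(e x \<odot>\<^bsub>I a\<^esub> \<psi> a k) j = \<psi> a k j" using jS[OF a j] cbD(6)[OF a j] by (simp add: inj_module_simps(4))
   then show "(e x \<odot>\<^bsub>I a\<^esub> \<psi> a k) j \<odot> u a j = (if k = j then u a j else \<zero>)"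
    using cbD(7)[OF a k j] uA[OF j] by simp
  qed (use uA in auto)
  also have "\<dots> = u a k" using A.finsum_singleton[OF k cbD(1)[OF a], of "u a"] uA by auto
  finally show ?thesis .
 qed
 ultimately show ?thesis by blast
qed

lemma column_inj:
 assumes z: "z \<in> carrier (PA x)" and "\<pi> z = \<zero>\<^sub>B"
  and \<theta>0: "\<And>a j. a \<in> F ==> j \<in> Y a ==> \<theta> a z (\<psi> a j) = \<zero>"
 shows "z = \<zero>"
proof (rule zero_if_components_zero)
 show zA: "z \<in> carrier A" and "\<pi> z = \<zero>\<^sub>B" using z PA_mem[OF x] assms(2) by auto
 have ze: "z \<otimes> eA x = z" using z PA_mem[OF x] by auto
 fix a \<phi> assume a: "a \<in> F" and \<phi>: "\<phi> \<in> carrier (I a)"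
 have "\<theta> a z \<phi> = \<theta> a z (e x \<odot>\<^bsub>I a\<^esub> \<phi>)" using \<theta>_idem[OF a zA \<phi>] ze by simp
 also have "\<dots> = (\<Oplus>j\<in>Y a. \<phi> j \<odot> \<theta> a z (\<psi> a j))" by (rule cbD(8)[OF a \<theta>_lin_form[OF a zA] \<phi>])
 also have "\<dots> = (\<Oplus>j\<in>Y a. \<zero>)" using \<theta>0[OF a] I_val[OF a \<phi> jS[OF a]] by (intro A.finsum_cong') auto
 finally show "\<theta> a z \<phi> = \<zero>" by simp
qed

lemma \<pi>_column: "\<pi> \<in> module_hom B (L x) (proj_module B e x)"
proof (rule module_homI)
 fix z assume "z \<in> carrier (L x)"
 then have z: "z \<in> carrier A" "z \<otimes> eA x = z" using PA_mem[OF x] by auto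
 show "\<pi> z \<in> carrier (proj_module B e x)"
  using p(6)[OF z(1) eA(1)[OF x]] z \<pi>\<iota>[OF e(1)[OF x]] p(3)[OF z(1)] PB_mem[OF x] by simp
 show "\<pi> (b \<odot>\<^bsub>L x\<^esub> z) = b \<odot>\<^bsub>proj_module B e x\<^esub> \<pi> z" if "b \<in> carrier B" for b
  using p(6)[OF i(3)[OF that] z(1)] \<pi>\<iota>[OF that] by simp
next
 fix z w assume "z \<in> carrier (L x)" "w \<in> carrier (L x)"
 then have "z \<in> carrier A" "w \<in> carrier A" using PA_mem[OF x] by auto
 then show "\<pi> (z \<oplus>\<^bsub>L x\<^esub> w) = \<pi> z \<oplus>\<^bsub>proj_module B e x\<^esub> \<pi> w" by (simp add: p(4))
qed

text \<open>Left multiplication by elements of \<open>B\<close> commutes with the Fox derivatives, since these vanish on \<open>B\<close>.\<close>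

lemma \<theta>_left:
 assumes a: "a \<in> F" and \<phi>: "\<phi> \<in> carrier (I a)" and b: "b \<in> carrier B" and z: "z \<in> carrier A"
 shows "\<theta> a (\<iota> b \<otimes> z) \<phi> = \<iota> b \<otimes> \<theta> a z \<phi>"
 using \<theta>_mult[OF a i(3)[OF b] z \<phi>] \<theta>\<iota>[OF a b I_smult[OF a p(3)[OF z] \<phi>]] i(3)[OF b] \<theta>_closed[OF a z \<phi>] by simp

lemma \<theta>_column:
 assumes a: "a \<in> F" and \<phi>: "\<phi> \<in> carrier (I a)"
 shows "(\<lambda>z. \<theta> a z \<phi>) \<in> module_hom B (L x) (L (t a))"
proof (rule module_homI)
 fix z assume "z \<in> carrier (L x)"
 then have z: "z \<in> carrier A" using PA_mem[OF x] by auto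
 show "\<theta> a z \<phi> \<in> carrier (L (t a))" using \<theta>_PA[OF a z \<phi>] by simp
 show "\<theta> a (b \<odot>\<^bsub>L x\<^esub> z) \<phi> = b \<odot>\<^bsub>L (t a)\<^esub> \<theta> a z \<phi>" if "b \<in> carrier B" for b
  using \<theta>_left[OF a \<phi> that z] by simp
next
 fix z w assume "z \<in> carrier (L x)" "w \<in> carrier (L x)"
 then have "z \<in> carrier A" "w \<in> carrier A" using PA_mem[OF x] by auto
 then show "\<theta> a (z \<oplus>\<^bsub>L x\<^esub> w) \<phi> = \<theta> a z \<phi> \<oplus>\<^bsub>L (t a)\<^esub> \<theta> a w \<phi>" using module_homD(2)[OF \<theta>_lin[OF a \<phi>]] by simp
qed

end

lemma fin_dim_PB: "x \<in> V ==> kfin_dim K (space_of B (proj_module B e x))"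
 by (rule fin_dim_proj_module[of K B e x, OF B fdB e(1)])

lemma column_ex':
 assumes x: "x \<in> V" and cb: "\<forall>a\<in>F. column_basis x a (Y a) (\<psi> a)"
  and w0: "w0 \<in> carrier (proj_module B e x)" and w: "\<And>i. i \<in> Sigma F Y ==> w i \<in> carrier (L (t (fst i)))"
 shows "\<exists>z\<in>carrier (PA x). \<pi> z = w0 \<and> (\<forall>i\<in>Sigma F Y. \<theta> (fst i) z (\<psi> (fst i) (snd i)) = w i)"
proof -
 have "\<exists>z\<in>carrier (PA x). \<pi> z = w0 \<and> (\<forall>a\<in>F. \<forall>j\<in>Y a. \<theta> a z (\<psi> a j) = w (a, j))"
  by (rule column_ex[OF x cb w0]) (use w[of "(_, _)"] in simp)
 then show ?thesis by auto
qed

text \<open>One step of the recursion for \<open>A x\<close>: only arrows \<open>a\<close> with \<open>s(a) B x \<noteq> 0\<close> occur, which is what the induction along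
 relative paths needs.\<close>

lemma fin_dim_L_step:
 assumes x: "x \<in> V" and fd: "\<And>a. a \<in> F ==> corner_nz B e (s a) x ==> kfin_dim K (space_of B (L (t a)))"
 shows "kfin_dim K (space_of B (L x))"
proof -
 obtain Y \<psi> where cb: "\<forall>a\<in>F. column_basis x a (Y a) (\<psi> a)" using column_basis_family[OF x] by blast
 note c = cbD[OF x cb]
 have nz: "corner_nz B e (s a) x" if "a \<in> F" "Y a \<noteq> {}" for a
 proof (rule ccontr)
  assume "\<not> corner_nz B e (s a) x"
  then have "corner B e (s a) x = B\<lparr>carrier := {\<zero>\<^sub>B}\<rparr>" by (simp add: corner_nz_def corner_def)
  then have "corner_dim K B e (s a) x = 0" using fin_dim_zero_space(3)[OF BV.vectorspace_axioms] by (simp add: corner_dim_def)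
  then show False using c(1,2)[OF that(1)] that(2) by auto
 qed
 show ?thesis
 proof (rule dim_jointly_bijective(1)[where J = "Sigma F Y" and W = "\<lambda>i. space_of B (L (t (fst i)))"
    and ?T0.0 = \<pi> and T = "\<lambda>i z. \<theta> (fst i) z (\<psi> (fst i) (snd i))"])
  show "vectorspace K (space_of B (L x))" by (rule vectorspace_underlying_space[OF B Lmod[OF x]])
  show "vectorspace K (space_of B (proj_module B e x))" by (rule vectorspace_underlying_space[OF B PBmod[OF x]])
  show "kfin_dim K (space_of B (proj_module B e x))" by (rule fin_dim_PB[OF x])
  show "finite (Sigma F Y)" using F(1) c(1) by auto
  show "vectorspace K (space_of B (L (t (fst i))))" if "i \<in> Sigma F Y" for i
   by (rule vectorspace_underlying_space[OF B Lmod]) (use that F(3) in auto)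
  show "kfin_dim K (space_of B (L (t (fst i))))" if "i \<in> Sigma F Y" for i
   by (rule fd[OF _ nz]) (use that in auto)
  show "\<pi> \<in> module_hom K (space_of B (L x)) (space_of B (proj_module B e x))"
   by (rule module_hom_underlying[OF B \<pi>_column[OF x cb]])
  show "(\<lambda>z. \<theta> (fst i) z (\<psi> (fst i) (snd i))) \<in> module_hom K (space_of B (L x)) (space_of B (L (t (fst i))))"
   if "i \<in> Sigma F Y" for i
   by (rule module_hom_underlying[OF B \<theta>_column[OF x cb]]) (use that c(3) in auto)
  show "\<exists>v\<in>carrier (space_of B (L x)). \<pi> v = w0 \<and> (\<forall>i\<in>Sigma F Y. \<theta> (fst i) v (\<psi> (fst i) (snd i)) = w i)"
   if "w0 \<in> carrier (space_of B (proj_module B e x))"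
    "\<And>i. i \<in> Sigma F Y ==> w i \<in> carrier (space_of B (L (t (fst i))))" for w0 w
   using column_ex'[OF x cb, of w0 w] that by simp
  show "v = \<zero>\<^bsub>space_of B (L x)\<^esub>"
   if "v \<in> carrier (space_of B (L x))" "\<pi> v = \<zero>\<^bsub>space_of B (proj_module B e x)\<^esub>"
    "\<And>i. i \<in> Sigma F Y ==> \<theta> (fst i) v (\<psi> (fst i) (snd i)) = \<zero>\<^bsub>space_of B (L (t (fst i)))\<^esub>" for v
  proof -
   have "v = \<zero>" by (rule column_inj[OF x cb]) (use that(1,2) that(3)[of "(_, _)"] in simp_all)
   then show ?thesis by simp
  qed
 qed
qed

lemma corner_mem:
 assumes "ring R" "f y \<in> carrier R" "f x \<in> carrier R" "f y \<otimes>\<^sub>R f y = f y" "f x \<otimes>\<^sub>R f x = f x"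
 shows "z \<in> carrier (corner R f y x) \<longleftrightarrow> z \<in> carrier R \<and> f y \<otimes>\<^sub>R z = z \<and> z \<otimes>\<^sub>R f x = z"
proof -
 interpret R: ring R by fact
 show ?thesis
 proof
  assume "z \<in> carrier (corner R f y x)"
  then obtain b where b: "b \<in> carrier R" "z = f y \<otimes>\<^sub>R b \<otimes>\<^sub>R f x" by (auto simp: corner_def)
  have "f y \<otimes>\<^sub>R z = z" using b assms by (simp add: R.m_assoc[symmetric])
  moreover have "z \<otimes>\<^sub>R f x = z" using b assms by (simp add: R.m_assoc)
  ultimately show "z \<in> carrier R \<and> f y \<otimes>\<^sub>R z = z \<and> z \<otimes>\<^sub>R f x = z" using b assms by simp
 next
  assume z: "z \<in> carrier R \<and> f y \<otimes>\<^sub>R z = z \<and> z \<otimes>\<^sub>R f x = z"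
  then have "z = f y \<otimes>\<^sub>R z \<otimes>\<^sub>R f x" by simp
  then show "z \<in> carrier (corner R f y x)" using z unfolding corner_def by (auto intro!: exI[of _ z])
 qed
qed

lemma cornerA: "y \<in> V ==> x \<in> V ==> z \<in> carrier (corner A eA y x) \<longleftrightarrow> z \<in> carrier A \<and> eA y \<otimes> z = z \<and> z \<otimes> eA x = z"
 by (rule corner_mem) (auto simp: A.ring_axioms eA)

lemma cornerB: "y \<in> V ==> x \<in> V ==> z \<in> carrier (corner B e y x) \<longleftrightarrow> z \<in> carrier B \<and> e y \<otimes>\<^sub>B z = z \<and> z \<otimes>\<^sub>B e x = z"
 by (rule corner_mem) (auto simp: B.ring_axioms e)

lemma corner_ops [simp]: "add (corner R f y x) = add R" "zero (corner R f y x) = zero R" "smult (corner R f y x) = smult R"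
 by (simp_all add: corner_def)

text \<open>The decomposition of \<open>A x\<close> restricted to the elements fixed by left multiplication by \<open>y\<close>.\<close>

lemma corner_dim_step:
 assumes x: "x \<in> V" and y: "y \<in> V" and fdA: "kfin_dim K A"
 shows "corner_dim K A eA y x = corner_dim K B e y x + (\<Sum>a\<in>F. corner_dim K B e (s a) x * corner_dim K A eA y (t a))"
proof -
 obtain Y \<psi> where cb: "\<forall>a\<in>F. column_basis x a (Y a) (\<psi> a)" using column_basis_family[OF x] by blast
 note c = cbD[OF x cb]
 have csA: "vectorspace K (corner A eA y' x')" "kfin_dim K (corner A eA y' x')" if "y' \<in> V" "x' \<in> V" for y' x'
  using corner_space[OF A eA(1)[OF that(1)] eA(1)[OF that(2)]] fdA by (simp_all add: corner_def)
 have csB: "vectorspace K (corner B e y x)" "kfin_dim K (corner B e y x)"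
  using corner_space[OF B e(1)[OF y] e(1)[OF x]] fdB by (simp_all add: corner_def)
 have PAz: "z \<in> carrier (PA x)" if "z \<in> carrier (corner A eA y x)" for z using that cornerA[OF y x] PA_mem[OF x] by blast
 have "kdim K (corner A eA y x) = kdim K (corner B e y x) +
  (\<Sum>i\<in>Sigma F Y. kdim K (corner A eA y (t (fst i))))"
 proof (rule dim_jointly_bijective(2)[where J = "Sigma F Y" and W = "\<lambda>i. corner A eA y (t (fst i))"
    and ?T0.0 = \<pi> and T = "\<lambda>i z. \<theta> (fst i) z (\<psi> (fst i) (snd i))"])
  show "vectorspace K (corner A eA y x)" by (rule csA(1)[OF y x])
  show "vectorspace K (corner B e y x)" "kfin_dim K (corner B e y x)" by (rule csB)+
  show "finite (Sigma F Y)" using F(1) c(1) by auto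
  show "vectorspace K (corner A eA y (t (fst i)))" "kfin_dim K (corner A eA y (t (fst i)))" if "i \<in> Sigma F Y" for i
   using csA[OF y, of "t (fst i)"] that F(3) by auto
  show "\<pi> \<in> module_hom K (corner A eA y x) (corner B e y x)"
  proof (rule module_homI)
   fix z assume "z \<in> carrier (corner A eA y x)"
   then have z: "z \<in> carrier A" "eA y \<otimes> z = z" "z \<otimes> eA x = z" using cornerA[OF y x] by auto
   show "\<pi> z \<in> carrier (corner B e y x)"
    using p(6)[OF z(1) eA(1)[OF x]] p(6)[OF eA(1)[OF y] z(1)] z \<pi>\<iota>[OF e(1)[OF x]] \<pi>\<iota>[OF e(1)[OF y]] p(3)[OF z(1)] cornerB[OF y x] by simp
   show "\<pi> (k \<odot>\<^bsub>corner A eA y x\<^esub> z) = k \<odot>\<^bsub>corner B e y x\<^esub> \<pi> z" if "k \<in> carrier K" for k using p(5)[OF that z(1)] by simp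
  qed (use cornerA[OF y x] p(4) in auto)
  show "(\<lambda>z. \<theta> (fst i) z (\<psi> (fst i) (snd i))) \<in> module_hom K (corner A eA y x) (corner A eA y (t (fst i)))" if "i \<in> Sigma F Y" for i
  proof -
   have a: "fst i \<in> F" and j: "\<psi> (fst i) (snd i) \<in> carrier (I (fst i))" using that c(3) by auto
   note l = module_homD[OF \<theta>_lin[OF a j]]
   show ?thesis
   proof (rule module_homI)
    fix z assume "z \<in> carrier (corner A eA y x)"
    then have z: "z \<in> carrier A" "eA y \<otimes> z = z" using cornerA[OF y x] by auto
    show "\<theta> (fst i) z (\<psi> (fst i) (snd i)) \<in> carrier (corner A eA y (t (fst i)))"
     using \<theta>_left[OF x cb a j e(1)[OF y] z(1)] z \<theta>_PA[OF a z(1) j] PA_mem[OF F(3)[OF a]] cornerA[OF y F(3)[OF a]] by simp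
    show "\<theta> (fst i) (k \<odot>\<^bsub>corner A eA y x\<^esub> z) (\<psi> (fst i) (snd i)) = k \<odot>\<^bsub>corner A eA y (t (fst i))\<^esub> \<theta> (fst i) z (\<psi> (fst i) (snd i))"
     if "k \<in> carrier K" for k using l(3)[OF that z(1)] by simp
   qed (use cornerA[OF y x] l(2) in auto)
  qed
  show "\<exists>z\<in>carrier (corner A eA y x). \<pi> z = w0 \<and> (\<forall>i\<in>Sigma F Y. \<theta> (fst i) z (\<psi> (fst i) (snd i)) = w i)"
   if w0: "w0 \<in> carrier (corner B e y x)" and w: "\<And>i. i \<in> Sigma F Y ==> w i \<in> carrier (corner A eA y (t (fst i)))" for w0 w
  proof -
   have w0': "w0 \<in> carrier (proj_module B e x)" using w0 cornerB[OF y x] PB_mem[OF x] by blast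
   have w': "w i \<in> carrier (L (t (fst i)))" if "i \<in> Sigma F Y" for i
   proof -
    have tV: "t (fst i) \<in> V" using that F(3) by auto
    have "w i \<in> carrier A \<and> w i \<otimes> eA (t (fst i)) = w i" using w[OF that] cornerA[OF y tV] by blast
    then show ?thesis using PA_mem[OF tV] unfolding pull_module_simps(1) by blast
   qed
   obtain z where z: "z \<in> carrier (PA x)" "\<pi> z = w0" "\<forall>i\<in>Sigma F Y. \<theta> (fst i) z (\<psi> (fst i) (snd i)) = w i"
    using column_ex'[OF x cb w0' w'] by blast
   have zA: "z \<in> carrier A" "z \<otimes> eA x = z" using z(1) PA_mem[OF x] by auto
   let ?z = "eA y \<otimes> z"
   have zz: "?z \<in> carrier (corner A eA y x)" using zA eA[OF y] eA(1)[OF x] cornerA[OF y x] by (simp add: A.m_assoc A.m_assoc[symmetric])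
   have "\<pi> ?z = w0" using p(6)[OF eA(1)[OF y] zA(1)] \<pi>\<iota>[OF e(1)[OF y]] z(2) w0 cornerB[OF y x] by simp
   moreover have "\<theta> (fst i) ?z (\<psi> (fst i) (snd i)) = w i" if ii: "i \<in> Sigma F Y" for i
   proof -
    have a: "fst i \<in> F" and j: "\<psi> (fst i) (snd i) \<in> carrier (I (fst i))" using ii c(3) by auto
    show ?thesis using \<theta>_left[OF x cb a j e(1)[OF y] zA(1)] z(3) ii w[OF ii] cornerA[OF y F(3)[OF a]] by auto
   qed
   ultimately show ?thesis using zz by blast
  qed
  show "v = \<zero>\<^bsub>corner A eA y x\<^esub>"
   if v: "v \<in> carrier (corner A eA y x)" "\<pi> v = \<zero>\<^bsub>corner B e y x\<^esub>"
    "\<And>i. i \<in> Sigma F Y ==> \<theta> (fst i) v (\<psi> (fst i) (snd i)) = \<zero>\<^bsub>corner A eA y (t (fst i))\<^esub>" for v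
  proof -
   have "v = \<zero>" by (rule column_inj[OF x cb PAz[OF v(1)]]) (use v(2) v(3)[of "(_, _)"] in simp_all)
   then show ?thesis by simp
  qed
 qed
 also have "(\<Sum>i\<in>Sigma F Y. kdim K (corner A eA y (t (fst i)))) = (\<Sum>a\<in>F. \<Sum>j\<in>Y a. kdim K (corner A eA y (t a)))"
  using sum.Sigma[OF F(1), of Y "\<lambda>a j. kdim K (corner A eA y (t a))"] c(1) by (simp add: case_prod_unfold)
 also have "\<dots> = (\<Sum>a\<in>F. corner_dim K B e (s a) x * corner_dim K A eA y (t a))"
  by (rule sum.cong) (auto simp: c(2) corner_dim_def)
 finally show ?thesis by (simp add: corner_dim_def)
qed

text \<open>The decomposition of \<open>A x\<close> as a left \<open>B\<close>-module, under the functor \<open>Hom\<^sub>k(M, _)\<close>.\<close>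

lemma excess_step:
 assumes x: "x \<in> V" and fd: "\<And>a. a \<in> F ==> kfin_dim K (space_of B (L (t a)))"
  and M: "left_module B M" "kfin_dim K (space_of B M)"
 shows "derivation_excess K B (hom_bimodule K B M (L x)) = derivation_excess K B (hom_bimodule K B M (proj_module B e x)) +
  (\<Sum>a\<in>F. int (corner_dim K B e (s a) x) * derivation_excess K B (hom_bimodule K B M (L (t a))))"
proof -
 obtain Y \<psi> where cb: "\<forall>a\<in>F. column_basis x a (Y a) (\<psi> a)" using column_basis_family[OF x] by blast
 note c = cbD[OF x cb]
 have "derivation_excess K B (hom_bimodule K B M (L x)) = derivation_excess K B (hom_bimodule K B M (proj_module B e x)) +
   (\<Sum>i\<in>Sigma F Y. derivation_excess K B (hom_bimodule K B M (L (t (fst i)))))"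
 proof (rule hom_bimodule_excess_additive[OF B fdB M Lmod[OF x] PBmod[OF x] fin_dim_PB[OF x], where J = "Sigma F Y" and W = "\<lambda>i. L (t (fst i))"
    and ?T0.0 = \<pi> and T = "\<lambda>i z. \<theta> (fst i) z (\<psi> (fst i) (snd i))"])
  show "finite (Sigma F Y)" using F(1) c(1) by auto
  show "left_module B (L (t (fst i)))" if "i \<in> Sigma F Y" for i by (rule Lmod) (use that F(3) in auto)
  show "kfin_dim K (space_of B (L (t (fst i))))" if "i \<in> Sigma F Y" for i by (rule fd) (use that in auto)
  show "\<pi> \<in> module_hom B (L x) (proj_module B e x)" by (rule \<pi>_column[OF x cb])
  show "(\<lambda>z. \<theta> (fst i) z (\<psi> (fst i) (snd i))) \<in> module_hom B (L x) (L (t (fst i)))" if "i \<in> Sigma F Y" for i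
   by (rule \<theta>_column[OF x cb]) (use that c(3) in auto)
  show "\<exists>v\<in>carrier (L x). \<pi> v = w0 \<and> (\<forall>i\<in>Sigma F Y. \<theta> (fst i) v (\<psi> (fst i) (snd i)) = w i)"
   if "w0 \<in> carrier (proj_module B e x)" "\<And>i. i \<in> Sigma F Y ==> w i \<in> carrier (L (t (fst i)))" for w0 w
   using column_ex'[OF x cb, of w0 w] that by simp
  show "v = \<zero>\<^bsub>L x\<^esub>"
   if "v \<in> carrier (L x)" "\<pi> v = \<zero>\<^bsub>proj_module B e x\<^esub>"
    "\<And>i. i \<in> Sigma F Y ==> \<theta> (fst i) v (\<psi> (fst i) (snd i)) = \<zero>\<^bsub>L (t (fst i))\<^esub>" for v
  proof -
   have "v = \<zero>" by (rule column_inj[OF x cb]) (use that(1,2) that(3)[of "(_, _)"] in simp_all)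
   then show ?thesis by simp
  qed
 qed
 also have "(\<Sum>i\<in>Sigma F Y. derivation_excess K B (hom_bimodule K B M (L (t (fst i))))) =
   (\<Sum>a\<in>F. \<Sum>j\<in>Y a. derivation_excess K B (hom_bimodule K B M (L (t a))))"
  using sum.Sigma[OF F(1), of Y "\<lambda>a j. derivation_excess K B (hom_bimodule K B M (L (t a)))"] c(1) by (simp add: case_prod_unfold)
 also have "\<dots> = (\<Sum>a\<in>F. int (corner_dim K B e (s a) x) * derivation_excess K B (hom_bimodule K B M (L (t a))))"
  by (rule sum.cong) (auto simp: c(2))
 finally show ?thesis .
qed

end

section \<open>The extended algebra as a bimodule\<close>

context arrow_extension
begin

abbreviation "XA \<equiv> restrict_scalars \<iota> (regular_bimodule A)"

lemma corner_dim_zero: "\<not> corner_nz B e y x ==> corner_dim K B e y x = 0"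
proof -
 assume "\<not> corner_nz B e y x"
 then have "corner B e y x = B\<lparr>carrier := {\<zero>\<^sub>B}\<rparr>" by (simp add: corner_nz_def corner_def)
 then show "corner_dim K B e y x = 0" using fin_dim_zero_space(3)[OF BV.vectorspace_axioms] by (simp add: corner_dim_def)
qed

lemma XA_bimodule: "bimodule K B XA"
 by (rule bimodule_restrict_scalars[OF bimodule_regular[OF A] B \<iota>])

lemma XA_simps [simp]: "carrier XA = carrier A" "zero XA = zero A" "add XA = add A" "smult XA = smult A"
 "lact XA b z = \<iota> b \<otimes> z" "ract XA b z = z \<otimes> \<iota> b"
 by (simp_all add: restrict_scalars_def regular_bimodule_def)

lemma regular_simps [simp]: "carrier (regular_bimodule R) = carrier R" "zero (regular_bimodule R) = zero R"
 "add (regular_bimodule R) = add R" "smult (regular_bimodule R) = smult R"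
 "lact (regular_bimodule R) b z = b \<otimes>\<^sub>R z" "ract (regular_bimodule R) b z = z \<otimes>\<^sub>R b"
 by (simp_all add: regular_bimodule_def)

lemma \<pi>_component: "\<pi> \<in> bimodule_homs K B XA (regular_bimodule B)"
 unfolding bimodule_homs_def
 by (intro CollectI conjI module_homI) (auto simp: p(3-6) i(3) \<pi>\<iota>)

lemma L_homs: "a \<in> F ==> homs K (space_of B (I a)) (space_of B (L (t a))) =
  homs K (space_of B (I a)) (space_of A (PA (t a)))"
proof -
 have id: "(\<lambda>x. x) \<in> algebra_homs K B B" by (auto simp: algebra_homs_def intro: module_homI)
 have "homs K (space_of B (pull_module (\<lambda>x. x) (I a))) (space_of B (L (t a))) =
  homs K (space_of B (I a)) (space_of A (PA (t a)))" by (rule homs_pull_module[OF B id \<iota>])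
 moreover have "homs K (space_of B (pull_module (\<lambda>x. x) (I a))) (space_of B (L (t a))) =
  homs K (space_of B (I a)) (space_of B (L (t a)))"
  unfolding homs_def module_hom_def' by simp
 ultimately show ?thesis by simp
qed

text \<open>A derivation on \<open>A\<close> that vanishes on \<open>B\<close> is linear over \<open>B\<close> on both sides, by the product rule.\<close>

lemma \<theta>_component:
 assumes a: "a \<in> F"
 shows "\<theta> a \<in> bimodule_homs K B XA (hom_bimodule K B (I a) (L (t a)))"
proof -
 note d = \<theta>a[OF a]
 have ext: "\<theta> a z \<in> extensional (carrier (I a))" if "z \<in> carrier A" for z
  using homsD(5)[OF \<theta>_hom[OF a that]] by simp
 have cl: "\<theta> a z \<phi> \<in> carrier A" if "z \<in> carrier A" "\<phi> \<in> carrier (I a)" for z \<phi> by (rule \<theta>_closed[OF a that])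
 note lin = module_homD[OF \<theta>_lin[OF a]]
 show ?thesis unfolding bimodule_homs_def
 proof (intro CollectI conjI module_homI ballI)
  fix z assume "z \<in> carrier XA"
  then have z: "z \<in> carrier A" by simp
  show "\<theta> a z \<in> carrier (hom_bimodule K B (I a) (L (t a)))"
   using \<theta>_hom[OF a z] L_homs[OF a] by (simp add: hom_bimodule_simps(1))
  show "\<theta> a (k \<odot>\<^bsub>XA\<^esub> z) = k \<odot>\<^bsub>hom_bimodule K B (I a) (L (t a))\<^esub> \<theta> a z" if k: "k \<in> carrier K" for k
  proof (rule extensional_eqI[OF ext])
   fix \<phi> assume f: "\<phi> \<in> carrier (I a)"
   show "\<theta> a (k \<odot>\<^bsub>XA\<^esub> z) \<phi> = (k \<odot>\<^bsub>hom_bimodule K B (I a) (L (t a))\<^esub> \<theta> a z) \<phi>"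
    using lin(3)[OF f k z] f scalar_hom[OF B \<iota> k] A_scalar[OF k cl[OF z f]] by (simp add: hom_bimodule_simps)
  qed (use k z in \<open>auto simp: hom_bimodule_simps\<close>)
  fix b assume b: "b \<in> carrier B"
  note ib = i(3)[OF b]
  show "\<theta> a (lact XA b z) = lact (hom_bimodule K B (I a) (L (t a))) b (\<theta> a z)"
  proof (rule extensional_eqI[OF ext])
   fix \<phi> assume f: "\<phi> \<in> carrier (I a)"
   show "\<theta> a (lact XA b z) \<phi> = lact (hom_bimodule K B (I a) (L (t a))) b (\<theta> a z) \<phi>"
    using \<theta>_mult[OF a ib z f] \<theta>\<iota>[OF a b I_smult[OF a p(3)[OF z] f]] f ib cl[OF z f] by (simp add: hom_bimodule_simps)
  qed (use ib z in \<open>auto simp: hom_bimodule_simps\<close>)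
  show "\<theta> a (ract XA b z) = ract (hom_bimodule K B (I a) (L (t a))) b (\<theta> a z)"
  proof (rule extensional_eqI[OF ext])
   fix \<phi> assume f: "\<phi> \<in> carrier (I a)"
   show "\<theta> a (ract XA b z) \<phi> = ract (hom_bimodule K B (I a) (L (t a))) b (\<theta> a z) \<phi>"
    using \<theta>_mult[OF a z ib f] \<theta>\<iota>[OF a b f] f z cl[OF z I_smult[OF a b f]] \<pi>\<iota>[OF b] by (simp add: hom_bimodule_simps)
  qed (use ib z in \<open>auto simp: hom_bimodule_simps\<close>)
 next
  fix z w assume "z \<in> carrier XA" "w \<in> carrier XA"
  then have z: "z \<in> carrier A" and w: "w \<in> carrier A" by auto
  show "\<theta> a (z \<oplus>\<^bsub>XA\<^esub> w) = \<theta> a z \<oplus>\<^bsub>hom_bimodule K B (I a) (L (t a))\<^esub> \<theta> a w"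
  proof (rule extensional_eqI[OF ext])
   fix \<phi> assume f: "\<phi> \<in> carrier (I a)"
   show "\<theta> a (z \<oplus>\<^bsub>XA\<^esub> w) \<phi> = (\<theta> a z \<oplus>\<^bsub>hom_bimodule K B (I a) (L (t a))\<^esub> \<theta> a w) \<phi>"
    using lin(2)[OF f z w] f by (simp add: hom_bimodule_simps)
  qed (use z w in \<open>auto simp: hom_bimodule_simps\<close>)
 qed
qed

text \<open>A linear map on \<open>I a\<close> is given by its values on a dual basis, so it is the Fox derivative of a sum of words.\<close>

lemma components_exist:
 assumes b: "b \<in> carrier B" and w: "\<And>a. a \<in> F ==> w a \<in> homs K (space_of B (I a)) (space_of A (PA (t a)))"
 shows "\<exists>z\<in>carrier A. \<pi> z = b \<and> (\<forall>a\<in>F. \<theta> a z = w a)"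
proof -
 obtain Y \<psi> where d: "\<forall>a\<in>F. dual_basis a (Y a) (\<psi> a)" using dual_basis_family by blast
 have Y: "finite (Y a)" "j \<in> Y a ==> \<psi> a j \<in> carrier (I a)" "j \<in> Y a ==> j \<in> carrier B"
   "j \<in> Y a ==> e (s a) \<otimes>\<^sub>B j = j"
  "h \<in> module_hom K (space_of B (I a)) A ==> \<phi> \<in> carrier (I a) ==> h \<phi> = (\<Oplus>j\<in>Y a. \<phi> j \<odot> h (\<psi> a j))"
  if "a \<in> F" for a j h \<phi>
  using bspec[OF d that] unfolding dual_basis_def by blast+
 have u: "w a (\<psi> a j) \<in> carrier (PA (t a))" if "a \<in> F" "j \<in> Y a" for a j
  using homsD(1)[OF w[OF that(1)]] Y(2)[OF that] by simp
 have "\<exists>z\<in>carrier A. \<pi> z = b \<and>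
  (\<forall>a\<in>F. \<forall>\<phi>\<in>carrier (I a). \<theta> a z \<phi> = (\<Oplus>j\<in>Y a. \<phi> j \<odot> w a (\<psi> a j)))"
  by (rule word_sum_exists[OF Y(1) Y(3) Y(4) b u])
 then obtain z where z: "z \<in> carrier A" "\<pi> z = b"
  "\<And>a \<phi>. a \<in> F ==> \<phi> \<in> carrier (I a) ==> \<theta> a z \<phi> = (\<Oplus>j\<in>Y a. \<phi> j \<odot> w a (\<psi> a j))" by blast
 have "\<theta> a z = w a" if a: "a \<in> F" for a
 proof (rule extensional_eqI)
  show "\<theta> a z \<in> extensional (carrier (I a))" using homsD(5)[OF \<theta>_hom[OF a z(1)]] by simp
  show "w a \<in> extensional (carrier (I a))" using homsD(5)[OF w[OF a]] by simp
  fix \<phi> assume f: "\<phi> \<in> carrier (I a)"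
  show "\<theta> a z \<phi> = w a \<phi>" using z(3)[OF a f] Y(5)[OF a fox_hom[OF F(3)[OF a] w[OF a]] f] by simp
 qed
 then show ?thesis using z by blast
qed

context
 assumes no_cycles: "rel_cycles B e F s t = {}"
begin

lemma fin_dim_L: "c \<in> F ==> kfin_dim K (space_of B (L (t c)))"
proof (erule rel_path_induct[OF F(1) no_cycles])
 fix c assume c: "c \<in> F" and IH: "\<And>a. a \<in> F ==> corner_nz B e (s a) (t c) ==> kfin_dim K (space_of B (L (t a)))"
 show "kfin_dim K (space_of B (L (t c)))" by (rule fin_dim_L_step[OF F(3)[OF c]]) (rule IH)
qed

lemma fox_hom_fin_dim:
 assumes a: "a \<in> F" and x: "x \<in> V" and fd: "kfin_dim K (space_of B N)" and N: "left_module B N"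
 shows "int (kdim K (Ext1 B (I a) N)) - int (kdim K (Hom_space B (I a) N)) =
    derivation_excess K B (hom_bimodule K B (I a) N)"
  "kfin_dim K (hom_bimodule K B (I a) N)"
proof -
 note tm = two_modules.intro[OF B fdB IB(1)[OF a] N IB(2)[OF a] fd]
 show "int (kdim K (Ext1 B (I a) N)) - int (kdim K (Hom_space B (I a) N)) =
    derivation_excess K B (hom_bimodule K B (I a) N)"
  "kfin_dim K (hom_bimodule K B (I a) N)" by (rule two_modules.dim_Ext1_minus_dim_Hom[OF tm])+
qed

text \<open>The bimodule \<open>A\<close> over \<open>B\<close> has the components \<open>B\<close> and \<open>Hom\<^sub>k(I a, A t(a))\<close>. Finite-dimensionality of \<open>A\<close> itself is a
 consequence.\<close>

lemma excess_XA:
 "kfin_dim K XA"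
 "derivation_excess K B XA = derivation_excess K B (regular_bimodule B) +
   (\<Sum>a\<in>F. derivation_excess K B (hom_bimodule K B (I a) (L (t a))))"
proof -
 have H: "bimodule K B (hom_bimodule K B (I a) (L (t a)))" "kfin_dim K (hom_bimodule K B (I a) (L (t a)))" if a: "a \<in> F" for a
  using bimodule_hom_bimodule[OF B IB(1)[OF a] Lmod[OF F(3)[OF a]]] fox_hom_fin_dim(2)[OF a F(3)[OF a] fin_dim_L[OF a] Lmod[OF F(3)[OF a]]] by auto
 have vsRB: "vectorspace K (regular_bimodule B)" using bimodule.vs[OF bimodule_regular[OF B]] .
 have fdRB: "kfin_dim K (regular_bimodule B)"
  by (rule dim_cong(1)[OF vsRB BV.vectorspace_axioms fdB]) auto
 have ex: "\<exists>v\<in>carrier XA. \<pi> v = w0 \<and> (\<forall>a\<in>F. \<theta> a v = w a)"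
  if "w0 \<in> carrier (regular_bimodule B)" "\<And>a. a \<in> F ==> w a \<in> carrier (hom_bimodule K B (I a) (L (t a)))" for w0 w
  using components_exist[of w0 w] that L_homs by (simp add: hom_bimodule_simps(1))
 have inj: "v = \<zero>\<^bsub>XA\<^esub>" if "v \<in> carrier XA" "\<pi> v = \<zero>\<^bsub>regular_bimodule B\<^esub>"
   "\<And>a. a \<in> F ==> \<theta> a v = \<zero>\<^bsub>hom_bimodule K B (I a) (L (t a))\<^esub>" for v
  using zero_if_components_zero[of v] that by (simp add: hom_bimodule_simps(2))
 note ad = derivation_excess_additive[OF B fdB XA_bimodule bimodule_regular[OF B] fdRB F(1), of "\<lambda>a. hom_bimodule K B (I a) (L (t a))" \<pi> \<theta>,
   OF H(1) H(2) \<pi>_component \<theta>_component ex inj]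
 show "kfin_dim K XA" by (rule ad(1))
 show "derivation_excess K B XA = derivation_excess K B (regular_bimodule B) +
   (\<Sum>a\<in>F. derivation_excess K B (hom_bimodule K B (I a) (L (t a))))" by (rule ad(2))
qed

lemma fdA: "kfin_dim K A"
 by (rule dim_cong(1)[OF AV.vectorspace_axioms bimodule.vs[OF XA_bimodule] excess_XA(1)]) auto

lemma dim_XA: "kdim K XA = kdim K A"
 by (rule dim_cong(2)[OF bimodule.vs[OF XA_bimodule] AV.vectorspace_axioms fdA]) auto

end
end

section \<open>Derivations of the extended algebra\<close>

context arrow_extension
begin

lemma regular_derivationD:
 assumes D: "D \<in> derivations K A (regular_bimodule A)"
 shows "z \<in> carrier A ==> D z \<in> carrier A"
  "z \<in> carrier A ==> w \<in> carrier A ==> D (z \<oplus> w) = D z \<oplus> D w"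
  "k \<in> carrier K ==> z \<in> carrier A ==> D (k \<odot> z) = k \<odot> D z"
  "z \<in> carrier A ==> w \<in> carrier A ==> D (z \<otimes> w) = z \<otimes> D w \<oplus> D z \<otimes> w"
 using derivationsD(2,3,4,7)[OF D] by simp_all

lemma restricted_derivation:
 assumes D: "D \<in> derivations K A (regular_bimodule A)"
 shows "(\<lambda>b\<in>carrier B. D (\<iota> b)) \<in> derivations K B XA"
 unfolding derivations_def
 by (intro CollectI conjI ballI homsI) (simp_all add: i(3-6) regular_derivationD[OF D])

lemma corner_of: "x \<in> V ==> y \<in> V ==> z \<in> carrier A ==> eA y \<otimes> z \<otimes> eA x \<in> carrier (corner A eA y x)"
 by (auto simp: corner_def)

text \<open>A derivation that vanishes on the idempotents \<open>t(a)\<close> and \<open>s(a)\<close> maps \<open>a\<close> to the corner between them.\<close>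

lemma derivation_zero_if_zero_on_generators:
 assumes D: "D \<in> derivations K A (regular_bimodule A)" and b: "\<And>b. b \<in> carrier B ==> D (\<iota> b) = \<zero>"
  and a: "\<And>a. a \<in> F ==> eA (t a) \<otimes> D (\<alpha> a) \<otimes> eA (s a) = \<zero>" and z: "z \<in> carrier A"
 shows "D z = \<zero>"
proof -
 note d = regular_derivationD[OF D]
 have "D (\<alpha> a) = \<zero>" if aF: "a \<in> F" for a
 proof -
  note es = eA(1)[OF F(2)[OF aF]] and et = eA(1)[OF F(3)[OF aF]] and aa = \<alpha>(1)[OF aF]
  have "\<alpha> a = eA (t a) \<otimes> \<alpha> a \<otimes> eA (s a)" using \<alpha>[OF aF] by simp
  then have "D (\<alpha> a) = D (eA (t a) \<otimes> \<alpha> a \<otimes> eA (s a))" by (rule arg_cong)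
  also have "\<dots> = eA (t a) \<otimes> D (\<alpha> a) \<otimes> eA (s a)"
   using es et aa d(1)[OF aa] b[OF e(1)[OF F(2)[OF aF]]] b[OF e(1)[OF F(3)[OF aF]]] by (simp add: d(4))
  finally show ?thesis using a[OF aF] by simp
 qed
 then have "carrier A \<subseteq> {z \<in> carrier A. D z = \<zero>}"
  by (intro generated) (auto simp: i(3) b \<alpha> d)
 then show ?thesis using z by blast
qed

context
 assumes no_cycles: "rel_cycles B e F s t = {}"
begin

text \<open>A derivation of \<open>A\<close> corresponds to its restriction to \<open>B\<close> and to the corner parts of its values on the new arrows; the
 rest of these values is forced by the restriction to \<open>B\<close>.\<close>

lemma dim_derivations:
 "kdim K (der_space K A (regular_bimodule A)) =
   kdim K (der_space K B XA) + (\<Sum>a\<in>F. corner_dim K A eA (t a) (s a))"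
proof -
 note RA = bimodule_regular[OF A]
 have fdXA: "kfin_dim K XA" and fdA: "kfin_dim K A" by (rule excess_XA(1)[OF no_cycles] fdA[OF no_cycles])+
 have "kdim K (der_space K A (regular_bimodule A)) =
   kdim K (der_space K B XA) + (\<Sum>a\<in>F. kdim K (corner A eA (t a) (s a)))"
 proof (rule dim_jointly_bijective(2)[where J = F and W = "\<lambda>a. corner A eA (t a) (s a)"
   and ?T0.0 = "\<lambda>D. \<lambda>b\<in>carrier B. D (\<iota> b)" and T = "\<lambda>a D. eA (t a) \<otimes> D (\<alpha> a) \<otimes> eA (s a)"])
  show "vectorspace K (der_space K A (regular_bimodule A))" by (rule bimodule.subspace_derivations(2)[OF RA])
  show "vectorspace K (der_space K B XA)" by (rule bimodule.subspace_derivations(2)[OF XA_bimodule])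
  show "kfin_dim K (der_space K B XA)" by (rule bimodule.fin_dim_der_space[OF XA_bimodule fdB fdXA])
  show "finite F" by (rule F(1))
  show "vectorspace K (corner A eA (t a) (s a))" "kfin_dim K (corner A eA (t a) (s a))" if a: "a \<in> F" for a
   using corner_space[OF A eA(1)[OF F(3)[OF a]] eA(1)[OF F(2)[OF a]]] fdA by (simp_all add: corner_def)
  show "(\<lambda>D. \<lambda>b\<in>carrier B. D (\<iota> b)) \<in> module_hom K (der_space K A (regular_bimodule A)) (der_space K B XA)"
  proof (rule module_homI)
   show "(\<lambda>b\<in>carrier B. D (\<iota> b)) \<in> carrier (der_space K B XA)" if "D \<in> carrier (der_space K A (regular_bimodule A))" for D
    using restricted_derivation[of D] that by simp
  qed (auto simp: i(3) intro!: restrict_ext)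
  show "(\<lambda>D. eA (t a) \<otimes> D (\<alpha> a) \<otimes> eA (s a)) \<in> module_hom K (der_space K A (regular_bimodule A)) (corner A eA (t a) (s a))"
   if a: "a \<in> F" for a
  proof (rule module_homI)
   note cl = eA(1)[OF F(3)[OF a]] eA(1)[OF F(2)[OF a]]
   fix D assume "D \<in> carrier (der_space K A (regular_bimodule A))"
   then have D: "D (\<alpha> a) \<in> carrier A" using regular_derivationD(1)[OF _ \<alpha>(1)[OF a]] by simp
   show "eA (t a) \<otimes> D (\<alpha> a) \<otimes> eA (s a) \<in> carrier (corner A eA (t a) (s a))" by (rule corner_of[OF F(2,3)[OF a] D])
   show "eA (t a) \<otimes> (k \<odot>\<^bsub>der_space K A (regular_bimodule A)\<^esub> D) (\<alpha> a) \<otimes> eA (s a) =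
     k \<odot>\<^bsub>corner A eA (t a) (s a)\<^esub> (eA (t a) \<otimes> D (\<alpha> a) \<otimes> eA (s a))" if "k \<in> carrier K" for k
    using \<alpha>(1)[OF a] cl D that by (simp add: k_algebraD(3,4)[OF A])
   fix D' assume "D' \<in> carrier (der_space K A (regular_bimodule A))"
   then have D': "D' (\<alpha> a) \<in> carrier A" using regular_derivationD(1)[OF _ \<alpha>(1)[OF a]] by simp
   show "eA (t a) \<otimes> (D \<oplus>\<^bsub>der_space K A (regular_bimodule A)\<^esub> D') (\<alpha> a) \<otimes> eA (s a) =
     eA (t a) \<otimes> D (\<alpha> a) \<otimes> eA (s a) \<oplus>\<^bsub>corner A eA (t a) (s a)\<^esub> eA (t a) \<otimes> D' (\<alpha> a) \<otimes> eA (s a)"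
    using \<alpha>(1)[OF a] cl D D' by (simp add: A.l_distr A.r_distr)
  qed
  show "\<exists>D\<in>carrier (der_space K A (regular_bimodule A)). (\<lambda>b\<in>carrier B. D (\<iota> b)) = \<delta> \<and>
    (\<forall>a\<in>F. eA (t a) \<otimes> D (\<alpha> a) \<otimes> eA (s a) = d a)"
   if \<delta>: "\<delta> \<in> carrier (der_space K B XA)" and d: "\<And>a. a \<in> F ==> d a \<in> carrier (corner A eA (t a) (s a))" for \<delta> d
  proof -
   have \<delta>': "\<delta> \<in> derivations K B XA" using \<delta> by simp
   have d': "d a \<in> carrier A \<and> eA (t a) \<otimes> d a \<otimes> eA (s a) = d a" if "a \<in> F" for a
    using d[OF that] cornerA[OF F(3)[OF that] F(2)[OF that]] by auto
   obtain D where D: "D \<in> derivations K A (regular_bimodule A)" "\<forall>b\<in>carrier B. D (\<iota> b) = \<delta> b"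
     "\<forall>a\<in>F. eA (t a) \<otimes> D (\<alpha> a) \<otimes> eA (s a) = d a"
    using extend_derivation[OF \<delta>' d'] by blast
   have "(\<lambda>b\<in>carrier B. D (\<iota> b)) = \<delta>"
    by (rule extensional_eqI[OF _ derivationsD(6)[OF \<delta>']]) (use D in auto)
   then show ?thesis using D by auto
  qed
  show "D = \<zero>\<^bsub>der_space K A (regular_bimodule A)\<^esub>"
   if D: "D \<in> carrier (der_space K A (regular_bimodule A))" "(\<lambda>b\<in>carrier B. D (\<iota> b)) = \<zero>\<^bsub>der_space K B XA\<^esub>"
    "\<And>a. a \<in> F ==> eA (t a) \<otimes> D (\<alpha> a) \<otimes> eA (s a) = \<zero>\<^bsub>corner A eA (t a) (s a)\<^esub>" for D
  proof -
   have D1: "D \<in> derivations K A (regular_bimodule A)" using D(1) by simp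
   have b0: "D (\<iota> b) = \<zero>" if "b \<in> carrier B" for b using fun_cong[OF D(2), of b] that by simp
   have "D z = \<zero>" if "z \<in> carrier A" for z
    by (rule derivation_zero_if_zero_on_generators[OF D1 b0 _ that]) (use D(3) in auto)
   then show ?thesis using derivationsD(6)[OF D1] by (auto intro!: extensional_eqI[of _ "carrier A"])
  qed
 qed
 then show ?thesis by (simp add: corner_dim_def)
qed

lemma excess_fox:
 assumes a: "a \<in> F"
 shows "derivation_excess K B (hom_bimodule K B (I a) (L (t a))) =
  (\<Sum>\<gamma>\<in>{\<gamma> \<in> rel_paths B e F s t. hd \<gamma> = a}. int (rel_dim K B e s t \<gamma>) *
    (int (kdim K (Ext1 B (I a) (proj_module B e (rel_target t \<gamma>)))) -
    int (kdim K (Hom_space B (I a) (proj_module B e (rel_target t \<gamma>))))))"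
proof (rule sum_rel_paths_from[where g = "\<lambda>c. derivation_excess K B (hom_bimodule K B (I a) (L (t c)))"
  and v = "\<lambda>x. int (kdim K (Ext1 B (I a) (proj_module B e x))) - int (kdim K (Hom_space B (I a) (proj_module B e x)))", OF F(1) no_cycles _ corner_dim_zero a])
 fix c assume c: "c \<in> F"
 note tc = F(3)[OF c]
 show "derivation_excess K B (hom_bimodule K B (I a) (L (t c))) =
   int (kdim K (Ext1 B (I a) (proj_module B e (t c)))) - int (kdim K (Hom_space B (I a) (proj_module B e (t c)))) +
   (\<Sum>a'\<in>F. int (corner_dim K B e (s a') (t c)) * derivation_excess K B (hom_bimodule K B (I a) (L (t a'))))"
  using excess_step[OF tc fin_dim_L[OF no_cycles] IB[OF a]] fox_hom_fin_dim(1)[OF no_cycles a tc fin_dim_PB[OF tc] PBmod[OF tc]] by simp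
qed

text \<open>This is the sum of the dimensions of the extended relative paths from \<open>x\<close> to \<open>y\<close>.\<close>

lemma corner_dim_A:
 assumes y: "y \<in> V" and x: "x \<in> V"
 shows "int (corner_dim K A eA y x) = int (corner_dim K B e y x) +
   (\<Sum>\<gamma>\<in>rel_paths B e F s t. int (corner_dim K B e y (rel_target t \<gamma>)) * int (rel_dim K B e s t \<gamma>) *
    int (corner_dim K B e (rel_source s \<gamma>) x))"
proof -
 note fd = fdA[OF no_cycles]
 have step: "int (corner_dim K A eA y x) = int (corner_dim K B e y x) + (\<Sum>a\<in>F. int (corner_dim K B e (s a) x) * int (corner_dim K A eA y (t a)))"
  if "x \<in> V" for x
  using corner_dim_step[OF that y fd] by simp
 have 1: "int (corner_dim K A eA y (t a)) = (\<Sum>\<gamma>\<in>{\<gamma> \<in> rel_paths B e F s t. hd \<gamma> = a}. int (rel_dim K B e s t \<gamma>) * int (corner_dim K B e y (rel_target t \<gamma>)))"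
  if a: "a \<in> F" for a
  by (rule sum_rel_paths_from[where g = "\<lambda>a. int (corner_dim K A eA y (t a))" and v = "\<lambda>x. int (corner_dim K B e y x)", OF F(1) no_cycles step[OF F(3)] corner_dim_zero a])
 have "(\<Sum>a\<in>F. int (corner_dim K B e (s a) x) * int (corner_dim K A eA y (t a))) =
  (\<Sum>a\<in>F. \<Sum>\<gamma>\<in>{\<gamma> \<in> rel_paths B e F s t. hd \<gamma> = a}. int (corner_dim K B e y (rel_target t \<gamma>)) * int (rel_dim K B e s t \<gamma>) *
    int (corner_dim K B e (rel_source s \<gamma>) x))"
  by (intro sum.cong refl) (auto simp: 1 sum_distrib_left rel_source_def intro!: sum.cong)
 then show ?thesis using step[OF x] sum_rel_paths_by_source_arrow[OF F(1) no_cycles] by simp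
qed

text \<open>The excess of \<open>A\<close> over itself is that of \<open>A\<close> over \<open>B\<close> plus the dimensions of the corners \<open>t(a) A s(a)\<close>, which give the sum
 over parallel pairs.\<close>

theorem HH1_difference:
 "int (kdim K (HH1 K A)) - int (kdim K (HH1 K B)) =
  int (kdim K (center A)) - int (kdim K (center B))
  + (\<Sum>(a, \<omega>)\<in>parallel_pairs V B e F s t. int (ext_rel_dim K B e s t \<omega>))
  + (\<Sum>\<gamma>\<in>rel_paths B e F s t. int (rel_dim K B e s t \<gamma>) *
    (int (kdim K (Ext1 B (inj_module K B e (rel_source s \<gamma>)) (proj_module B e (rel_target t \<gamma>))))
     - int (kdim K (Hom_space B (inj_module K B e (rel_source s \<gamma>)) (proj_module B e (rel_target t \<gamma>))))))"
proof -
 let ?h = "\<lambda>\<gamma>. int (rel_dim K B e s t \<gamma>) *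
    (int (kdim K (Ext1 B (inj_module K B e (rel_source s \<gamma>)) (proj_module B e (rel_target t \<gamma>))))
     - int (kdim K (Hom_space B (inj_module K B e (rel_source s \<gamma>)) (proj_module B e (rel_target t \<gamma>)))))"
 have dimRA: "kdim K (regular_bimodule A) = kdim K A"
  by (rule dim_cong(2)[OF bimodule.vs[OF bimodule_regular[OF A]] AV.vectorspace_axioms fdA[OF no_cycles]]) auto
 have pp: "(\<Sum>(a, \<omega>)\<in>parallel_pairs V B e F s t. int (ext_rel_dim K B e s t \<omega>)) = (\<Sum>a\<in>F. int (corner_dim K A eA (t a) (s a)))"
 proof -
  have sub: "s ` F \<subseteq> V" "t ` F \<subseteq> V" using F by auto
  have "(\<Sum>(a, \<omega>)\<in>parallel_pairs V B e F s t. int (ext_rel_dim K B e s t \<omega>)) =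
   (\<Sum>a\<in>F. int (corner_dim K B e (t a) (s a)) +
    (\<Sum>\<gamma>\<in>rel_paths B e F s t. int (corner_dim K B e (t a) (rel_target t \<gamma>)) * int (rel_dim K B e s t \<gamma>) *
     int (corner_dim K B e (rel_source s \<gamma>) (s a))))"
   by (rule sum_parallel_pairs[OF F(1) no_cycles _ sub]) (rule corner_dim_zero)
  also have "\<dots> = (\<Sum>a\<in>F. int (corner_dim K A eA (t a) (s a)))"
   by (rule sum.cong[OF refl]) (simp add: corner_dim_A[OF F(3) F(2)])
  finally show ?thesis .
 qed
 have hh: "(\<Sum>a\<in>F. derivation_excess K B (hom_bimodule K B (I a) (L (t a)))) = (\<Sum>\<gamma>\<in>rel_paths B e F s t. ?h \<gamma>)"
  unfolding sum_rel_paths_by_source_arrow[OF F(1) no_cycles, of ?h]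
  by (rule sum.cong[OF refl]) (auto simp: excess_fox rel_source_def intro!: sum.cong)
 have "derivation_excess K A (regular_bimodule A) = derivation_excess K B XA + (\<Sum>a\<in>F. int (corner_dim K A eA (t a) (s a)))"
  unfolding derivation_excess_def dim_derivations dimRA dim_XA[OF no_cycles] by simp
 then show ?thesis unfolding dim_HH1[OF A fdA[OF no_cycles]] dim_HH1[OF B fdB] pp hh[symmetric] excess_XA(2)[OF no_cycles] by simp
qed

end
end

section \<open>Path algebras\<close>

locale quiver =
 fixes K :: "('k, 'r) ring_scheme" and Q :: "('v, 'a) pre_digraph"
 assumes K: "field K" and Q: "fin_digraph Q"
begin

sublocale K: field K by (rule K)
sublocale Q: fin_digraph Q by (rule Q)

abbreviation "P \<equiv> path_algebra K Q"
abbreviation "\<delta> \<equiv> path_elt K"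

lemma path_simps [simp]:
 "carrier P = {f. range f \<subseteq> carrier K \<and> finite {\<rho>. f \<rho> \<noteq> \<zero>\<^sub>K} \<and> {\<rho>. f \<rho> \<noteq> \<zero>\<^sub>K} \<subseteq> qpaths Q}"
 "zero P = (\<lambda>\<rho>. \<zero>\<^sub>K)" "add P = (\<lambda>f g \<rho>. f \<rho> \<oplus>\<^sub>K g \<rho>)" "smult P = (\<lambda>c f \<rho>. c \<otimes>\<^sub>K f \<rho>)"
 by (simp_all add: path_algebra_def)

declare path_simps(1) [simp del]

lemma path_val: "f \<in> carrier P ==> f \<rho> \<in> carrier K" by (auto simp: path_simps)

lemma path_carrierI:
 assumes "\<And>\<rho>. f \<rho> \<in> carrier K" "finite S" "\<And>\<rho>. \<rho> \<notin> S ==> f \<rho> = \<zero>\<^sub>K" "S \<subseteq> qpaths Q"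
 shows "f \<in> carrier P"
proof -
 have "{\<rho>. f \<rho> \<noteq> \<zero>\<^sub>K} \<subseteq> S" using assms(3) by blast
 then show ?thesis using assms finite_subset by (auto simp: path_simps)
qed

lemma vectorspace_path_algebra: "vectorspace K P"
proof -
 note reg = vectorspace_regular_module[OF K]
 let ?U = "pointwise (UNIV :: ('v, 'a) qpath set) (regular_module K)"
 have "vectorspace K (?U\<lparr>carrier := carrier P\<rparr>)"
 proof (rule vectorspace_subsetI[OF vectorspace_pointwise[OF reg]])
  show "carrier P \<subseteq> carrier ?U" by (auto simp: path_simps)
  show "\<zero>\<^bsub>?U\<^esub> \<in> carrier P" by (auto simp: path_simps)
  show "x \<oplus>\<^bsub>?U\<^esub> y \<in> carrier P" if x: "x \<in> carrier P" and y: "y \<in> carrier P" for x y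
  proof (rule path_carrierI[of _ "{\<rho>. x \<rho> \<noteq> \<zero>\<^sub>K} \<union> {\<rho>. y \<rho> \<noteq> \<zero>\<^sub>K}"])
   show "(x \<oplus>\<^bsub>?U\<^esub> y) \<rho> \<in> carrier K" for \<rho> using path_val[OF x, of \<rho>] path_val[OF y, of \<rho>] by simp
  qed (use x y in \<open>auto simp: path_simps\<close>)
  show "c \<odot>\<^bsub>?U\<^esub> x \<in> carrier P" if c: "c \<in> carrier K" and x: "x \<in> carrier P" for c x
  proof (rule path_carrierI[of _ "{\<rho>. x \<rho> \<noteq> \<zero>\<^sub>K}"])
   show "(c \<odot>\<^bsub>?U\<^esub> x) \<rho> \<in> carrier K" for \<rho> using path_val[OF x, of \<rho>] c by simp
  qed (use c x in \<open>auto simp: path_simps\<close>)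
 qed
 then show ?thesis by (rule vectorspace_cong) (auto simp: fun_eq_iff)
qed

sublocale PV: vectorspace K P by (rule vectorspace_path_algebra)

lemma path_elt_closed: "\<rho> \<in> qpaths Q ==> \<delta> \<rho> \<in> carrier P"
 by (rule path_carrierI[of _ "{\<rho>}"]) (auto simp: path_elt_def)

text \<open>Path algebra elements are the elements of the free module on the set of paths, extended by 0 instead
 of \<^const>\<open>undefined\<close>.\<close>

lemma path_restrict: "f \<in> carrier P ==> restrict f (qpaths Q) \<in> carrier (free_module K (qpaths Q))"
proof -
 assume f: "f \<in> carrier P"
 have "{x \<in> qpaths Q. restrict f (qpaths Q) x \<noteq> \<zero>\<^sub>K} \<subseteq> {\<rho>. f \<rho> \<noteq> \<zero>\<^sub>K}" by auto
 moreover have "finite {\<rho>. f \<rho> \<noteq> \<zero>\<^sub>K}" using f by (simp add: path_simps)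
 ultimately have "finite {x \<in> qpaths Q. restrict f (qpaths Q) x \<noteq> \<zero>\<^sub>K}" by (rule finite_subset)
 then show ?thesis using f path_val by (auto simp: free_module_simps)
qed

lemma path_induct [consumes 1, case_names zero add single]:
 assumes f: "f \<in> carrier P" and zero: "S \<zero>\<^sub>P"
  and add: "\<And>f g. f \<in> carrier P ==> g \<in> carrier P ==> S f ==> S g ==> S (f \<oplus>\<^sub>P g)"
  and single: "\<And>c \<rho>. c \<in> carrier K ==> \<rho> \<in> qpaths Q ==> S (c \<odot>\<^sub>P \<delta> \<rho>)"
 shows "S f"
proof -
 define E where "E g = (\<lambda>\<rho>. if \<rho> \<in> qpaths Q then g \<rho> else \<zero>\<^sub>K)" for g :: "('v, 'a) qpath => 'k"
 have E: "E g \<in> carrier P" if "g \<in> carrier (free_module K (qpaths Q))" for g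
  by (rule path_carrierI[of _ "{\<rho> \<in> qpaths Q. g \<rho> \<noteq> \<zero>\<^sub>K}"]) (use that in \<open>auto simp: free_module_simps E_def\<close>)
 have "S (E g)" if "g \<in> carrier (free_module K (qpaths Q))" for g
  using K.ring_axioms that
 proof (induction rule: free_module_induct)
  case zero
  have "E \<zero>\<^bsub>free_module K (qpaths Q)\<^esub> = \<zero>\<^sub>P" by (auto simp: E_def free_module_simps)
  then show ?case using assms(2) by simp
 next
  case (add f g)
  have "E (f \<oplus>\<^bsub>free_module K (qpaths Q)\<^esub> g) = E f \<oplus>\<^sub>P E g" by (auto simp: E_def free_module_simps)
  then show ?case using assms(3)[OF E E] add by simp
 next
  case (single \<rho> c)
  have "E (single K (qpaths Q) \<rho> c) = c \<odot>\<^sub>P \<delta> \<rho>" using single by (auto simp: E_def single_def path_elt_def)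
  then show ?case using assms(4)[OF single(2,1)] by simp
 qed
 moreover have "E (restrict f (qpaths Q)) = f"
 proof
  fix \<rho>
  have "{\<rho>. f \<rho> \<noteq> \<zero>\<^sub>K} \<subseteq> qpaths Q" using f by (simp add: path_simps)
  then have "\<rho> \<notin> qpaths Q ==> f \<rho> = \<zero>\<^sub>K" by blast
  then show "E (restrict f (qpaths Q)) \<rho> = f \<rho>" by (cases "\<rho> \<in> qpaths Q") (auto simp: E_def)
 qed
 ultimately show ?thesis using path_restrict[OF f] by metis
qed

subsection \<open>The product\<close>

lemma mult_def': "(f \<otimes>\<^sub>P g) \<rho> = (\<Oplus>\<^sub>K \<pi>\<in>factorizations Q \<rho>. f (fst \<pi>) \<otimes>\<^sub>K g (snd \<pi>))"
 by (simp add: path_algebra_def)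

definition cat :: "('v, 'a) qpath => ('v, 'a) qpath => ('v, 'a) qpath" where
 "cat \<sigma> \<tau> = (fst \<tau>, fst (snd \<tau>) @ fst (snd \<sigma>), snd (snd \<sigma>))"

lemma factorizations_iff: "(\<sigma>, \<tau>) \<in> factorizations Q \<rho> \<longleftrightarrow>
  \<sigma> \<in> qpaths Q \<and> \<tau> \<in> qpaths Q \<and> fst \<sigma> = snd (snd \<tau>) \<and> \<rho> = cat \<sigma> \<tau>"
 by (cases \<sigma>; cases \<tau>) (auto simp: factorizations_def cat_def)

lemma cat_path: "\<sigma> \<in> qpaths Q ==> \<tau> \<in> qpaths Q ==> fst \<sigma> = snd (snd \<tau>) ==> cat \<sigma> \<tau> \<in> qpaths Q"
 by (cases \<sigma>; cases \<tau>) (auto simp: cat_def qpaths_def)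

lemma cat_assoc: "cat (cat \<rho> \<sigma>) \<tau> = cat \<rho> (cat \<sigma> \<tau>)" "fst (cat \<sigma> \<tau>) = fst \<tau>" "snd (snd (cat \<sigma> \<tau>)) = snd (snd \<sigma>)"
 by (simp_all add: cat_def)

lemma finite_factorizations: "finite (factorizations Q \<rho>)"
proof -
 obtain x p y where r: "\<rho> = (x, p, y)" by (cases \<rho>)
 have "factorizations Q \<rho> \<subseteq> (\<Union>z\<in>verts Q. \<Union>i\<in>{..length p}. {((z, drop i p, y), (x, take i p, z))})"
 proof
  fix \<pi> assume "\<pi> \<in> factorizations Q \<rho>"
  then obtain z q p' where h: "\<pi> = ((z, q, y), (x, p', z))" "p = p' @ q" "z \<in> verts Q"
   by (auto simp: factorizations_def r qpaths_def)
  show "\<pi> \<in> (\<Union>z\<in>verts Q. \<Union>i\<in>{..length p}. {((z, drop i p, y), (x, take i p, z))})"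
   using h by (intro UN_I[OF h(3)] UN_I[of "length p'"]) auto
 qed
 then show ?thesis by (rule finite_subset) auto
qed

lemma mult_terms: "f \<in> carrier P ==> g \<in> carrier P ==> (\<lambda>\<pi>. f (fst \<pi>) \<otimes>\<^sub>K g (snd \<pi>)) \<in> factorizations Q \<rho> \<rightarrow> carrier K"
 using path_val by auto

lemma mult_closed: "f \<in> carrier P ==> g \<in> carrier P ==> f \<otimes>\<^sub>P g \<in> carrier P"
proof -
 assume f: "f \<in> carrier P" and g: "g \<in> carrier P"
 let ?S = "{(\<sigma>, \<tau>). f \<sigma> \<noteq> \<zero>\<^sub>K \<and> g \<tau> \<noteq> \<zero>\<^sub>K \<and> fst \<sigma> = snd (snd \<tau>)}"
 have "?S \<subseteq> {\<rho>. f \<rho> \<noteq> \<zero>\<^sub>K} \<times> {\<rho>. g \<rho> \<noteq> \<zero>\<^sub>K}" by auto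
 then have fin: "finite ?S" using f g finite_subset[of ?S] by (auto simp: path_simps)
 show "f \<otimes>\<^sub>P g \<in> carrier P"
 proof (rule path_carrierI[of _ "(\<lambda>(\<sigma>, \<tau>). cat \<sigma> \<tau>) ` ?S"])
  show "(f \<otimes>\<^sub>P g) \<rho> \<in> carrier K" for \<rho> unfolding mult_def' using mult_terms[OF f g] by (rule K.finsum_closed)
  show "finite ((\<lambda>(\<sigma>, \<tau>). cat \<sigma> \<tau>) ` ?S)" using fin by simp
  show "(\<lambda>(\<sigma>, \<tau>). cat \<sigma> \<tau>) ` ?S \<subseteq> qpaths Q" using f g by (auto simp: path_simps intro!: cat_path)
  fix \<rho> assume r: "\<rho> \<notin> (\<lambda>(\<sigma>, \<tau>). cat \<sigma> \<tau>) ` ?S"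
  have "f (fst \<pi>) \<otimes>\<^sub>K g (snd \<pi>) = \<zero>\<^sub>K" if "\<pi> \<in> factorizations Q \<rho>" for \<pi>
  proof -
   obtain \<sigma> \<tau> where p: "\<pi> = (\<sigma>, \<tau>)" by (cases \<pi>)
   have "f \<sigma> = \<zero>\<^sub>K \<or> g \<tau> = \<zero>\<^sub>K" using r that p factorizations_iff by auto
   then show ?thesis using p path_val[OF f, of \<sigma>] path_val[OF g, of \<tau>] by auto
  qed
  then have "(f \<otimes>\<^sub>P g) \<rho> = (\<Oplus>\<^sub>K \<pi>\<in>factorizations Q \<rho>. \<zero>\<^sub>K)" unfolding mult_def' by (intro K.finsum_cong') auto
  then show "(f \<otimes>\<^sub>P g) \<rho> = \<zero>\<^sub>K" by simp
 qed
qed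

lemma mult_distr:
 assumes f: "f \<in> carrier P" and g: "g \<in> carrier P" and h: "h \<in> carrier P"
 shows "(f \<oplus>\<^sub>P g) \<otimes>\<^sub>P h = f \<otimes>\<^sub>P h \<oplus>\<^sub>P g \<otimes>\<^sub>P h" "h \<otimes>\<^sub>P (f \<oplus>\<^sub>P g) = h \<otimes>\<^sub>P f \<oplus>\<^sub>P h \<otimes>\<^sub>P g"
proof -
 show "(f \<oplus>\<^sub>P g) \<otimes>\<^sub>P h = f \<otimes>\<^sub>P h \<oplus>\<^sub>P g \<otimes>\<^sub>P h"
 proof
  fix \<rho>
  have "((f \<oplus>\<^sub>P g) \<otimes>\<^sub>P h) \<rho> = (\<Oplus>\<^sub>K \<pi>\<in>factorizations Q \<rho>. f (fst \<pi>) \<otimes>\<^sub>K h (snd \<pi>) \<oplus>\<^sub>K g (fst \<pi>) \<otimes>\<^sub>K h (snd \<pi>))"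
   unfolding mult_def' using path_val[OF f] path_val[OF g] path_val[OF h] by (intro K.finsum_cong') (auto simp: K.l_distr)
  then show "((f \<oplus>\<^sub>P g) \<otimes>\<^sub>P h) \<rho> = (f \<otimes>\<^sub>P h \<oplus>\<^sub>P g \<otimes>\<^sub>P h) \<rho>"
   using K.finsum_addf[OF mult_terms[OF f h] mult_terms[OF g h]] by (simp add: mult_def')
 qed
 show "h \<otimes>\<^sub>P (f \<oplus>\<^sub>P g) = h \<otimes>\<^sub>P f \<oplus>\<^sub>P h \<otimes>\<^sub>P g"
 proof
  fix \<rho>
  have "(h \<otimes>\<^sub>P (f \<oplus>\<^sub>P g)) \<rho> = (\<Oplus>\<^sub>K \<pi>\<in>factorizations Q \<rho>. h (fst \<pi>) \<otimes>\<^sub>K f (snd \<pi>) \<oplus>\<^sub>K h (fst \<pi>) \<otimes>\<^sub>K g (snd \<pi>))"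
   unfolding mult_def' using path_val[OF f] path_val[OF g] path_val[OF h] by (intro K.finsum_cong') (auto simp: K.r_distr)
  then show "(h \<otimes>\<^sub>P (f \<oplus>\<^sub>P g)) \<rho> = (h \<otimes>\<^sub>P f \<oplus>\<^sub>P h \<otimes>\<^sub>P g) \<rho>"
   using K.finsum_addf[OF mult_terms[OF h f] mult_terms[OF h g]] by (simp add: mult_def')
 qed
qed

lemma mult_smult:
 assumes c: "c \<in> carrier K" and f: "f \<in> carrier P" and g: "g \<in> carrier P"
 shows "(c \<odot>\<^sub>P f) \<otimes>\<^sub>P g = c \<odot>\<^sub>P (f \<otimes>\<^sub>P g)" "f \<otimes>\<^sub>P (c \<odot>\<^sub>P g) = c \<odot>\<^sub>P (f \<otimes>\<^sub>P g)"
proof -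
 note d = K.finsum_rdistr[OF finite_factorizations c mult_terms[OF f g]]
 show "(c \<odot>\<^sub>P f) \<otimes>\<^sub>P g = c \<odot>\<^sub>P (f \<otimes>\<^sub>P g)"
 proof
  fix \<rho>
  show "((c \<odot>\<^sub>P f) \<otimes>\<^sub>P g) \<rho> = (c \<odot>\<^sub>P (f \<otimes>\<^sub>P g)) \<rho>"
   unfolding path_simps(4) mult_def' d using c path_val[OF f] path_val[OF g] by (intro K.finsum_cong') (auto simp: K.m_assoc)
 qed
 show "f \<otimes>\<^sub>P (c \<odot>\<^sub>P g) = c \<odot>\<^sub>P (f \<otimes>\<^sub>P g)"
 proof
  fix \<rho>
  show "(f \<otimes>\<^sub>P (c \<odot>\<^sub>P g)) \<rho> = (c \<odot>\<^sub>P (f \<otimes>\<^sub>P g)) \<rho>"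
   unfolding path_simps(4) mult_def' d using c path_val[OF f] path_val[OF g] by (intro K.finsum_cong') (auto simp: K.m_lcomm)
 qed
qed

text \<open>Every value of the convolution is a sum with at most one nonzero term.\<close>

lemma mult_path_elt:
 assumes "\<sigma> \<in> qpaths Q" "\<tau> \<in> qpaths Q"
 shows "\<delta> \<sigma> \<otimes>\<^sub>P \<delta> \<tau> = (if fst \<sigma> = snd (snd \<tau>) then \<delta> (cat \<sigma> \<tau>) else \<zero>\<^sub>P)"
proof
 fix \<rho>
 have t: "\<delta> \<sigma> (fst \<pi>) \<otimes>\<^sub>K \<delta> \<tau> (snd \<pi>) = (if (\<sigma>, \<tau>) = \<pi> then \<one>\<^sub>K else \<zero>\<^sub>K)" for \<pi> by (cases \<pi>) (auto simp: path_elt_def)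
 have "(\<delta> \<sigma> \<otimes>\<^sub>P \<delta> \<tau>) \<rho> = (if (\<sigma>, \<tau>) \<in> factorizations Q \<rho> then \<one>\<^sub>K else \<zero>\<^sub>K)"
 proof (cases "(\<sigma>, \<tau>) \<in> factorizations Q \<rho>")
  case True
  then show ?thesis unfolding mult_def' t using K.finsum_singleton[OF True finite_factorizations, of "\<lambda>_. \<one>\<^sub>K"] by simp
 next
  case False
  have "(\<delta> \<sigma> \<otimes>\<^sub>P \<delta> \<tau>) \<rho> = (\<Oplus>\<^sub>K \<pi>\<in>factorizations Q \<rho>. \<zero>\<^sub>K)" unfolding mult_def' t using False by (intro K.finsum_cong') auto
  then show ?thesis using False by simp
 qed
 then show "(\<delta> \<sigma> \<otimes>\<^sub>P \<delta> \<tau>) \<rho> = (if fst \<sigma> = snd (snd \<tau>) then \<delta> (cat \<sigma> \<tau>) else \<zero>\<^sub>P) \<rho>"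
  using assms by (auto simp: factorizations_iff path_elt_def)
qed

lemma vertex_path: "x \<in> verts Q ==> (x, [], x) \<in> qpaths Q"
 by (simp add: qpaths_def Q.awalk_Nil_iff)

lemma arrow_path: "a \<in> arcs Q ==> (tail Q a, [a], head Q a) \<in> qpaths Q"
 by (simp add: qpaths_def Q.awalk_simps)

lemma qpaths_verts: "\<rho> \<in> qpaths Q ==> fst \<rho> \<in> verts Q" "\<rho> \<in> qpaths Q ==> snd (snd \<rho>) \<in> verts Q"
 by (cases \<rho>; auto simp: qpaths_def)+

lemma one_eq: "\<one>\<^sub>P = (\<Oplus>\<^sub>P x\<in>verts Q. \<delta> (x, [], x))"
proof
 fix \<rho>
 have cl: "(\<lambda>x. \<delta> (x, [], x)) \<in> verts Q \<rightarrow> carrier P" using vertex_path path_elt_closed by auto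
 have ev: "(\<lambda>f. f \<rho>) \<in> module_hom K P (regular_module K)" by (rule module_homI) (auto simp: path_val)
 have "(\<Oplus>\<^sub>P x\<in>verts Q. \<delta> (x, [], x)) \<rho> = (\<Oplus>\<^sub>K x\<in>verts Q. \<delta> (x, [], x) \<rho>)"
  using linear_finsum[OF vectorspace_path_algebra vectorspace_regular_module[OF K] ev Q.finite_verts cl] by simp
 also have "\<dots> = \<one>\<^sub>P \<rho>"
 proof (cases "\<rho> \<in> qpaths_len Q 0")
  case True
  then obtain x where x: "\<rho> = (x, [], x)" "x \<in> verts Q" by (auto simp: qpaths_len_def qpaths_def Q.awalk_Nil_iff)
  have "(\<Oplus>\<^sub>K z\<in>verts Q. \<delta> (z, [], z) \<rho>) = (\<Oplus>\<^sub>K z\<in>verts Q. if x = z then \<one>\<^sub>K else \<zero>\<^sub>K)"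
   by (rule K.finsum_cong') (auto simp: path_elt_def x)
  then show ?thesis using K.finsum_singleton[OF x(2) Q.finite_verts, of "\<lambda>_. \<one>\<^sub>K"] True by (simp add: path_algebra_def)
 next
  case False
  have "(\<Oplus>\<^sub>K z\<in>verts Q. \<delta> (z, [], z) \<rho>) = (\<Oplus>\<^sub>K z\<in>verts Q. \<zero>\<^sub>K)"
   by (rule K.finsum_cong') (use False in \<open>auto simp: path_elt_def qpaths_len_def qpaths_def Q.awalk_Nil_iff\<close>)
  then show ?thesis using False by (simp add: path_algebra_def)
 qed
 finally show "\<one>\<^sub>P \<rho> = (\<Oplus>\<^sub>P x\<in>verts Q. \<delta> (x, [], x)) \<rho>" by simp
qed

lemma one_closed: "\<one>\<^sub>P \<in> carrier P"
 unfolding one_eq using vertex_path path_elt_closed by (intro PV.M.finsum_closed) auto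

lemma right_mult_hom: "g \<in> carrier P ==> (\<lambda>f. f \<otimes>\<^sub>P g) \<in> module_hom K P P"
 by (rule module_homI) (auto simp: mult_closed mult_distr mult_smult simp del: path_simps)

lemma left_mult_hom: "g \<in> carrier P ==> (\<lambda>f. g \<otimes>\<^sub>P f) \<in> module_hom K P P"
 by (rule module_homI) (auto simp: mult_closed mult_distr mult_smult simp del: path_simps)

text \<open>Paths form a basis. Associativity and the unit laws reduce to paths in this way, one argument at a time.\<close>

lemma path_linear_eqI:
 assumes W: "vectorspace K W" and S: "S \<in> module_hom K P W" and T: "T \<in> module_hom K P W"
  and eq: "\<And>\<rho>. \<rho> \<in> qpaths Q ==> S (\<delta> \<rho>) = T (\<delta> \<rho>)" and f: "f \<in> carrier P"
 shows "S f = T f"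
 using f
proof (induction rule: path_induct)
 case zero
 then show ?case using linear_zero[OF vectorspace_path_algebra W S] linear_zero[OF vectorspace_path_algebra W T] by simp
next
 case (add f g)
 then show ?case using module_homD(2)[OF S add(1,2)] module_homD(2)[OF T add(1,2)] by simp
next
 case (single c \<rho>)
 then show ?case using module_homD(3)[OF S] module_homD(3)[OF T] eq path_elt_closed by metis
qed

lemma path_one_mult:
 assumes "f \<in> carrier P"
 shows "\<one>\<^sub>P \<otimes>\<^sub>P f = f" "f \<otimes>\<^sub>P \<one>\<^sub>P = f"
proof -
 have id: "(\<lambda>f. f) \<in> module_hom K P P" by (rule module_homI) auto
 have cl: "(\<lambda>x. \<delta> (x, [], x)) \<in> verts Q \<rightarrow> carrier P" using vertex_path path_elt_closed by auto
 have l: "\<one>\<^sub>P \<otimes>\<^sub>P \<delta> \<rho> = \<delta> \<rho>" if r: "\<rho> \<in> qpaths Q" for \<rho>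
 proof -
  note dr = path_elt_closed[OF r]
  have "\<one>\<^sub>P \<otimes>\<^sub>P \<delta> \<rho> = (\<Oplus>\<^sub>P x\<in>verts Q. \<delta> (x, [], x) \<otimes>\<^sub>P \<delta> \<rho>)"
   unfolding one_eq by (rule linear_finsum[OF vectorspace_path_algebra vectorspace_path_algebra right_mult_hom[OF dr] Q.finite_verts cl])
  also have "\<dots> = (\<Oplus>\<^sub>P x\<in>verts Q. if snd (snd \<rho>) = x then \<delta> \<rho> else \<zero>\<^sub>P)"
   by (rule PV.M.finsum_cong') (use r dr in \<open>auto simp: mult_path_elt vertex_path cat_def simp del: path_simps\<close>)
  also have "\<dots> = \<delta> \<rho>" using PV.M.finsum_singleton[OF qpaths_verts(2)[OF r] Q.finite_verts, of "\<lambda>_. \<delta> \<rho>"] dr by (simp del: path_simps)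
  finally show ?thesis .
 qed
 have r: "\<delta> \<rho> \<otimes>\<^sub>P \<one>\<^sub>P = \<delta> \<rho>" if r: "\<rho> \<in> qpaths Q" for \<rho>
 proof -
  note dr = path_elt_closed[OF r]
  have "\<delta> \<rho> \<otimes>\<^sub>P \<one>\<^sub>P = (\<Oplus>\<^sub>P x\<in>verts Q. \<delta> \<rho> \<otimes>\<^sub>P \<delta> (x, [], x))"
   unfolding one_eq by (rule linear_finsum[OF vectorspace_path_algebra vectorspace_path_algebra left_mult_hom[OF dr] Q.finite_verts cl])
  also have "\<dots> = (\<Oplus>\<^sub>P x\<in>verts Q. if fst \<rho> = x then \<delta> \<rho> else \<zero>\<^sub>P)"
   by (rule PV.M.finsum_cong') (use r dr in \<open>auto simp: mult_path_elt vertex_path cat_def simp del: path_simps\<close>)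
  also have "\<dots> = \<delta> \<rho>" using PV.M.finsum_singleton[OF qpaths_verts(1)[OF r] Q.finite_verts, of "\<lambda>_. \<delta> \<rho>"] dr by (simp del: path_simps)
  finally show ?thesis .
 qed
 show "\<one>\<^sub>P \<otimes>\<^sub>P f = f" by (rule path_linear_eqI[OF vectorspace_path_algebra left_mult_hom[OF one_closed] id l assms])
 show "f \<otimes>\<^sub>P \<one>\<^sub>P = f" by (rule path_linear_eqI[OF vectorspace_path_algebra right_mult_hom[OF one_closed] id r assms])
qed

lemma path_mult_assoc:
 assumes f: "f \<in> carrier P" and g: "g \<in> carrier P" and h: "h \<in> carrier P"
 shows "f \<otimes>\<^sub>P g \<otimes>\<^sub>P h = f \<otimes>\<^sub>P (g \<otimes>\<^sub>P h)"
proof -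
 note V = vectorspace_path_algebra and c = module_hom_comp and L = left_mult_hom and R = right_mult_hom
 have 0: "\<zero>\<^sub>P \<otimes>\<^sub>P f = \<zero>\<^sub>P" "f \<otimes>\<^sub>P \<zero>\<^sub>P = \<zero>\<^sub>P" if "f \<in> carrier P" for f
  using linear_zero[OF V V R[OF that]] linear_zero[OF V V L[OF that]] by auto
 have 1: "\<delta> \<rho> \<otimes>\<^sub>P \<delta> \<sigma> \<otimes>\<^sub>P \<delta> \<tau> = \<delta> \<rho> \<otimes>\<^sub>P (\<delta> \<sigma> \<otimes>\<^sub>P \<delta> \<tau>)"
  if "\<rho> \<in> qpaths Q" "\<sigma> \<in> qpaths Q" "\<tau> \<in> qpaths Q" for \<rho> \<sigma> \<tau>
  using that by (simp add: mult_path_elt cat_path cat_assoc 0 path_elt_closed del: path_simps)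
 have 2: "f \<otimes>\<^sub>P \<delta> \<sigma> \<otimes>\<^sub>P \<delta> \<tau> = f \<otimes>\<^sub>P (\<delta> \<sigma> \<otimes>\<^sub>P \<delta> \<tau>)" if s: "\<sigma> \<in> qpaths Q" and t: "\<tau> \<in> qpaths Q" for \<sigma> \<tau>
  by (rule path_linear_eqI[OF V c[OF R R] R _ f]) (use s t path_elt_closed mult_closed 1 in auto)
 have 3: "f \<otimes>\<^sub>P g \<otimes>\<^sub>P \<delta> \<tau> = f \<otimes>\<^sub>P (g \<otimes>\<^sub>P \<delta> \<tau>)" if t: "\<tau> \<in> qpaths Q" for \<tau>
  by (rule path_linear_eqI[OF V c[OF L R] c[OF R L] _ g]) (use f t path_elt_closed 2 in auto)
 show ?thesis
  by (rule path_linear_eqI[OF V L c[OF L L] _ h]) (use f g mult_closed 3 in auto)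
qed

lemma k_algebra_path_algebra: "k_algebra K P"
 by (rule k_algebraI[OF vectorspace_path_algebra one_closed mult_closed path_mult_assoc path_one_mult mult_distr mult_smult])

end

lemma algebra_homs_comp: "f \<in> algebra_homs K A B ==> g \<in> algebra_homs K B C ==> (\<lambda>x. g (f x)) \<in> algebra_homs K A C"
 using module_hom_comp[of f K A B g C] by (auto simp: algebra_homs_def module_homD)

context quiver
begin

lemma path_algebra_homI:
 assumes C: "k_algebra K C" and T: "T \<in> module_hom K P C" and one: "T \<one>\<^sub>P = \<one>\<^sub>C"
  and mult: "\<And>\<sigma> \<tau>. \<sigma> \<in> qpaths Q ==> \<tau> \<in> qpaths Q ==> T (\<delta> \<sigma> \<otimes>\<^sub>P \<delta> \<tau>) = T (\<delta> \<sigma>) \<otimes>\<^sub>C T (\<delta> \<tau>)"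
 shows "T \<in> algebra_homs K P C"
proof -
 interpret C: ring C using k_algebraD(2)[OF C] .
 note CV = k_algebraD(1)[OF C] and V = vectorspace_path_algebra
 have L: "(\<lambda>z. w \<otimes>\<^sub>C z) \<in> module_hom K C C" "(\<lambda>z. z \<otimes>\<^sub>C w) \<in> module_hom K C C" if "w \<in> carrier C" for w
  using that by (auto intro!: module_homI simp: k_algebraD(3,4)[OF C] C.l_distr C.r_distr)
 have 2: "T (f \<otimes>\<^sub>P g) = T f \<otimes>\<^sub>C T g" if f: "f \<in> carrier P" and g: "g \<in> carrier P" for f g
 proof -
 have 1: "T (\<delta> \<sigma> \<otimes>\<^sub>P g) = T (\<delta> \<sigma>) \<otimes>\<^sub>C T g" if s: "\<sigma> \<in> qpaths Q" for \<sigma>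
 proof (rule path_linear_eqI[OF CV module_hom_comp[OF left_mult_hom T] module_hom_comp[OF T L(1)] _ g])
  show "\<delta> \<sigma> \<in> carrier P" by (rule path_elt_closed[OF s])
  then show "T (\<delta> \<sigma>) \<in> carrier C" by (rule module_homD(1)[OF T])
 qed (rule mult[OF s])
 show "T (f \<otimes>\<^sub>P g) = T f \<otimes>\<^sub>C T g"
  by (rule path_linear_eqI[OF CV module_hom_comp[OF right_mult_hom[OF g] T] module_hom_comp[OF T L(2)[OF module_homD(1)[OF T g]]] _ f]) (rule 1)
 qed
 show ?thesis unfolding algebra_homs_def using T one 2 by blast
qed

text \<open>Scalar multiples are required only for vertices, since a path is a product of arrows and of its source.\<close>

lemma path_algebra_generated:
 assumes sub: "S \<subseteq> carrier P" and add: "\<And>f g. f \<in> S ==> g \<in> S ==> f \<oplus>\<^sub>P g \<in> S" and mult: "\<And>f g. f \<in> S ==> g \<in> S ==> f \<otimes>\<^sub>P g \<in> S"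
  and zero: "\<zero>\<^sub>P \<in> S"
  and vertex: "\<And>c x. c \<in> carrier K ==> x \<in> verts Q ==> c \<odot>\<^sub>P \<delta> (x, [], x) \<in> S"
  and arrow: "\<And>a. a \<in> arcs Q ==> \<delta> (tail Q a, [a], head Q a) \<in> S"
  and f: "f \<in> carrier P"
 shows "f \<in> S"
 using f
proof (induction rule: path_induct)
 case (single c \<rho>)
 obtain x p y where r: "\<rho> = (x, p, y)" by (cases \<rho>)
 have "Q.awalk x p y ==> c \<odot>\<^sub>P \<delta> (x, p, y) \<in> S"
 proof (induction p arbitrary: y rule: rev_induct)
  case Nil
  then show ?case using vertex[OF single(1)] by (auto simp: Q.awalk_Nil_iff simp del: path_simps)
 next
  case (snoc a p)
  then have a: "a \<in> arcs Q" "y = head Q a" and p: "Q.awalk x p (tail Q a)" by (auto simp: Q.awalk_simps)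
  have pq: "(x, p, tail Q a) \<in> qpaths Q" using p by (simp add: qpaths_def)
  have "c \<odot>\<^sub>P \<delta> (x, p @ [a], y) = \<delta> (tail Q a, [a], head Q a) \<otimes>\<^sub>P (c \<odot>\<^sub>P \<delta> (x, p, tail Q a))"
   using mult_smult(2)[OF single(1) path_elt_closed[OF arrow_path[OF a(1)]] path_elt_closed[OF pq]]
   by (simp add: mult_path_elt[OF arrow_path[OF a(1)] pq] cat_def a(2) del: path_simps)
  then show ?case using mult[OF arrow[OF a(1)] snoc.IH[OF p]] by (simp del: path_simps)
 qed
 then show ?case using single(2) by (simp add: r qpaths_def del: path_simps)
qed (use zero add in auto)

lemma path_algebra_homs_eqI:
 assumes C: "k_algebra K C" and S: "S \<in> algebra_homs K P C" and T: "T \<in> algebra_homs K P C"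
  and vertex: "\<And>x. x \<in> verts Q ==> S (\<delta> (x, [], x)) = T (\<delta> (x, [], x))"
  and arrow: "\<And>a. a \<in> arcs Q ==> S (\<delta> (tail Q a, [a], head Q a)) = T (\<delta> (tail Q a, [a], head Q a))"
  and f: "f \<in> carrier P"
 shows "S f = T f"
proof -
 note s = algebra_homsD[OF S] and u = algebra_homsD[OF T] and pe = path_elt_closed[OF vertex_path] path_elt_closed[OF arrow_path]
 have z: "S \<zero>\<^sub>P = T \<zero>\<^sub>P"
  using linear_zero[OF vectorspace_path_algebra k_algebraD(1)[OF C] s(1)] linear_zero[OF vectorspace_path_algebra k_algebraD(1)[OF C] u(1)] by simp
 have "f \<in> {f \<in> carrier P. S f = T f}"
  by (rule path_algebra_generated[OF _ _ _ _ _ _ f])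
   (use z pe vertex arrow in \<open>auto simp: s(4-6) u(4-6) mult_closed simp del: path_simps intro: PV.smult_closed PV.M.zero_closed PV.M.a_closed\<close>)
 then show ?thesis by simp
qed

subsection \<open>The universal property\<close>

definition path_val_fold :: "('k, 'c) module => ('v => 'c) => ('a => 'c) => ('v, 'a) qpath => 'c" where
 "path_val_fold C \<epsilon> c = (\<lambda>(x, p, y). fold (\<lambda>a z. c a \<otimes>\<^sub>C z) p (\<epsilon> x))"

text \<open>A path is sent to the product of the images of its arrows. The vertices keep track of the sources and targets:
 two paths that cannot be composed have images that are separated by orthogonal idempotents.\<close>

lemma path_algebra_universal:
 fixes C :: "('k, 'c) module"
 assumes C: "k_algebra K C" and \<epsilon>: "\<And>x. x \<in> verts Q ==> \<epsilon> x \<in> carrier C"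
  "\<And>x y. x \<in> verts Q ==> y \<in> verts Q ==> \<epsilon> x \<otimes>\<^sub>C \<epsilon> y = (if x = y then \<epsilon> x else \<zero>\<^sub>C)"
  "(\<Oplus>\<^sub>C x\<in>verts Q. \<epsilon> x) = \<one>\<^sub>C"
  and c: "\<And>a. a \<in> arcs Q ==> c a \<in> carrier C" "\<And>a. a \<in> arcs Q ==> \<epsilon> (head Q a) \<otimes>\<^sub>C c a = c a"
   "\<And>a. a \<in> arcs Q ==> c a \<otimes>\<^sub>C \<epsilon> (tail Q a) = c a"
 shows "\<exists>T\<in>algebra_homs K P C. (\<forall>x\<in>verts Q. T (\<delta> (x, [], x)) = \<epsilon> x) \<and> (\<forall>a\<in>arcs Q. T (\<delta> (tail Q a, [a], head Q a)) = c a)"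
proof -
 interpret C: ring C using k_algebraD(2)[OF C] .
 interpret CV: vectorspace K C using k_algebraD(1)[OF C] .
 define W where "W = path_val_fold C \<epsilon> c"
 define ev where "ev f = supp_sum K (qpaths Q) C (\<lambda>\<rho> k. k \<odot>\<^sub>C W \<rho>) (restrict f (qpaths Q))" for f
 have W_Nil: "W (x, [], y) = \<epsilon> x" and W_snoc: "W (x, p @ [a], y) = c a \<otimes>\<^sub>C W (x, p, y')" for x y p a y'
  by (simp_all add: W_def path_val_fold_def)
 have W1: "W (x, p, y) \<in> carrier C \<and> \<epsilon> y \<otimes>\<^sub>C W (x, p, y) = W (x, p, y) \<and> W (x, p, y) \<otimes>\<^sub>C \<epsilon> x = W (x, p, y)"
  if "Q.awalk x p y" for x p y
  using that
 proof (induction p arbitrary: y rule: rev_induct)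
  case Nil
  then show ?case using \<epsilon> by (auto simp: Q.awalk_Nil_iff W_Nil)
 next
  case (snoc a p)
  then have a: "a \<in> arcs Q" "y = head Q a" and p: "Q.awalk x p (tail Q a)" by (auto simp: Q.awalk_simps)
  note IH = snoc.IH[OF p]
  have "\<epsilon> x \<in> carrier C" using p \<epsilon>(1) by (auto simp: Q.awalk_def)
  then show ?case using IH c[OF a(1)] \<epsilon>(1)[of "head Q a"] a Q.head_in_verts[OF a(1)]
   by (simp add: W_snoc[of _ _ _ _ "tail Q a"] C.m_assoc) (simp add: C.m_assoc[symmetric])
 qed
 have WC: "W \<rho> \<in> carrier C" "\<epsilon> (snd (snd \<rho>)) \<otimes>\<^sub>C W \<rho> = W \<rho>" "W \<rho> \<otimes>\<^sub>C \<epsilon> (fst \<rho>) = W \<rho>" if "\<rho> \<in> qpaths Q" for \<rho>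
  using W1[of "fst \<rho>" "fst (snd \<rho>)" "snd (snd \<rho>)"] that by (auto simp: qpaths_def)
 have W_cat: "W \<sigma> \<otimes>\<^sub>C W \<tau> = (if fst \<sigma> = snd (snd \<tau>) then W (cat \<sigma> \<tau>) else \<zero>\<^sub>C)"
  if s: "\<sigma> \<in> qpaths Q" and t: "\<tau> \<in> qpaths Q" for \<sigma> \<tau>
 proof (cases "fst \<sigma> = snd (snd \<tau>)")
  case False
  have "W \<sigma> \<otimes>\<^sub>C W \<tau> = (W \<sigma> \<otimes>\<^sub>C \<epsilon> (fst \<sigma>)) \<otimes>\<^sub>C (\<epsilon> (snd (snd \<tau>)) \<otimes>\<^sub>C W \<tau>)" using WC[OF s] WC[OF t] by simp
  also have "\<dots> = W \<sigma> \<otimes>\<^sub>C (\<epsilon> (fst \<sigma>) \<otimes>\<^sub>C \<epsilon> (snd (snd \<tau>))) \<otimes>\<^sub>C W \<tau>"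
   using WC(1)[OF s] WC(1)[OF t] \<epsilon>(1)[OF qpaths_verts(1)[OF s]] \<epsilon>(1)[OF qpaths_verts(2)[OF t]] by (simp add: C.m_assoc)
  also have "\<dots> = \<zero>\<^sub>C" using \<epsilon>(2)[OF qpaths_verts(1)[OF s] qpaths_verts(2)[OF t]] False WC(1)[OF s] WC(1)[OF t] by simp
  finally show ?thesis using False by simp
 next
  case True
  obtain z q y where sq: "\<sigma> = (z, q, y)" by (cases \<sigma>)
  obtain x p z' where tp: "\<tau> = (x, p, z')" by (cases \<tau>)
  have z': "z' = z" and p: "Q.awalk x p z" using True t by (auto simp: sq tp qpaths_def)
  have "Q.awalk z q y ==> W (z, q, y) \<otimes>\<^sub>C W (x, p, z) = W (x, p @ q, y)"
  proof (induction q arbitrary: y rule: rev_induct)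
   case Nil
   then show ?case using W1[OF p] W1[OF Nil] by (simp add: Q.awalk_Nil_iff W_Nil)
  next
   case (snoc a q)
   then have a: "a \<in> arcs Q" and q: "Q.awalk z q (tail Q a)" by (auto simp: Q.awalk_simps)
   have "W (z, q @ [a], y) \<otimes>\<^sub>C W (x, p, z) = c a \<otimes>\<^sub>C (W (z, q, tail Q a) \<otimes>\<^sub>C W (x, p, z))"
    using W1[OF q] W1[OF p] c(1)[OF a] by (simp add: W_snoc[of _ _ _ _ "tail Q a"] C.m_assoc)
   also have "\<dots> = W (x, (p @ q) @ [a], y)" using snoc.IH[OF q] W_snoc[of x "p @ q" a y "tail Q a"] by simp
   finally show ?case by simp
  qed
  then show ?thesis using s True by (simp add: sq tp z' cat_def qpaths_def)
 qed
 have hcl: "k \<odot>\<^sub>C W \<rho> \<in> carrier C" if "\<rho> \<in> qpaths Q" "k \<in> carrier K" for \<rho> k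
  using CV.smult_closed[OF that(2) WC(1)[OF that(1)]] .
 have hadd: "(k \<oplus>\<^sub>K l) \<odot>\<^sub>C W \<rho> = k \<odot>\<^sub>C W \<rho> \<oplus>\<^sub>C l \<odot>\<^sub>C W \<rho>" if "\<rho> \<in> qpaths Q" "k \<in> carrier K" "l \<in> carrier K" for \<rho> k l
  using CV.smult_l_distr[OF that(2,3) WC(1)[OF that(1)]] .
 let ?h = "\<lambda>\<rho> k. k \<odot>\<^sub>C W \<rho>" and ?S = "qpaths Q"
 note sa = supp_sum_additive[OF K.ring_axioms C.is_abelian_group, of ?S ?h]
 have ss1: "supp_sum K ?S C ?h f \<in> carrier C" if f: "f \<in> carrier (free_module K ?S)" for f
  by (rule sa(1)[OF _ _ f]) (rule hcl hadd, assumption+)+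
 have ss2: "supp_sum K ?S C ?h (f \<oplus>\<^bsub>free_module K ?S\<^esub> g) = supp_sum K ?S C ?h f \<oplus>\<^sub>C supp_sum K ?S C ?h g"
  if f: "f \<in> carrier (free_module K ?S)" and g: "g \<in> carrier (free_module K ?S)" for f g
  by (rule sa(2)[OF _ _ f g]) (rule hcl hadd, assumption+)+
 have ss3: "supp_sum K ?S C ?h (single K ?S \<rho> k) = k \<odot>\<^sub>C W \<rho>" if r: "\<rho> \<in> ?S" and k: "k \<in> carrier K" for \<rho> k
  by (rule sa(3)[OF _ _ r k]) (rule hcl hadd, assumption+)+
 have ss4: "supp_sum K ?S C ?h \<zero>\<^bsub>free_module K ?S\<^esub> = \<zero>\<^sub>C"
  by (rule sa(4)) (rule hcl hadd, assumption+)+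
 have ev_add: "ev (f \<oplus>\<^sub>P g) = ev f \<oplus>\<^sub>C ev g" if "f \<in> carrier P" "g \<in> carrier P" for f g
 proof -
  have "restrict (f \<oplus>\<^sub>P g) (qpaths Q) = restrict f (qpaths Q) \<oplus>\<^bsub>free_module K (qpaths Q)\<^esub> restrict g (qpaths Q)"
   by (auto simp: free_module_simps)
  then show ?thesis unfolding ev_def using ss2[OF path_restrict[OF that(1)] path_restrict[OF that(2)]] by simp
 qed
 have ev_closed: "ev f \<in> carrier C" if "f \<in> carrier P" for f unfolding ev_def using ss1[OF path_restrict[OF that]] by simp
 have ev_single: "ev (k \<odot>\<^sub>P \<delta> \<rho>) = k \<odot>\<^sub>C W \<rho>" if "k \<in> carrier K" "\<rho> \<in> qpaths Q" for k \<rho>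
 proof -
  have "restrict (k \<odot>\<^sub>P \<delta> \<rho>) (qpaths Q) = single K (qpaths Q) \<rho> k" using that by (auto simp: single_def path_elt_def)
  then show ?thesis unfolding ev_def using ss3[OF that(2,1)] by simp
 qed
 have ev_zero: "ev \<zero>\<^sub>P = \<zero>\<^sub>C"
 proof -
  have "restrict \<zero>\<^sub>P (qpaths Q) = \<zero>\<^bsub>free_module K (qpaths Q)\<^esub>" by (auto simp: free_module_simps)
  then show ?thesis unfolding ev_def using ss4 by simp
 qed
 have ev_smult: "ev (k \<odot>\<^sub>P f) = k \<odot>\<^sub>C ev f" if k: "k \<in> carrier K" and "f \<in> carrier P" for k f
  using that(2)
 proof (induction rule: path_induct)
  case zero
  then show ?case using ev_zero k by (simp add: CV.smult_r_null)
 next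
  case (add f g)
  have "ev (k \<odot>\<^sub>P (f \<oplus>\<^sub>P g)) = ev (k \<odot>\<^sub>P f \<oplus>\<^sub>P k \<odot>\<^sub>P g)" using PV.smult_r_distr[OF k add(1,2)] by (rule arg_cong)
  also have "\<dots> = k \<odot>\<^sub>C ev (f \<oplus>\<^sub>P g)"
   using ev_add[OF PV.smult_closed[OF k add(1)] PV.smult_closed[OF k add(2)]] ev_add[OF add(1,2)] add(3,4) CV.smult_r_distr[OF k ev_closed[OF add(1)] ev_closed[OF add(2)]] by simp
  finally show ?case .
 next
  case (single c \<rho>)
  have "k \<odot>\<^sub>P (c \<odot>\<^sub>P \<delta> \<rho>) = (k \<otimes>\<^sub>K c) \<odot>\<^sub>P \<delta> \<rho>" using PV.smult_assoc1[OF k single(1) path_elt_closed[OF single(2)]] by simp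
  then show ?case using ev_single[OF _ single(2)] single k CV.smult_assoc1[OF k single(1) WC(1)[OF single(2)]] by (simp del: path_simps)
 qed
 have lin: "ev \<in> module_hom K P C" by (rule module_homI) (rule ev_closed ev_add ev_smult, assumption+)+
 have ev_\<delta>: "ev (\<delta> \<rho>) = W \<rho>" if "\<rho> \<in> qpaths Q" for \<rho>
  using ev_single[OF K.one_closed that] PV.smult_one[OF path_elt_closed[OF that]] CV.smult_one[OF WC(1)[OF that]] by (simp del: path_simps)
 have one: "ev \<one>\<^sub>P = \<one>\<^sub>C"
 proof -
  have "ev \<one>\<^sub>P = (\<Oplus>\<^sub>C x\<in>verts Q. ev (\<delta> (x, [], x)))"
   unfolding one_eq by (rule linear_finsum[OF vectorspace_path_algebra CV.vectorspace_axioms lin Q.finite_verts]) (use vertex_path path_elt_closed in auto)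
  also have "\<dots> = (\<Oplus>\<^sub>C x\<in>verts Q. \<epsilon> x)" by (rule C.finsum_cong') (auto simp: ev_\<delta> vertex_path W_Nil \<epsilon>)
  finally show ?thesis using \<epsilon>(3) by simp
 qed
 have hom: "ev \<in> algebra_homs K P C"
 proof (rule path_algebra_homI[OF C lin one])
  fix \<sigma> \<tau> assume st: "\<sigma> \<in> qpaths Q" "\<tau> \<in> qpaths Q"
  show "ev (\<delta> \<sigma> \<otimes>\<^sub>P \<delta> \<tau>) = ev (\<delta> \<sigma>) \<otimes>\<^sub>C ev (\<delta> \<tau>)"
   using ev_zero by (simp add: mult_path_elt[OF st] ev_\<delta> st W_cat[OF st] cat_path[OF st] del: path_simps)
 qed
 show ?thesis
 proof (intro bexI[OF _ hom] conjI ballI)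
  show "ev (\<delta> (x, [], x)) = \<epsilon> x" if "x \<in> verts Q" for x using ev_\<delta>[OF vertex_path[OF that]] by (simp add: W_Nil)
  show "ev (\<delta> (tail Q a, [a], head Q a)) = c a" if "a \<in> arcs Q" for a
   using ev_\<delta>[OF arrow_path[OF that]] W_snoc[of "tail Q a" "[]" a _ undefined] c(3)[OF that] by (simp add: W_Nil)
 qed
qed

end

section \<open>Quotient algebras and bound quiver algebras\<close>

text \<open>Scalars act through multiples of the unit.\<close>

lemma ideal_subspace:
 assumes P: "k_algebra K P" and I: "ideal I P"
 shows "VectorSpace.subspace K I P"
proof -
 interpret P: ring P using k_algebraD(2)[OF P] .
 interpret V: vectorspace K P using k_algebraD(1)[OF P] .
 interpret I: ideal I P by fact
 show ?thesis
 proof (rule vectorspace_subsetI(1)[OF V.vectorspace_axioms])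
  show "I \<subseteq> carrier P" by (rule I.a_subset)
  show "\<zero>\<^sub>P \<in> I" by simp
  show "x \<oplus>\<^sub>P y \<in> I" if "x \<in> I" "y \<in> I" for x y using that by (rule I.a_closed)
  show "c \<odot>\<^sub>P x \<in> I" if c: "c \<in> carrier K" and x: "x \<in> I" for c x
  proof -
   have "(c \<odot>\<^sub>P \<one>\<^sub>P) \<otimes>\<^sub>P x \<in> I" using I.I_l_closed[OF x, of "c \<odot>\<^sub>P \<one>\<^sub>P"] c by simp
   then show ?thesis using k_algebraD(3)[OF P c P.one_closed] I.Icarr[OF x] by simp
  qed
 qed
qed

lemma quotient_algebra:
 fixes P :: "('k, 'p) module"
 assumes P: "k_algebra K P" and I: "ideal I P"
 shows "k_algebra K (quot_module P I)"
  and "(\<lambda>x. I +>\<^sub>P x) \<in> algebra_homs K P (quot_module P I)"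
  and "\<And>x. x \<in> carrier P ==> I +>\<^sub>P x = \<zero>\<^bsub>quot_module P I\<^esub> \<longleftrightarrow> x \<in> I"
  and "carrier (quot_module P I) = (\<lambda>x. I +>\<^sub>P x) ` carrier P"
proof -
 interpret P: ring P using k_algebraD(2)[OF P] .
 interpret V: vectorspace K P using k_algebraD(1)[OF P] .
 interpret I: ideal I P by fact
 note sub = ideal_subspace[OF P I]
 let ?A = "quot_module P I" and ?q = "\<lambda>x. I +>\<^sub>P x"
 note c = quot_module_coset[OF V.vectorspace_axioms sub] and v = quot_module_vectorspace[OF V.vectorspace_axioms sub]
 have m: "?q x \<otimes>\<^bsub>?A\<^esub> ?q y = ?q (x \<otimes>\<^sub>P y)" if "x \<in> carrier P" "y \<in> carrier P" for x y
  using I.rcoset_mult_add[OF that] by (simp add: quot_module_simps)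
 have o: "\<one>\<^bsub>?A\<^esub> = ?q \<one>\<^sub>P" by (simp add: quot_module_simps)
 show "k_algebra K ?A"
  by (rule k_algebraI[OF v(1)]) (auto simp: c(1-3) o m P.m_assoc P.l_distr P.r_distr k_algebraD(3,4)[OF P] simp del: r_coset_def)
 show "?q \<in> algebra_homs K P ?A" unfolding algebra_homs_def using v(2) m o by auto
 show "\<And>x. x \<in> carrier P ==> ?q x = \<zero>\<^bsub>?A\<^esub> \<longleftrightarrow> x \<in> I" by (rule v(3))
 show "carrier ?A = ?q ` carrier P" by (rule c(1))
qed

text \<open>The value on a coset is that of any representative.\<close>

lemma quotient_algebra_lift:
 fixes P :: "('k, 'p) module" and C :: "('k, 'c, 'z) module_scheme"
 assumes P: "k_algebra K P" and I: "ideal I P" and C: "k_algebra K C" and h: "h \<in> algebra_homs K P C"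
  and h0: "\<And>x. x \<in> I ==> h x = \<zero>\<^sub>C"
 shows "\<exists>g\<in>algebra_homs K (quot_module P I) C. \<forall>x\<in>carrier P. g (I +>\<^sub>P x) = h x"
proof -
 interpret P: ring P using k_algebraD(2)[OF P] .
 interpret V: vectorspace K P using k_algebraD(1)[OF P] .
 interpret C: ring C using k_algebraD(2)[OF C] .
 note sub = ideal_subspace[OF P I]
 let ?A = "quot_module P I" and ?q = "\<lambda>x. I +>\<^sub>P x"
 note c = quot_module_coset[OF V.vectorspace_axioms sub] and Q = quotient_algebra[OF P I]
 note hD = algebra_homsD[OF h] and qD = algebra_homsD[OF Q(2)]
 define g where "g X = h (SOME x. x \<in> X)" for X
 have g: "g (?q x) = h x" if x: "x \<in> carrier P" for x
 proof -
  let ?y = "SOME y. y \<in> ?q x"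
  have "?y \<in> ?q x" by (rule someI[of _ x]) (rule c(6)[OF x])
  then have y: "?y \<in> carrier P" "?q ?y = ?q x" using c(7)[OF x] by auto
  then have "?y \<ominus>\<^sub>P x \<in> I" using c(5)[OF y(1) x] by simp
  then have "h (?y \<ominus>\<^sub>P x) = \<zero>\<^sub>C" by (rule h0)
  then have "h ?y \<ominus>\<^sub>C h x = \<zero>\<^sub>C" using linear_minus[OF V.vectorspace_axioms k_algebraD(1)[OF C] hD(1) y(1) x] by simp
  then show ?thesis unfolding g_def using C.minus_eq_zero_iff[OF hD(3)[OF y(1)] hD(3)[OF x]] by simp
 qed
 have "g \<in> algebra_homs K ?A C"
 proof -
  have "g \<in> module_hom K ?A C"
  proof (rule module_homI)
   fix X assume "X \<in> carrier ?A"
   then obtain x where x: "x \<in> carrier P" "X = ?q x" using Q(4) by auto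
   show "g X \<in> carrier C" using g[OF x(1)] hD(3)[OF x(1)] x(2) by simp
   show "g (k \<odot>\<^bsub>?A\<^esub> X) = k \<odot>\<^sub>C g X" if k: "k \<in> carrier K" for k
    using qD(5)[OF k x(1)] g[OF x(1)] g[OF V.smult_closed[OF k x(1)]] hD(5)[OF k x(1)] x(2) by simp
   fix Y assume "Y \<in> carrier ?A"
   then obtain y where y: "y \<in> carrier P" "Y = ?q y" using Q(4) by auto
   show "g (X \<oplus>\<^bsub>?A\<^esub> Y) = g X \<oplus>\<^sub>C g Y"
    using qD(4)[OF x(1) y(1)] g[OF x(1)] g[OF y(1)] g[OF P.a_closed[OF x(1) y(1)]] hD(4)[OF x(1) y(1)] x(2) y(2) by simp
  qed
  moreover have "g \<one>\<^bsub>?A\<^esub> = \<one>\<^sub>C" using qD(2) g[OF P.one_closed] hD(2) by simp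
  moreover have "g (X \<otimes>\<^bsub>?A\<^esub> Y) = g X \<otimes>\<^sub>C g Y" if X: "X \<in> carrier ?A" and Y: "Y \<in> carrier ?A" for X Y
  proof -
   obtain x where x: "x \<in> carrier P" "X = ?q x" using Q(4) X by auto
   obtain y where y: "y \<in> carrier P" "Y = ?q y" using Q(4) Y by auto
   show ?thesis
    using qD(6)[OF x(1) y(1)] g[OF x(1)] g[OF y(1)] g[OF P.m_closed[OF x(1) y(1)]] hD(6)[OF x(1) y(1)] x(2) y(2) by simp
  qed
  ultimately show ?thesis by (simp add: algebra_homs_def)
 qed
 then show ?thesis using g by blast
qed

lemma algebra_hom_kernel:
 assumes P: "k_algebra K P" and C: "k_algebra K C" and h: "h \<in> algebra_homs K P C"
 shows "ideal {x \<in> carrier P. h x = \<zero>\<^sub>C} P"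
proof -
 interpret P: ring P using k_algebraD(2)[OF P] .
 interpret C: ring C using k_algebraD(2)[OF C] .
 note hD = algebra_homsD[OF h]
 have "ring_hom_ring P C h"
  by (rule ring_hom_ringI2[OF P.ring_axioms C.ring_axioms]) (auto simp: ring_hom_def hD(2-4,6))
 then have "ideal (a_kernel P C h) P" by (rule ring_hom_ring.kernel_is_ideal)
 then show ?thesis by (simp add: a_kernel_def')
qed

locale quiver_with_arrows = quiver K Q
 for K :: "('k, 'r) ring_scheme" and Q :: "('v, 'a) pre_digraph" +
 fixes I :: "(('v, 'a) qpath => 'k) set" and F :: "'f set" and s t :: "'f => 'v"
 assumes I: "ideal I (path_algebra K Q)" and F: "finite F" "s ` F \<subseteq> verts Q" "t ` F \<subseteq> verts Q"
begin

abbreviation "QF \<equiv> add_arrows Q F s t"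

lemma add_arrows_simps [simp]:
 "verts QF = verts Q" "arcs QF = arcs Q <+> F" "tail QF = case_sum (tail Q) s" "head QF = case_sum (head Q) t"
 by (simp_all add: add_arrows_def)

lemma fin_digraph_QF: "fin_digraph QF"
 by unfold_locales (use F in auto)

sublocale F: quiver K QF
 by (rule quiver.intro[OF K fin_digraph_QF])

lemma awalk_QF: "F.Q.awalk x (map Inl p) y \<longleftrightarrow> Q.awalk x p y"
 by (induction p arbitrary: x) (auto simp: Q.awalk_simps F.Q.awalk_simps)

subsection \<open>The inclusion of path algebras\<close>

lemma path_incl_elt:
 fixes p :: "'a list"
 shows "path_incl K (path_elt K (x, p, y)) = path_elt K (x :: 'v, map Inl p :: ('a + 'f) list, y)"
proof (rule ext)
 fix \<rho> :: "'v \<times> ('a + 'f) list \<times> 'v"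
 obtain x' p' y' where r: "\<rho> = (x', p', y')" by (cases \<rho>)
 have "(\<forall>a\<in>set p'. isl a) ==> map Inl (map projl p') = p'" by (induction p') auto
 moreover have "\<forall>a\<in>set (map Inl p :: ('a + 'f) list). isl a" by auto
 moreover have "map projl (map Inl p) = p" by (induction p) auto
 ultimately show "path_incl K (path_elt K (x, p, y)) \<rho> = path_elt K (x, map Inl p, y) \<rho>"
  unfolding r path_incl_def path_elt_def by auto
qed

lemma path_incl_closed: "f \<in> carrier P ==> path_incl K f \<in> carrier F.P"
proof -
 assume f: "f \<in> carrier P"
 let ?S = "{\<rho>. f \<rho> \<noteq> \<zero>\<^sub>K}" and ?j = "\<lambda>(x, p, y). (x, map Inl p, y) :: ('v, 'a + 'f) qpath"
 have S: "finite ?S" "?S \<subseteq> qpaths Q" using f by (auto simp: path_simps)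
 show "path_incl K f \<in> carrier F.P"
 proof (rule F.path_carrierI[of _ "?j ` ?S"])
  show "path_incl K f \<rho> \<in> carrier K" for \<rho> :: "('v, 'a + 'f) qpath" by (cases \<rho>) (auto simp: path_incl_def path_val[OF f])
  show "finite (?j ` ?S)" using S by simp
  show "?j ` ?S \<subseteq> qpaths QF" using S(2) awalk_QF by (auto simp: qpaths_def)
  fix \<rho> :: "('v, 'a + 'f) qpath" assume r: "\<rho> \<notin> ?j ` ?S"
  obtain x p y where xp: "\<rho> = (x, p, y)" by (cases \<rho>)
  show "path_incl K f \<rho> = \<zero>\<^sub>K"
  proof (cases "\<forall>a\<in>set p. isl a")
   case True
   then have "map Inl (map projl p) = p" by (induction p) auto
   then have "\<rho> = ?j (x, map projl p, y)" by (simp add: xp)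
   then have "f (x, map projl p, y) = \<zero>\<^sub>K" using r by blast
   then show ?thesis by (simp add: path_incl_def xp)
  next
   case False
   then show ?thesis unfolding path_incl_def xp by auto
  qed
 qed
qed

lemma path_incl_hom: "path_incl K \<in> algebra_homs K P F.P"
proof (rule path_algebra_homI[OF F.k_algebra_path_algebra])
 show lin: "path_incl K \<in> module_hom K P F.P"
  by (rule module_homI[OF path_incl_closed]) (auto simp: path_incl_def path_val)
 have 0: "path_incl K \<zero>\<^sub>P = \<zero>\<^bsub>F.P\<^esub>" by (auto simp: path_incl_def)
 show "path_incl K \<one>\<^sub>P = \<one>\<^bsub>F.P\<^esub>"
  by (auto simp: path_incl_def path_algebra_def qpaths_len_def qpaths_def Q.awalk_Nil_iff F.Q.awalk_Nil_iff intro!: ext)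
 fix \<sigma> \<tau> assume st: "\<sigma> \<in> qpaths Q" "\<tau> \<in> qpaths Q"
 obtain z q y where sq: "\<sigma> = (z, q, y)" by (cases \<sigma>)
 obtain x p z' where tp: "\<tau> = (x, p, z')" by (cases \<tau>)
 have q: "(z, map Inl q, y) \<in> qpaths QF" and p: "(x, map Inl p, z') \<in> qpaths QF" using st awalk_QF by (auto simp: sq tp qpaths_def)
 show "path_incl K (\<delta> \<sigma> \<otimes>\<^sub>P \<delta> \<tau>) = path_incl K (\<delta> \<sigma>) \<otimes>\<^bsub>F.P\<^esub> path_incl K (\<delta> \<tau>)"
  using mult_path_elt[OF st] F.mult_path_elt[OF q p] 0 by (simp add: sq tp path_incl_elt cat_def F.cat_def del: path_simps F.path_simps)
qed

end

section \<open>The extended algebra and its universal property\<close>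

context quiver
begin

text \<open>A path of length at least \<open>n\<close> starts with a path of length \<open>n\<close>, so it is in \<open>I\<close>. The finitely many shorter paths span the
 quotient.\<close>

lemma quotient_fin_dim:
 assumes I: "ideal I P" and n: "path_ideal K Q n \<subseteq> I"
 shows "kfin_dim K (quot_module P I)"
proof -
 interpret PR: ring P using k_algebraD(2)[OF k_algebra_path_algebra] .
 interpret I: ideal I P by fact
 let ?B = "quot_module P I" and ?q = "\<lambda>x. I +>\<^sub>P x"
 note Q = quotient_algebra[OF k_algebra_path_algebra I]
 interpret BV: vectorspace K ?B using k_algebraD(1)[OF Q(1)] .
 note q = algebra_homsD[OF Q(2)]
 let ?S = "{\<rho> \<in> qpaths Q. length (fst (snd \<rho>)) < n}"
 have "?S \<subseteq> verts Q \<times> {p. set p \<subseteq> arcs Q \<and> length p \<le> n} \<times> verts Q"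
  by (auto simp: qpaths_def)
 then have fin: "finite ?S" by (rule finite_subset) (simp add: finite_lists_length_le)
 let ?G = "(\<lambda>\<rho>. ?q (\<delta> \<rho>)) ` ?S"
 have G: "?G \<subseteq> carrier ?B" "finite ?G" using fin q(3) path_elt_closed by auto
 note sp = BV.span_is_submodule[OF G(1)]
 have "I \<noteq> {}" using I.zero_closed by auto
 have long: "\<delta> \<rho> \<in> I" if r: "\<rho> \<in> qpaths Q" "n \<le> length (fst (snd \<rho>))" for \<rho>
 proof -
  obtain x p y where xp: "\<rho> = (x, p, y)" by (cases \<rho>)
  have w: "Q.awalk x (take n p @ drop n p) y" using r by (simp add: xp qpaths_def)
  obtain z where z: "Q.awalk x (take n p) z" "Q.awalk z (drop n p) y" using w unfolding Q.awalk_append_iff by blast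
  have zp: "(x, take n p, z) \<in> qpaths Q" "(z, drop n p, y) \<in> qpaths Q" using z by (auto simp: qpaths_def)
  have sub: "path_elt K ` qpaths_len Q n \<subseteq> carrier P" using path_elt_closed by (auto simp: qpaths_len_def)
  have "\<delta> (x, take n p, z) \<in> path_ideal K Q n"
   unfolding path_ideal_def using PR.genideal_self[OF sub] zp(1) r(2) by (auto simp: qpaths_len_def xp)
  then have "\<delta> (z, drop n p, y) \<otimes>\<^sub>P \<delta> (x, take n p, z) \<in> I" using n I.I_l_closed path_elt_closed[OF zp(2)] by blast
  then show ?thesis using mult_path_elt[OF zp(2,1)] by (simp add: cat_def xp del: path_simps)
 qed
 have mem: "?q f \<in> BV.span ?G" if "f \<in> carrier P" for f
  using that
 proof (induction rule: path_induct)
  case zero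
  have "?q \<zero>\<^sub>P = \<zero>\<^bsub>?B\<^esub>" by (rule linear_zero[OF vectorspace_path_algebra BV.vectorspace_axioms q(1)])
  then show ?case using LinearCombinations.submodule.zero_closed[OF sp] by simp
 next
  case (add f g)
  then show ?case using q(4)[OF add(1,2)] LinearCombinations.submodule.m_closed[OF sp] by simp
 next
  case (single c \<rho>)
  have "?q (\<delta> \<rho>) \<in> BV.span ?G"
  proof (cases "\<rho> \<in> ?S")
   case True
   then show ?thesis using BV.in_own_span[OF G(1)] by blast
  next
   case False
   then have "?q (\<delta> \<rho>) = \<zero>\<^bsub>?B\<^esub>" using long[OF single(2)] single(2) Q(3)[OF path_elt_closed[OF single(2)]] by simp
   then show ?thesis using LinearCombinations.submodule.zero_closed[OF sp] by simp
  qed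
  then show ?case using q(5)[OF single(1) path_elt_closed[OF single(2)]] LinearCombinations.submodule.smult_closed[OF sp single(1)] by simp
 qed
 have "BV.span ?G = carrier ?B" using mem Q(4) BV.span_is_subset2[OF G(1)] by auto
 then show ?thesis using G unfolding BV.fin_dim_def by blast
qed

end

context quiver_with_arrows
begin

abbreviation "B \<equiv> quiver_algebra K Q I"
abbreviation "A \<equiv> extended_algebra K Q I F s t"
abbreviation "e \<equiv> idem K Q I"
abbreviation "J \<equiv> genideal F.P (path_incl K ` I)"
abbreviation "qB \<equiv> \<lambda>f. I +>\<^sub>P f"
abbreviation "qA \<equiv> \<lambda>f. J +>\<^bsub>F.P\<^esub> f"

definition new_arrow :: "'f => (('v, 'a + 'f) qpath => 'k) set" where
 "new_arrow a = qA (F.\<delta> (s a, [Inr a], t a))"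

sublocale PR: ring P using k_algebraD(2)[OF k_algebra_path_algebra] .
sublocale FR: ring F.P using k_algebraD(2)[OF F.k_algebra_path_algebra] .

lemma incl_subset: "path_incl K ` I \<subseteq> carrier F.P"
 using path_incl_closed ideal.Icarr[OF I] by blast

lemma J: "ideal J F.P" by (rule FR.genideal_ideal[OF incl_subset])

lemma A_eq: "A = quot_module F.P J" by (simp add: extended_algebra_def quiver_algebra_def)
lemma B_eq: "B = quot_module P I" by (simp add: quiver_algebra_def)

lemmas QB = quotient_algebra[OF k_algebra_path_algebra I, folded B_eq]
lemmas QA = quotient_algebra[OF F.k_algebra_path_algebra J, folded A_eq]
lemmas qb = algebra_homsD[OF QB(2)]
lemmas qa = algebra_homsD[OF QA(2)]

sublocale AR: ring A using k_algebraD(2)[OF QA(1)] .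
sublocale BR: ring B using k_algebraD(2)[OF QB(1)] .

lemma inclusion_exists: "\<exists>i\<in>algebra_homs K B A. \<forall>f\<in>carrier P. i (qB f) = qA (path_incl K f)"
proof -
 have h: "(\<lambda>f. qA (path_incl K f)) \<in> algebra_homs K P A" by (rule algebra_homs_comp[OF path_incl_hom QA(2)])
 have h0: "qA (path_incl K f) = \<zero>\<^sub>A" if "f \<in> I" for f
  using QA(3)[OF path_incl_closed[OF ideal.Icarr[OF I that]]] FR.genideal_self[OF incl_subset] that by blast
 show ?thesis using quotient_algebra_lift[OF k_algebra_path_algebra I QA(1) h h0] by (simp add: B_eq)
qed

text \<open>The homomorphism that the inclusion of path algebras induces on the quotients; the stated property determines it on \<open>B\<close>.\<close>

definition base_incl :: "(('v, 'a) qpath => 'k) set => (('v, 'a + 'f) qpath => 'k) set" where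
 "base_incl = (SOME i. i \<in> algebra_homs K B A \<and> (\<forall>f\<in>carrier P. i (qB f) = qA (path_incl K f)))"

lemma base_incl: "base_incl \<in> algebra_homs K B A" "f \<in> carrier P ==> base_incl (qB f) = qA (path_incl K f)"
 using someI_ex[of "\<lambda>i. i \<in> algebra_homs K B A \<and> (\<forall>f\<in>carrier P. i (qB f) = qA (path_incl K f))"] inclusion_exists
 unfolding base_incl_def by blast+

lemma e_eq: "e x = qB (\<delta> (x, [], x))" by (simp add: idem_def)

lemma e_mem: "x \<in> verts Q ==> e x \<in> carrier B"
 unfolding e_eq by (rule qb(3)[OF path_elt_closed[OF vertex_path]])

lemma e_orth: "x \<in> verts Q ==> y \<in> verts Q ==> e x \<otimes>\<^sub>B e y = (if x = y then e x else \<zero>\<^sub>B)"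
 using qb(6)[OF path_elt_closed[OF vertex_path] path_elt_closed[OF vertex_path], of x y]
  mult_path_elt[OF vertex_path vertex_path, of x y] linear_zero[OF vectorspace_path_algebra k_algebraD(1)[OF QB(1)] qb(1)]
 by (cases "x = y") (simp_all add: e_eq cat_def del: path_simps)

lemma e_sum: "(\<Oplus>\<^sub>B x\<in>verts Q. e x) = \<one>\<^sub>B"
 using linear_finsum[OF vectorspace_path_algebra k_algebraD(1)[OF QB(1)] qb(1) Q.finite_verts, of "\<lambda>x. \<delta> (x, [], x)"] qb(2)
  path_elt_closed[OF vertex_path] by (simp add: e_eq one_eq del: path_simps)

lemma F_vertex: "path_incl K (path_elt K (x, [] :: 'a list, x)) = path_elt K (x :: 'v, [] :: ('a + 'f) list, x)" by (simp add: path_incl_elt)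

lemma new_path: "a \<in> F ==> (s a, [Inr a], t a) \<in> qpaths QF"
 using F.arrow_path[of "Inr a"] by auto

lemma st_verts: "a \<in> F ==> s a \<in> verts Q" "a \<in> F ==> t a \<in> verts Q" using F by auto

lemma eA_eq: "x \<in> verts Q ==> base_incl (e x) = qA (F.\<delta> (x, [], x))"
 using base_incl(2)[OF path_elt_closed[OF vertex_path]] by (simp add: e_eq F_vertex)

lemma new_arrow:
 assumes a: "a \<in> F"
 shows "new_arrow a \<in> carrier A" "base_incl (e (t a)) \<otimes>\<^sub>A new_arrow a = new_arrow a" "new_arrow a \<otimes>\<^sub>A base_incl (e (s a)) = new_arrow a"
proof -
 note n = new_path[OF a] F.path_elt_closed[OF new_path[OF a]]
 have v: "(x, [], x) \<in> qpaths QF" if "x \<in> verts Q" for x using F.vertex_path[of x] that by simp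
 show "new_arrow a \<in> carrier A" unfolding new_arrow_def by (rule qa(3)[OF n(2)])
 show "base_incl (e (t a)) \<otimes>\<^sub>A new_arrow a = new_arrow a"
  using qa(6)[OF F.path_elt_closed[OF v[OF st_verts(2)[OF a]]] n(2)] F.mult_path_elt[OF v[OF st_verts(2)[OF a]] n(1)]
  by (simp add: new_arrow_def eA_eq st_verts[OF a] F.cat_def del: F.path_simps)
 show "new_arrow a \<otimes>\<^sub>A base_incl (e (s a)) = new_arrow a"
  using qa(6)[OF n(2) F.path_elt_closed[OF v[OF st_verts(1)[OF a]]]] F.mult_path_elt[OF n(1) v[OF st_verts(1)[OF a]]]
  by (simp add: new_arrow_def eA_eq st_verts[OF a] F.cat_def del: F.path_simps)
qed

text \<open>Every arrow of the larger quiver is new or comes from \<open>B\<close>, and so do all vertices.\<close>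

lemma extended_algebra_generated:
 assumes sub: "S \<subseteq> carrier A" and b: "base_incl ` carrier B \<subseteq> S" and n: "new_arrow ` F \<subseteq> S"
  and add: "\<And>x y. x \<in> S ==> y \<in> S ==> x \<oplus>\<^sub>A y \<in> S" and mult: "\<And>x y. x \<in> S ==> y \<in> S ==> x \<otimes>\<^sub>A y \<in> S"
 shows "carrier A \<subseteq> S"
proof
 fix z assume "z \<in> carrier A"
 then obtain f where f: "f \<in> carrier F.P" "z = qA f" using QA(4) by auto
 have old: "qA (path_incl K g) \<in> S" if "g \<in> carrier P" for g
  using base_incl(2)[OF that] b qb(3)[OF that] by (metis image_subset_iff)
 have "f \<in> {f \<in> carrier F.P. qA f \<in> S}"
 proof (rule F.path_algebra_generated[OF _ _ _ _ _ _ f(1)])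
  show "{f \<in> carrier F.P. qA f \<in> S} \<subseteq> carrier F.P" by auto
  show "g \<oplus>\<^bsub>F.P\<^esub> h \<in> {f \<in> carrier F.P. qA f \<in> S}" if "g \<in> {f \<in> carrier F.P. qA f \<in> S}" "h \<in> {f \<in> carrier F.P. qA f \<in> S}" for g h
   using F.PV.M.a_closed[of g h] qa(4)[of g h] add[of "qA g" "qA h"] that by (simp del: F.path_simps)
  show "g \<otimes>\<^bsub>F.P\<^esub> h \<in> {f \<in> carrier F.P. qA f \<in> S}" if "g \<in> {f \<in> carrier F.P. qA f \<in> S}" "h \<in> {f \<in> carrier F.P. qA f \<in> S}" for g h
   using FR.m_closed[of g h] qa(6)[of g h] mult[of "qA g" "qA h"] that by (simp del: F.path_simps)
  show "\<zero>\<^bsub>F.P\<^esub> \<in> {f \<in> carrier F.P. qA f \<in> S}"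
   using old[OF PV.M.zero_closed] linear_zero[OF vectorspace_path_algebra F.vectorspace_path_algebra algebra_homsD(1)[OF path_incl_hom]] F.PV.M.zero_closed
   by (simp del: F.path_simps path_simps)
  show "c \<odot>\<^bsub>F.P\<^esub> F.\<delta> (x, [], x) \<in> {f \<in> carrier F.P. qA f \<in> S}" if c: "c \<in> carrier K" and "x \<in> verts QF" for c x
  proof -
   have x: "x \<in> verts Q" using that(2) by simp
   note px = path_elt_closed[OF vertex_path[OF x]]
   have "path_incl K (c \<odot>\<^sub>P \<delta> (x, [], x)) = c \<odot>\<^bsub>F.P\<^esub> F.\<delta> (x, [], x)"
    using algebra_homsD(5)[OF path_incl_hom c px] by (simp add: F_vertex del: F.path_simps path_simps)
   then show ?thesis using old[OF PV.smult_closed[OF c px]] path_incl_closed[OF PV.smult_closed[OF c px]] by simp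
  qed
  show "F.\<delta> (tail QF a, [a], head QF a) \<in> {f \<in> carrier F.P. qA f \<in> S}" if a: "a \<in> arcs QF" for a
  proof (cases a)
   case (Inl a')
   then have a': "a' \<in> arcs Q" using a by auto
   note pa = path_elt_closed[OF arrow_path[OF a']]
   have "path_incl K (\<delta> (tail Q a', [a'], head Q a')) = F.\<delta> (tail QF a, [a], head QF a)" by (simp add: path_incl_elt Inl)
   then show ?thesis using old[OF pa] path_incl_closed[OF pa] by simp
  next
   case (Inr a')
   then have a': "a' \<in> F" using a by auto
   show ?thesis using n a' F.path_elt_closed[OF new_path[OF a']] by (auto simp: Inr new_arrow_def)
  qed
 qed
 then show "z \<in> S" using f(2) by simp
qed

text \<open>The images of the new arrows and, through \<open>f\<close>, of the old ones define a homomorphism on the larger path algebra. On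
 the old path algebra it is \<open>f\<close> by uniqueness, so its kernel contains the image of \<open>I\<close> and the ideal generated by it.\<close>

theorem extended_algebra_universal:
 fixes C :: "('k, 'c) module"
 assumes C: "k_algebra K C" and f: "f \<in> algebra_homs K B C"
  and c: "\<And>a. a \<in> F ==> c a \<in> carrier C" "\<And>a. a \<in> F ==> f (e (t a)) \<otimes>\<^sub>C c a = c a" "\<And>a. a \<in> F ==> c a \<otimes>\<^sub>C f (e (s a)) = c a"
 shows "\<exists>h\<in>algebra_homs K A C. (\<forall>b\<in>carrier B. h (base_incl b) = f b) \<and> (\<forall>a\<in>F. h (new_arrow a) = c a)"
proof -
 interpret C: ring C using k_algebraD(2)[OF C] .
 note fD = algebra_homsD[OF f]
 define c' where "c' = case_sum (\<lambda>a. f (qB (\<delta> (tail Q a, [a], head Q a)))) c"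
 have pa: "\<delta> (tail Q a, [a], head Q a) \<in> carrier P" if "a \<in> arcs Q" for a by (rule path_elt_closed[OF arrow_path[OF that]])
 have "\<exists>T\<in>algebra_homs K F.P C. (\<forall>x\<in>verts QF. T (F.\<delta> (x, [], x)) = f (e x)) \<and> (\<forall>a\<in>arcs QF. T (F.\<delta> (tail QF a, [a], head QF a)) = c' a)"
 proof (rule F.path_algebra_universal[OF C])
  show "f (e x) \<in> carrier C" if "x \<in> verts QF" for x using fD(3)[OF e_mem] that by simp
  show "f (e x) \<otimes>\<^sub>C f (e y) = (if x = y then f (e x) else \<zero>\<^sub>C)" if "x \<in> verts QF" "y \<in> verts QF" for x y
   using fD(6)[OF e_mem e_mem, of x y] e_orth[of x y] linear_zero[OF k_algebraD(1)[OF QB(1)] k_algebraD(1)[OF C] fD(1)] that by (cases "x = y") simp_all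
  show "(\<Oplus>\<^sub>C x\<in>verts QF. f (e x)) = \<one>\<^sub>C"
   using linear_finsum[OF k_algebraD(1)[OF QB(1)] k_algebraD(1)[OF C] fD(1) Q.finite_verts, of e] e_sum e_mem fD(2) by simp
  fix a assume "a \<in> arcs QF"
  then have "c' a \<in> carrier C \<and> f (e (head QF a)) \<otimes>\<^sub>C c' a = c' a \<and> c' a \<otimes>\<^sub>C f (e (tail QF a)) = c' a"
  proof (cases a)
   case (Inl b)
   then have b: "b \<in> arcs Q" using \<open>a \<in> arcs QF\<close> by auto
   note pb = pa[OF b] arrow_path[OF b] and hv = vertex_path[OF Q.head_in_verts[OF b]] and tv = vertex_path[OF Q.tail_in_verts[OF b]]
   let ?b = "qB (\<delta> (tail Q b, [b], head Q b))"
   have "e (head Q b) \<otimes>\<^sub>B ?b = ?b"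
    using qb(6)[OF path_elt_closed[OF hv] pb(1)] mult_path_elt[OF hv pb(2)] by (simp add: e_eq cat_def del: path_simps)
   moreover have "?b \<otimes>\<^sub>B e (tail Q b) = ?b"
    using qb(6)[OF pb(1) path_elt_closed[OF tv]] mult_path_elt[OF pb(2) tv] by (simp add: e_eq cat_def del: path_simps)
   ultimately show ?thesis
    using fD(6)[OF e_mem[OF Q.head_in_verts[OF b]] qb(3)[OF pb(1)]] fD(6)[OF qb(3)[OF pb(1)] e_mem[OF Q.tail_in_verts[OF b]]] fD(3)[OF qb(3)[OF pb(1)]]
    by (simp add: Inl c'_def)
  next
   case (Inr b)
   then have "b \<in> F" using \<open>a \<in> arcs QF\<close> by auto
   then show ?thesis using c[of b] by (simp add: Inr c'_def)
  qed
  then show "c' a \<in> carrier C" "f (e (head QF a)) \<otimes>\<^sub>C c' a = c' a" "c' a \<otimes>\<^sub>C f (e (tail QF a)) = c' a" by auto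
 qed
 then obtain T where T: "T \<in> algebra_homs K F.P C" "\<forall>x\<in>verts QF. T (F.\<delta> (x, [], x)) = f (e x)"
  "\<forall>a\<in>arcs QF. T (F.\<delta> (tail QF a, [a], head QF a)) = c' a" by blast
 have Ti: "T (path_incl K g) = f (qB g)" if g: "g \<in> carrier P" for g
 proof (rule path_algebra_homs_eqI[OF C algebra_homs_comp[OF path_incl_hom T(1)] algebra_homs_comp[OF QB(2) f] _ _ g])
  show "T (path_incl K (\<delta> (x, [], x))) = f (qB (\<delta> (x, [], x)))" if "x \<in> verts Q" for x
   using T(2) that by (simp add: F_vertex e_eq)
  show "T (path_incl K (\<delta> (tail Q a, [a], head Q a))) = f (qB (\<delta> (tail Q a, [a], head Q a)))" if "a \<in> arcs Q" for a
   using bspec[OF T(3), of "Inl a"] that by (auto simp: path_incl_elt c'_def)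
 qed
 have "J \<subseteq> {x \<in> carrier F.P. T x = \<zero>\<^sub>C}"
 proof (rule FR.genideal_minimal[OF algebra_hom_kernel[OF F.k_algebra_path_algebra C T(1)]])
  show "path_incl K ` I \<subseteq> {x \<in> carrier F.P. T x = \<zero>\<^sub>C}"
  proof
   fix z :: "('v, 'a + 'f) qpath => 'k" assume "z \<in> path_incl K ` I"
   then obtain g where g: "g \<in> I" "z = path_incl K g" by auto
   note gP = ideal.Icarr[OF I g(1)]
   have "qB g = \<zero>\<^sub>B" using QB(3)[OF gP] g(1) by simp
   then have "T z = \<zero>\<^sub>C" using Ti[OF gP] g(2) linear_zero[OF k_algebraD(1)[OF QB(1)] k_algebraD(1)[OF C] fD(1)] by simp
   then show "z \<in> {x \<in> carrier F.P. T x = \<zero>\<^sub>C}" using path_incl_closed[OF gP] g(2) by simp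
  qed
 qed
 then have T0: "T x = \<zero>\<^sub>C" if "x \<in> J" for x using that by blast
 obtain h where h: "h \<in> algebra_homs K A C" "\<forall>x\<in>carrier F.P. h (qA x) = T x"
  using quotient_algebra_lift[OF F.k_algebra_path_algebra J C T(1) T0] unfolding A_eq by blast
 show ?thesis
 proof (intro bexI[OF _ h(1)] conjI ballI)
  fix b assume "b \<in> carrier B"
  then obtain g where g: "g \<in> carrier P" "b = qB g" using QB(4) by auto
  show "h (base_incl b) = f b" using h(2) path_incl_closed[OF g(1)] Ti[OF g(1)] base_incl(2)[OF g(1)] g(2) by simp
 next
  fix a assume a: "a \<in> F"
  show "h (new_arrow a) = c a"
   using h(2) F.path_elt_closed[OF new_path[OF a]] bspec[OF T(3), of "Inr a"] a by (auto simp: new_arrow_def c'_def)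
 qed
qed

end

section \<open>Derivations as homomorphisms to a trivial extension\<close>

definition trivial_extension :: "('k, 'b) module => ('k, 'x, 'b) bimodule => ('k, 'b \<times> 'x) module" where
 "trivial_extension A X = \<lparr>carrier = carrier A \<times> carrier X,
   mult = (\<lambda>(a, x) (b, y). (a \<otimes>\<^sub>A b, lact X a y \<oplus>\<^sub>X ract X b x)), one = (\<one>\<^sub>A, \<zero>\<^sub>X), zero = (\<zero>\<^sub>A, \<zero>\<^sub>X),
   add = (\<lambda>(a, x) (b, y). (a \<oplus>\<^sub>A b, x \<oplus>\<^sub>X y)), smult = (\<lambda>c (a, x). (c \<odot>\<^sub>A a, c \<odot>\<^sub>X x))\<rparr>"

lemma trivial_extension_simps [simp]:
 "carrier (trivial_extension A X) = carrier A \<times> carrier X"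
 "(a, x) \<otimes>\<^bsub>trivial_extension A X\<^esub> (b, y) = (a \<otimes>\<^sub>A b, lact X a y \<oplus>\<^sub>X ract X b x)"
 "(a, x) \<oplus>\<^bsub>trivial_extension A X\<^esub> (b, y) = (a \<oplus>\<^sub>A b, x \<oplus>\<^sub>X y)"
 "c \<odot>\<^bsub>trivial_extension A X\<^esub> (a, x) = (c \<odot>\<^sub>A a, c \<odot>\<^sub>X x)"
 "\<one>\<^bsub>trivial_extension A X\<^esub> = (\<one>\<^sub>A, \<zero>\<^sub>X)" "\<zero>\<^bsub>trivial_extension A X\<^esub> = (\<zero>\<^sub>A, \<zero>\<^sub>X)"
 by (simp_all add: trivial_extension_def)

text \<open>The ring axioms of \<open>A \<oplus> X\<close>, with \<open>X\<close> of square 0, are the bimodule axioms.\<close>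

lemma k_algebra_trivial_extension:
 assumes X: "bimodule K A X"
 shows "k_algebra K (trivial_extension A X)"
proof -
 interpret X: bimodule K A X by fact
 interpret A: ring A using k_algebraD(2)[OF X.alg] .
 interpret AV: vectorspace K A using k_algebraD(1)[OF X.alg] .
 interpret XV: vectorspace K X using X.vs .
 have "Module.module K (direct_sum A X)" by (rule direct_sum_is_module[OF AV.module_axioms XV.module_axioms])
 then have "vectorspace K (direct_sum A X)" using AV.vectorspace_axioms by (simp add: vectorspace_def)
 then have V: "vectorspace K (trivial_extension A X)"
  by (rule vectorspace_cong) (auto simp: trivial_extension_def direct_sum_def fun_eq_iff)
 note z = X.act_zero
 have zl: "lact X \<zero>\<^sub>A x = \<zero>\<^sub>X" "ract X \<zero>\<^sub>A x = \<zero>\<^sub>X" if "x \<in> carrier X" for x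
  using X.lact_smult_left[of "\<zero>\<^sub>K" "\<zero>\<^sub>A" x] X.ract_smult_left[of "\<zero>\<^sub>K" "\<zero>\<^sub>A" x] that
  by (auto simp: X.lact_closed X.ract_closed)
 show ?thesis
  by (rule k_algebraI[OF V])
   (auto simp: X.lact_closed X.ract_closed X.lact_add X.ract_add X.lact_add_left X.ract_add_left X.lact_smult X.ract_smult
     X.lact_smult_left X.ract_smult_left X.lact_mult X.ract_mult X.lact_one X.ract_one X.lact_ract z zl A.m_assoc A.l_distr A.r_distr
     k_algebraD(3,4)[OF X.alg] XV.smult_r_distr XV.M.a_ac)
qed

lemma derivation_graph_hom:
 assumes X: "bimodule K A X" and B: "k_algebra K B" and f: "f \<in> algebra_homs K B A" and D: "D \<in> derivations K B (restrict_scalars f X)"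
 shows "(\<lambda>b. (f b, D b)) \<in> algebra_homs K B (trivial_extension A X)"
proof -
 interpret Xf: bimodule K B "restrict_scalars f X" by (rule bimodule_restrict_scalars[OF X B f])
 note fD = algebra_homsD[OF f] and d = derivationsD[OF D]
 have rs: "carrier (restrict_scalars f X) = carrier X" "add (restrict_scalars f X) = add X" "smult (restrict_scalars f X) = smult X"
  "zero (restrict_scalars f X) = zero X" "lact (restrict_scalars f X) = (\<lambda>b. lact X (f b))" "ract (restrict_scalars f X) = (\<lambda>b. ract X (f b))"
  by (simp_all add: restrict_scalars_def)
 have "(\<lambda>b. (f b, D b)) \<in> module_hom K B (trivial_extension A X)"
  by (rule module_homI) (use d fD rs in auto)
 then show ?thesis unfolding algebra_homs_def using fD Xf.derivation_one[OF D] d(7) rs by auto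
qed

lemma derivation_from_hom:
 assumes X: "bimodule K A X" and h: "h \<in> algebra_homs K A (trivial_extension A X)" and "\<And>z. z \<in> carrier A ==> fst (h z) = z"
 shows "(\<lambda>z\<in>carrier A. snd (h z)) \<in> derivations K A X"
proof -
 interpret X: bimodule K A X by fact
 interpret A: ring A using k_algebraD(2)[OF X.alg] .
 interpret AV: vectorspace K A using k_algebraD(1)[OF X.alg] .
 note hD = algebra_homsD[OF h]
 have e: "h z = (z, snd (h z))" and c: "snd (h z) \<in> carrier X" if "z \<in> carrier A" for z
  using assms(3)[OF that] hD(3)[OF that] by (auto simp: prod_eq_iff)
 have a: "snd (h (y \<oplus>\<^sub>A z)) = snd (h y) \<oplus>\<^sub>X snd (h z)" if "y \<in> carrier A" "z \<in> carrier A" for y z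
  using hD(4)[OF that] e[OF that(1)] e[OF that(2)] by (metis snd_conv trivial_extension_simps(3))
 have s: "snd (h (k \<odot>\<^sub>A z)) = k \<odot>\<^sub>X snd (h z)" if "k \<in> carrier K" "z \<in> carrier A" for k z
  using hD(5)[OF that] e[OF that(2)] by (metis snd_conv trivial_extension_simps(4))
 have m: "snd (h (y \<otimes>\<^sub>A z)) = lact X y (snd (h z)) \<oplus>\<^sub>X ract X z (snd (h y))" if "y \<in> carrier A" "z \<in> carrier A" for y z
  using hD(6)[OF that] e[OF that(1)] e[OF that(2)] by (metis snd_conv trivial_extension_simps(2))
 show ?thesis unfolding derivations_def
  by (intro CollectI conjI ballI homsI) (simp_all add: a s m c)
qed

text \<open>For a derivation \<open>D\<close> and an idempotent \<open>p\<close> this says that \<open>p D(p) p = 0\<close>: multiply \<open>D(p) = p D(p) + D(p) p\<close> by \<open>p\<close>.\<close>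

lemma (in bimodule) idempotent_derivation:
 assumes p: "p \<in> carrier B" "p \<otimes>\<^sub>B p = p" and z: "z \<in> carrier X" "z = lact X p z \<oplus>\<^sub>X ract X p z"
 shows "ract X p (lact X p z) = \<zero>\<^sub>X"
proof -
 interpret XV: vectorspace K X using vs .
 let ?w = "ract X p z" and ?u = "ract X p (lact X p z)"
 have w: "?w \<in> carrier X" and u: "?u \<in> carrier X" using p z by (simp_all add: ract_closed lact_closed)
 have "?w = ract X p (lact X p z \<oplus>\<^sub>X ract X p z)" by (rule arg_cong[OF z(2)])
 also have "\<dots> = ?u \<oplus>\<^sub>X ?w" using ract_add[OF p(1) lact_closed[OF p(1) z(1)] w] ract_mult[OF p(1,1) z(1)] p(2) by simp
 finally show ?thesis using XV.M.add.r_cancel_one'[OF w u] by simp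
qed

context quiver_with_arrows
begin

text \<open>The graph of \<open>D0\<close> is a homomorphism \<open>f\<close> from \<open>B\<close> to the trivial extension. The pair \<open>(a, d a)\<close> need not lie in the corner
 between \<open>f(t(a))\<close> and \<open>f(s(a))\<close>, so it is first multiplied by these idempotents. This adds \<open>a D0(s(a)) + D0(t(a)) a\<close> to the
 second component, whose part between \<open>t(a)\<close> and \<open>s(a)\<close> is 0.\<close>

lemma extend_derivation_to_new_arrows:
 fixes X :: "('k, 'x, (('v, 'a + 'f) qpath => 'k) set) bimodule"
 assumes X: "bimodule K A X" and D0: "D0 \<in> derivations K B (restrict_scalars base_incl X)"
  and d: "\<And>a. a \<in> F ==> d a \<in> carrier X" "\<And>a. a \<in> F ==> lact X (base_incl (e (t a))) (d a) = d a"
   "\<And>a. a \<in> F ==> ract X (base_incl (e (s a))) (d a) = d a"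
 shows "\<exists>D\<in>derivations K A X. (\<forall>b\<in>carrier B. D (base_incl b) = D0 b) \<and>
   (\<forall>a\<in>F. lact X (base_incl (e (t a))) (ract X (base_incl (e (s a))) (D (new_arrow a))) = d a)"
proof -
 interpret X: bimodule K A X by fact
 interpret XV: vectorspace K X using X.vs .
 let ?C = "trivial_extension A X" and ?f = "\<lambda>b. (base_incl b, D0 b)"
 note C = k_algebra_trivial_extension[OF X] and f = derivation_graph_hom[OF X QB(1) base_incl(1) D0]
 interpret C: ring ?C using k_algebraD(2)[OF C] .
 note fD = algebra_homsD[OF f] and i = algebra_homsD[OF base_incl(1)]
 note D0D = derivationsD[OF D0, unfolded restrict_scalars_def with_actions_simps]
 let ?c = "\<lambda>a. ?f (e (t a)) \<otimes>\<^bsub>?C\<^esub> ((new_arrow a, d a) \<otimes>\<^bsub>?C\<^esub> ?f (e (s a)))"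
 have fe: "?f (e x) \<in> carrier ?C" "?f (e x) \<otimes>\<^bsub>?C\<^esub> ?f (e x) = ?f (e x)" if "x \<in> verts Q" for x
  using fD(3)[OF e_mem[OF that]] fD(6)[OF e_mem[OF that] e_mem[OF that]] e_orth[OF that that] by auto
 have nd: "(new_arrow a, d a) \<in> carrier ?C" if "a \<in> F" for a using new_arrow(1)[OF that] d(1)[OF that] by simp
 have "\<exists>h\<in>algebra_homs K A ?C. (\<forall>b\<in>carrier B. h (base_incl b) = ?f b) \<and> (\<forall>a\<in>F. h (new_arrow a) = ?c a)"
 proof (rule extended_algebra_universal[OF C f])
  fix a assume a: "a \<in> F"
  note t = fe[OF st_verts(2)[OF a]] and s = fe[OF st_verts(1)[OF a]]
  have sn: "(new_arrow a, d a) \<otimes>\<^bsub>?C\<^esub> ?f (e (s a)) \<in> carrier ?C" by (rule C.m_closed[OF nd[OF a] s(1)])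
  show "?c a \<in> carrier ?C" by (rule C.m_closed[OF t(1) sn])
  show "?f (e (t a)) \<otimes>\<^bsub>?C\<^esub> ?c a = ?c a" using C.m_assoc[OF t(1) t(1) sn] unfolding t(2) by (rule sym)
  show "?c a \<otimes>\<^bsub>?C\<^esub> ?f (e (s a)) = ?c a"
   using C.m_assoc[OF t(1) sn s(1)] C.m_assoc[OF nd[OF a] s(1) s(1)] unfolding s(2) by (rule trans[OF _ arg_cong])
 qed
 then obtain h where h: "h \<in> algebra_homs K A ?C" "\<forall>b\<in>carrier B. h (base_incl b) = ?f b" "\<forall>a\<in>F. h (new_arrow a) = ?c a" by blast
 note hD = algebra_homsD[OF h(1)]
 have c: "?c a = (new_arrow a, lact X (new_arrow a) (D0 (e (s a))) \<oplus>\<^sub>X d a \<oplus>\<^sub>X ract X (new_arrow a) (D0 (e (t a))))" if a: "a \<in> F" for a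
 proof -
  note t = st_verts(2)[OF a] and s = st_verts(1)[OF a] and n = new_arrow[OF a] and dd = d[OF a]
  have cl: "D0 (e (s a)) \<in> carrier X" "D0 (e (t a)) \<in> carrier X" using D0D(2) e_mem[OF s] e_mem[OF t] by auto
  have l: "lact X (base_incl (e (t a))) (lact X (new_arrow a) (D0 (e (s a)))) = lact X (new_arrow a) (D0 (e (s a)))"
   using X.lact_mult[OF i(3)[OF e_mem[OF t]] n(1) cl(1)] n(2) by simp
  show ?thesis using n dd cl i(3)[OF e_mem[OF t]] l by (simp add: X.lact_add X.lact_closed)
 qed
 have fst_h: "fst (h z) = z" if "z \<in> carrier A" for z
 proof -
  have "carrier A \<subseteq> {z \<in> carrier A. fst (h z) = z}"
  proof (rule extended_algebra_generated)
   show "base_incl ` carrier B \<subseteq> {z \<in> carrier A. fst (h z) = z}" using h(2) i(3) by auto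
   show "new_arrow ` F \<subseteq> {z \<in> carrier A. fst (h z) = z}" using h(3) c new_arrow(1) by auto
   show "x \<oplus>\<^sub>A y \<in> {z \<in> carrier A. fst (h z) = z}" if "x \<in> {z \<in> carrier A. fst (h z) = z}" "y \<in> {z \<in> carrier A. fst (h z) = z}" for x y
    using that hD(4)[of x y] by (cases "h x"; cases "h y") (auto intro: AR.add.m_closed)
   show "x \<otimes>\<^sub>A y \<in> {z \<in> carrier A. fst (h z) = z}" if "x \<in> {z \<in> carrier A. fst (h z) = z}" "y \<in> {z \<in> carrier A. fst (h z) = z}" for x y
    using that hD(6)[of x y] by (cases "h x"; cases "h y") auto
  qed auto
  then show ?thesis using that by blast
 qed
 let ?D = "\<lambda>z\<in>carrier A. snd (h z)"
 show ?thesis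
 proof (intro bexI[OF _ derivation_from_hom[OF X h(1) fst_h]] conjI ballI)
  show "?D (base_incl b) = D0 b" if "b \<in> carrier B" for b using h(2) that i(3)[OF that] by simp
  fix a assume a: "a \<in> F"
  note t = st_verts(2)[OF a] and s = st_verts(1)[OF a] and n = new_arrow[OF a] and dd = d[OF a]
  let ?et = "base_incl (e (t a))" and ?es = "base_incl (e (s a))" and ?x = "D0 (e (s a))" and ?y = "D0 (e (t a))"
  have eA: "base_incl (e v) \<in> carrier A" "base_incl (e v) \<otimes>\<^sub>A base_incl (e v) = base_incl (e v)" "D0 (e v) \<in> carrier X"
    "ract X (base_incl (e v)) (lact X (base_incl (e v)) (D0 (e v))) = \<zero>\<^sub>X" if v: "v \<in> verts Q" for v
  proof -
   show 1: "base_incl (e v) \<in> carrier A" "D0 (e v) \<in> carrier X" using i(3) D0D(2) e_mem[OF v] by auto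
   show 2: "base_incl (e v) \<otimes>\<^sub>A base_incl (e v) = base_incl (e v)" using i(6)[OF e_mem[OF v] e_mem[OF v]] e_orth[OF v v] by simp
   have "D0 (e v) = lact X (base_incl (e v)) (D0 (e v)) \<oplus>\<^sub>X ract X (base_incl (e v)) (D0 (e v))"
    using D0D(7)[OF e_mem[OF v] e_mem[OF v]] e_orth[OF v v] by simp
   then show "ract X (base_incl (e v)) (lact X (base_incl (e v)) (D0 (e v))) = \<zero>\<^sub>X"
    by (rule X.idempotent_derivation[OF 1(1) 2 1(2)])
  qed
  note es = eA[OF s] and et = eA[OF t]
  have 1: "ract X ?es (lact X (new_arrow a) ?x) = \<zero>\<^sub>X"
  proof -
   have "ract X ?es (lact X (new_arrow a) ?x) = ract X ?es (lact X (new_arrow a) (lact X ?es ?x))"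
    using X.lact_mult[OF n(1) es(1,3)] n(3) by simp
   also have "\<dots> = lact X (new_arrow a) (ract X ?es (lact X ?es ?x))"
    using X.lact_ract[OF n(1) es(1) X.lact_closed[OF es(1,3)]] by simp
   finally show ?thesis using es(4) X.act_zero(1)[OF n(1)] by simp
  qed
  have 2: "lact X ?et (ract X (new_arrow a) ?y) = \<zero>\<^sub>X"
  proof -
   have "lact X ?et (ract X (new_arrow a) ?y) = lact X ?et (ract X (new_arrow a) (ract X ?et ?y))"
    using X.ract_mult[OF et(1) n(1) et(3)] n(2) by simp
   also have "\<dots> = ract X (new_arrow a) (ract X ?et (lact X ?et ?y))"
    using X.lact_ract[OF et(1) n(1) X.ract_closed[OF et(1,3)]] X.lact_ract[OF et(1) et(1) et(3)] by simp
   finally show ?thesis using et(4) X.act_zero(2)[OF n(1)] by simp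
  qed
  have "?D (new_arrow a) = lact X (new_arrow a) ?x \<oplus>\<^sub>X d a \<oplus>\<^sub>X ract X (new_arrow a) ?y" using h(3) a c[OF a] n(1) by simp
  moreover have "lact X ?et (ract X ?es (lact X (new_arrow a) ?x \<oplus>\<^sub>X d a \<oplus>\<^sub>X ract X (new_arrow a) ?y)) = d a"
  proof -
   have "ract X ?es (lact X (new_arrow a) ?x \<oplus>\<^sub>X d a \<oplus>\<^sub>X ract X (new_arrow a) ?y) = d a \<oplus>\<^sub>X ract X ?es (ract X (new_arrow a) ?y)"
    using n(1) dd es(1,3) et(1,3) 1 by (simp add: X.ract_add X.lact_closed X.ract_closed)
   also have "ract X ?es (ract X (new_arrow a) ?y) = ract X (new_arrow a) ?y"
    using X.ract_mult[OF n(1) es(1) et(3)] n(3) by simp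
   finally show ?thesis using n(1) dd es(1,3) et(1,3) 2 by (simp add: X.lact_add X.ract_closed)
  qed
  ultimately show "lact X ?et (ract X ?es (?D (new_arrow a))) = d a" by simp
 qed
qed

end

section \<open>Fox derivatives and the dimension formula\<close>

context quiver_with_arrows
begin

text \<open>The identity of \<open>B\<close> and the images 0 for the new arrows satisfy the conditions of the universal property.\<close>

lemma augmentation_exists:
 "\<exists>\<pi>\<in>algebra_homs K A B. (\<forall>b\<in>carrier B. \<pi> (base_incl b) = b) \<and> (\<forall>a\<in>F. \<pi> (new_arrow a) = \<zero>\<^sub>B)"
proof (rule extended_algebra_universal[OF QB(1)])
 show "(\<lambda>b. b) \<in> algebra_homs K B B" by (auto simp: algebra_homs_def intro: module_homI)
qed (use e_mem st_verts in auto)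

text \<open>The value at \<open>a\<close> is the map that corresponds to the tensor \<open>t(a) \<otimes> s(a)\<close> in \<open>A t(a) \<otimes> s(a) B\<close>. A derivation that vanishes on \<open>B\<close>
 takes values in the corners on the new arrows, so the corner parts of its values are the values themselves.\<close>

lemma fox_derivation_exists:
 assumes \<pi>: "\<pi> \<in> algebra_homs K A B" "\<And>b. b \<in> carrier B ==> \<pi> (base_incl b) = b" and a: "a \<in> F"
 shows "\<exists>D\<in>derivations K A (hom_bimodule K A (pull_module \<pi> (inj_module K B e (s a))) (proj_module A (\<lambda>x. base_incl (e x)) (t a))).
  (\<forall>b\<in>carrier B. \<forall>\<phi>\<in>carrier (inj_module K B e (s a)). D (base_incl b) \<phi> = \<zero>\<^sub>A) \<and>
  (\<forall>c\<in>F. \<forall>\<phi>\<in>carrier (inj_module K B e (s a)). D (new_arrow c) \<phi> =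
    (if c = a then \<phi> (e (s a)) \<odot>\<^sub>A base_incl (e (t a)) else \<zero>\<^sub>A))"
proof -
 let ?I = "inj_module K B e (s a)" and ?P = "proj_module A (\<lambda>x. base_incl (e x)) (t a)"
 let ?X = "hom_bimodule K A (pull_module \<pi> ?I) ?P"
 note i = algebra_homsD[OF base_incl(1)]
 interpret AV: vectorspace K A using k_algebraD(1)[OF QA(1)] .
 have es: "e (s a) \<in> carrier B" and et: "e (t a) \<in> carrier B" using e_mem st_verts[OF a] by auto
 have etA: "base_incl (e (t a)) \<in> carrier A" "base_incl (e (t a)) \<otimes>\<^sub>A base_incl (e (t a)) = base_incl (e (t a))"
  using i(3)[OF et] i(6)[OF et et] e_orth[of "t a" "t a"] st_verts[OF a] by auto
 have Imod: "left_module B ?I" by (rule inj_module_facts(1)[of K B e "s a", OF QB(1) es])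
 have Pmod: "left_module A ?P" by (rule left_module_proj_module) (use AR.ring_axioms etA in auto)
 have X: "bimodule K A ?X"
  by (rule bimodule_hom_bimodule[OF QA(1) left_module_pull_module[OF Imod QA(1) \<pi>(1)] Pmod])
 interpret X: bimodule K A ?X by (rule X)
 interpret XV: vectorspace K ?X by (rule X.vs)
 interpret XB: bimodule K B "restrict_scalars base_incl ?X" by (rule bimodule_restrict_scalars[OF X QB(1) base_incl(1)])
 interpret DV: vectorspace K "der_space K B (restrict_scalars base_incl ?X)" by (rule XB.subspace_derivations(2))
 define D0 where "D0 = \<zero>\<^bsub>der_space K B (restrict_scalars base_incl ?X)\<^esub>"
 have D0: "D0 \<in> derivations K B (restrict_scalars base_incl ?X)" using DV.M.zero_closed by (simp add: D0_def)
 have D0_val: "D0 b = \<zero>\<^bsub>?X\<^esub>" if "b \<in> carrier B" for b using that by (simp add: D0_def restrict_scalars_def)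
 \<comment> \<open>the value at \<open>a\<close>: the rank one map that corresponds to the tensor of the two idempotents\<close>
 let ?d = "\<lambda>\<phi>\<in>carrier ?I. \<phi> (e (s a)) \<odot>\<^sub>A base_incl (e (t a))"
 define d where "d c = (if c = a then ?d else \<zero>\<^bsub>?X\<^esub>)" for c
 have d_same: "d c = ?d" if "c = a" for c unfolding d_def by (rule if_P[OF that])
 have d_other: "d c = \<zero>\<^bsub>?X\<^esub>" if "c \<noteq> a" for c unfolding d_def by (rule if_not_P[OF that])
 have es_mem: "e (s a) \<in> carrier (right_ideal_space B e (s a))"
  using es by (auto simp: right_ideal_simps intro!: exI[of _ "\<one>\<^sub>B"])
 have val: "\<phi> (e (s a)) \<in> carrier K" if "\<phi> \<in> carrier ?I" for \<phi>
  using homsD(1)[of \<phi> K "right_ideal_space B e (s a)" "regular_module K"] es_mem that by (simp add: inj_module_simps)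
 have dX: "?d \<in> carrier ?X"
 proof -
  have "?d \<in> homs K (space_of A (pull_module \<pi> ?I)) (space_of A ?P)"
  proof (rule homsI)
   fix \<phi> assume "\<phi> \<in> carrier (space_of A (pull_module \<pi> ?I))"
   then have f: "\<phi> \<in> carrier ?I" by simp
   have "\<phi> (e (s a)) \<odot>\<^sub>A base_incl (e (t a)) = (\<phi> (e (s a)) \<odot>\<^sub>A base_incl (e (t a))) \<otimes>\<^sub>A base_incl (e (t a))"
    using k_algebraD(3)[OF QA(1) val[OF f] etA(1) etA(1)] etA(2) by simp
   then show "?d \<phi> \<in> carrier (space_of A ?P)" using f AV.smult_closed[OF val[OF f] etA(1)] by auto
   fix k assume k: "k \<in> carrier K"
   have sm: "(k \<odot>\<^sub>A \<one>\<^sub>A) \<odot>\<^bsub>pull_module \<pi> ?I\<^esub> \<phi> = k \<odot>\<^bsub>space_of B ?I\<^esub> \<phi>"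
    using scalar_hom[OF QA(1) \<pi>(1) k] by simp
   have k1: "k \<odot>\<^sub>B \<one>\<^sub>B \<in> carrier B" using vectorspace_underlying_space[OF QB(1) Imod] k
    by (metis BR.one_closed QB(1) k_algebraD(1) vectorspace_def Module.module.smult_closed)
   have cl: "k \<odot>\<^bsub>space_of B ?I\<^esub> \<phi> \<in> carrier ?I" using left_module.smult_closed[OF Imod k1 f] by simp
   have ev: "(k \<odot>\<^bsub>space_of B ?I\<^esub> \<phi>) (e (s a)) = k \<otimes>\<^sub>K \<phi> (e (s a))"
    using inj_module_facts(3)[of K B e "s a", OF QB(1) es k f] es_mem by (simp del: underlying_space_simps)
   have "?d (k \<odot>\<^bsub>space_of A (pull_module \<pi> ?I)\<^esub> \<phi>) = ?d (k \<odot>\<^bsub>space_of B ?I\<^esub> \<phi>)"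
    using sm by (simp only: underlying_space_simps)
   also have "\<dots> = (k \<otimes>\<^sub>K \<phi> (e (s a))) \<odot>\<^sub>A base_incl (e (t a))" using cl ev by (simp del: underlying_space_simps)
   also have "\<dots> = k \<odot>\<^sub>A (\<phi> (e (s a)) \<odot>\<^sub>A base_incl (e (t a)))" by (rule AV.smult_assoc1[OF k val[OF f] etA(1)])
   also have "\<dots> = (k \<odot>\<^sub>A \<one>\<^sub>A) \<otimes>\<^sub>A (\<phi> (e (s a)) \<odot>\<^sub>A base_incl (e (t a)))"
    using k_algebraD(3)[OF QA(1) k AR.one_closed AV.smult_closed[OF val[OF f] etA(1)]] AV.smult_closed[OF val[OF f] etA(1)] by simp
   finally show "?d (k \<odot>\<^bsub>space_of A (pull_module \<pi> ?I)\<^esub> \<phi>) = k \<odot>\<^bsub>space_of A ?P\<^esub> ?d \<phi>" using f by simp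
  next
   fix \<phi> \<psi> assume "\<phi> \<in> carrier (space_of A (pull_module \<pi> ?I))" "\<psi> \<in> carrier (space_of A (pull_module \<pi> ?I))"
   then have f: "\<phi> \<in> carrier ?I" and g: "\<psi> \<in> carrier ?I" by auto
   have fg: "\<phi> \<oplus>\<^bsub>?I\<^esub> \<psi> \<in> carrier ?I" using abelian_monoid.a_closed[OF abelian_group.axioms(1)[OF left_module.M[OF Imod]] f g] .
   have "(\<phi> \<oplus>\<^bsub>?I\<^esub> \<psi>) (e (s a)) = \<phi> (e (s a)) \<oplus>\<^sub>K \<psi> (e (s a))" using es_mem by (simp add: inj_module_simps(2))
   then show "?d (\<phi> \<oplus>\<^bsub>space_of A (pull_module \<pi> ?I)\<^esub> \<psi>) = ?d \<phi> \<oplus>\<^bsub>space_of A ?P\<^esub> ?d \<psi>"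
    using f g fg AV.smult_l_distr[OF val[OF f] val[OF g] etA(1)] by simp
  qed simp
  then show ?thesis by (simp only: hom_bimodule_simps(1))
 qed
 have ext: "x \<in> extensional (carrier ?I)" if x: "x \<in> carrier ?X" for x
 proof -
  have "x \<in> homs K (space_of A (pull_module \<pi> ?I)) (space_of A ?P)" using x by (simp only: hom_bimodule_simps(1))
  from homsD(5)[OF this] show ?thesis by simp
 qed
 have e_inv: "lact ?X (base_incl (e (t a))) ?d = ?d" "ract ?X (base_incl (e (s a))) ?d = ?d"
 proof -
  have sA: "base_incl (e (s a)) \<in> carrier A" by (rule i(3)[OF es])
  show "lact ?X (base_incl (e (t a))) ?d = ?d"
  proof (rule extensional_eqI[OF ext[OF X.lact_closed[OF etA(1) dX]] ext[OF dX]])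
   fix \<phi> assume f: "\<phi> \<in> carrier ?I"
   show "lact ?X (base_incl (e (t a))) ?d \<phi> = ?d \<phi>"
    using f k_algebraD(4)[OF QA(1) val[OF f] etA(1) etA(1)] etA(2) by (simp add: hom_bimodule_simps(5))
  qed
  show "ract ?X (base_incl (e (s a))) ?d = ?d"
  proof (rule extensional_eqI[OF ext[OF X.ract_closed[OF sA dX]] ext[OF dX]])
   fix \<phi> assume f: "\<phi> \<in> carrier ?I"
   have cl: "e (s a) \<odot>\<^bsub>?I\<^esub> \<phi> \<in> carrier ?I" by (rule left_module.smult_closed[OF Imod es f])
   have "(e (s a) \<odot>\<^bsub>?I\<^esub> \<phi>) (e (s a)) = \<phi> (e (s a))" using es_mem e_orth[of "s a" "s a"] st_verts[OF a] by (simp add: inj_module_simps(4))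
   then show "ract ?X (base_incl (e (s a))) ?d \<phi> = ?d \<phi>" using f cl \<pi>(2)[OF es] by (simp add: hom_bimodule_simps(6))
  qed
 qed
 have d: "d c \<in> carrier ?X" "lact ?X (base_incl (e (t c))) (d c) = d c" "ract ?X (base_incl (e (s c))) (d c) = d c" if c: "c \<in> F" for c
 proof -
  have ec: "base_incl (e (t c)) \<in> carrier A" "base_incl (e (s c)) \<in> carrier A" using i(3) e_mem st_verts[OF c] by auto
  show "d c \<in> carrier ?X"
  proof (cases "c = a")
   case True show ?thesis unfolding d_same[OF True] unfolding True by (rule dX)
  next
   case False show ?thesis unfolding d_other[OF False] by (rule XV.M.zero_closed)
  qed
  show "lact ?X (base_incl (e (t c))) (d c) = d c"
  proof (cases "c = a")
   case True show ?thesis unfolding d_same[OF True] unfolding True by (rule e_inv(1))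
  next
   case False show ?thesis unfolding d_other[OF False] by (rule X.act_zero(1)[OF ec(1)])
  qed
  show "ract ?X (base_incl (e (s c))) (d c) = d c"
  proof (cases "c = a")
   case True show ?thesis unfolding d_same[OF True] unfolding True by (rule e_inv(2))
  next
   case False show ?thesis unfolding d_other[OF False] by (rule X.act_zero(2)[OF ec(2)])
  qed
 qed
 obtain D where D: "D \<in> derivations K A ?X" "\<forall>b\<in>carrier B. D (base_incl b) = D0 b"
  "\<forall>c\<in>F. lact ?X (base_incl (e (t c))) (ract ?X (base_incl (e (s c))) (D (new_arrow c))) = d c"
  using extend_derivation_to_new_arrows[OF X D0 d] by blast
 note dD = derivationsD[OF D(1)]
 have Dn: "D (new_arrow c) = d c" if c: "c \<in> F" for c
 proof -
  note n = new_arrow[OF c]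
  have sB: "e (s c) \<in> carrier B" and tB: "e (t c) \<in> carrier B" using e_mem st_verts[OF c] by auto
  note sA = i(3)[OF sB] and tA = i(3)[OF tB]
  have z: "D (base_incl (e (s c))) = \<zero>\<^bsub>?X\<^esub>" "D (base_incl (e (t c))) = \<zero>\<^bsub>?X\<^esub>" using D(2) D0_val sB tB by auto
  have "D (new_arrow c) = D (new_arrow c \<otimes>\<^sub>A base_incl (e (s c)))" by (rule arg_cong[OF n(3)[symmetric]])
  also have "\<dots> = lact ?X (new_arrow c) \<zero>\<^bsub>?X\<^esub> \<oplus>\<^bsub>?X\<^esub> ract ?X (base_incl (e (s c))) (D (new_arrow c))" unfolding dD(7)[OF n(1) sA] z by (rule refl)
  also have "\<dots> = ract ?X (base_incl (e (s c))) (D (new_arrow c))"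
   unfolding X.act_zero(1)[OF n(1)] by (rule XV.M.l_zero[OF X.ract_closed[OF sA dD(2)[OF n(1)]]])
  finally have 1: "ract ?X (base_incl (e (s c))) (D (new_arrow c)) = D (new_arrow c)" by (rule sym)
  have "D (new_arrow c) = D (base_incl (e (t c)) \<otimes>\<^sub>A new_arrow c)" by (rule arg_cong[OF n(2)[symmetric]])
  also have "\<dots> = lact ?X (base_incl (e (t c))) (D (new_arrow c)) \<oplus>\<^bsub>?X\<^esub> ract ?X (new_arrow c) \<zero>\<^bsub>?X\<^esub>" unfolding dD(7)[OF tA n(1)] z by (rule refl)
  also have "\<dots> = lact ?X (base_incl (e (t c))) (D (new_arrow c))"
   unfolding X.act_zero(2)[OF n(1)] by (rule XV.M.r_zero[OF X.lact_closed[OF tA dD(2)[OF n(1)]]])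
  finally have 2: "lact ?X (base_incl (e (t c))) (D (new_arrow c)) = D (new_arrow c)" by (rule sym)
  show ?thesis using bspec[OF D(3) c] unfolding 1 2 .
 qed
 have z: "\<zero>\<^bsub>?X\<^esub> \<phi> = \<zero>\<^sub>A" if "\<phi> \<in> carrier ?I" for \<phi> using that by (simp add: hom_bimodule_simps(2))
 show ?thesis
 proof (intro bexI[OF _ D(1)] conjI ballI)
  fix b \<phi> assume "b \<in> carrier B" "\<phi> \<in> carrier ?I"
  then show "D (base_incl b) \<phi> = \<zero>\<^sub>A" using D(2) D0_val z by simp
 next
  fix c \<phi> assume "c \<in> F" "\<phi> \<in> carrier ?I"
  then show "D (new_arrow c) \<phi> = (if c = a then \<phi> (e (s a)) \<odot>\<^sub>A base_incl (e (t a)) else \<zero>\<^sub>A)"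
   using Dn z by (simp add: d_def)
 qed
qed

lemma arrow_extension_exists:
 assumes fd: "kfin_dim K B"
 shows "\<exists>\<pi> \<theta>. arrow_extension K B A base_incl \<pi> (verts Q) e F s t new_arrow \<theta>"
proof -
 obtain \<pi> where \<pi>: "\<pi> \<in> algebra_homs K A B" "\<forall>b\<in>carrier B. \<pi> (base_incl b) = b" "\<forall>a\<in>F. \<pi> (new_arrow a) = \<zero>\<^sub>B"
  using augmentation_exists by (elim bexE conjE) (rule that)
 define fox where "fox a D \<longleftrightarrow> D \<in> derivations K A (hom_bimodule K A (pull_module \<pi> (inj_module K B e (s a))) (proj_module A (\<lambda>x. base_incl (e x)) (t a))) \<and>
  (\<forall>b\<in>carrier B. \<forall>\<phi>\<in>carrier (inj_module K B e (s a)). D (base_incl b) \<phi> = \<zero>\<^sub>A) \<and>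
  (\<forall>c\<in>F. \<forall>\<phi>\<in>carrier (inj_module K B e (s a)). D (new_arrow c) \<phi> =
    (if c = a then \<phi> (e (s a)) \<odot>\<^sub>A base_incl (e (t a)) else \<zero>\<^sub>A))" for a D
 have ex: "\<exists>D. fox a D" if a: "a \<in> F" for a
  using fox_derivation_exists[OF \<pi>(1) bspec[OF \<pi>(2)] a] unfolding fox_def Bex_def .
 have "\<forall>a\<in>F. \<exists>D. fox a D" by (intro ballI ex)
 from bchoice[OF this] obtain \<theta> where \<theta>: "\<forall>a\<in>F. fox a (\<theta> a)" ..
 have \<theta>1: "\<theta> a \<in> derivations K A (hom_bimodule K A (pull_module \<pi> (inj_module K B e (s a))) (proj_module A (\<lambda>x. base_incl (e x)) (t a)))" if a: "a \<in> F" for a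
  using bspec[OF \<theta> a] unfolding fox_def by (rule conjunct1)
 have \<theta>2: "\<theta> a (base_incl b) \<phi> = \<zero>\<^sub>A" if a: "a \<in> F" and b: "b \<in> carrier B" and f: "\<phi> \<in> carrier (inj_module K B e (s a))" for a b \<phi>
  using bspec[OF bspec[OF conjunct1[OF conjunct2[OF bspec[OF \<theta> a, unfolded fox_def]]] b] f] .
 have \<theta>3: "\<theta> a (new_arrow c) \<phi> = (if c = a then \<phi> (e (s a)) \<odot>\<^sub>A base_incl (e (t a)) else \<zero>\<^sub>A)"
  if a: "a \<in> F" and c: "c \<in> F" and f: "\<phi> \<in> carrier (inj_module K B e (s a))" for a c \<phi>
  using bspec[OF bspec[OF conjunct2[OF conjunct2[OF bspec[OF \<theta> a, unfolded fox_def]]] c] f] .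
 have RA: "bimodule K A (regular_bimodule A)" by (rule bimodule_regular[OF QA(1)])
 have rs: "carrier (regular_bimodule A) = carrier A" "lact (regular_bimodule A) = (\<lambda>x y. x \<otimes>\<^sub>A y)" "ract (regular_bimodule A) = (\<lambda>x y. y \<otimes>\<^sub>A x)"
  by (simp_all add: regular_bimodule_def)
 have "arrow_extension K B A base_incl \<pi> (verts Q) e F s t new_arrow \<theta>"
 proof (rule arrow_extension.intro)
  fix \<delta> d assume \<delta>: "\<delta> \<in> derivations K B (restrict_scalars base_incl (regular_bimodule A))"
   and d: "\<And>a. a \<in> F ==> d a \<in> carrier A \<and> base_incl (e (t a)) \<otimes>\<^sub>A d a \<otimes>\<^sub>A base_incl (e (s a)) = d a"
  have eA: "base_incl (e v) \<in> carrier A" "base_incl (e v) \<otimes>\<^sub>A base_incl (e v) = base_incl (e v)" if "v \<in> verts Q" for v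
   using algebra_homsD(3)[OF base_incl(1) e_mem[OF that]] algebra_homsD(6)[OF base_incl(1) e_mem[OF that] e_mem[OF that]] e_orth[OF that that] by auto
  have d': "base_incl (e (t a)) \<otimes>\<^sub>A d a = d a" "d a \<otimes>\<^sub>A base_incl (e (s a)) = d a" if a: "a \<in> F" for a
  proof -
   note et = eA[OF st_verts(2)[OF a]] and es = eA[OF st_verts(1)[OF a]]
   have da: "d a \<in> carrier A" "d a = base_incl (e (t a)) \<otimes>\<^sub>A d a \<otimes>\<^sub>A base_incl (e (s a))" using d[OF a] by auto
   have "base_incl (e (t a)) \<otimes>\<^sub>A (base_incl (e (t a)) \<otimes>\<^sub>A d a \<otimes>\<^sub>A base_incl (e (s a))) = base_incl (e (t a)) \<otimes>\<^sub>A d a \<otimes>\<^sub>A base_incl (e (s a))"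
    using et es da(1) by (simp add: AR.m_assoc[symmetric])
   then show "base_incl (e (t a)) \<otimes>\<^sub>A d a = d a" using da(2) by simp
   have "base_incl (e (t a)) \<otimes>\<^sub>A d a \<otimes>\<^sub>A base_incl (e (s a)) \<otimes>\<^sub>A base_incl (e (s a)) = base_incl (e (t a)) \<otimes>\<^sub>A d a \<otimes>\<^sub>A base_incl (e (s a))"
    using et es da(1) by (simp add: AR.m_assoc)
   then show "d a \<otimes>\<^sub>A base_incl (e (s a)) = d a" using da(2) by simp
  qed
  have "\<exists>D\<in>derivations K A (regular_bimodule A). (\<forall>b\<in>carrier B. D (base_incl b) = \<delta> b) \<and>
   (\<forall>a\<in>F. base_incl (e (t a)) \<otimes>\<^sub>A (D (new_arrow a) \<otimes>\<^sub>A base_incl (e (s a))) = d a)"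
   by (rule extend_derivation_to_new_arrows[OF RA \<delta>, of d, unfolded rs]) (use d in \<open>simp_all add: d'\<close>)
  then obtain D where D: "D \<in> derivations K A (regular_bimodule A)" "\<forall>b\<in>carrier B. D (base_incl b) = \<delta> b"
   "\<forall>a\<in>F. base_incl (e (t a)) \<otimes>\<^sub>A (D (new_arrow a) \<otimes>\<^sub>A base_incl (e (s a))) = d a"
   by (elim bexE conjE) (rule that)
  have Da: "base_incl (e (t a)) \<otimes>\<^sub>A D (new_arrow a) \<otimes>\<^sub>A base_incl (e (s a)) = d a" if a: "a \<in> F" for a
  proof -
   have "D (new_arrow a) \<in> carrier A" using derivationsD(2)[OF D(1) new_arrow(1)[OF a]] by (simp add: rs)
   then show ?thesis using bspec[OF D(3) a] eA[OF st_verts(2)[OF a]] eA[OF st_verts(1)[OF a]] by (simp add: AR.m_assoc)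
  qed
  show "\<exists>D\<in>derivations K A (regular_bimodule A). (\<forall>b\<in>carrier B. D (base_incl b) = \<delta> b) \<and>
     (\<forall>a\<in>F. base_incl (e (t a)) \<otimes>\<^sub>A D (new_arrow a) \<otimes>\<^sub>A base_incl (e (s a)) = d a)"
   by (rule bexI[OF _ D(1)]) (intro conjI ballI Da bspec[OF D(2)])
 next
  fix S assume "S \<subseteq> carrier A" "base_incl ` carrier B \<subseteq> S" "new_arrow ` F \<subseteq> S"
   "\<And>x y. x \<in> S ==> y \<in> S ==> x \<oplus>\<^sub>A y \<in> S" "\<And>x y. x \<in> S ==> y \<in> S ==> x \<otimes>\<^sub>A y \<in> S"
  then show "carrier A \<subseteq> S" by (rule extended_algebra_generated)
 qed (simp_all add: QA(1) QB(1) fd base_incl(1) \<pi> \<theta>1 \<theta>2 \<theta>3 new_arrow e_mem e_orth st_verts F(1))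
 then show ?thesis by blast
qed

end

theorem theorem4p2:
  fixes K :: "('k, 'r) ring_scheme"
    and Q :: "('v, 'a) pre_digraph"
    and I :: "(('v, 'a) qpath \<Rightarrow> 'k) set"
    and F :: "'f set" and s t :: "'f \<Rightarrow> 'v"
    and B :: "('k, (('v, 'a) qpath \<Rightarrow> 'k) set) module"
    and e :: "'v \<Rightarrow> (('v, 'a) qpath \<Rightarrow> 'k) set"
    and BF :: "('k, (('v, 'a + 'f) qpath \<Rightarrow> 'k) set) module"
  assumes "field K"
    and "fin_digraph Q"
    and "admissible K Q I"
    and "finite F" and "s ` F \<subseteq> verts Q" and "t ` F \<subseteq> verts Q"
    and B_def: "B = quiver_algebra K Q I"
    and e_def: "e = idem K Q I"
    and BF_def: "BF = extended_algebra K Q I F s t"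
    and no_rel_cycles: "rel_cycles B e F s t = {}"
  shows "int (vectorspace.dim K (HH1 K BF)) - int (vectorspace.dim K (HH1 K B)) =
    int (vectorspace.dim K (center BF)) - int (vectorspace.dim K (center B))
    + (\<Sum>(a, \<omega>)\<in>parallel_pairs (verts Q) B e F s t. int (ext_rel_dim K B e s t \<omega>))
    + (\<Sum>\<gamma>\<in>rel_paths B e F s t. int (rel_dim K B e s t \<gamma>) *
        (int (vectorspace.dim K
           (Ext1 B (inj_module K B e (rel_source s \<gamma>)) (proj_module B e (rel_target t \<gamma>))))
         - int (vectorspace.dim K
           (Hom_space B (inj_module K B e (rel_source s \<gamma>)) (proj_module B e (rel_target t \<gamma>))))))"
proof -
 have ideal: "ideal I (path_algebra K Q)" and "\<exists>n. path_ideal K Q n \<subseteq> I"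
  using \<open>admissible K Q I\<close> by (auto simp: admissible_def)
 then obtain n where n: "path_ideal K Q n \<subseteq> I" by blast
 have quiver: "quiver K Q" by (rule quiver.intro) fact+
 interpret QA: quiver_with_arrows K Q I F s t
  by (intro quiver_with_arrows.intro quiver quiver_with_arrows_axioms.intro ideal) fact+
 have "kfin_dim K B" using quiver.quotient_fin_dim[OF quiver ideal n] by (simp add: B_def quiver_algebra_def)
 then obtain \<pi> \<theta> where "arrow_extension K B BF QA.base_incl \<pi> (verts Q) e F s t QA.new_arrow \<theta>"
  using QA.arrow_extension_exists unfolding B_def e_def BF_def by blast
 then show ?thesis by (rule arrow_extension.HH1_difference[OF _ no_rel_cycles])
qed

end
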